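(* Let $\overline{T}$ be a splay over a field $k$ with coordinate algebras $A_i$, $i\in I$, given with presentations $A_i=\mathbf{S}\mathcal{X}_i/\mathcal{S}_i$, degree maps $\deg_i:\mathcal{X}_i\to\mathbb{Z}_{\ge1}$ and total orderings $<_i$ on $\mathcal{X}_i$ such that for each $i$ there is a collection of polynomials $\{f_{i,j}\mid j\in J_i\}$ which is a Gröbner basis of the ideal $\mathcal{S}_i$ with respect to the graded lexicographic ordering on $\mathbf{S}\mathcal{X}_i$ induced by $<_i$ and $\deg_i$. Suppose that $\pi$ is a strongly filtered Poisson structure on $\overline{T}$, and let $\mathcal{J}$ be the two-sided ideal of the splay algebra $T=\coprod_{i\in I}A_i$ generated by the elements $aa'-a'a-\pi(a,a')$, $a,a'\in T$. Then, fixing the choice of a total ordering $<$ on $I$, the algebra $U:=T/\mathcal{J}$ is isomorphic as a $k$-module to $S:=\bigotimes_{i\in I}A_i$.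
   Context: All algebras are associative unital $k$-algebras; tensor products are over $k$. $\mathbf{S}\mathcal{X}$ and $\mathbf{T}\mathcal{X}$ denote the free commutative and the free associative algebra on a set $\mathcal{X}$. **Splays.** The splay $\overline{T}$ of commutative algebras $A_i$ ($i\in I$), called its coordinate algebras, is the diagram $\iota_i:A_i\hookrightarrow T:=\coprod_{i\in I}A_i$ (coproduct in associative unital algebras); $T$ is the splay algebra. **Poisson structures.** A Poisson structure on a (possibly noncommutative) algebra $A$ is a $k$-bilinear skew-symmetric bi-derivation $\pi:A\times A\to A$ (so $\pi(ab,c)=a\pi(b,c)+\pi(a,c)b$, and likewise in the second variable) satisfying the Jacobi identity; all Poisson structures are assumed to vanish on constants: $\pi(1,a)=\pi(a,1)=0$. A Poisson structure on a splay $\overline{T}$ is a Poisson structure on $T$ with internal symmetry: $\pi(A_i,A_i)=0$ for all $i$. **Orderings.** For a set $\mathcal{X}$ with a map $\deg:\mathcal{X}\to\mathbb{Z}_{\ge1}$ and a total ordering, a monomial $x_1\cdots x_n$ has degree $\sum\deg(x_l)$; the graded lexicographic ordering compares monomials first by degree and then lexicographically. It is assumed to be a monomial ordering (in particular a well-ordering). A Gröbner basis of an ideal is a subset of it whose leading monomials generate the ideal of leading monomials. **Filtration.** Let $\mathcal{X}=\coprod_i\mathcal{X}_i$ with the degree map $\deg$ induced by the $\deg_i$. $T$ is a quotient of $\mathbf{T}\mathcal{X}$; let $T^{(n)}$ be the image of the span of monomials of degree $\le n$. A Poisson structure $\pi$ on $T$ is strongly filtered if $\pi(T^{(m)},T^{(n)})\subseteq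 T^{(m+n-1)}$ for all $m,n$. *)

theory Defs
  imports "HOL-Algebra.QuotRing" "HOL-Algebra.Module" "HOL-Library.Poly_Mapping"
begin

section \<open>Algebras over a field\<close>

text \<open>
  The ground field is a type \<open>'k :: field\<close>.  A \<open>k\<close>-algebra is a \<^type>\<open>module\<close>-record of
  HOL-Algebra, that is, a ring together with a scalar multiplication \<open>\<odot>\<close>.
  (The locale \<^locale>\<open>algebra\<close> of HOL-Algebra is restricted to commutative algebras.)
\<close>

definition field_ring :: "'k::field ring"
  where "field_ring = \<lparr>carrier = UNIV, mult = (*), one = 1, zero = 0, add = (+)\<rparr>"

locale k_algebra = module field_ring A + ring A
  for A :: "('k::field, 'a, 'm) module_scheme" (structure) +
  assumes smult_mult_left:
      "\<lbrakk>a \<in> carrier A; b \<in> carrier A\<rbrakk> \<Longrightarrow> (c \<odot> a) \<otimes> b = c \<odot> (a \<otimes> b)"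
    and smult_mult_right:
      "\<lbrakk>a \<in> carrier A; b \<in> carrier A\<rbrakk> \<Longrightarrow> a \<otimes> (c \<odot> b) = c \<odot> (a \<otimes> b)"

definition alg_hom :: "('k::field, 'a, 'm) module_scheme \<Rightarrow> ('k, 'b, 'n) module_scheme \<Rightarrow> ('a \<Rightarrow> 'b) set"
  where "alg_hom A B =
    {h \<in> ring_hom A B. \<forall>c. \<forall>a\<in>carrier A. h (c \<odot>\<^bsub>A\<^esub> a) = c \<odot>\<^bsub>B\<^esub> h a}"

definition k_module_iso :: "('k::field, 'a, 'm) module_scheme \<Rightarrow> ('k, 'b, 'n) module_scheme \<Rightarrow> bool"
  where "k_module_iso M N \<longleftrightarrow> (\<exists>h. bij_betw h (carrier M) (carrier N) \<and>
    (\<forall>a\<in>carrier M. \<forall>b\<in>carrier M. h (a \<oplus>\<^bsub>M\<^esub> b) = h a \<oplus>\<^bsub>N\<^esub> h b) \<and>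
    (\<forall>c. \<forall>a\<in>carrier M. h (c \<odot>\<^bsub>M\<^esub> a) = c \<odot>\<^bsub>N\<^esub> h a))"

text \<open>
  The quotient \<open>A / J\<close>: this is \<^const>\<open>FactRing\<close> together with the scalar multiplication of cosets.
\<close>

definition quot_alg :: "('k::field, 'a, 'm) module_scheme \<Rightarrow> 'a set \<Rightarrow> ('k, 'a set) module"
  where "quot_alg A J =
    \<lparr>carrier = a_rcosets\<^bsub>A\<^esub> J, mult = rcoset_mult A J, one = J +>\<^bsub>A\<^esub> \<one>\<^bsub>A\<^esub>, zero = J,
     add = set_add A, smult = (\<lambda>c C. \<Union>a\<in>C. J +>\<^bsub>A\<^esub> (c \<odot>\<^bsub>A\<^esub> a))\<rparr>"


section \<open>Free commutative and free associative algebras\<close>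

text \<open>
  A commutative monomial is a finitely supported exponent function \<open>'x \<Rightarrow>\<^sub>0 nat\<close>, and a
  noncommutative one is a word, i.e. a list.  Concatenation turns lists into a (noncommutative)
  additive monoid, so that the product of \<^type>\<open>poly_mapping\<close> is that of the monoid algebra
  in both cases.
\<close>

instantiation list :: (type) monoid_add
begin

definition zero_list :: "'a list" where "zero_list = []"
definition plus_list :: "'a list \<Rightarrow> 'a list \<Rightarrow> 'a list" where "plus_list = (@)"

instance by standard (simp_all add: zero_list_def plus_list_def)

end

abbreviation scale_poly :: "'k::field \<Rightarrow> ('m \<Rightarrow>\<^sub>0 'k) \<Rightarrow> ('m \<Rightarrow>\<^sub>0 'k)"
  where "scale_poly c p \<equiv> Poly_Mapping.map ((*) c) p"

definition free_comm :: "'x set \<Rightarrow> ('k::field, ('x \<Rightarrow>\<^sub>0 nat) \<Rightarrow>\<^sub>0 'k) module"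
  where "free_comm X =
    \<lparr>carrier = {p. \<forall>m\<in>Poly_Mapping.keys p. Poly_Mapping.keys m \<subseteq> X},
     mult = (*), one = 1, zero = 0, add = (+), smult = scale_poly\<rparr>"

definition free_assoc :: "'x set \<Rightarrow> ('k::field, 'x list \<Rightarrow>\<^sub>0 'k) module"
  where "free_assoc X =
    \<lparr>carrier = {p. \<forall>w\<in>Poly_Mapping.keys p. set w \<subseteq> X},
     mult = (*), one = 1, zero = 0, add = (+), smult = scale_poly\<rparr>"

definition cvar :: "'x \<Rightarrow> ('x \<Rightarrow>\<^sub>0 nat) \<Rightarrow>\<^sub>0 'k::field"
  where "cvar x = Poly_Mapping.single (Poly_Mapping.single x 1) 1"

definition avar :: "'x \<Rightarrow> 'x list \<Rightarrow>\<^sub>0 'k::field"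
  where "avar x = Poly_Mapping.single [x] 1"

text \<open>The extension of a map \<open>\<phi> : X \<rightarrow> A\<close> to the free associative algebra on \<open>X\<close>.\<close>

definition word_eval :: "('k::field, 'a, 'm) module_scheme \<Rightarrow> ('x \<Rightarrow> 'a) \<Rightarrow> 'x list \<Rightarrow> 'a"
  where "word_eval A \<phi> w = foldr (\<lambda>x a. \<phi> x \<otimes>\<^bsub>A\<^esub> a) w \<one>\<^bsub>A\<^esub>"

definition free_assoc_lift ::
    "('k::field, 'a, 'm) module_scheme \<Rightarrow> ('x \<Rightarrow> 'a) \<Rightarrow> ('x list \<Rightarrow>\<^sub>0 'k) \<Rightarrow> 'a"
  where "free_assoc_lift A \<phi> p =
    (\<Oplus>\<^bsub>A\<^esub>w\<in>Poly_Mapping.keys p. Poly_Mapping.lookup p w \<odot>\<^bsub>A\<^esub> word_eval A \<phi> w)"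


section \<open>Monomial orderings and Groebner bases in free commutative algebras\<close>

definition monomials :: "'x set \<Rightarrow> ('x \<Rightarrow>\<^sub>0 nat) set"
  where "monomials X = {m. Poly_Mapping.keys m \<subseteq> X}"

definition mon_deg :: "('x \<Rightarrow> nat) \<Rightarrow> ('x \<Rightarrow>\<^sub>0 nat) \<Rightarrow> nat"
  where "mon_deg d m = (\<Sum>x\<in>Poly_Mapping.keys m. Poly_Mapping.lookup m x * d x)"

text \<open>
  Orderings are strict and given as sets of pairs (smaller, larger).  In the lexicographic
  comparison the largest variable is the most significant one: \<open>m\<close> precedes \<open>m'\<close> if the largest
  variable in which the exponents differ has the smaller exponent in \<open>m\<close>.
\<close>

definition grlex :: "'x set \<Rightarrow> ('x \<Rightarrow> nat) \<Rightarrow> 'x rel \<Rightarrow> ('x \<Rightarrow>\<^sub>0 nat) rel"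
  where "grlex X d r = {(m, m'). m \<in> monomials X \<and> m' \<in> monomials X \<and>
    (mon_deg d m < mon_deg d m' \<or>
     mon_deg d m = mon_deg d m' \<and>
       (\<exists>x\<in>X. Poly_Mapping.lookup m x < Poly_Mapping.lookup m' x \<and>
          (\<forall>y\<in>X. (x, y) \<in> r \<longrightarrow> Poly_Mapping.lookup m y = Poly_Mapping.lookup m' y)))}"

text \<open>Multiplication of monomials is addition of exponents.\<close>

definition monomial_ordering :: "'x set \<Rightarrow> ('x \<Rightarrow>\<^sub>0 nat) rel \<Rightarrow> bool"
  where "monomial_ordering X R \<longleftrightarrow>
    R \<subseteq> monomials X \<times> monomials X \<and> strict_linear_order_on (monomials X) R \<and> wf R \<and>
    (\<forall>(m, m')\<in>R. \<forall>u\<in>monomials X. (m + u, m' + u) \<in> R)"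

definition lead_mon :: "('x \<Rightarrow>\<^sub>0 nat) rel \<Rightarrow> (('x \<Rightarrow>\<^sub>0 nat) \<Rightarrow>\<^sub>0 'k::field) \<Rightarrow> ('x \<Rightarrow>\<^sub>0 nat)"
  where "lead_mon R p = (THE m. m \<in> Poly_Mapping.keys p \<and>
    (\<forall>m'\<in>Poly_Mapping.keys p. m' \<noteq> m \<longrightarrow> (m', m) \<in> R))"

definition lead_mon_ideal ::
    "'x set \<Rightarrow> ('x \<Rightarrow>\<^sub>0 nat) rel \<Rightarrow> (('x \<Rightarrow>\<^sub>0 nat) \<Rightarrow>\<^sub>0 'k::field) set \<Rightarrow> (('x \<Rightarrow>\<^sub>0 nat) \<Rightarrow>\<^sub>0 'k) set"
  where "lead_mon_ideal X R G =
    genideal (free_comm X) {Poly_Mapping.single (lead_mon R g) 1 | g. g \<in> G \<and> g \<noteq> 0}"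

definition groebner_basis ::
    "'x set \<Rightarrow> ('x \<Rightarrow>\<^sub>0 nat) rel \<Rightarrow> (('x \<Rightarrow>\<^sub>0 nat) \<Rightarrow>\<^sub>0 'k::field) set \<Rightarrow> (('x \<Rightarrow>\<^sub>0 nat) \<Rightarrow>\<^sub>0 'k) set \<Rightarrow> bool"
  where "groebner_basis X R G S \<longleftrightarrow> G \<subseteq> S \<and> lead_mon_ideal X R G = lead_mon_ideal X R S"


section \<open>Coproducts of associative algebras\<close>

text \<open>
  The coproduct is the free associative algebra on the disjoint union of the carriers of the \<open>A i\<close>
  modulo the relations that make each \<open>A i \<rightarrow> coproduct I A\<close> a homomorphism of unital algebras.
  The universal property is \<open>coproj_hom\<close>, \<open>coproduct_universal\<close> and \<open>coproduct_universal_unique\<close>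
  at the end of this theory.
\<close>

definition coproduct_rels ::
    "'i set \<Rightarrow> ('i \<Rightarrow> ('k::field, 'a, 'm) module_scheme) \<Rightarrow> (('i \<times> 'a) list \<Rightarrow>\<^sub>0 'k) set"
  where "coproduct_rels I A =
    {avar (i, a \<oplus>\<^bsub>A i\<^esub> b) - (avar (i, a) + avar (i, b)) | i a b.
       i \<in> I \<and> a \<in> carrier (A i) \<and> b \<in> carrier (A i)} \<union>
    {avar (i, c \<odot>\<^bsub>A i\<^esub> a) - scale_poly c (avar (i, a)) | i c a.
       i \<in> I \<and> a \<in> carrier (A i)} \<union>
    {avar (i, a \<otimes>\<^bsub>A i\<^esub> b) - avar (i, a) * avar (i, b) | i a b.
       i \<in> I \<and> a \<in> carrier (A i) \<and> b \<in> carrier (A i)} \<union>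
    {avar (i, \<one>\<^bsub>A i\<^esub>) - 1 | i. i \<in> I}"

definition coproduct_free ::
    "'i set \<Rightarrow> ('i \<Rightarrow> ('k::field, 'a, 'm) module_scheme) \<Rightarrow> ('k, ('i \<times> 'a) list \<Rightarrow>\<^sub>0 'k) module"
  where "coproduct_free I A = free_assoc (SIGMA i:I. carrier (A i))"

definition coproduct_ideal ::
    "'i set \<Rightarrow> ('i \<Rightarrow> ('k::field, 'a, 'm) module_scheme) \<Rightarrow> (('i \<times> 'a) list \<Rightarrow>\<^sub>0 'k) set"
  where "coproduct_ideal I A = genideal (coproduct_free I A) (coproduct_rels I A)"

definition coproduct ::
    "'i set \<Rightarrow> ('i \<Rightarrow> ('k::field, 'a, 'm) module_scheme) \<Rightarrow> ('k, (('i \<times> 'a) list \<Rightarrow>\<^sub>0 'k) set) module"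
  where "coproduct I A = quot_alg (coproduct_free I A) (coproduct_ideal I A)"

definition coproj ::
    "'i set \<Rightarrow> ('i \<Rightarrow> ('k::field, 'a, 'm) module_scheme) \<Rightarrow> 'i \<Rightarrow> 'a \<Rightarrow> (('i \<times> 'a) list \<Rightarrow>\<^sub>0 'k) set"
  where "coproj I A i a = coproduct_ideal I A +>\<^bsub>coproduct_free I A\<^esub> avar (i, a)"


section \<open>Tensor products of algebras\<close>

text \<open>
  The tensor product of a possibly infinite family of algebras is the direct limit of the tensor
  products over finite subsets of \<open>I\<close>, along the maps that insert units.  It is generated by the
  pure tensors of families with almost all entries equal to the unit, and the relations
  are multilinearity in each factor: the free module on such families modulo the submodule
  generated by these relations.  For finite \<open>I\<close> this is the usual construction.  The
  multiplication is componentwise on pure tensors.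
\<close>

definition tensor_families :: "'i set \<Rightarrow> ('i \<Rightarrow> ('k::field, 'a, 'm) module_scheme) \<Rightarrow> ('i \<Rightarrow> 'a) set"
  where "tensor_families I A =
    {a \<in> (\<Pi>\<^sub>E i\<in>I. carrier (A i)). finite {i\<in>I. a i \<noteq> \<one>\<^bsub>A i\<^esub>}}"

definition tensor_free ::
    "'i set \<Rightarrow> ('i \<Rightarrow> ('k::field, 'a, 'm) module_scheme) \<Rightarrow> ('k, ('i \<Rightarrow> 'a) \<Rightarrow>\<^sub>0 'k) module"
  where "tensor_free I A =
    \<lparr>carrier = {p. Poly_Mapping.keys p \<subseteq> tensor_families I A},
     mult = (\<lambda>p q. \<Sum>a\<in>Poly_Mapping.keys p. \<Sum>b\<in>Poly_Mapping.keys q.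
       Poly_Mapping.single (\<lambda>i\<in>I. a i \<otimes>\<^bsub>A i\<^esub> b i) (Poly_Mapping.lookup p a * Poly_Mapping.lookup q b)),
     one = Poly_Mapping.single (\<lambda>i\<in>I. \<one>\<^bsub>A i\<^esub>) 1, zero = 0, add = (+), smult = scale_poly\<rparr>"

definition tensor_rels ::
    "'i set \<Rightarrow> ('i \<Rightarrow> ('k::field, 'a, 'm) module_scheme) \<Rightarrow> (('i \<Rightarrow> 'a) \<Rightarrow>\<^sub>0 'k) set"
  where "tensor_rels I A =
    {Poly_Mapping.single (a(i := u \<oplus>\<^bsub>A i\<^esub> v)) 1
       - (Poly_Mapping.single (a(i := u)) 1 + Poly_Mapping.single (a(i := v)) 1) | a i u v.
       a \<in> tensor_families I A \<and> i \<in> I \<and> u \<in> carrier (A i) \<and> v \<in> carrier (A i)} \<union>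
    {Poly_Mapping.single (a(i := c \<odot>\<^bsub>A i\<^esub> u)) 1
       - scale_poly c (Poly_Mapping.single (a(i := u)) 1) | a i c u.
       a \<in> tensor_families I A \<and> i \<in> I \<and> u \<in> carrier (A i)}"

definition tensor_product ::
    "'i set \<Rightarrow> ('i \<Rightarrow> ('k::field, 'a, 'm) module_scheme) \<Rightarrow> ('k, (('i \<Rightarrow> 'a) \<Rightarrow>\<^sub>0 'k) set) module"
  where "tensor_product I A = quot_alg (tensor_free I A)
    (\<Inter>{N. submodule N field_ring (tensor_free I A) \<and> tensor_rels I A \<subseteq> N})"


section \<open>Poisson structures\<close>

locale poisson_structure = k_algebra A
  for A :: "('k::field, 'a, 'm) module_scheme" (structure) and \<pi> :: "'a \<Rightarrow> 'a \<Rightarrow> 'a" +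
  assumes closed: "\<lbrakk>a \<in> carrier A; b \<in> carrier A\<rbrakk> \<Longrightarrow> \<pi> a b \<in> carrier A"
    and add_left: "\<lbrakk>a \<in> carrier A; b \<in> carrier A; c \<in> carrier A\<rbrakk> \<Longrightarrow> \<pi> (a \<oplus> b) c = \<pi> a c \<oplus> \<pi> b c"
    and add_right: "\<lbrakk>a \<in> carrier A; b \<in> carrier A; c \<in> carrier A\<rbrakk> \<Longrightarrow> \<pi> a (b \<oplus> c) = \<pi> a b \<oplus> \<pi> a c"
    and smult_left: "\<lbrakk>a \<in> carrier A; b \<in> carrier A\<rbrakk> \<Longrightarrow> \<pi> (r \<odot> a) b = r \<odot> \<pi> a b"
    and smult_right: "\<lbrakk>a \<in> carrier A; b \<in> carrier A\<rbrakk> \<Longrightarrow> \<pi> a (r \<odot> b) = r \<odot> \<pi> a b"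
    and skew: "\<lbrakk>a \<in> carrier A; b \<in> carrier A\<rbrakk> \<Longrightarrow> \<pi> a b = \<ominus> \<pi> b a"
    and deriv_left: "\<lbrakk>a \<in> carrier A; b \<in> carrier A; c \<in> carrier A\<rbrakk> \<Longrightarrow>
      \<pi> (a \<otimes> b) c = (a \<otimes> \<pi> b c) \<oplus> (\<pi> a c \<otimes> b)"
    and deriv_right: "\<lbrakk>a \<in> carrier A; b \<in> carrier A; c \<in> carrier A\<rbrakk> \<Longrightarrow>
      \<pi> a (b \<otimes> c) = (b \<otimes> \<pi> a c) \<oplus> (\<pi> a b \<otimes> c)"
    and jacobi: "\<lbrakk>a \<in> carrier A; b \<in> carrier A; c \<in> carrier A\<rbrakk> \<Longrightarrow>
      \<pi> a (\<pi> b c) \<oplus> \<pi> b (\<pi> c a) \<oplus> \<pi> c (\<pi> a b) = \<zero>"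
    and one_left: "a \<in> carrier A \<Longrightarrow> \<pi> \<one> a = \<zero>"
    and one_right: "a \<in> carrier A \<Longrightarrow> \<pi> a \<one> = \<zero>"

definition splay_poisson ::
    "'i set \<Rightarrow> ('i \<Rightarrow> ('k::field, 'a, 'm) module_scheme) \<Rightarrow>
     ((('i \<times> 'a) list \<Rightarrow>\<^sub>0 'k) set \<Rightarrow> (('i \<times> 'a) list \<Rightarrow>\<^sub>0 'k) set \<Rightarrow> (('i \<times> 'a) list \<Rightarrow>\<^sub>0 'k) set) \<Rightarrow> bool"
  where "splay_poisson I A \<pi> \<longleftrightarrow> poisson_structure (coproduct I A) \<pi> \<and>
    (\<forall>i\<in>I. \<forall>a\<in>carrier (A i). \<forall>b\<in>carrier (A i).
       \<pi> (coproj I A i a) (coproj I A i b) = \<zero>\<^bsub>coproduct I A\<^esub>)"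

definition bracket_ideal :: "('k::field, 'a, 'm) module_scheme \<Rightarrow> ('a \<Rightarrow> 'a \<Rightarrow> 'a) \<Rightarrow> 'a set"
  where "bracket_ideal A \<pi> = genideal A
    {a \<otimes>\<^bsub>A\<^esub> b \<ominus>\<^bsub>A\<^esub> b \<otimes>\<^bsub>A\<^esub> a \<ominus>\<^bsub>A\<^esub> \<pi> a b | a b. a \<in> carrier A \<and> b \<in> carrier A}"


section \<open>Splays of algebras given by presentations\<close>

definition presented_alg ::
    "('i \<Rightarrow> 'x set) \<Rightarrow> ('i \<Rightarrow> (('x \<Rightarrow>\<^sub>0 nat) \<Rightarrow>\<^sub>0 'k::field) set) \<Rightarrow> 'i \<Rightarrow> ('k, (('x \<Rightarrow>\<^sub>0 nat) \<Rightarrow>\<^sub>0 'k) set) module"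
  where "presented_alg X S i = quot_alg (free_comm (X i)) (S i)"

text \<open>The image in the splay algebra of a generator \<open>(i, x)\<close> of \<open>SIGMA i:I. X i\<close>.\<close>

definition splay_gen ::
    "'i set \<Rightarrow> ('i \<Rightarrow> 'x set) \<Rightarrow> ('i \<Rightarrow> (('x \<Rightarrow>\<^sub>0 nat) \<Rightarrow>\<^sub>0 'k::field) set) \<Rightarrow> 'i \<times> 'x \<Rightarrow>
     (('i \<times> (('x \<Rightarrow>\<^sub>0 nat) \<Rightarrow>\<^sub>0 'k) set) list \<Rightarrow>\<^sub>0 'k) set"
  where "splay_gen I X S = (\<lambda>(i, x).
    coproj I (presented_alg X S) i (S i +>\<^bsub>free_comm (X i)\<^esub> cvar x))"

text \<open>
  The filtration is indexed by integers, as \<open>m + n - 1\<close> may be negative; the piece of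
  index \<open>-1\<close> is zero.
\<close>

definition splay_filtration ::
    "'i set \<Rightarrow> ('i \<Rightarrow> 'x set) \<Rightarrow> ('i \<Rightarrow> (('x \<Rightarrow>\<^sub>0 nat) \<Rightarrow>\<^sub>0 'k::field) set) \<Rightarrow> ('i \<Rightarrow> 'x \<Rightarrow> nat) \<Rightarrow> int \<Rightarrow>
     (('i \<times> (('x \<Rightarrow>\<^sub>0 nat) \<Rightarrow>\<^sub>0 'k) set) list \<Rightarrow>\<^sub>0 'k) set set"
  where "splay_filtration I X S d n =
    free_assoc_lift (coproduct I (presented_alg X S)) (splay_gen I X S) `
      {p \<in> carrier (free_assoc (SIGMA i:I. X i)).
         \<forall>w\<in>Poly_Mapping.keys p. int (\<Sum>(i, x)\<leftarrow>w. d i x) \<le> n}"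

definition strongly_filtered :: "(int \<Rightarrow> 'a set) \<Rightarrow> ('a \<Rightarrow> 'a \<Rightarrow> 'a) \<Rightarrow> bool"
  where "strongly_filtered F \<pi> \<longleftrightarrow>
    (\<forall>m n :: nat. \<forall>a\<in>F (int m). \<forall>b\<in>F (int n). \<pi> a b \<in> F (int m + int n - 1))"


section \<open>Free algebras and quotients\<close>

lemma field_ring_simps [simp]:
  "carrier field_ring = UNIV" "mult field_ring = (*)" "one field_ring = 1"
  "zero field_ring = 0" "add field_ring = (+)"
  by (simp_all add: field_ring_def)

lemma cring_field_ring: "cring (field_ring :: 'k::field ring)"
proof (rule cringI)
  show "abelian_group (field_ring :: 'k ring)"
    by (rule abelian_groupI) (auto intro: exI[of _ "- x" for x] simp: algebra_simps add_eq_0_iff2)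
  show "comm_monoid (field_ring :: 'k ring)"
    by (rule comm_monoidI) auto
qed (auto simp: algebra_simps)

lemma k_algebraI:
  fixes A :: "('k::field, 'a, 'm) module_scheme"
  assumes "ring A"
    and "\<And>c a. a \<in> carrier A \<Longrightarrow> c \<odot>\<^bsub>A\<^esub> a \<in> carrier A"
    and "\<And>c d a. a \<in> carrier A \<Longrightarrow> (c + d) \<odot>\<^bsub>A\<^esub> a = c \<odot>\<^bsub>A\<^esub> a \<oplus>\<^bsub>A\<^esub> d \<odot>\<^bsub>A\<^esub> a"
    and "\<And>c a b. a \<in> carrier A \<Longrightarrow> b \<in> carrier A \<Longrightarrow> c \<odot>\<^bsub>A\<^esub> (a \<oplus>\<^bsub>A\<^esub> b) = c \<odot>\<^bsub>A\<^esub> a \<oplus>\<^bsub>A\<^esub> c \<odot>\<^bsub>A\<^esub> b"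
    and "\<And>c d a. a \<in> carrier A \<Longrightarrow> (c * d) \<odot>\<^bsub>A\<^esub> a = c \<odot>\<^bsub>A\<^esub> (d \<odot>\<^bsub>A\<^esub> a)"
    and "\<And>a. a \<in> carrier A \<Longrightarrow> 1 \<odot>\<^bsub>A\<^esub> a = a"
    and "\<And>c a b. a \<in> carrier A \<Longrightarrow> b \<in> carrier A \<Longrightarrow> (c \<odot>\<^bsub>A\<^esub> a) \<otimes>\<^bsub>A\<^esub> b = c \<odot>\<^bsub>A\<^esub> (a \<otimes>\<^bsub>A\<^esub> b)"
    and "\<And>c a b. a \<in> carrier A \<Longrightarrow> b \<in> carrier A \<Longrightarrow> a \<otimes>\<^bsub>A\<^esub> (c \<odot>\<^bsub>A\<^esub> b) = c \<odot>\<^bsub>A\<^esub> (a \<otimes>\<^bsub>A\<^esub> b)"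
  shows "k_algebra A"
proof -
  interpret ring A by fact
  have "module field_ring A"
    by (rule moduleI) (use assms in \<open>auto intro: cring_field_ring is_abelian_group\<close>)
  then show ?thesis
    by (intro k_algebra.intro k_algebra_axioms.intro assms)
qed

lemma k_algebraD:
  assumes "k_algebra A"
  shows "ring A" "module field_ring A"
  using assms by (auto simp: k_algebra_def)

lemma lookup_scale_poly [simp]: "Poly_Mapping.lookup (scale_poly c p) m = c * Poly_Mapping.lookup p m"
  by (simp add: Poly_Mapping.map.rep_eq when_def)

lemma keys_scale_poly: "Poly_Mapping.keys (scale_poly c p) \<subseteq> Poly_Mapping.keys p"
  by (auto simp: in_keys_iff)


lemma scale_poly_single [simp]:
  "scale_poly c (Poly_Mapping.single m d) = Poly_Mapping.single m (c * d :: 'k::field)"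
  by (rule poly_mapping_eqI) (simp add: lookup_single when_def)

lemma scale_poly_add: "scale_poly c (p + q) = scale_poly c p + scale_poly c (q :: 'm \<Rightarrow>\<^sub>0 'k::field)"
  by (rule poly_mapping_eqI) (simp add: lookup_add algebra_simps)

lemma poly_sum_single:
  "p = (\<Sum>m\<in>Poly_Mapping.keys p. Poly_Mapping.single m (Poly_Mapping.lookup p m :: 'k::field))"
proof (rule poly_mapping_eqI)
  fix k
  show "Poly_Mapping.lookup p k = Poly_Mapping.lookup
      (\<Sum>m\<in>Poly_Mapping.keys p. Poly_Mapping.single m (Poly_Mapping.lookup p m)) k"
    by (cases "k \<in> Poly_Mapping.keys p")
       (auto simp: lookup_sum lookup_single when_def in_keys_iff if_distrib cong: if_cong)
qed

lemma poly_mapping_sum_induct [case_names zero single add]: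
  fixes p :: "'m \<Rightarrow>\<^sub>0 'k::field"
  assumes "P 0" "\<And>m c. P (Poly_Mapping.single m c)" "\<And>p q. P p \<Longrightarrow> P q \<Longrightarrow> P (p + q)"
  shows "P p"
proof -
  have "P (\<Sum>m\<in>M. Poly_Mapping.single m (Poly_Mapping.lookup p m))" if "finite M" for M
    using that by induction (auto intro: assms)
  then show ?thesis by (subst poly_sum_single) simp
qed

lemma scale_poly_mult:
  fixes p q :: "'m::monoid_add \<Rightarrow>\<^sub>0 'k::field"
  shows "scale_poly c p * q = scale_poly c (p * q)" "p * scale_poly c q = scale_poly c (p * q)"
proof -
  show 1: "scale_poly c p * q = scale_poly c (p * q)"
    by (simp add: mult_map_scale_conv_mult mult.assoc)
  have comm: "p * Poly_Mapping.single 0 c = Poly_Mapping.single 0 c * p" for p :: "'m \<Rightarrow>\<^sub>0 'k"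
    by (induction p rule: poly_mapping_sum_induct) (auto simp: mult_single algebra_simps)
  show "p * scale_poly c q = scale_poly c (p * q)"
    by (simp add: mult_map_scale_conv_mult comm flip: mult.assoc)
qed

lemma k_algebra_poly_mapping:
  fixes C :: "('m::monoid_add \<Rightarrow>\<^sub>0 'k::field) set"
  assumes "0 \<in> C" "1 \<in> C" "\<And>p q. p \<in> C \<Longrightarrow> q \<in> C \<Longrightarrow> p + q \<in> C"
    "\<And>p q. p \<in> C \<Longrightarrow> q \<in> C \<Longrightarrow> p * q \<in> C" "\<And>p c. p \<in> C \<Longrightarrow> scale_poly c p \<in> C"
  shows "k_algebra \<lparr>carrier = C, mult = (*), one = 1, zero = 0, add = (+), smult = scale_poly\<rparr>"
proof (rule k_algebraI)
  have neg: "- p \<in> C" if "p \<in> C" for p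
  proof -
    have "- p = scale_poly (- 1) p" by (rule poly_mapping_eqI) simp
    then show ?thesis using assms(5)[OF that, of "-1"] by simp
  qed
  show "ring \<lparr>carrier = C, mult = (*), one = 1, zero = 0, add = (+), smult = scale_poly\<rparr>"
  proof (rule ringI)
    show "abelian_group \<lparr>carrier = C, mult = (*), one = 1, zero = 0, add = (+), smult = scale_poly\<rparr>"
    proof (rule abelian_groupI)
      fix p assume "p \<in> carrier \<lparr>carrier = C, mult = (*), one = 1, zero = 0, add = (+), smult = scale_poly\<rparr>"
      then have "- p \<in> C" "- p + p = 0" using neg by auto
      then have "\<exists>q\<in>C. q + p = 0" by blast
      then show "\<exists>q\<in>carrier \<lparr>carrier = C, mult = (*), one = 1, zero = 0, add = (+), smult = scale_poly\<rparr>.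
        q \<oplus>\<^bsub>\<lparr>carrier = C, mult = (*), one = 1, zero = 0, add = (+), smult = scale_poly\<rparr>\<^esub> p =
          \<zero>\<^bsub>\<lparr>carrier = C, mult = (*), one = 1, zero = 0, add = (+), smult = scale_poly\<rparr>\<^esub>"
        by simp
    qed (auto simp: algebra_simps assms)
    show "Group.monoid \<lparr>carrier = C, mult = (*), one = 1, zero = 0, add = (+), smult = scale_poly\<rparr>"
      by (rule monoidI) (auto simp: mult.assoc assms)
  qed (auto simp: algebra_simps)
qed (auto simp: assms scale_poly_mult scale_poly_add intro!: poly_mapping_eqI simp: lookup_add algebra_simps)

lemma k_algebra_free_comm: "k_algebra (free_comm X :: ('k::field, ('x \<Rightarrow>\<^sub>0 nat) \<Rightarrow>\<^sub>0 'k) module)"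
  unfolding free_comm_def
proof (rule k_algebra_poly_mapping)
  show "p + q \<in> {p. \<forall>m\<in>Poly_Mapping.keys p. Poly_Mapping.keys m \<subseteq> X}"
    if "p \<in> {p. \<forall>m\<in>Poly_Mapping.keys p. Poly_Mapping.keys m \<subseteq> X}"
       "q \<in> {p. \<forall>m\<in>Poly_Mapping.keys p. Poly_Mapping.keys m \<subseteq> X}" for p q :: "('x \<Rightarrow>\<^sub>0 nat) \<Rightarrow>\<^sub>0 'k"
    using that Poly_Mapping.keys_add[of p q] by blast
  show "p * q \<in> {p. \<forall>m\<in>Poly_Mapping.keys p. Poly_Mapping.keys m \<subseteq> X}"
    if pq: "p \<in> {p. \<forall>m\<in>Poly_Mapping.keys p. Poly_Mapping.keys m \<subseteq> X}"
       "q \<in> {p. \<forall>m\<in>Poly_Mapping.keys p. Poly_Mapping.keys m \<subseteq> X}" for p q :: "('x \<Rightarrow>\<^sub>0 nat) \<Rightarrow>\<^sub>0 'k"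
  proof -
    have "Poly_Mapping.keys m \<subseteq> X" if m: "m \<in> Poly_Mapping.keys (p * q)" for m
    proof -
      obtain a b where "m = a + b" "a \<in> Poly_Mapping.keys p" "b \<in> Poly_Mapping.keys q"
        using keys_mult[of p q] m by auto
      then show ?thesis using pq Poly_Mapping.keys_add[of a b] by blast
    qed
    then show ?thesis by blast
  qed
qed (use keys_scale_poly in \<open>fastforce simp: in_keys_iff lookup_one when_def split: if_splits\<close>)+

lemma k_algebra_free_assoc: "k_algebra (free_assoc X :: ('k::field, 'x list \<Rightarrow>\<^sub>0 'k) module)"
  unfolding free_assoc_def
proof (rule k_algebra_poly_mapping)
  show "p + q \<in> {p. \<forall>w\<in>Poly_Mapping.keys p. set w \<subseteq> X}"
    if "p \<in> {p. \<forall>w\<in>Poly_Mapping.keys p. set w \<subseteq> X}"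
       "q \<in> {p. \<forall>w\<in>Poly_Mapping.keys p. set w \<subseteq> X}" for p q :: "'x list \<Rightarrow>\<^sub>0 'k"
    using that Poly_Mapping.keys_add[of p q] by blast
  show "p * q \<in> {p. \<forall>w\<in>Poly_Mapping.keys p. set w \<subseteq> X}"
    if "p \<in> {p. \<forall>w\<in>Poly_Mapping.keys p. set w \<subseteq> X}"
       "q \<in> {p. \<forall>w\<in>Poly_Mapping.keys p. set w \<subseteq> X}" for p q :: "'x list \<Rightarrow>\<^sub>0 'k"
    using that keys_mult[of p q] by (fastforce simp: plus_list_def)
qed (use keys_scale_poly in \<open>fastforce simp: in_keys_iff lookup_one when_def zero_list_def split: if_splits\<close>)+

context
  fixes A :: "('k::field, 'a, 'm) module_scheme" (structure) and J :: "'a set"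
  assumes A: "k_algebra A" and J: "ideal J A"
begin

interpretation k_algebra A by (rule A)
interpretation J: ideal J A by (rule J)

lemma quot_alg_carrier: "carrier (quot_alg A J) = (\<lambda>a. J +> a) ` carrier A"
  by (auto simp: quot_alg_def A_RCOSETS_def')

lemma quot_alg_one: "\<one>\<^bsub>quot_alg A J\<^esub> = J +> \<one>"
  by (simp add: quot_alg_def)

lemma quot_alg_zero: "\<zero>\<^bsub>quot_alg A J\<^esub> = J +> \<zero>"
  by (simp add: quot_alg_def J.a_rcos_const J.zero_closed)

lemma quot_alg_add: "a \<in> carrier A \<Longrightarrow> b \<in> carrier A \<Longrightarrow>
  (J +> a) \<oplus>\<^bsub>quot_alg A J\<^esub> (J +> b) = J +> (a \<oplus> b)"
  by (simp add: quot_alg_def J.a_rcos_sum)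

lemma quot_alg_mult: "a \<in> carrier A \<Longrightarrow> b \<in> carrier A \<Longrightarrow>
  (J +> a) \<otimes>\<^bsub>quot_alg A J\<^esub> (J +> b) = J +> (a \<otimes> b)"
  by (simp add: quot_alg_def J.rcoset_mult_add)

lemma ideal_smult: "a \<in> J \<Longrightarrow> c \<odot> a \<in> J"
proof -
  assume a: "a \<in> J"
  then have aA: "a \<in> carrier A" by (rule J.a_Hcarr)
  have "c \<odot> a = (c \<odot> \<one>) \<otimes> a" using smult_mult_left[OF one_closed aA] aA by simp
  also have "\<dots> \<in> J" using a by (intro J.I_l_closed smult_closed) auto
  finally show ?thesis .
qed

lemma quot_alg_smult:
  assumes "a \<in> carrier A"
  shows "c \<odot>\<^bsub>quot_alg A J\<^esub> (J +> a) = J +> (c \<odot> a)"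
proof -
  have "J +> (c \<odot> b) = J +> (c \<odot> a)" if b: "b \<in> J +> a" for b
  proof -
    obtain h where h: "h \<in> J" "b = h \<oplus> a" using b by (auto simp: a_r_coset_def')
    then have "c \<odot> b = c \<odot> h \<oplus> c \<odot> a" using assms J.a_Hcarr[of h] by (simp add: smult_r_distr)
    then have "c \<odot> b \<in> J +> (c \<odot> a)" using ideal_smult[OF h(1)] by (auto simp: a_r_coset_def')
    then show ?thesis
      using J.a_repr_independence'[of "c \<odot> b" "c \<odot> a"] assms by simp
  qed
  then have "(\<Union>b\<in>J +> a. J +> (c \<odot> b)) = (\<Union>b\<in>J +> a. J +> (c \<odot> a))"
    by (intro SUP_cong refl)
  also have "\<dots> = J +> (c \<odot> a)" using J.a_rcos_self[OF assms] by blast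
  finally show ?thesis by (simp add: quot_alg_def)
qed

lemmas quot_alg_simps = quot_alg_one quot_alg_zero quot_alg_add quot_alg_mult quot_alg_smult

lemma quot_alg_ring: "ring (quot_alg A J)"
proof (rule ringI)
  show "abelian_group (quot_alg A J)"
  proof (rule abelian_groupI)
    fix x assume "x \<in> carrier (quot_alg A J)"
    then obtain a where a: "a \<in> carrier A" "x = J +> a" by (auto simp: quot_alg_carrier)
    then have "(J +> (\<ominus> a)) \<oplus>\<^bsub>quot_alg A J\<^esub> x = \<zero>\<^bsub>quot_alg A J\<^esub>"
      by (simp add: quot_alg_simps l_neg)
    then show "\<exists>y\<in>carrier (quot_alg A J). y \<oplus>\<^bsub>quot_alg A J\<^esub> x = \<zero>\<^bsub>quot_alg A J\<^esub>"
      using a by (auto simp: quot_alg_carrier)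
  qed (auto simp: quot_alg_carrier quot_alg_simps a_ac)
  show "Group.monoid (quot_alg A J)"
    by (rule monoidI) (auto simp: quot_alg_carrier quot_alg_simps m_assoc)
qed (auto simp: quot_alg_carrier quot_alg_simps l_distr r_distr)

lemma k_algebra_quot_alg: "k_algebra (quot_alg A J)"
proof (rule k_algebraI[OF quot_alg_ring])
  show "(c + d) \<odot>\<^bsub>quot_alg A J\<^esub> a = c \<odot>\<^bsub>quot_alg A J\<^esub> a \<oplus>\<^bsub>quot_alg A J\<^esub> d \<odot>\<^bsub>quot_alg A J\<^esub> a"
    if "a \<in> carrier (quot_alg A J)" for c d a
    using that smult_l_distr by (auto simp: quot_alg_carrier quot_alg_simps)
  show "(c * d) \<odot>\<^bsub>quot_alg A J\<^esub> a = c \<odot>\<^bsub>quot_alg A J\<^esub> (d \<odot>\<^bsub>quot_alg A J\<^esub> a)"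
    if "a \<in> carrier (quot_alg A J)" for c d a
    using that smult_assoc1 by (auto simp: quot_alg_carrier quot_alg_simps)
  show "1 \<odot>\<^bsub>quot_alg A J\<^esub> a = a" if "a \<in> carrier (quot_alg A J)" for a
    using that smult_one by (auto simp: quot_alg_carrier quot_alg_simps)
qed (auto simp: quot_alg_carrier quot_alg_simps smult_r_distr smult_mult_left smult_mult_right)

lemma quot_alg_proj: "(\<lambda>a. J +> a) \<in> alg_hom A (quot_alg A J)"
  unfolding alg_hom_def
  by (auto intro!: ring_hom_memI simp: quot_alg_carrier quot_alg_simps)

lemma quot_alg_factor:
  fixes B :: "('k, 'b, 'n) module_scheme"
  assumes B: "k_algebra B" and h: "h \<in> alg_hom A B" and hJ: "\<And>a. a \<in> J \<Longrightarrow> h a = \<zero>\<^bsub>B\<^esub>"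
  obtains g where "g \<in> alg_hom (quot_alg A J) B" "\<And>a. a \<in> carrier A \<Longrightarrow> g (J +> a) = h a"
proof -
  interpret B: k_algebra B by (rule B)
  have hr: "h \<in> ring_hom A B" using h by (simp add: alg_hom_def)
  note hs = ring_hom_memE[OF hr]
  define g where "g C = h (SOME a. a \<in> C)" for C
  have g: "g (J +> a) = h a" if a: "a \<in> carrier A" for a
  proof -
    have "(SOME b. b \<in> J +> a) \<in> J +> a" using J.a_rcos_self[OF a] by (rule someI)
    then obtain j where j: "j \<in> J" "(SOME b. b \<in> J +> a) = j \<oplus> a" by (auto simp: a_r_coset_def')
    then show ?thesis using hs(1)[OF a] hs(3)[of j a] a J.a_Hcarr[of j] hJ[of j] by (simp add: g_def)
  qed
  have "g \<in> alg_hom (quot_alg A J) B"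
    using h hs unfolding alg_hom_def
    by (auto intro!: ring_hom_memI simp: quot_alg_carrier quot_alg_simps g)
  then show ?thesis using g that by blast
qed

end


lemma free_assoc_simps [simp]:
  "mult (free_assoc X) = (*)" "one (free_assoc X) = 1" "zero (free_assoc X) = 0"
  "add (free_assoc X) = (+)" "smult (free_assoc X) = scale_poly"
  by (simp_all add: free_assoc_def)

lemma free_assoc_carrier:
  "p \<in> carrier (free_assoc X) \<longleftrightarrow> (\<forall>w\<in>Poly_Mapping.keys p. set w \<subseteq> X)"
  by (simp add: free_assoc_def)

lemma avar_carrier: "x \<in> X \<Longrightarrow> avar x \<in> carrier (free_assoc X)"
  by (simp add: free_assoc_carrier avar_def)

lemma single_Cons: "Poly_Mapping.single (x # w) 1 = avar x * Poly_Mapping.single w (1 :: 'k::field)"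
  by (simp add: avar_def mult_single plus_list_def)

context
  fixes A :: "('k::field, 'a, 'm) module_scheme" (structure) and \<phi> :: "'x \<Rightarrow> 'a"
  assumes A: "k_algebra A" and \<phi>: "\<And>x. \<phi> x \<in> carrier A"
begin

interpretation k_algebra A by (rule A)

lemma smult_closed': "a \<in> carrier A \<Longrightarrow> c \<odot> a \<in> carrier A"
  by (rule smult_closed) auto

lemma word_eval_closed: "word_eval A \<phi> w \<in> carrier A"
  by (induction w) (auto simp: word_eval_def \<phi>)

lemma word_eval_append: "word_eval A \<phi> (u @ v) = word_eval A \<phi> u \<otimes> word_eval A \<phi> v"
proof (induction u)
  case (Cons x u)
  then show ?case using \<phi> word_eval_closed[of u] word_eval_closed[of v]
    by (simp add: word_eval_def m_assoc)
qed (use word_eval_closed[of v] in \<open>simp add: word_eval_def\<close>)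

lemma lift_superset:
  assumes "finite W" "Poly_Mapping.keys p \<subseteq> W"
  shows "free_assoc_lift A \<phi> p = (\<Oplus>w\<in>W. Poly_Mapping.lookup p w \<odot> word_eval A \<phi> w)"
  unfolding free_assoc_lift_def
  using assms
  by (intro add.finprod_mono_neutral_cong_left)
     (auto simp: in_keys_iff smult_closed' word_eval_closed intro: smult_l_null[simplified])

lemma lift_closed: "free_assoc_lift A \<phi> p \<in> carrier A"
  unfolding free_assoc_lift_def by (intro finsum_closed) (auto simp: smult_closed' word_eval_closed)

lemma lift_add: "free_assoc_lift A \<phi> (p + q) = free_assoc_lift A \<phi> p \<oplus> free_assoc_lift A \<phi> q"
proof -
  define W where "W = Poly_Mapping.keys p \<union> Poly_Mapping.keys q"
  have W: "finite W" "Poly_Mapping.keys p \<subseteq> W" "Poly_Mapping.keys q \<subseteq> W" "Poly_Mapping.keys (p + q) \<subseteq> W"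
    using Poly_Mapping.keys_add[of p q] by (auto simp: W_def)
  show ?thesis
    unfolding lift_superset[OF W(1,2)] lift_superset[OF W(1,3)] lift_superset[OF W(1,4)]
    by (subst finsum_addf[symmetric])
       (auto simp: lookup_add smult_closed' word_eval_closed smult_l_distr[simplified]
             intro!: finsum_cong')
qed

lemma lift_single: "free_assoc_lift A \<phi> (Poly_Mapping.single w c) = c \<odot> word_eval A \<phi> w"
  by (subst lift_superset[of "{w}"]) (auto simp: smult_closed' word_eval_closed)

lemma lift_0: "free_assoc_lift A \<phi> 0 = \<zero>"
  by (simp add: free_assoc_lift_def)

lemma lift_scale: "free_assoc_lift A \<phi> (scale_poly c p) = c \<odot> free_assoc_lift A \<phi> p"
proof (induction p rule: poly_mapping_sum_induct)
  case zero
  have "scale_poly c (0 :: 'x list \<Rightarrow>\<^sub>0 'k) = 0" by (rule poly_mapping_eqI) simp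
  then show ?case by (simp add: lift_0 smult_r_null[simplified])
next
  case (single m d)
  then show ?case
    using smult_assoc1[of c d "word_eval A \<phi> m"] by (simp add: lift_single word_eval_closed)
next
  case (add p q)
  then show ?case
    using smult_r_distr[of c "free_assoc_lift A \<phi> p" "free_assoc_lift A \<phi> q"]
    by (simp add: scale_poly_add lift_add lift_closed)
qed

lemma lift_mult: "free_assoc_lift A \<phi> (p * q) = free_assoc_lift A \<phi> p \<otimes> free_assoc_lift A \<phi> q"
proof (induction p rule: poly_mapping_sum_induct)
  case zero
  then show ?case by (simp add: lift_0 lift_closed)
next
  case (single u c)
  show ?case
  proof (induction q rule: poly_mapping_sum_induct)
    case zero
    then show ?case by (simp add: lift_0 lift_closed)
  next
    case (single v d)
    then show ?case
      using smult_assoc1[of c d "word_eval A \<phi> (u @ v)"] smult_assoc1[of d c "word_eval A \<phi> (u @ v)"]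
      by (simp add: mult_single lift_single word_eval_closed smult_mult_left smult_mult_right
          smult_closed' word_eval_append plus_list_def mult.commute)
  next
    case (add p q)
    then show ?case by (simp add: distrib_left lift_add lift_closed r_distr)
  qed
next
  case (add p q)
  then show ?case by (simp add: distrib_right lift_add lift_closed l_distr)
qed

lemma lift_1: "free_assoc_lift A \<phi> 1 = \<one>"
  using lift_single[of "[]" 1] smult_one[of \<one>]
  by (simp flip: single_one add: zero_list_def word_eval_def)

lemma lift_avar: "free_assoc_lift A \<phi> (avar x) = \<phi> x"
  using \<phi> smult_one[of "\<phi> x"] by (simp add: avar_def lift_single word_eval_def)

end

lemma lift_cong:
  assumes A: "k_algebra A" and \<psi>: "\<And>x. \<psi> x \<in> carrier A"
    and p: "p \<in> carrier (free_assoc X)" and eq: "\<And>x. x \<in> X \<Longrightarrow> \<phi> x = \<psi> x"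
  shows "free_assoc_lift A \<phi> p = free_assoc_lift A \<psi> p"
proof -
  interpret k_algebra A by (rule A)
  have "word_eval A \<phi> w = word_eval A \<psi> w" if w: "w \<in> Poly_Mapping.keys p" for w
  proof -
    have "\<phi> x = \<psi> x" if "x \<in> set w" for x
      using p w that by (intro eq) (auto simp: free_assoc_carrier)
    then show ?thesis unfolding word_eval_def by (intro foldr_cong) auto
  qed
  then show ?thesis
    unfolding free_assoc_lift_def
    by (intro finsum_cong') (auto simp: smult_closed'[OF A] word_eval_closed[OF A \<psi>])
qed

lemma free_assoc_lift_hom:
  fixes A :: "('k::field, 'a, 'm) module_scheme" and \<phi> :: "'x \<Rightarrow> 'a"
  assumes A: "k_algebra A" and \<phi>: "\<phi> \<in> X \<rightarrow> carrier A"
  shows "free_assoc_lift A \<phi> \<in> alg_hom (free_assoc X) A"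
    and "\<And>x. x \<in> X \<Longrightarrow> free_assoc_lift A \<phi> (avar x) = \<phi> x"
proof -
  interpret k_algebra A by (rule A)
  interpret F: k_algebra "free_assoc X :: ('k, 'x list \<Rightarrow>\<^sub>0 'k) module" by (rule k_algebra_free_assoc)
  define \<psi> where "\<psi> x = (if x \<in> X then \<phi> x else \<one>\<^bsub>A\<^esub>)" for x
  have \<psi>: "\<psi> x \<in> carrier A" for x using \<phi> by (auto simp: \<psi>_def)
  have eq: "free_assoc_lift A \<phi> p = free_assoc_lift A \<psi> p" if "p \<in> carrier (free_assoc X)" for p
    using A \<psi> that by (rule lift_cong) (auto simp: \<psi>_def)
  note [simp] = lift_closed[OF A \<psi>] lift_add[OF A \<psi>] lift_mult[OF A \<psi>] lift_1[OF A \<psi>]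
    lift_scale[OF A \<psi>] lift_avar[OF A \<psi>]
  show "free_assoc_lift A \<phi> \<in> alg_hom (free_assoc X) A"
    unfolding alg_hom_def
    using F.add.m_closed[simplified] F.m_closed[simplified] F.one_closed[simplified] F.smult_closed[simplified]
    by (auto intro!: ring_hom_memI simp: eq)
  show "free_assoc_lift A \<phi> (avar x) = \<phi> x" if "x \<in> X" for x
    using that by (simp add: eq avar_carrier \<psi>_def)
qed

lemma free_assoc_hom_unique:
  fixes A :: "('k::field, 'a, 'm) module_scheme" and X :: "'x set"
  assumes A: "k_algebra A" and g: "g \<in> alg_hom (free_assoc X) A" and h: "h \<in> alg_hom (free_assoc X) A"
    and eq: "\<And>x. x \<in> X \<Longrightarrow> g (avar x) = h (avar x)" and p: "p \<in> carrier (free_assoc X)"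
  shows "g p = h p"
proof -
  interpret k_algebra A by (rule A)
  interpret F: k_algebra "free_assoc X :: ('k, 'x list \<Rightarrow>\<^sub>0 'k) module" by (rule k_algebra_free_assoc)
  have hr: "g \<in> ring_hom (free_assoc X) A" "h \<in> ring_hom (free_assoc X) A"
    using g h by (auto simp: alg_hom_def)
  note gs = ring_hom_memE[OF hr(1)] and hs = ring_hom_memE[OF hr(2)]
  have single: "Poly_Mapping.single w c \<in> carrier (free_assoc X)" if "set w \<subseteq> X" for w and c :: 'k
    using that by (auto simp: free_assoc_carrier)
  have 1: "g (Poly_Mapping.single w 1) = h (Poly_Mapping.single w 1)" if "set w \<subseteq> X" for w
    using that
  proof (induction w)
    case Nil
    then show ?case using gs(4) hs(4) by (simp flip: single_one add: zero_list_def)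
  next
    case (Cons x w)
    then show ?case
      using gs(2)[of "avar x" "Poly_Mapping.single w 1"] hs(2)[of "avar x" "Poly_Mapping.single w 1"]
      by (simp add: single_Cons avar_carrier single eq)
  qed
  have 2: "g (Poly_Mapping.single w c) = h (Poly_Mapping.single w c)" if "set w \<subseteq> X" for w c
  proof -
    have sc: "f (scale_poly c q) = c \<odot>\<^bsub>A\<^esub> f q"
      if "f \<in> alg_hom (free_assoc X) A" "q \<in> carrier (free_assoc X)" for f q
      using that by (simp add: alg_hom_def)
    show ?thesis
      using sc[OF g single[OF that], of 1] sc[OF h single[OF that], of 1] 1[OF that] by simp
  qed
  have "finite M \<Longrightarrow> M \<subseteq> Poly_Mapping.keys p \<Longrightarrow>
      (\<Sum>m\<in>M. Poly_Mapping.single m (Poly_Mapping.lookup p m)) \<in> carrier (free_assoc X) \<and>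
      g (\<Sum>m\<in>M. Poly_Mapping.single m (Poly_Mapping.lookup p m))
      = h (\<Sum>m\<in>M. Poly_Mapping.single m (Poly_Mapping.lookup p m))" for M
  proof (induction M rule: finite_induct)
    case empty
    have "g 0 = \<zero>\<^bsub>A\<^esub>" "h 0 = \<zero>\<^bsub>A\<^esub>"
      using ring_hom_zero[OF hr(1) F.ring_axioms ring_axioms] ring_hom_zero[OF hr(2) F.ring_axioms ring_axioms]
      by simp_all
    then show ?case using F.zero_closed by simp
  next
    case (insert m M)
    have m: "set m \<subseteq> X" using insert p by (auto simp: free_assoc_carrier)
    let ?s = "Poly_Mapping.single m (Poly_Mapping.lookup p m)"
    let ?S = "\<Sum>m\<in>M. Poly_Mapping.single m (Poly_Mapping.lookup p m)"
    have S: "?S \<in> carrier (free_assoc X)" "g ?S = h ?S" using insert by auto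
    have "?s + ?S \<in> carrier (free_assoc X)"
      using F.add.m_closed[OF single[OF m, of "Poly_Mapping.lookup p m"] S(1)] by simp
    moreover have "g (?s + ?S) = h (?s + ?S)"
      using gs(3)[OF single[OF m] S(1)] hs(3)[OF single[OF m] S(1)] 2[OF m] S(2) by simp
    ultimately show ?case using insert by simp
  qed
  from this[OF _ order_refl] show ?thesis by (simp flip: poly_sum_single)
qed


section \<open>The universal property of the coproduct\<close>

lemma coproduct_rels_carrier:
  assumes "\<And>i. i \<in> I \<Longrightarrow> k_algebra (A i)"
  shows "coproduct_rels I A \<subseteq> carrier (coproduct_free I A)"
proof -
  interpret F: k_algebra "coproduct_free I A" unfolding coproduct_free_def by (rule k_algebra_free_assoc)
  have minus: "p - q \<in> carrier (coproduct_free I A)"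
    if "p \<in> carrier (coproduct_free I A)" "q \<in> carrier (coproduct_free I A)" for p q
  proof -
    have pq: "p - q = p + scale_poly (- 1) q" by (rule poly_mapping_eqI) (simp add: lookup_minus lookup_add)
    have "p + scale_poly (- 1) q \<in> carrier (coproduct_free I A)"
      using F.add.m_closed[OF that(1) F.smult_closed[OF _ that(2), of "-1"]]
      by (simp add: coproduct_free_def)
    then show ?thesis by (simp only: pq)
  qed
  have A: "\<And>i. i \<in> I \<Longrightarrow> ring (A i)" "\<And>i. i \<in> I \<Longrightarrow> module field_ring (A i)"
    using assms k_algebraD by blast+
  have F: "add (coproduct_free I A) = (+)" "mult (coproduct_free I A) = (*)" "one (coproduct_free I A) = 1"
    "smult (coproduct_free I A) = scale_poly"
    by (simp_all add: coproduct_free_def)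
  have v: "avar (i, a) \<in> carrier (coproduct_free I A)" if "i \<in> I" "a \<in> carrier (A i)" for i a
    using that by (auto simp: coproduct_free_def intro!: avar_carrier)
  have [intro!]: "c \<odot>\<^bsub>A i\<^esub> a \<in> carrier (A i)" if "i \<in> I" "a \<in> carrier (A i)" for c i a
    using module.smult_closed[OF A(2)] that by simp
  have [intro!]: "scale_poly c (avar (i, a)) \<in> carrier (coproduct_free I A)"
    if "i \<in> I" "a \<in> carrier (A i)" for c i a
    using F.smult_closed[OF _ v[OF that], of c] by (simp add: F)
  note [intro!] = F.add.m_closed[OF v v, unfolded F] F.m_closed[OF v v, unfolded F]
    F.one_closed[unfolded F] minus v ring.ring_simprules(1,5,6)[OF A(1)]
  show ?thesis unfolding coproduct_rels_def by auto
qed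


context
  fixes I :: "'i set" and A :: "'i \<Rightarrow> ('k::field, 'a, 'm) module_scheme"
  assumes A: "\<And>i. i \<in> I \<Longrightarrow> k_algebra (A i)"
begin

lemma coproduct_free_alg: "k_algebra (coproduct_free I A)"
  unfolding coproduct_free_def by (rule k_algebra_free_assoc)

lemma coproduct_free_avar: "i \<in> I \<Longrightarrow> a \<in> carrier (A i) \<Longrightarrow> avar (i, a) \<in> carrier (coproduct_free I A)"
  by (auto simp: coproduct_free_def intro!: avar_carrier)

lemma coproduct_ideal: "ideal (coproduct_ideal I A) (coproduct_free I A)"
  unfolding coproduct_ideal_def
  by (rule ring.genideal_ideal[OF k_algebraD(1)[OF coproduct_free_alg] coproduct_rels_carrier[OF A]])

theorem k_algebra_coproduct: "k_algebra (coproduct I A)"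
  unfolding coproduct_def by (rule k_algebra_quot_alg[OF coproduct_free_alg coproduct_ideal])

lemma coproduct_rel_eq:
  assumes "p - q \<in> coproduct_rels I A" "q \<in> carrier (coproduct_free I A)"
  shows "coproduct_ideal I A +>\<^bsub>coproduct_free I A\<^esub> p = coproduct_ideal I A +>\<^bsub>coproduct_free I A\<^esub> q"
proof -
  interpret F: k_algebra "coproduct_free I A" by (rule coproduct_free_alg)
  interpret J: ideal "coproduct_ideal I A" "coproduct_free I A" by (rule coproduct_ideal)
  have "p - q \<in> coproduct_ideal I A"
    using F.genideal_self[OF coproduct_rels_carrier[OF A]] assms(1) by (auto simp: coproduct_ideal_def)
  moreover have "p = (p - q) \<oplus>\<^bsub>coproduct_free I A\<^esub> q" by (simp add: coproduct_free_def)
  ultimately have "p \<in> coproduct_ideal I A +>\<^bsub>coproduct_free I A\<^esub> q"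
    unfolding a_r_coset_def' by blast
  then show ?thesis using J.a_repr_independence'[OF _ assms(2)] by simp
qed

theorem coproj_hom:
  assumes i: "i \<in> I"
  shows "coproj I A i \<in> alg_hom (A i) (coproduct I A)"
proof -
  interpret F: k_algebra "coproduct_free I A" by (rule coproduct_free_alg)
  interpret Ai: k_algebra "A i" by (rule A[OF i])
  note v = coproduct_free_avar[OF i]
  let ?p = "\<lambda>p. coproduct_ideal I A +>\<^bsub>coproduct_free I A\<^esub> p"
  note q = quot_alg_simps[OF coproduct_free_alg coproduct_ideal, folded coproduct_def]
  have F: "add (coproduct_free I A) = (+)" "mult (coproduct_free I A) = (*)" "one (coproduct_free I A) = 1"
    "smult (coproduct_free I A) = scale_poly"
    by (simp_all add: coproduct_free_def)
  show ?thesis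
    unfolding alg_hom_def mem_Collect_eq
  proof (intro conjI ballI allI ring_hom_memI)
    fix a b c assume a: "a \<in> carrier (A i)"
    show "coproj I A i a \<in> carrier (coproduct I A)"
      using v[OF a] by (auto simp: coproj_def coproduct_def quot_alg_carrier[OF coproduct_free_alg coproduct_ideal])
    show "coproj I A i (c \<odot>\<^bsub>A i\<^esub> a) = c \<odot>\<^bsub>coproduct I A\<^esub> coproj I A i a"
      unfolding coproj_def q(5)[OF v[OF a]]
      using i a F.smult_closed[OF _ v[OF a], of c]
      by (intro coproduct_rel_eq) (auto simp: coproduct_rels_def F)
    assume b: "b \<in> carrier (A i)"
    show "coproj I A i (a \<oplus>\<^bsub>A i\<^esub> b) = coproj I A i a \<oplus>\<^bsub>coproduct I A\<^esub> coproj I A i b"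
      unfolding coproj_def q(3)[OF v[OF a] v[OF b]]
      using i a b F.add.m_closed[OF v[OF a] v[OF b]]
      by (intro coproduct_rel_eq) (auto simp: coproduct_rels_def F)
    show "coproj I A i (a \<otimes>\<^bsub>A i\<^esub> b) = coproj I A i a \<otimes>\<^bsub>coproduct I A\<^esub> coproj I A i b"
      unfolding coproj_def q(4)[OF v[OF a] v[OF b]]
      using i a b F.m_closed[OF v[OF a] v[OF b]]
      by (intro coproduct_rel_eq) (auto simp: coproduct_rels_def F)
  next
    show "coproj I A i \<one>\<^bsub>A i\<^esub> = \<one>\<^bsub>coproduct I A\<^esub>"
      unfolding coproj_def q(1)
      using i F.one_closed
      by (intro coproduct_rel_eq) (auto simp: coproduct_rels_def F)
  qed
qed

theorem coproduct_universal:
  fixes B :: "('k, 'b, 'n) module_scheme"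
  assumes B: "k_algebra B" and h: "\<And>i. i \<in> I \<Longrightarrow> h i \<in> alg_hom (A i) B"
  shows "\<exists>g\<in>alg_hom (coproduct I A) B. \<forall>i\<in>I. \<forall>a\<in>carrier (A i). g (coproj I A i a) = h i a"
proof -
  interpret F: k_algebra "coproduct_free I A" by (rule coproduct_free_alg)
  interpret B: k_algebra B by (rule B)
  let ?L = "free_assoc_lift B (\<lambda>(i, a). h i a)"
  have hr: "h i \<in> ring_hom (A i) B" if "i \<in> I" for i using h[OF that] by (simp add: alg_hom_def)
  have *: "(\<lambda>(i, a). h i a) \<in> (SIGMA i:I. carrier (A i)) \<rightarrow> carrier B"
    using ring_hom_memE(1)[OF hr] by auto
  have L: "?L \<in> alg_hom (coproduct_free I A) B"
    using free_assoc_lift_hom(1)[OF B *] by (simp add: coproduct_free_def)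
  have Lv: "?L (avar (i, a)) = h i a" if "i \<in> I" "a \<in> carrier (A i)" for i a
    using free_assoc_lift_hom(2)[OF B *, of "(i, a)"] that by simp
  have Lr: "?L \<in> ring_hom (coproduct_free I A) B" using L by (simp add: alg_hom_def)
  interpret L: ring_hom_ring "coproduct_free I A" B ?L
    by (rule ring_hom_ringI2[OF F.ring_axioms B.ring_axioms Lr])
  note v = coproduct_free_avar
  have F: "add (coproduct_free I A) = (+)" "mult (coproduct_free I A) = (*)" "one (coproduct_free I A) = 1"
    "smult (coproduct_free I A) = scale_poly"
    by (simp_all add: coproduct_free_def)
  have Ls: "?L (scale_poly c p) = c \<odot>\<^bsub>B\<^esub> ?L p" if "p \<in> carrier (coproduct_free I A)" for c p
    using L that by (simp add: alg_hom_def F)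
  have zero: "?L (p - q) = \<zero>\<^bsub>B\<^esub>"
    if r: "p - q \<in> coproduct_rels I A" and q: "q \<in> carrier (coproduct_free I A)" and e: "?L p = ?L q" for p q
  proof -
    have pq: "p - q \<in> carrier (coproduct_free I A)" 
      by (rule subsetD[OF coproduct_rels_carrier[OF A] r])
    have "(p - q) \<oplus>\<^bsub>coproduct_free I A\<^esub> q = p" by (simp add: F)
    then have "?L p = ?L (p - q) \<oplus>\<^bsub>B\<^esub> ?L q" using L.hom_add[OF pq q] by (simp only:)
    then have "\<zero>\<^bsub>B\<^esub> \<oplus>\<^bsub>B\<^esub> ?L q = ?L (p - q) \<oplus>\<^bsub>B\<^esub> ?L q"
      using L.hom_closed[OF q] by (simp only: e B.l_zero)
    then show ?thesis
      using B.add.right_cancel[OF L.hom_closed[OF q] B.zero_closed L.hom_closed[OF pq]] by (simp only:)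
  qed
  have "coproduct_rels I A \<subseteq> a_kernel (coproduct_free I A) B ?L"
  proof
    fix r assume r: "r \<in> coproduct_rels I A"
    have "r \<in> carrier (coproduct_free I A)"
      by (rule subsetD[OF coproduct_rels_carrier[OF A] r])
    moreover have "?L r = \<zero>\<^bsub>B\<^esub>"
    proof -
      consider (add) i a b where "r = avar (i, a \<oplus>\<^bsub>A i\<^esub> b) - (avar (i, a) + avar (i, b))"
          "i \<in> I" "a \<in> carrier (A i)" "b \<in> carrier (A i)"
        | (smult) i c a where "r = avar (i, c \<odot>\<^bsub>A i\<^esub> a) - scale_poly c (avar (i, a))"
          "i \<in> I" "a \<in> carrier (A i)"
        | (mult) i a b where "r = avar (i, a \<otimes>\<^bsub>A i\<^esub> b) - avar (i, a) * avar (i, b)"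
          "i \<in> I" "a \<in> carrier (A i)" "b \<in> carrier (A i)"
        | (one) i where "r = avar (i, \<one>\<^bsub>A i\<^esub>) - 1" "i \<in> I"
        using r unfolding coproduct_rels_def by blast
      then show ?thesis
      proof cases
        case add
        interpret Ai: k_algebra "A i" by (rule A[OF add(2)])
        note w = v[OF add(2) add(3)] v[OF add(2) add(4)]
        show ?thesis unfolding add(1)
          by (rule zero)
             (use r add w F.add.m_closed[OF w] L.hom_add[OF w] ring_hom_memE(3)[OF hr] in \<open>auto simp: Lv F\<close>)
      next
        case smult
        interpret Ai: k_algebra "A i" by (rule A[OF smult(2)])
        note w = v[OF smult(2) smult(3)]
        show ?thesis unfolding smult(1)
          by (rule zero)
             (use r smult w F.smult_closed[OF _ w, of c] Ls[OF w] h in \<open>auto simp: Lv F alg_hom_def\<close>)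
      next
        case mult
        interpret Ai: k_algebra "A i" by (rule A[OF mult(2)])
        note w = v[OF mult(2) mult(3)] v[OF mult(2) mult(4)]
        show ?thesis unfolding mult(1)
          by (rule zero)
             (use r mult w F.m_closed[OF w] L.hom_mult[OF w] ring_hom_memE(2)[OF hr] in \<open>auto simp: Lv F\<close>)
      next
        case one
        interpret Ai: k_algebra "A i" by (rule A[OF one(2)])
        show ?thesis unfolding one(1)
          by (rule zero)
             (use r one F.one_closed L.hom_one ring_hom_memE(4)[OF hr] in \<open>auto simp: Lv F\<close>)
      qed
    qed
    ultimately show "r \<in> a_kernel (coproduct_free I A) B ?L" unfolding a_kernel_def' by blast
  qed
  then have "coproduct_ideal I A \<subseteq> a_kernel (coproduct_free I A) B ?L"
    unfolding coproduct_ideal_def by (rule F.genideal_minimal[OF L.kernel_is_ideal])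
  then have L0: "?L p = \<zero>\<^bsub>B\<^esub>" if "p \<in> coproduct_ideal I A" for p
    using that unfolding a_kernel_def' by blast
  obtain g where g: "g \<in> alg_hom (coproduct I A) B"
    "\<And>p. p \<in> carrier (coproduct_free I A) \<Longrightarrow> g (coproduct_ideal I A +>\<^bsub>coproduct_free I A\<^esub> p) = ?L p"
    using quot_alg_factor[OF coproduct_free_alg coproduct_ideal B L L0] unfolding coproduct_def by blast
  have "g (coproj I A i a) = h i a" if "i \<in> I" "a \<in> carrier (A i)" for i a
    unfolding coproj_def using g(2)[OF v[OF that]] Lv[OF that] by simp
  with g(1) show ?thesis by blast
qed

theorem coproduct_universal_unique:
  fixes B :: "('k, 'b, 'n) module_scheme"
  assumes B: "k_algebra B" and g: "g \<in> alg_hom (coproduct I A) B" and h: "h \<in> alg_hom (coproduct I A) B"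
    and eq: "\<And>i a. i \<in> I \<Longrightarrow> a \<in> carrier (A i) \<Longrightarrow> g (coproj I A i a) = h (coproj I A i a)"
    and t: "t \<in> carrier (coproduct I A)"
  shows "g t = h t"
proof -
  let ?p = "\<lambda>p. coproduct_ideal I A +>\<^bsub>coproduct_free I A\<^esub> p"
  have P: "?p \<in> alg_hom (coproduct_free I A) (coproduct I A)"
    unfolding coproduct_def by (rule quot_alg_proj[OF coproduct_free_alg coproduct_ideal])
  have comp: "(\<lambda>p. f (?p p)) \<in> alg_hom (free_assoc (SIGMA i:I. carrier (A i))) B"
    if "f \<in> alg_hom (coproduct I A) B" for f
    using P that unfolding alg_hom_def coproduct_free_def[symmetric]
    by (auto simp: ring_hom_def Pi_def)
  obtain p where p: "p \<in> carrier (coproduct_free I A)" "t = ?p p"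
    using t by (auto simp: coproduct_def quot_alg_carrier[OF coproduct_free_alg coproduct_ideal])
  have "g (?p p) = h (?p p)"
    by (rule free_assoc_hom_unique[OF B comp[OF g] comp[OF h]])
       (use eq p(1) in \<open>auto simp: coproj_def coproduct_free_def\<close>)
  then show ?thesis using p(2) by simp
qed

end

end

theory Submission
  imports Defs Complex_Main
begin

text \<open>
  Write \<open>T\<close> for the splay algebra, \<open>S\<close> for the tensor product and \<open>J\<close> for the ideal generated by the
  \<open>a a' - a' a - \<pi>(a, a')\<close>.  Let \<open>ord : S \<rightarrow> T\<close> multiply the components of a pure tensor in the order
  of \<open>I\<close>.  A commutator agrees modulo \<open>J\<close> with a bracket, which has lower degree, so
  \<open>T = ord(S) + J\<close> by induction on the degree, and it remains to find a linear map \<open>\<tau> : T \<rightarrow> S\<close> that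
  kills \<open>J\<close> and splits \<open>ord\<close>.

  A Poisson bracket on a noncommutative algebra is rigid: expanding \<open>\<pi>(a c, b d)\<close> in two ways, and
  then replacing \<open>c\<close> by \<open>u c\<close>, gives \<open>[a, b] u \<pi>(c, d) = \<pi>(a, b) u [c, d]\<close>.  Apply this in representations of \<open>T\<close> by upper
  triangular matrices over \<open>S \<otimes> S\<close>, whose diagonal entries are the two abelianizations
  \<open>T \<rightarrow> S \<otimes> S\<close>.  Since \<open>\<pi>\<close> lowers the degree, either all brackets vanish in \<open>S\<close>, and the
  abelianization \<open>T \<rightarrow> S\<close> is the required \<open>\<tau>\<close>; or \<open>k\<close> has characteristic two, exactly two of the
  coordinate algebras are nontrivial, they are \<open>k[x]/(x\<^sup>2 - p)\<close> and \<open>k[y]/(y\<^sup>2 - q)\<close>, and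
  \<open>\<pi>(x, y)\<close> is a scalar.  In the latter case \<open>T / J\<close> is a Clifford algebra, and \<open>\<tau>\<close> is read off
  from a representation by matrices of size two over \<open>S\<close>.
\<close>

section \<open>Linear maps and functionals\<close>

text \<open>The map \<open>abel\<close> from T to S splits \<open>ord\<close> for every order on I,
  and it kills J exactly when all brackets become zero in S; the work goes into a bracket that does
  not. Rigidity says nothing in S, where commutators vanish. In a triangular representation a
  commutator has zero diagonal but a visible corner entry, and the unknown corner entry of a bracket
  only ever meets that zero diagonal, so it drops out. What is left is an identity between known
  elements of S \<otimes> S, read through slices id \<otimes> \<psi>. Take x in A_i and y in A_j
  with nonzero bracket of smallest degree. Functionals that see only the top degrees of x and y show
  that the bracket is affine in x and y over k. Unless it involves x but not y, rigidity then gives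
  x \<otimes> w + w \<otimes> x = 1 \<otimes> xw + xw \<otimes> 1 for all w in A_i. Pairing this
  with functionals, one of which vanishes at 1, gives 2 = 0, x^2 in k and A_i = k + kx; this is
  where characteristic two comes from. All this happens in S. A representation of T needs the
  bracket itself, and a second use of the degree shows that it is a scalar already in T.\<close>

context k_algebra
begin

lemma scale_closed [simp, intro]: "a \<in> carrier A \<Longrightarrow> c \<odot> a \<in> carrier A"
  by (rule smult_closed) auto

lemma scale_add_left: "a \<in> carrier A \<Longrightarrow> (c + d) \<odot> a = c \<odot> a \<oplus> d \<odot> a"
  using smult_l_distr[of c d a] by simp

lemma scale_add_right: "a \<in> carrier A \<Longrightarrow> b \<in> carrier A \<Longrightarrow> c \<odot> (a \<oplus> b) = c \<odot> a \<oplus> c \<odot> b"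
  using smult_r_distr[of c a b] by simp

lemma scale_scale [simp]: "a \<in> carrier A \<Longrightarrow> c \<odot> (d \<odot> a) = (c * d) \<odot> a"
  using smult_assoc1[of c d a] by simp

lemma scale_zero_left [simp]: "a \<in> carrier A \<Longrightarrow> 0 \<odot> a = \<zero>"
  using smult_l_null[of a] by simp

lemma scale_zero_right [simp]: "c \<odot> \<zero> = \<zero>"
  using smult_r_null[of c] by simp

lemma scale_one [simp]: "a \<in> carrier A \<Longrightarrow> 1 \<odot> a = a"
  using smult_one[of a] by simp

lemma scale_uminus_left: "a \<in> carrier A \<Longrightarrow> (- c) \<odot> a = \<ominus> (c \<odot> a)"
  using minus_equality[of "(- c) \<odot> a" "c \<odot> a"] scale_add_left[of a "- c" c] by simp

lemma minus_scale: "a \<in> carrier A \<Longrightarrow> \<ominus> a = (- 1) \<odot> a"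
  using scale_uminus_left[of a 1] by simp

lemma scale_cancel: "a \<in> carrier A \<Longrightarrow> c \<odot> a = \<zero> \<Longrightarrow> c \<noteq> 0 \<Longrightarrow> a = \<zero>"
  using scale_scale[of a "inverse c" c] by simp

text \<open>Negatives are multiples by -1, so closure under scalars covers the group part.\<close>

lemma submodI:
  assumes "H \<subseteq> carrier A" "\<zero> \<in> H" "\<And>a b. a \<in> H \<Longrightarrow> b \<in> H \<Longrightarrow> a \<oplus> b \<in> H"
    "\<And>c a. a \<in> H \<Longrightarrow> c \<odot> a \<in> H"
  shows "submodule H field_ring A"
proof (rule submoduleI)
  show "\<ominus> a \<in> H" if "a \<in> H" for a
    using assms(1) assms(4)[OF that, of "-1"] that by (auto simp: minus_scale)
qed (use assms in auto)

lemma ideal_submod: "ideal J A \<Longrightarrow> submodule J field_ring A"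
  using ideal.axioms(1) additive_subgroup.a_subgroup ideal_smult[OF k_algebra_axioms]
  by (auto simp: submodule_def submodule_axioms_def)

lemma submodD:
  assumes "submodule H field_ring A"
  shows "\<And>a. a \<in> H \<Longrightarrow> a \<in> carrier A" "\<zero> \<in> H" "\<And>a b. a \<in> H \<Longrightarrow> b \<in> H \<Longrightarrow> a \<oplus> b \<in> H"
    "\<And>c a. a \<in> H \<Longrightarrow> c \<odot> a \<in> H" "\<And>a b. a \<in> H \<Longrightarrow> b \<in> H \<Longrightarrow> a \<ominus> b \<in> H"
proof -
  note E = submoduleE[OF assms]
  show "\<And>a. a \<in> H \<Longrightarrow> a \<in> carrier A" using E(1) by blast
  show "\<And>a b. a \<in> H \<Longrightarrow> b \<in> H \<Longrightarrow> a \<oplus> b \<in> H" using E(5) .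
  show sc: "\<And>c a. a \<in> H \<Longrightarrow> c \<odot> a \<in> H" using E(4) by simp
  obtain a where "a \<in> H" using E(2) by blast
  then show "\<zero> \<in> H" using sc[of a 0] E(1) by auto
  show "\<And>a b. a \<in> H \<Longrightarrow> b \<in> H \<Longrightarrow> a \<ominus> b \<in> H" using E(3,5) by (simp add: a_minus_def)
qed

end

text \<open>Values off \<open>carrier M\<close> are unconstrained, so maps are compared on the
  carrier alone. Functionals are the case \<open>N = base_alg\<close>.\<close>

definition lin_map :: "('k::field, 'a, 'm) module_scheme \<Rightarrow> ('k, 'b, 'n) module_scheme \<Rightarrow> ('a \<Rightarrow> 'b) set"
  where "lin_map M N = {h. (\<forall>a\<in>carrier M. h a \<in> carrier N) \<and>
    (\<forall>a\<in>carrier M. \<forall>b\<in>carrier M. h (a \<oplus>\<^bsub>M\<^esub> b) = h a \<oplus>\<^bsub>N\<^esub> h b) \<and>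
    (\<forall>c. \<forall>a\<in>carrier M. h (c \<odot>\<^bsub>M\<^esub> a) = c \<odot>\<^bsub>N\<^esub> h a)}"

lemma lin_mapI:
  assumes "\<And>a. a \<in> carrier M \<Longrightarrow> h a \<in> carrier N"
    "\<And>a b. a \<in> carrier M \<Longrightarrow> b \<in> carrier M \<Longrightarrow> h (a \<oplus>\<^bsub>M\<^esub> b) = h a \<oplus>\<^bsub>N\<^esub> h b"
    "\<And>c a. a \<in> carrier M \<Longrightarrow> h (c \<odot>\<^bsub>M\<^esub> a) = c \<odot>\<^bsub>N\<^esub> h a"
  shows "h \<in> lin_map M N"
  using assms by (simp add: lin_map_def)

lemma lin_mapD:
  assumes "h \<in> lin_map M N"
  shows "\<And>a. a \<in> carrier M \<Longrightarrow> h a \<in> carrier N"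
    "\<And>a b. a \<in> carrier M \<Longrightarrow> b \<in> carrier M \<Longrightarrow> h (a \<oplus>\<^bsub>M\<^esub> b) = h a \<oplus>\<^bsub>N\<^esub> h b"
    "\<And>c a. a \<in> carrier M \<Longrightarrow> h (c \<odot>\<^bsub>M\<^esub> a) = c \<odot>\<^bsub>N\<^esub> h a"
  using assms by (auto simp: lin_map_def)

lemma lin_map_zero_minus:
  assumes "h \<in> lin_map M N" "k_algebra M" "k_algebra N"
  shows "h \<zero>\<^bsub>M\<^esub> = \<zero>\<^bsub>N\<^esub>"
    and "\<And>a b. a \<in> carrier M \<Longrightarrow> b \<in> carrier M \<Longrightarrow> h (a \<ominus>\<^bsub>M\<^esub> b) = h a \<ominus>\<^bsub>N\<^esub> h b"
    and "\<And>a. a \<in> carrier M \<Longrightarrow> h (\<ominus>\<^bsub>M\<^esub> a) = \<ominus>\<^bsub>N\<^esub> h a"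
proof -
  interpret M: k_algebra M by fact
  interpret N: k_algebra N by fact
  note h = lin_mapD[OF assms(1)]
  show "h \<zero>\<^bsub>M\<^esub> = \<zero>\<^bsub>N\<^esub>" using h(3)[of "\<zero>\<^bsub>M\<^esub>" 0] h(1)[of "\<zero>\<^bsub>M\<^esub>"] by simp
  show neg: "\<And>a. a \<in> carrier M \<Longrightarrow> h (\<ominus>\<^bsub>M\<^esub> a) = \<ominus>\<^bsub>N\<^esub> h a"
    by (simp add: M.minus_scale N.minus_scale h)
  show "\<And>a b. a \<in> carrier M \<Longrightarrow> b \<in> carrier M \<Longrightarrow> h (a \<ominus>\<^bsub>M\<^esub> b) = h a \<ominus>\<^bsub>N\<^esub> h b"
    by (simp add: a_minus_def h neg)
qed

lemma alg_hom_lin: "h \<in> alg_hom M N \<Longrightarrow> h \<in> lin_map M N"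
  by (auto simp: alg_hom_def ring_hom_def intro!: lin_mapI)

lemma alg_homD:
  assumes "h \<in> alg_hom M N"
  shows "\<And>a b. a \<in> carrier M \<Longrightarrow> b \<in> carrier M \<Longrightarrow> h (a \<otimes>\<^bsub>M\<^esub> b) = h a \<otimes>\<^bsub>N\<^esub> h b"
    "h \<one>\<^bsub>M\<^esub> = \<one>\<^bsub>N\<^esub>"
  using assms by (auto simp: alg_hom_def ring_hom_def)

lemma alg_homI:
  assumes "h \<in> lin_map M N"
    "\<And>a b. a \<in> carrier M \<Longrightarrow> b \<in> carrier M \<Longrightarrow> h (a \<otimes>\<^bsub>M\<^esub> b) = h a \<otimes>\<^bsub>N\<^esub> h b"
    "h \<one>\<^bsub>M\<^esub> = \<one>\<^bsub>N\<^esub>"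
  shows "h \<in> alg_hom M N"
  using assms by (auto simp: alg_hom_def ring_hom_def lin_map_def)

text \<open>Factorization through a quotient for maps that are linear but need not respect products:
  the retraction onto S in the exceptional case is of this kind.\<close>

lemma lin_map_quot:
  assumes M: "k_algebra M" and J: "ideal J M" and N: "k_algebra N"
    and h: "h \<in> lin_map M N" and hJ: "\<And>a. a \<in> J \<Longrightarrow> h a = \<zero>\<^bsub>N\<^esub>"
  shows "\<exists>g\<in>lin_map (quot_alg M J) N. \<forall>a\<in>carrier M. g (J +>\<^bsub>M\<^esub> a) = h a"
proof -
  interpret M: k_algebra M by fact
  interpret N: k_algebra N by fact
  interpret J: ideal J M by fact
  note hs = lin_mapD[OF h]
  define g where "g C = h (SOME a. a \<in> C)" for C
  have g: "g (J +>\<^bsub>M\<^esub> a) = h a" if a: "a \<in> carrier M" for a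
  proof -
    have "(SOME b. b \<in> J +>\<^bsub>M\<^esub> a) \<in> J +>\<^bsub>M\<^esub> a" using J.a_rcos_self[OF a] by (rule someI)
    then obtain j where j: "j \<in> J" "(SOME b. b \<in> J +>\<^bsub>M\<^esub> a) = j \<oplus>\<^bsub>M\<^esub> a" by (auto simp: a_r_coset_def')
    then show ?thesis using hs(1)[OF a] hs(2)[of j a] a J.a_Hcarr[of j] hJ[of j] by (simp add: g_def)
  qed
  have "g \<in> lin_map (quot_alg M J) N"
    by (rule lin_mapI) (auto simp: quot_alg_carrier[OF M J] quot_alg_simps[OF M J] g hs)
  then show ?thesis using g by blast
qed

section \<open>Linear functionals and the separation of a vector from a submodule\<close>

definition base_alg :: "('k::field, 'k) module"
  where "base_alg = \<lparr>carrier = UNIV, mult = (*), one = 1, zero = 0, add = (+), smult = (*)\<rparr>"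

lemma base_alg_simps [simp]:
  "carrier base_alg = UNIV" "mult base_alg = (*)" "one base_alg = 1" "zero base_alg = 0"
  "add base_alg = (+)" "smult base_alg = (*)"
  by (simp_all add: base_alg_def)

lemma k_algebra_base: "k_algebra (base_alg :: ('k::field, 'k) module)"
proof (rule k_algebraI)
  have "cring (base_alg :: ('k, 'k) module)"
  proof (rule cringI)
    show "abelian_group (base_alg :: ('k, 'k) module)"
      by (rule abelian_groupI) (auto intro: exI[of _ "- x" for x] simp: algebra_simps add_eq_0_iff2)
    show "comm_monoid (base_alg :: ('k, 'k) module)"
      by (rule comm_monoidI) auto
  qed (auto simp: algebra_simps)
  then show "ring (base_alg :: ('k, 'k) module)" by (rule cring.axioms(1))
qed (auto simp: algebra_simps)

lemma poly_mapping_induct_on [consumes 1, case_names zero single add]: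
  fixes p :: "'m \<Rightarrow>\<^sub>0 'k::field"
  assumes "Poly_Mapping.keys p \<subseteq> F" "P 0" "\<And>m c. m \<in> F \<Longrightarrow> P (Poly_Mapping.single m c)"
    "\<And>p q. Poly_Mapping.keys p \<subseteq> F \<Longrightarrow> Poly_Mapping.keys q \<subseteq> F \<Longrightarrow> P p \<Longrightarrow> P q \<Longrightarrow> P (p + q)"
  shows "P p"
proof -
  let ?s = "\<lambda>M. \<Sum>m\<in>M. Poly_Mapping.single m (Poly_Mapping.lookup p m)"
  have "Poly_Mapping.keys (?s M) \<subseteq> F \<and> P (?s M)" if "finite M" "M \<subseteq> F" for M
    using that
  proof (induction M)
    case (insert m M)
    let ?t = "Poly_Mapping.single m (Poly_Mapping.lookup p m)"
    have "Poly_Mapping.keys (?t + ?s M) \<subseteq> F"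
      using insert Poly_Mapping.keys_add[of ?t "?s M"] by (auto split: if_splits)
    then show ?case using insert assms(3)[of m] assms(4)[of ?t "?s M"] by auto
  qed (auto simp: assms)
  then show ?thesis using assms(1) by (subst poly_sum_single) simp
qed

text \<open>Extend a basis of W by v and prescribe 0 on the basis and 1 at v. Formal sums form a
  vector space on the whole type, where bases are at hand; the case of a carrier is reduced to this
  one.\<close>

lemma poly_functional_exists:
  fixes W :: "('m \<Rightarrow>\<^sub>0 'k::field) set"
  assumes W: "0 \<in> W" "\<And>p q. p \<in> W \<Longrightarrow> q \<in> W \<Longrightarrow> p + q \<in> W" "\<And>c p. p \<in> W \<Longrightarrow> scale_poly c p \<in> W"
    and v: "v \<notin> W"
  obtains f :: "('m \<Rightarrow>\<^sub>0 'k) \<Rightarrow> 'k" where "\<And>p q. f (p + q) = f p + f q" "\<And>p q. f (p - q) = f p - f q"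
    "\<And>c p. f (scale_poly c p) = c * f p" "\<And>w. w \<in> W \<Longrightarrow> f w = 0" "f v = 1"
proof -
  interpret V: vector_space "scale_poly :: 'k \<Rightarrow> ('m \<Rightarrow>\<^sub>0 'k) \<Rightarrow> _"
    by unfold_locales (auto intro!: poly_mapping_eqI simp: lookup_add algebra_simps)
  interpret K: vector_space "(*) :: 'k \<Rightarrow> 'k \<Rightarrow> 'k"
    by unfold_locales (auto simp: algebra_simps)
  interpret VK: vector_space_pair "scale_poly :: 'k \<Rightarrow> ('m \<Rightarrow>\<^sub>0 'k) \<Rightarrow> _" "(*) :: 'k \<Rightarrow> 'k \<Rightarrow> 'k" ..
  have "V.subspace W" using W by (simp add: V.subspace_def)
  then obtain B where B: "B \<subseteq> W" "V.independent B" "V.span B = W"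
    using V.basis_exists[of W] V.span_subspace[of _ W] by metis
  have "V.independent (insert v B)"
    using B v by (intro V.independent_insertI) auto
  then obtain f where f: "Vector_Spaces.linear scale_poly (*) f" "\<forall>x\<in>insert v B. f x = (if x = v then 1 else 0)"
    using VK.linear_independent_extend[of "insert v B" "\<lambda>x. if x = v then 1 else 0"] by blast
  have "f w = 0" if "w \<in> W" for w
    using that unfolding B(3)[symmetric]
    by (rule VK.linear_eq_0_on_span[OF f(1), rotated]) (use f(2) B(1) v in auto)
  moreover have "f v = 1" using f(2) by simp
  ultimately show thesis
    using that[of f] VK.linear_add[OF f(1)] VK.linear_diff[OF f(1)] VK.linear_scale[OF f(1)] by blast
qed

text \<open>The universal property of the free module on F. The rules are restricted to sums
  supported in F because g is unconstrained elsewhere.\<close>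

lemma (in k_algebra) linear_extension:
  assumes g: "\<And>a. a \<in> F \<Longrightarrow> g a \<in> carrier A"
  obtains ev :: "('b \<Rightarrow>\<^sub>0 'k) \<Rightarrow> 'a" where
    "\<And>p. Poly_Mapping.keys p \<subseteq> F \<Longrightarrow> ev p \<in> carrier A" "ev 0 = \<zero>"
    "\<And>a c. a \<in> F \<Longrightarrow> ev (Poly_Mapping.single a c) = c \<odot> g a"
    "\<And>p q. Poly_Mapping.keys p \<subseteq> F \<Longrightarrow> Poly_Mapping.keys q \<subseteq> F \<Longrightarrow> ev (p + q) = ev p \<oplus> ev q"
    "\<And>c p. Poly_Mapping.keys p \<subseteq> F \<Longrightarrow> ev (scale_poly c p) = c \<odot> ev p"
proof
  define ev where "ev p = (\<Oplus>a\<in>Poly_Mapping.keys p. Poly_Mapping.lookup p a \<odot> g a)" for p :: "'b \<Rightarrow>\<^sub>0 'k"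
  have sup: "ev p = (\<Oplus>a\<in>M. Poly_Mapping.lookup p a \<odot> g a)"
    if "finite M" "Poly_Mapping.keys p \<subseteq> M" "M \<subseteq> F" for p M
    unfolding ev_def using that g by (intro add.finprod_mono_neutral_cong_left) (auto simp: in_keys_iff)
  show "ev 0 = \<zero>" by (simp add: ev_def)
  show "ev (Poly_Mapping.single a c) = c \<odot> g a" if "a \<in> F" for a c
    using that g by (subst sup[of "{a}"]) auto
  show "ev (p + q) = ev p \<oplus> ev q" if "Poly_Mapping.keys p \<subseteq> F" "Poly_Mapping.keys q \<subseteq> F" for p q
  proof -
    have M: "finite (Poly_Mapping.keys p \<union> Poly_Mapping.keys q)" "Poly_Mapping.keys p \<union> Poly_Mapping.keys q \<subseteq> F"
      "Poly_Mapping.keys (p + q) \<subseteq> Poly_Mapping.keys p \<union> Poly_Mapping.keys q"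
      using that Poly_Mapping.keys_add[of p q] by auto
    show ?thesis
      unfolding sup[OF M(1) Un_upper1 M(2)] sup[OF M(1) Un_upper2 M(2)] sup[OF M(1,3,2)]
      using M g by (subst finsum_addf[symmetric]) (auto simp: lookup_add scale_add_left intro!: finsum_cong')
  qed
  show "ev p \<in> carrier A" if "Poly_Mapping.keys p \<subseteq> F" for p
    unfolding ev_def using that g by (intro finsum_closed) auto
  show "ev (scale_poly c p) = c \<odot> ev p" if "Poly_Mapping.keys p \<subseteq> F" for c p
  proof -
    note M = finite_keys[of p] that keys_scale_poly[of c p]
    show ?thesis
      unfolding sup[OF M(1) order_refl M(2)] sup[OF M(1,3,2)]
      using M g by (subst finsum_smult_ldistr) (auto intro!: finsum_cong')
  qed
qed

text \<open>A is the image under \<open>ev\<close> of the formal sums on its carrier. The functional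
  is found there, for the preimage \<open>W1\<close> of W, and then restricted to the symbols of
  single elements.\<close>

lemma (in k_algebra) functional_exists:
  assumes W: "submodule W field_ring A" and v: "v \<in> carrier A" "v \<notin> W"
  obtains f where "f \<in> lin_map A base_alg" "\<And>w. w \<in> W \<Longrightarrow> f w = 0" "f v = 1"
proof -
  note W' = submodD[OF W]
  obtain ev :: "('a \<Rightarrow>\<^sub>0 'k) \<Rightarrow> 'a" where ev:
    "\<And>p. Poly_Mapping.keys p \<subseteq> carrier A \<Longrightarrow> ev p \<in> carrier A" "ev 0 = \<zero>"
    "\<And>a c. a \<in> carrier A \<Longrightarrow> ev (Poly_Mapping.single a c) = c \<odot> a"
    "\<And>p q. Poly_Mapping.keys p \<subseteq> carrier A \<Longrightarrow> Poly_Mapping.keys q \<subseteq> carrier A \<Longrightarrow> ev (p + q) = ev p \<oplus> ev q"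
    "\<And>c p. Poly_Mapping.keys p \<subseteq> carrier A \<Longrightarrow> ev (scale_poly c p) = c \<odot> ev p"
    using linear_extension[of "carrier A" "\<lambda>a. a"] by blast
  define C where "C = {p :: 'a \<Rightarrow>\<^sub>0 'k. Poly_Mapping.keys p \<subseteq> carrier A}"
  have closed: "ev p \<in> carrier A" if "p \<in> C" for p using that ev(1) by (simp add: C_def)
  have single: "ev (Poly_Mapping.single a c) = c \<odot> a" if "a \<in> carrier A" for a c using that by (rule ev(3))
  have add: "ev (p + q) = ev p \<oplus> ev q" if "p \<in> C" "q \<in> C" for p q using that ev(4) by (simp add: C_def)
  have scale: "ev (scale_poly c p) = c \<odot> ev p" if "p \<in> C" for c p using that ev(5) by (simp add: C_def)
  have C: "0 \<in> C" "\<And>p q. p \<in> C \<Longrightarrow> q \<in> C \<Longrightarrow> p + q \<in> C" "\<And>c p. p \<in> C \<Longrightarrow> scale_poly c p \<in> C"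
    by (auto simp: C_def dest!: subsetD[OF Poly_Mapping.keys_add] subsetD[OF keys_scale_poly])
  define W1 where "W1 = {p \<in> C. ev p \<in> W}"
  have "Poly_Mapping.single v 1 \<notin> W1" using v by (simp add: W1_def single)
  then obtain f where f: "\<And>p q. f (p + q) = f p + f q" "\<And>p q. f (p - q) = f p - f q"
    "\<And>c p. f (scale_poly c p) = c * f p" "\<And>w. w \<in> W1 \<Longrightarrow> f w = 0" "f (Poly_Mapping.single v 1) = 1"
    by (rule poly_functional_exists[of W1, rotated 3])
       (use C W' in \<open>auto simp: W1_def add scale ev(2)\<close>)
  let ?s = "\<lambda>a. Poly_Mapping.single a (1 :: 'k)"
  have sC: "Poly_Mapping.single a c \<in> C" if "a \<in> carrier A" for a c using that by (simp add: C_def)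
  \<comment> \<open>Sums with the same value differ by an element over zero, which lies in
    \<open>W1\<close> and is killed by f. Hence f respects the relations that hold in A, although it
    was chosen on formal sums.\<close>
  have mW: "p - q \<in> W1" if "p \<in> C" "q \<in> C" "ev p = ev q" for p q
  proof -
    define r where "r = scale_poly (-1) q"
    have "p - q = p + r" by (rule poly_mapping_eqI) (simp add: r_def lookup_minus lookup_add)
    moreover have "r \<in> C" "ev r = \<ominus> ev q"
      using that C closed[of q] by (simp_all only: r_def scale minus_scale[symmetric])
    moreover have "p + r \<in> W1" using that C closed[of q] W'(2) calculation(2,3) by (simp add: W1_def add r_neg)
    ultimately show ?thesis by (simp only:)
  qed
  show ?thesis
  proof
    show "(\<lambda>a. f (?s a)) \<in> lin_map A base_alg"
    proof (rule lin_mapI)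
      show "f (?s (a \<oplus> b)) = f (?s a) \<oplus>\<^bsub>base_alg\<^esub> f (?s b)" if "a \<in> carrier A" "b \<in> carrier A" for a b
        using f(4)[OF mW[of "?s (a \<oplus> b)" "?s a + ?s b"]] that C sC by (simp add: f(1-3) add single)
      show "f (?s (c \<odot> a)) = c \<odot>\<^bsub>base_alg\<^esub> f (?s a)" if "a \<in> carrier A" for a c
        using f(4)[OF mW[of "?s (c \<odot> a)" "scale_poly c (?s a)"]] that C sC f(3)[of c "?s a"] by (simp add: f(2) scale single del: scale_poly_single)
    qed simp
    show "f (?s w) = 0" if "w \<in> W" for w using that W' by (intro f(4)) (auto simp: W1_def single sC)
    show "f (?s v) = 1" by fact
  qed
qed

section \<open>Matrices of size two\<close>

text \<open>The tuple lists the entries by rows.\<close>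

definition mat2 :: "('k::field, 'r, 'm) module_scheme \<Rightarrow> ('k, 'r \<times> 'r \<times> 'r \<times> 'r) module"
  where "mat2 R = \<lparr>carrier = carrier R \<times> carrier R \<times> carrier R \<times> carrier R,
    mult = (\<lambda>(a, b, c, d) (a', b', c', d').
      (a \<otimes>\<^bsub>R\<^esub> a' \<oplus>\<^bsub>R\<^esub> b \<otimes>\<^bsub>R\<^esub> c', a \<otimes>\<^bsub>R\<^esub> b' \<oplus>\<^bsub>R\<^esub> b \<otimes>\<^bsub>R\<^esub> d',
       c \<otimes>\<^bsub>R\<^esub> a' \<oplus>\<^bsub>R\<^esub> d \<otimes>\<^bsub>R\<^esub> c', c \<otimes>\<^bsub>R\<^esub> b' \<oplus>\<^bsub>R\<^esub> d \<otimes>\<^bsub>R\<^esub> d')),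
    one = (\<one>\<^bsub>R\<^esub>, \<zero>\<^bsub>R\<^esub>, \<zero>\<^bsub>R\<^esub>, \<one>\<^bsub>R\<^esub>), zero = (\<zero>\<^bsub>R\<^esub>, \<zero>\<^bsub>R\<^esub>, \<zero>\<^bsub>R\<^esub>, \<zero>\<^bsub>R\<^esub>),
    add = (\<lambda>(a, b, c, d) (a', b', c', d').
      (a \<oplus>\<^bsub>R\<^esub> a', b \<oplus>\<^bsub>R\<^esub> b', c \<oplus>\<^bsub>R\<^esub> c', d \<oplus>\<^bsub>R\<^esub> d')),
    smult = (\<lambda>r (a, b, c, d). (r \<odot>\<^bsub>R\<^esub> a, r \<odot>\<^bsub>R\<^esub> b, r \<odot>\<^bsub>R\<^esub> c, r \<odot>\<^bsub>R\<^esub> d))\<rparr>"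

lemma mat2_simps [simp]:
  "(a, b, c, d) \<in> carrier (mat2 R) \<longleftrightarrow> a \<in> carrier R \<and> b \<in> carrier R \<and> c \<in> carrier R \<and> d \<in> carrier R"
  "(a, b, c, d) \<otimes>\<^bsub>mat2 R\<^esub> (a', b', c', d') =
      (a \<otimes>\<^bsub>R\<^esub> a' \<oplus>\<^bsub>R\<^esub> b \<otimes>\<^bsub>R\<^esub> c', a \<otimes>\<^bsub>R\<^esub> b' \<oplus>\<^bsub>R\<^esub> b \<otimes>\<^bsub>R\<^esub> d',
       c \<otimes>\<^bsub>R\<^esub> a' \<oplus>\<^bsub>R\<^esub> d \<otimes>\<^bsub>R\<^esub> c', c \<otimes>\<^bsub>R\<^esub> b' \<oplus>\<^bsub>R\<^esub> d \<otimes>\<^bsub>R\<^esub> d')"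
  "\<one>\<^bsub>mat2 R\<^esub> = (\<one>\<^bsub>R\<^esub>, \<zero>\<^bsub>R\<^esub>, \<zero>\<^bsub>R\<^esub>, \<one>\<^bsub>R\<^esub>)" "\<zero>\<^bsub>mat2 R\<^esub> = (\<zero>\<^bsub>R\<^esub>, \<zero>\<^bsub>R\<^esub>, \<zero>\<^bsub>R\<^esub>, \<zero>\<^bsub>R\<^esub>)"
  "(a, b, c, d) \<oplus>\<^bsub>mat2 R\<^esub> (a', b', c', d') =
      (a \<oplus>\<^bsub>R\<^esub> a', b \<oplus>\<^bsub>R\<^esub> b', c \<oplus>\<^bsub>R\<^esub> c', d \<oplus>\<^bsub>R\<^esub> d')"
  "r \<odot>\<^bsub>mat2 R\<^esub> (a, b, c, d) = (r \<odot>\<^bsub>R\<^esub> a, r \<odot>\<^bsub>R\<^esub> b, r \<odot>\<^bsub>R\<^esub> c, r \<odot>\<^bsub>R\<^esub> d)"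
  by (auto simp: mat2_def)

lemma k_algebra_mat2:
  fixes R :: "('k::field, 'r, 'm) module_scheme"
  assumes "k_algebra R"
  shows "k_algebra (mat2 R)"
proof -
  interpret k_algebra R by fact
  show ?thesis
  proof (rule k_algebraI)
    show "ring (mat2 R)"
    proof (rule ringI)
      show "abelian_group (mat2 R)"
      proof (rule abelian_groupI)
        fix x assume "x \<in> carrier (mat2 R)"
        then show "\<exists>y\<in>carrier (mat2 R). y \<oplus>\<^bsub>mat2 R\<^esub> x = \<zero>\<^bsub>mat2 R\<^esub>"
          by (cases x, intro bexI[where x = "case x of (a, b, c, d) \<Rightarrow> (\<ominus>\<^bsub>R\<^esub> a, \<ominus>\<^bsub>R\<^esub> b, \<ominus>\<^bsub>R\<^esub> c, \<ominus>\<^bsub>R\<^esub> d)"])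
             (auto simp: l_neg)
      qed (auto simp: a_ac)
      show "Group.monoid (mat2 R)"
        by (rule monoidI) (auto simp: l_distr r_distr m_assoc a_ac)
    qed (auto simp: l_distr r_distr a_ac)
  qed (auto simp: scale_add_left scale_add_right smult_mult_left smult_mult_right)
qed

lemma mat2_minus [simp]:
  fixes R :: "('k::field, 'r, 'm) module_scheme"
  assumes "k_algebra R" "a \<in> carrier R" "b \<in> carrier R" "c \<in> carrier R" "d \<in> carrier R"
  shows "\<ominus>\<^bsub>mat2 R\<^esub> (a, b, c, d) = (\<ominus>\<^bsub>R\<^esub> a, \<ominus>\<^bsub>R\<^esub> b, \<ominus>\<^bsub>R\<^esub> c, \<ominus>\<^bsub>R\<^esub> d)"
    "(a', b', c', d') \<ominus>\<^bsub>mat2 R\<^esub> (a, b, c, d) = (a' \<ominus>\<^bsub>R\<^esub> a, b' \<ominus>\<^bsub>R\<^esub> b, c' \<ominus>\<^bsub>R\<^esub> c, d' \<ominus>\<^bsub>R\<^esub> d)"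
proof -
  interpret k_algebra R by fact
  interpret M: k_algebra "mat2 R" by (rule k_algebra_mat2) fact
  show 1: "\<ominus>\<^bsub>mat2 R\<^esub> (a, b, c, d) = (\<ominus>\<^bsub>R\<^esub> a, \<ominus>\<^bsub>R\<^esub> b, \<ominus>\<^bsub>R\<^esub> c, \<ominus>\<^bsub>R\<^esub> d)"
    using assms by (simp add: M.minus_scale minus_scale)
  show "(a', b', c', d') \<ominus>\<^bsub>mat2 R\<^esub> (a, b, c, d) = (a' \<ominus>\<^bsub>R\<^esub> a, b' \<ominus>\<^bsub>R\<^esub> b, c' \<ominus>\<^bsub>R\<^esub> c, d' \<ominus>\<^bsub>R\<^esub> d)"
    by (simp add: a_minus_def 1)
qed

section \<open>Tensor products of commutative algebras\<close>

text \<open>A sum over the support whose summand may depend on the coefficient. If the summand is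
  additive in the coefficient, the sum is additive in p; this yields both distributive laws for
  formal tensors.\<close>

definition sum_keys :: "('m \<Rightarrow>\<^sub>0 'k::field) \<Rightarrow> ('m \<Rightarrow> 'k \<Rightarrow> 'v::ab_group_add) \<Rightarrow> 'v"
  where "sum_keys p f = (\<Sum>a\<in>Poly_Mapping.keys p. f a (Poly_Mapping.lookup p a))"

lemma sum_keys_0 [simp]: "sum_keys 0 f = 0"
  by (simp add: sum_keys_def)

lemma sum_keys_single: "f a 0 = 0 \<Longrightarrow> sum_keys (Poly_Mapping.single a c) f = f a c"
  by (simp add: sum_keys_def)

lemma sum_keys_add:
  assumes f: "\<And>a. f a 0 = 0" "\<And>a x y. f a (x + y) = f a x + f a y"
  shows "sum_keys (p + q) f = sum_keys p f + sum_keys q f"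
proof -
  define M where "M = Poly_Mapping.keys p \<union> Poly_Mapping.keys q"
  have sup: "sum_keys r f = (\<Sum>a\<in>M. f a (Poly_Mapping.lookup r a))" if "Poly_Mapping.keys r \<subseteq> M" for r
    unfolding sum_keys_def using that
    by (intro sum.mono_neutral_left) (auto simp: M_def in_keys_iff f(1))
  show ?thesis
    using Poly_Mapping.keys_add[of p q]
    by (subst (1 2 3) sup) (auto simp: M_def lookup_add f(2) sum.distrib)
qed

lemma sum_keys_plus: "sum_keys p (\<lambda>a x. f a x + g a x) = sum_keys p f + sum_keys p g"
  by (simp add: sum_keys_def sum.distrib)

section \<open>The algebra of formal tensors and the ideal of relations\<close>

locale comm_algebra_family =
  fixes I :: "'i set" and A :: "'i \<Rightarrow> ('k::field, 'a, 'm) module_scheme"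
  assumes alg: "\<And>i. i \<in> I \<Longrightarrow> k_algebra (A i)"
    and comm: "\<And>i a b. i \<in> I \<Longrightarrow> a \<in> carrier (A i) \<Longrightarrow> b \<in> carrier (A i) \<Longrightarrow> a \<otimes>\<^bsub>A i\<^esub> b = b \<otimes>\<^bsub>A i\<^esub> a"
begin

abbreviation "fam \<equiv> tensor_families I A"
abbreviation "TF \<equiv> tensor_free I A"
definition "N = \<Inter>{N. submodule N field_ring TF \<and> tensor_rels I A \<subseteq> N}"
definition fam_mult :: "('i \<Rightarrow> 'a) \<Rightarrow> ('i \<Rightarrow> 'a) \<Rightarrow> 'i \<Rightarrow> 'a"
  where "fam_mult a b = (\<lambda>i\<in>I. a i \<otimes>\<^bsub>A i\<^esub> b i)"
definition fam_one :: "'i \<Rightarrow> 'a" where "fam_one = (\<lambda>i\<in>I. \<one>\<^bsub>A i\<^esub>)"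
definition pure :: "('i \<Rightarrow> 'a) \<Rightarrow> (('i \<Rightarrow> 'a) \<Rightarrow>\<^sub>0 'k) set"
  where "pure a = N +>\<^bsub>TF\<^esub> Poly_Mapping.single a 1"
abbreviation "S \<equiv> tensor_product I A"

lemma ring_A: "i \<in> I \<Longrightarrow> ring (A i)"
  using alg k_algebraD(1) by blast

lemma alg_closed:
  assumes "i \<in> I"
  shows "\<one>\<^bsub>A i\<^esub> \<in> carrier (A i)" "\<zero>\<^bsub>A i\<^esub> \<in> carrier (A i)"
    "\<And>a b. a \<in> carrier (A i) \<Longrightarrow> b \<in> carrier (A i) \<Longrightarrow> a \<otimes>\<^bsub>A i\<^esub> b \<in> carrier (A i)"
    "\<And>a b. a \<in> carrier (A i) \<Longrightarrow> b \<in> carrier (A i) \<Longrightarrow> a \<oplus>\<^bsub>A i\<^esub> b \<in> carrier (A i)"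
    "\<And>c a. a \<in> carrier (A i) \<Longrightarrow> c \<odot>\<^bsub>A i\<^esub> a \<in> carrier (A i)"
proof -
  interpret k_algebra "A i" by (rule alg[OF assms])
  show "\<one>\<^bsub>A i\<^esub> \<in> carrier (A i)" "\<zero>\<^bsub>A i\<^esub> \<in> carrier (A i)"
    "\<And>a b. a \<in> carrier (A i) \<Longrightarrow> b \<in> carrier (A i) \<Longrightarrow> a \<otimes>\<^bsub>A i\<^esub> b \<in> carrier (A i)"
    "\<And>a b. a \<in> carrier (A i) \<Longrightarrow> b \<in> carrier (A i) \<Longrightarrow> a \<oplus>\<^bsub>A i\<^esub> b \<in> carrier (A i)"
    "\<And>c a. a \<in> carrier (A i) \<Longrightarrow> c \<odot>\<^bsub>A i\<^esub> a \<in> carrier (A i)"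
    by auto
qed

lemma fam_one: "fam_one \<in> fam"
  by (auto simp: tensor_families_def fam_one_def alg_closed)

lemma fam_carrier: "a \<in> fam \<Longrightarrow> i \<in> I \<Longrightarrow> a i \<in> carrier (A i)"
  by (auto simp: tensor_families_def)

lemma fam_upd: "a \<in> fam \<Longrightarrow> i \<in> I \<Longrightarrow> u \<in> carrier (A i) \<Longrightarrow> a(i := u) \<in> fam"
proof -
  assume a: "a \<in> fam" and i: "i \<in> I" and u: "u \<in> carrier (A i)"
  have "{l\<in>I. (a(i := u)) l \<noteq> \<one>\<^bsub>A l\<^esub>} \<subseteq> insert i {l\<in>I. a l \<noteq> \<one>\<^bsub>A l\<^esub>}" by auto
  then have "finite {l\<in>I. (a(i := u)) l \<noteq> \<one>\<^bsub>A l\<^esub>}"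
    by (rule finite_subset) (use a in \<open>simp add: tensor_families_def\<close>)
  then show ?thesis using a i u by (auto simp: tensor_families_def PiE_iff extensional_def)
qed

lemma fam_mult:
  assumes "a \<in> fam" "b \<in> fam"
  shows "fam_mult a b \<in> fam"
proof -
  have "{l\<in>I. fam_mult a b l \<noteq> \<one>\<^bsub>A l\<^esub>} \<subseteq> {l\<in>I. a l \<noteq> \<one>\<^bsub>A l\<^esub>} \<union> {l\<in>I. b l \<noteq> \<one>\<^bsub>A l\<^esub>}"
    using ring.ring_simprules(12)[OF ring_A alg_closed(1)] by (auto simp: fam_mult_def)
  then have "finite {l\<in>I. fam_mult a b l \<noteq> \<one>\<^bsub>A l\<^esub>}"
    by (rule finite_subset) (use assms in \<open>simp add: tensor_families_def\<close>)
  then show ?thesis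
    using assms by (auto simp: tensor_families_def fam_mult_def PiE_iff alg_closed)
qed

lemma fam_mult_assoc: "a \<in> fam \<Longrightarrow> b \<in> fam \<Longrightarrow> c \<in> fam \<Longrightarrow>
  fam_mult (fam_mult a b) c = fam_mult a (fam_mult b c)"
  unfolding fam_mult_def
  by (rule restrict_ext) (simp add: fam_carrier Group.monoid.m_assoc[OF ring.is_monoid[OF ring_A]])

lemma fam_mult_comm: "a \<in> fam \<Longrightarrow> b \<in> fam \<Longrightarrow> fam_mult a b = fam_mult b a"
  unfolding fam_mult_def by (rule restrict_ext) (simp add: fam_carrier comm)

lemma fam_mult_one: "a \<in> fam \<Longrightarrow> fam_mult fam_one a = a"
proof (rule ext)
  fix i assume a: "a \<in> fam"
  show "fam_mult fam_one a i = a i"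
  proof (cases "i \<in> I")
    case True
    then show ?thesis
      using ring.ring_simprules(12)[OF ring_A[OF True] fam_carrier[OF a True]] by (simp add: fam_mult_def fam_one_def)
  next
    case False
    then show ?thesis
      using a by (simp add: fam_mult_def tensor_families_def PiE_iff extensional_def)
  qed
qed

text \<open>Multiplying a one-place change of a family by b gives a one-place change again, at the
  same place. This is why relations go to relations.\<close>

lemma fam_mult_upd: "i \<in> I \<Longrightarrow> fam_mult b (a(i := u)) = (fam_mult b a)(i := b i \<otimes>\<^bsub>A i\<^esub> u)"
  by (auto simp: fam_mult_def fun_eq_iff)

lemma TF_simps:
  "carrier TF = {p. Poly_Mapping.keys p \<subseteq> fam}" "one TF = Poly_Mapping.single fam_one 1"
  "zero TF = 0" "add TF = (+)" "smult TF = scale_poly"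
  by (simp_all add: tensor_free_def fam_one_def)

lemma TF_mult: "p \<otimes>\<^bsub>TF\<^esub> q = sum_keys p (\<lambda>a r. sum_keys q (\<lambda>b s. Poly_Mapping.single (fam_mult a b) (r * s)))"
  by (simp add: tensor_free_def sum_keys_def fam_mult_def)

lemma TF_mult_0 [simp]: "0 \<otimes>\<^bsub>TF\<^esub> q = 0" "p \<otimes>\<^bsub>TF\<^esub> 0 = 0"
  by (simp_all add: TF_mult) (simp add: sum_keys_def)

lemma TF_mult_single: "Poly_Mapping.single a r \<otimes>\<^bsub>TF\<^esub> Poly_Mapping.single b s = Poly_Mapping.single (fam_mult a b) (r * s)"
  by (simp add: TF_mult sum_keys_single)

lemma TF_mult_add:
  "(p + q) \<otimes>\<^bsub>TF\<^esub> r = p \<otimes>\<^bsub>TF\<^esub> r + q \<otimes>\<^bsub>TF\<^esub> r" "r \<otimes>\<^bsub>TF\<^esub> (p + q) = r \<otimes>\<^bsub>TF\<^esub> p + r \<otimes>\<^bsub>TF\<^esub> q"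
proof -
  show "(p + q) \<otimes>\<^bsub>TF\<^esub> r = p \<otimes>\<^bsub>TF\<^esub> r + q \<otimes>\<^bsub>TF\<^esub> r"
    unfolding TF_mult
    by (rule sum_keys_add) (simp_all add: distrib_right single_add sum_keys_plus sum_keys_def)
  have *: "sum_keys (p + q) (\<lambda>b s. Poly_Mapping.single (fam_mult a b) (x * s)) =
    sum_keys p (\<lambda>b s. Poly_Mapping.single (fam_mult a b) (x * s)) +
    sum_keys q (\<lambda>b s. Poly_Mapping.single (fam_mult a b) (x * s))" for a x
    by (rule sum_keys_add) (simp_all add: distrib_left single_add)
  show "r \<otimes>\<^bsub>TF\<^esub> (p + q) = r \<otimes>\<^bsub>TF\<^esub> p + r \<otimes>\<^bsub>TF\<^esub> q"
    by (simp add: TF_mult * sum_keys_plus)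
qed

lemma scale_poly_0 [simp]: "scale_poly c (0 :: 'z \<Rightarrow>\<^sub>0 'k) = 0"
  by (rule poly_mapping_eqI) simp

lemma TF_mult_scale:
  "scale_poly c p \<otimes>\<^bsub>TF\<^esub> q = scale_poly c (p \<otimes>\<^bsub>TF\<^esub> q)" "p \<otimes>\<^bsub>TF\<^esub> scale_poly c q = scale_poly c (p \<otimes>\<^bsub>TF\<^esub> q)"
proof -
  show "scale_poly c p \<otimes>\<^bsub>TF\<^esub> q = scale_poly c (p \<otimes>\<^bsub>TF\<^esub> q)"
  proof (induction p rule: poly_mapping_sum_induct)
    case (single m d)
    show ?case
    proof (induction q rule: poly_mapping_sum_induct)
      case (single n e)
      show ?case by (simp only: TF_mult_single scale_poly_single mult.assoc)
    next
      case (add p q)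
      then show ?case by (simp only: TF_mult_add scale_poly_add)
    qed simp
  next
    case (add p q)
    then show ?case by (simp only: TF_mult_add scale_poly_add)
  qed simp
  show "p \<otimes>\<^bsub>TF\<^esub> scale_poly c q = scale_poly c (p \<otimes>\<^bsub>TF\<^esub> q)"
  proof (induction p rule: poly_mapping_sum_induct)
    case (single m d)
    show ?case
    proof (induction q rule: poly_mapping_sum_induct)
      case (single n e)
      show ?case by (simp only: TF_mult_single scale_poly_single mult.left_commute)
    next
      case (add p q)
      then show ?case by (simp only: TF_mult_add scale_poly_add)
    qed simp
  next
    case (add p q)
    then show ?case by (simp only: TF_mult_add scale_poly_add)
  qed simp
qed

lemma TF_closed:
  "p \<in> carrier TF \<Longrightarrow> q \<in> carrier TF \<Longrightarrow> p + q \<in> carrier TF"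
  "p \<in> carrier TF \<Longrightarrow> scale_poly c p \<in> carrier TF"
  using Poly_Mapping.keys_add[of p q] keys_scale_poly[of c p] by (auto simp: TF_simps)

lemma TF_single [simp]: "a \<in> fam \<Longrightarrow> Poly_Mapping.single a c \<in> carrier TF"
  by (simp add: TF_simps)

lemma TF_induct [consumes 1, case_names zero single add]:
  assumes "p \<in> carrier TF" "P 0" "\<And>a c. a \<in> fam \<Longrightarrow> P (Poly_Mapping.single a c)"
    "\<And>p q. p \<in> carrier TF \<Longrightarrow> q \<in> carrier TF \<Longrightarrow> P p \<Longrightarrow> P q \<Longrightarrow> P (p + q)"
  shows "P p"
  using assms(1) unfolding TF_simps mem_Collect_eq
  by (rule poly_mapping_induct_on) (use assms(2-4) in \<open>auto simp: TF_simps\<close>)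

lemma TF_mult_closed: "p \<in> carrier TF \<Longrightarrow> q \<in> carrier TF \<Longrightarrow> p \<otimes>\<^bsub>TF\<^esub> q \<in> carrier TF"
proof (induction p rule: TF_induct)
  case (single a c)
  from this(2) show ?case
    by (induction q rule: TF_induct) (auto simp: single TF_mult_single TF_mult_add fam_mult intro: TF_closed, simp add: TF_simps)
qed (auto simp: TF_mult_add intro: TF_closed, simp add: TF_simps)

lemma TF_mult_comm: "p \<in> carrier TF \<Longrightarrow> q \<in> carrier TF \<Longrightarrow> p \<otimes>\<^bsub>TF\<^esub> q = q \<otimes>\<^bsub>TF\<^esub> p"
proof (induction p rule: TF_induct)
  case (single a c)
  from this(2) show ?case
    by (induction q rule: TF_induct) (auto simp: single TF_mult_single TF_mult_add fam_mult_comm mult.commute)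
qed (auto simp: TF_mult_add)

lemma TF_mult_assoc:
  assumes "p \<in> carrier TF" "q \<in> carrier TF" "r \<in> carrier TF"
  shows "(p \<otimes>\<^bsub>TF\<^esub> q) \<otimes>\<^bsub>TF\<^esub> r = p \<otimes>\<^bsub>TF\<^esub> (q \<otimes>\<^bsub>TF\<^esub> r)"
  using assms(1)
proof (induction p rule: TF_induct)
  case a: (single a c)
  from assms(2) show ?case
  proof (induction q rule: TF_induct)
    case b: (single b d)
    from assms(3) show ?case
    proof (induction r rule: TF_induct)
      case (single e s)
      then show ?case by (simp only: TF_mult_single fam_mult_assoc[OF a b single] mult.assoc)
    next
      case (add p q)
      then show ?case by (simp only: TF_mult_add)
    qed simp
  next
    case (add p q)
    then show ?case by (simp only: TF_mult_add)
  qed simp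
next
  case (add p q)
  then show ?case by (simp only: TF_mult_add)
qed simp

lemma TF_one: "p \<in> carrier TF \<Longrightarrow> \<one>\<^bsub>TF\<^esub> \<otimes>\<^bsub>TF\<^esub> p = p"
  by (induction p rule: TF_induct) (auto simp: TF_simps TF_mult_single TF_mult_add fam_mult_one)

lemma k_algebra_TF: "k_algebra TF"
proof (rule k_algebraI)
  have "cring TF"
  proof (rule cringI)
    show "abelian_group TF"
    proof (rule abelian_groupI)
      fix p assume "p \<in> carrier TF"
      then show "\<exists>q\<in>carrier TF. q \<oplus>\<^bsub>TF\<^esub> p = \<zero>\<^bsub>TF\<^esub>"
        by (intro bexI[of _ "- p"]) (auto simp: TF_simps)
    qed (use TF_closed in \<open>auto simp: TF_simps algebra_simps\<close>)
    show "comm_monoid TF"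
    proof (rule comm_monoidI)
      show "\<one>\<^bsub>TF\<^esub> \<in> carrier TF" by (simp add: TF_simps fam_one)
    qed (rule TF_mult_closed TF_mult_assoc TF_one TF_mult_comm; assumption)+
  qed (simp add: TF_simps TF_mult_add)
  then show "ring TF" by (rule cring.axioms(1))
qed (use TF_closed in \<open>auto simp: TF_simps TF_mult_scale scale_poly_add intro!: poly_mapping_eqI simp: lookup_add algebra_simps\<close>)

sublocale TF: k_algebra TF by (rule k_algebra_TF)

lemma TF_minus: "q \<in> carrier TF \<Longrightarrow> p \<ominus>\<^bsub>TF\<^esub> q = p - q"
proof -
  assume q: "q \<in> carrier TF"
  have "- q \<oplus>\<^bsub>TF\<^esub> q = \<zero>\<^bsub>TF\<^esub>" "- q \<in> carrier TF" using q by (simp_all add: TF_simps)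
  then have "\<ominus>\<^bsub>TF\<^esub> q = - q" using q TF.minus_equality by blast
  then show ?thesis by (simp add: a_minus_def TF_simps)
qed

lemma tensor_rels_carrier: "tensor_rels I A \<subseteq> carrier TF"
proof
  fix r assume "r \<in> tensor_rels I A"
  then consider (add) a i u v where "a \<in> fam" "i \<in> I" "u \<in> carrier (A i)" "v \<in> carrier (A i)"
      "r = Poly_Mapping.single (a(i := u \<oplus>\<^bsub>A i\<^esub> v)) 1
       - (Poly_Mapping.single (a(i := u)) 1 + Poly_Mapping.single (a(i := v)) 1)"
    | (smult) a i c u where "a \<in> fam" "i \<in> I" "u \<in> carrier (A i)"
      "r = Poly_Mapping.single (a(i := c \<odot>\<^bsub>A i\<^esub> u)) 1 - scale_poly c (Poly_Mapping.single (a(i := u)) 1)"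
    unfolding tensor_rels_def by blast
  then show "r \<in> carrier TF"
  proof cases
    case add
    then have *: "Poly_Mapping.single (a(i := u \<oplus>\<^bsub>A i\<^esub> v)) (1::'k) \<in> carrier TF"
      "Poly_Mapping.single (a(i := u)) (1::'k) + Poly_Mapping.single (a(i := v)) 1 \<in> carrier TF"
      by (auto intro!: TF_closed simp: fam_upd alg_closed)
    then show ?thesis unfolding add(5) using TF.minus_closed TF_minus by metis
  next
    case smult
    then have *: "Poly_Mapping.single (a(i := c \<odot>\<^bsub>A i\<^esub> u)) (1::'k) \<in> carrier TF"
      "scale_poly c (Poly_Mapping.single (a(i := u)) 1) \<in> carrier TF"
      by (auto simp: fam_upd alg_closed)
    then show ?thesis unfolding smult(4) using TF.minus_closed TF_minus by metis
  qed
qed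

lemma N_submod: "submodule N field_ring TF"
proof (rule TF.submodI)
  show "N \<subseteq> carrier TF"
    unfolding N_def using TF.carrier_is_submodule tensor_rels_carrier by blast
qed (auto simp: N_def dest: TF.submodD)

lemma rels_N: "tensor_rels I A \<subseteq> N"
  by (auto simp: N_def)

lemma N_least: "submodule H field_ring TF \<Longrightarrow> tensor_rels I A \<subseteq> H \<Longrightarrow> N \<subseteq> H"
  by (auto simp: N_def)

lemma TF_mult_diff: "r \<otimes>\<^bsub>TF\<^esub> (p - q) = r \<otimes>\<^bsub>TF\<^esub> p - r \<otimes>\<^bsub>TF\<^esub> q"
  using TF_mult_add(2)[of r "p - q" q] by (simp add: algebra_simps)

text \<open>A multilinearity relation times a pure tensor b is the relation at the product family,
  with u and v multiplied by the entry of b. So the elements that b sends into N form a submodule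
  containing all relations.\<close>

lemma N_single_mult:
  assumes b: "b \<in> fam" and n: "n \<in> N"
  shows "Poly_Mapping.single b c \<otimes>\<^bsub>TF\<^esub> n \<in> N"
proof -
  note N = TF.submodD[OF N_submod, unfolded TF_simps]
  define H where "H = {n \<in> carrier TF. Poly_Mapping.single b 1 \<otimes>\<^bsub>TF\<^esub> n \<in> N}"
  have H: "submodule H field_ring TF"
    by (rule TF.submodI) (use TF_closed N in \<open>auto simp: H_def TF_simps TF_mult_add TF_mult_scale\<close>)
  have "tensor_rels I A \<subseteq> H"
  proof
    fix r assume r: "r \<in> tensor_rels I A"
    have "Poly_Mapping.single b 1 \<otimes>\<^bsub>TF\<^esub> r \<in> tensor_rels I A"
      using r unfolding tensor_rels_def
    proof (elim UnE CollectE exE conjE, goal_cases)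
      case (1 a i u v)
      interpret Ai: k_algebra "A i" by (rule alg[OF 1(3)])
      have "b i \<in> carrier (A i)" using fam_carrier[OF b 1(3)] .
      then show ?case
        using 1 fam_mult[OF b 1(2)]
        by (intro UnI1 CollectI exI[of _ "fam_mult b a"] exI[of _ i] exI[of _ "b i \<otimes>\<^bsub>A i\<^esub> u"] exI[of _ "b i \<otimes>\<^bsub>A i\<^esub> v"])
           (auto simp: TF_mult_diff TF_mult_add TF_mult_single fam_mult_upd Ai.r_distr)
    next
      case (2 a i c u)
      interpret Ai: k_algebra "A i" by (rule alg[OF 2(3)])
      have "b i \<in> carrier (A i)" using fam_carrier[OF b 2(3)] .
      then show ?case
        using 2 fam_mult[OF b 2(2)]
        by (intro UnI2 CollectI exI[of _ "fam_mult b a"] exI[of _ i] exI[of _ c] exI[of _ "b i \<otimes>\<^bsub>A i\<^esub> u"])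
           (auto simp: TF_mult_diff TF_mult_single fam_mult_upd Ai.smult_mult_right)
    qed
    then show "r \<in> H" using r rels_N tensor_rels_carrier by (auto simp: H_def)
  qed
  then have "Poly_Mapping.single b 1 \<otimes>\<^bsub>TF\<^esub> n \<in> N" using N_least[OF H] n by (auto simp: H_def)
  then have "scale_poly c (Poly_Mapping.single b 1 \<otimes>\<^bsub>TF\<^esub> n) \<in> N" by (rule N)
  then show ?thesis by (simp flip: TF_mult_scale)
qed

text \<open>\<open>tensor_product\<close> divides by the submodule generated by the relations; the
  componentwise product descends because that submodule is an ideal.\<close>

lemma N_ideal: "ideal N TF"
proof (rule idealI)
  note N = TF.submodD[OF N_submod, unfolded TF_simps]
  show "ring TF" by (rule TF.ring_axioms)
  show "subgroup N (add_monoid TF)" using N_submod by (simp add: submodule_def)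
  show l: "x \<otimes>\<^bsub>TF\<^esub> a \<in> N" if a: "a \<in> N" and "x \<in> carrier TF" for a x
    using that(2) by (induction x rule: TF_induct) (auto simp: N N_single_mult a TF_mult_add)
  show "a \<otimes>\<^bsub>TF\<^esub> x \<in> N" if "a \<in> N" and "x \<in> carrier TF" for a x
    using l[OF that] TF_mult_comm[of a x] that TF.submodD(1)[OF N_submod] by simp
qed

section \<open>The tensor product S, its pure tensors and its universal property\<close>

lemma S_quot: "S = quot_alg TF N"
  by (simp add: tensor_product_def N_def)

lemma k_algebra_S: "k_algebra S"
  unfolding S_quot by (rule k_algebra_quot_alg[OF k_algebra_TF N_ideal])

sublocale S: k_algebra S by (rule k_algebra_S)

lemmas S_simps = quot_alg_simps[OF k_algebra_TF N_ideal, folded S_quot]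
lemmas S_carrier = quot_alg_carrier[OF k_algebra_TF N_ideal, folded S_quot]

lemma S_comm: "s \<in> carrier S \<Longrightarrow> t \<in> carrier S \<Longrightarrow> s \<otimes>\<^bsub>S\<^esub> t = t \<otimes>\<^bsub>S\<^esub> s"
  by (auto simp: S_carrier S_simps TF_mult_comm)

sublocale S: cring S
  by (intro cring.intro comm_monoid.intro comm_monoid_axioms.intro S_comm S.ring_axioms)
     (simp_all add: S.monoid_axioms)

lemma pure_closed [simp]: "a \<in> fam \<Longrightarrow> pure a \<in> carrier S"
  by (auto simp: S_carrier pure_def)

lemma pure_one: "pure fam_one = \<one>\<^bsub>S\<^esub>"
  by (simp add: S_simps pure_def TF_simps)

lemma pure_mult: "a \<in> fam \<Longrightarrow> b \<in> fam \<Longrightarrow> pure a \<otimes>\<^bsub>S\<^esub> pure b = pure (fam_mult a b)"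
  by (simp add: S_simps pure_def TF_mult_single)

lemma N_coset_eq:
  assumes "p - q \<in> N" "p \<in> carrier TF" "q \<in> carrier TF"
  shows "N +>\<^bsub>TF\<^esub> p = N +>\<^bsub>TF\<^esub> q"
proof -
  interpret N: ideal N TF by (rule N_ideal)
  have "p = (p - q) \<oplus>\<^bsub>TF\<^esub> q" by (simp add: TF_simps)
  then have "p \<in> N +>\<^bsub>TF\<^esub> q" using assms(1) unfolding a_r_coset_def' by blast
  then show ?thesis using N.a_repr_independence'[OF _ assms(3)] by simp
qed

lemma pure_add:
  assumes "a \<in> fam" "i \<in> I" "u \<in> carrier (A i)" "v \<in> carrier (A i)"
  shows "pure (a(i := u \<oplus>\<^bsub>A i\<^esub> v)) = pure (a(i := u)) \<oplus>\<^bsub>S\<^esub> pure (a(i := v))"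
proof -
  have "Poly_Mapping.single (a(i := u \<oplus>\<^bsub>A i\<^esub> v)) 1
       - (Poly_Mapping.single (a(i := u)) 1 + Poly_Mapping.single (a(i := v)) 1) \<in> tensor_rels I A"
    unfolding tensor_rels_def using assms by blast
  then show ?thesis
    using N_coset_eq[OF subsetD[OF rels_N]] TF_closed assms
    by (simp add: pure_def S_simps fam_upd alg_closed) (simp add: TF_simps alg_closed fam_upd)
qed

lemma pure_scale:
  assumes "a \<in> fam" "i \<in> I" "u \<in> carrier (A i)"
  shows "pure (a(i := c \<odot>\<^bsub>A i\<^esub> u)) = c \<odot>\<^bsub>S\<^esub> pure (a(i := u))"
proof -
  have "Poly_Mapping.single (a(i := c \<odot>\<^bsub>A i\<^esub> u)) 1
       - scale_poly c (Poly_Mapping.single (a(i := u)) 1) \<in> tensor_rels I A"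
    unfolding tensor_rels_def using assms by blast
  then show ?thesis
    using N_coset_eq[OF subsetD[OF rels_N]] TF_closed assms
    by (simp add: pure_def S_simps fam_upd alg_closed) (simp add: TF_simps alg_closed fam_upd)
qed

lemma S_induct [consumes 1, case_names pure add]:
  assumes "s \<in> carrier S" "\<And>a c. a \<in> fam \<Longrightarrow> P (c \<odot>\<^bsub>S\<^esub> pure a)"
    "\<And>s t. s \<in> carrier S \<Longrightarrow> t \<in> carrier S \<Longrightarrow> P s \<Longrightarrow> P t \<Longrightarrow> P (s \<oplus>\<^bsub>S\<^esub> t)"
  shows "P s"
proof -
  obtain p where p: "p \<in> carrier TF" "s = N +>\<^bsub>TF\<^esub> p" using assms(1) by (auto simp: S_carrier)
  have single: "P (N +>\<^bsub>TF\<^esub> Poly_Mapping.single a c)" if "a \<in> fam" for a c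
    using assms(2)[OF that, of c] that by (simp add: pure_def S_simps) (simp add: TF_simps)
  have "P (N +>\<^bsub>TF\<^esub> p)"
    using p(1)
  proof (induction p rule: TF_induct)
    case zero
    then show ?case using single[OF fam_one, of 0] by simp
  next
    case (add p q)
    then show ?case using assms(3)[of "N +>\<^bsub>TF\<^esub> p" "N +>\<^bsub>TF\<^esub> q"] by (auto simp: S_carrier S_simps) (simp add: TF_simps)
  qed (rule single)
  then show ?thesis using p by simp
qed

text \<open>The universal property for multilinear maps: g extends linearly to formal tensors, and
  the kernel of the extension is a submodule containing the relations, hence contains N.\<close>

lemma tensor_lift:
  fixes M :: "('k, 'b, 'n) module_scheme"
  assumes M: "k_algebra M" and g: "\<And>a. a \<in> fam \<Longrightarrow> g a \<in> carrier M"
    "\<And>a i u v. a \<in> fam \<Longrightarrow> i \<in> I \<Longrightarrow> u \<in> carrier (A i) \<Longrightarrow> v \<in> carrier (A i) \<Longrightarrow>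
      g (a(i := u \<oplus>\<^bsub>A i\<^esub> v)) = g (a(i := u)) \<oplus>\<^bsub>M\<^esub> g (a(i := v))"
    "\<And>a i c u. a \<in> fam \<Longrightarrow> i \<in> I \<Longrightarrow> u \<in> carrier (A i) \<Longrightarrow>
      g (a(i := c \<odot>\<^bsub>A i\<^esub> u)) = c \<odot>\<^bsub>M\<^esub> g (a(i := u))"
  obtains h where "h \<in> lin_map S M" "\<And>a. a \<in> fam \<Longrightarrow> h (pure a) = g a"
proof -
  interpret M: k_algebra M by fact
  obtain ev :: "(('i \<Rightarrow> 'a) \<Rightarrow>\<^sub>0 'k) \<Rightarrow> 'b" where ev:
    "\<And>p. Poly_Mapping.keys p \<subseteq> fam \<Longrightarrow> ev p \<in> carrier M" "ev 0 = \<zero>\<^bsub>M\<^esub>"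
    "\<And>a c. a \<in> fam \<Longrightarrow> ev (Poly_Mapping.single a c) = c \<odot>\<^bsub>M\<^esub> g a"
    "\<And>p q. Poly_Mapping.keys p \<subseteq> fam \<Longrightarrow> Poly_Mapping.keys q \<subseteq> fam \<Longrightarrow> ev (p + q) = ev p \<oplus>\<^bsub>M\<^esub> ev q"
    "\<And>c p. Poly_Mapping.keys p \<subseteq> fam \<Longrightarrow> ev (scale_poly c p) = c \<odot>\<^bsub>M\<^esub> ev p"
    using M.linear_extension[of fam g] g(1) by metis
  have lin: "ev \<in> lin_map TF M"
    by (rule lin_mapI) (auto simp: TF_simps ev)
  note ev_minus = lin_map_zero_minus(2)[OF lin k_algebra_TF M]
  define H where "H = {p \<in> carrier TF. ev p = \<zero>\<^bsub>M\<^esub>}"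
  have H: "submodule H field_ring TF"
    by (rule TF.submodI) (use TF_closed in \<open>auto simp: H_def TF_simps ev\<close>)
  have eq: "p - q \<in> H" if "p \<in> carrier TF" "q \<in> carrier TF" "ev p = ev q" for p q
  proof -
    have "p \<ominus>\<^bsub>TF\<^esub> q \<in> H"
      using that lin_mapD(1)[OF lin that(2)] by (simp add: H_def ev_minus a_minus_def[of M] M.r_neg)
    then show ?thesis by (simp only: TF_minus[OF that(2)])
  qed
  have "tensor_rels I A \<subseteq> H"
  proof
    fix r assume "r \<in> tensor_rels I A"
    then show "r \<in> H"
      unfolding tensor_rels_def
    proof (elim UnE CollectE exE conjE, goal_cases)
      case (1 a i u v)
      then show ?case
        by (simp only:, intro eq TF_closed) (auto simp: fam_upd alg_closed ev g)
    next
      case (2 a i c u)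
      then show ?case
        by (simp only:, intro eq TF_closed) (auto simp: fam_upd alg_closed ev g)
    qed
  qed
  then have "N \<subseteq> H" by (rule N_least[OF H])
  then obtain h where h: "h \<in> lin_map S M" "\<And>p. p \<in> carrier TF \<Longrightarrow> h (N +>\<^bsub>TF\<^esub> p) = ev p"
    using lin_map_quot[OF k_algebra_TF N_ideal M lin] unfolding S_quot H_def by blast
  show ?thesis
    by (rule that[OF h(1)]) (simp add: pure_def h(2) ev(3) g)
qed

definition emb :: "'i \<Rightarrow> 'a \<Rightarrow> (('i \<Rightarrow> 'a) \<Rightarrow>\<^sub>0 'k) set"
  where "emb i u = pure (fam_one(i := u))"

lemma emb_hom: "i \<in> I \<Longrightarrow> emb i \<in> alg_hom (A i) S"
proof (rule alg_homI)
  assume i: "i \<in> I"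
  show "emb i \<in> lin_map (A i) S"
    by (rule lin_mapI) (auto simp: emb_def fam_upd fam_one i pure_add pure_scale)
  show "emb i (u \<otimes>\<^bsub>A i\<^esub> v) = emb i u \<otimes>\<^bsub>S\<^esub> emb i v" if "u \<in> carrier (A i)" "v \<in> carrier (A i)" for u v
  proof -
    have "fam_mult (fam_one(i := u)) (fam_one(i := v)) = fam_one(i := u \<otimes>\<^bsub>A i\<^esub> v)"
      using i ring.ring_simprules(12)[OF ring_A alg_closed(1)] by (auto simp: fam_mult_def fam_one_def fun_eq_iff)
    then show ?thesis by (simp add: emb_def pure_mult fam_upd fam_one i that)
  qed
  have "fam_one(i := \<one>\<^bsub>A i\<^esub>) = fam_one" using i by (auto simp: fam_one_def)
  then show "emb i \<one>\<^bsub>A i\<^esub> = \<one>\<^bsub>S\<^esub>" by (simp add: emb_def pure_one)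
qed

lemma emb_mult_emb:
  assumes "i \<in> I" "j \<in> I" "i \<noteq> j" "u \<in> carrier (A i)" "v \<in> carrier (A j)"
  shows "emb i u \<otimes>\<^bsub>S\<^esub> emb j v = pure (fam_one(i := u, j := v))"
proof -
  have "fam_mult (fam_one(i := u)) (fam_one(j := v)) l = (fam_one(i := u, j := v)) l" for l
    using assms ring.ring_simprules(12)[OF ring_A alg_closed(1), of l]
      ring.ring_simprules(12)[OF ring_A[OF assms(2)] assms(5)]
      Group.monoid.r_one[OF ring.is_monoid[OF ring_A[OF assms(1)]] assms(4)]
    by (auto simp: fam_mult_def fam_one_def)
  then have "fam_mult (fam_one(i := u)) (fam_one(j := v)) = fam_one(i := u, j := v)" by (rule ext)
  then show ?thesis using assms by (simp add: emb_def pure_mult fam_upd fam_one)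
qed

text \<open>\<psi> is f \<otimes> g tensored with functionals of value 1 at the unit on the
  remaining factors, which exist because no factor is zero. The last clause records that the value
  at a pure tensor is divisible by its values at i and j; it serves to show that \<psi> vanishes
  there.\<close>

lemma product_functional:
  assumes ij: "i \<in> I" "j \<in> I" "i \<noteq> j" and nz: "\<And>l. l \<in> I \<Longrightarrow> \<one>\<^bsub>A l\<^esub> \<noteq> \<zero>\<^bsub>A l\<^esub>"
    and f: "f \<in> lin_map (A i) base_alg" and g: "g \<in> lin_map (A j) base_alg"
  obtains \<psi> where "\<psi> \<in> lin_map S base_alg"
    "\<And>a b. a \<in> carrier (A i) \<Longrightarrow> b \<in> carrier (A j) \<Longrightarrow> \<psi> (emb i a \<otimes>\<^bsub>S\<^esub> emb j b) = f a * g b"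
    "\<And>a. a \<in> fam \<Longrightarrow> \<exists>r. \<psi> (pure a) = f (a i) * g (a j) * r"
proof -
  have "\<exists>e. e \<in> lin_map (A l) base_alg \<and> e \<one>\<^bsub>A l\<^esub> = 1" if l: "l \<in> I" for l
  proof -
    interpret k_algebra "A l" by (rule alg[OF l])
    have "submodule {\<zero>\<^bsub>A l\<^esub>} field_ring (A l)" by (rule submodI) auto
    from functional_exists[OF this, of "\<one>\<^bsub>A l\<^esub>"] nz[OF l] show ?thesis by auto
  qed
  then obtain e where e: "\<And>l. l \<in> I \<Longrightarrow> e l \<in> lin_map (A l) base_alg \<and> e l \<one>\<^bsub>A l\<^esub> = 1" by metis
  define F where "F l = (if l = i then f else if l = j then g else e l)" for l
  have F: "F l \<in> lin_map (A l) base_alg" if "l \<in> I" for l using that f g e by (simp add: F_def)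
  \<comment> \<open>At indices other than i and j a unit entry contributes the factor 1, so the
    product may run over any finite set that contains the support and i, j. These two are always
    included, as f and g need not be 1 at the unit.\<close>
  define U where "U a = {i, j} \<union> {l\<in>I. a l \<noteq> \<one>\<^bsub>A l\<^esub>}" for a
  define G where "G a = (\<Prod>l\<in>U a. F l (a l))" for a
  have G: "G a = (\<Prod>l\<in>M. F l (a l))" if "finite M" "U a \<subseteq> M" "M \<subseteq> I" for a M
    unfolding G_def using that by (intro prod.mono_neutral_left) (auto simp: U_def F_def e)
  have U: "finite (U a)" "U a \<subseteq> I" if "a \<in> fam" for a
    using that ij by (auto simp: U_def tensor_families_def)
  have Gupd: "G (a(k := u)) = F k u * (\<Prod>l\<in>insert k (U a) - {k}. F l (a l))"
    if "a \<in> fam" "k \<in> I" for a k u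
  proof -
    have "G (a(k := u)) = (\<Prod>l\<in>insert k (U a). F l ((a(k := u)) l))"
      using that U by (intro G) (auto simp: U_def)
    also have "\<dots> = F k ((a(k := u)) k) * (\<Prod>l\<in>insert k (U a) - {k}. F l ((a(k := u)) l))"
      using U that by (intro prod.remove) auto
    finally show ?thesis by simp
  qed
  obtain \<psi> where \<psi>: "\<psi> \<in> lin_map S base_alg" "\<And>a. a \<in> fam \<Longrightarrow> \<psi> (pure a) = G a"
    by (rule tensor_lift[OF k_algebra_base, of G])
       (auto simp: Gupd lin_mapD[OF F] distrib_right)
  show ?thesis
  proof (rule that[OF \<psi>(1)])
    show "\<psi> (emb i a \<otimes>\<^bsub>S\<^esub> emb j b) = f a * g b" if "a \<in> carrier (A i)" "b \<in> carrier (A j)" for a b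
    proof -
      have "G (fam_one(i := a, j := b)) = (\<Prod>l\<in>{i, j}. F l ((fam_one(i := a, j := b)) l))"
        using ij by (intro G) (auto simp: U_def fam_one_def)
      also have "\<dots> = f a * g b" using ij by (simp add: F_def)
      finally show ?thesis using that ij by (simp add: emb_mult_emb \<psi>(2) fam_upd fam_one)
    qed
    show "\<exists>r. \<psi> (pure a) = f (a i) * g (a j) * r" if "a \<in> fam" for a
    proof -
      have "G a = F i (a i) * (F j (a j) * (\<Prod>l\<in>U a - {i} - {j}. F l (a l)))"
        unfolding G_def using U[OF that] ij
        by (subst prod.remove[of _ i], simp, simp add: U_def, subst prod.remove[of _ j], auto simp: U_def)
      moreover have "F i = f" "F j = g" using ij by (auto simp: F_def)
      ultimately have "\<psi> (pure a) = f (a i) * g (a j) * (\<Prod>l\<in>U a - {i} - {j}. F l (a l))"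
        by (simp only: \<psi>(2)[OF that] mult.assoc)
      then show ?thesis by (rule exI)
    qed
  qed
qed

end

section \<open>The coproduct and its abelianization\<close>

lemma (in abelian_group) add_eq_imp_minus_eq:
  assumes "a \<in> carrier G" "b \<in> carrier G" "c \<in> carrier G" "d \<in> carrier G" "a \<oplus> b = c \<oplus> d"
  shows "a \<ominus> c = d \<ominus> b"
proof -
  have "a = (c \<oplus> d) \<ominus> b" using assms(1,2) assms(5)[symmetric] by (simp add: a_minus_def a_assoc r_neg)
  also have "\<dots> = c \<oplus> (d \<ominus> b)" using assms by (simp add: a_minus_def a_assoc)
  also have "\<dots> = (d \<ominus> b) \<oplus> c" using assms by (simp add: a_comm)
  finally have "a = (d \<ominus> b) \<oplus> c" .
  moreover have "(x \<oplus> c) \<ominus> c = x" if "x \<in> carrier G" for x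
    using that assms(3) by (simp add: a_minus_def a_assoc r_neg)
  ultimately show ?thesis using assms(2,4) by simp
qed

context comm_algebra_family
begin

abbreviation "T \<equiv> coproduct I A"
abbreviation "\<iota> \<equiv> coproj I A"

lemma k_algebra_T: "k_algebra T"
  by (rule k_algebra_coproduct[OF alg])

sublocale T: k_algebra T by (rule k_algebra_T)

lemma \<iota>_hom: "i \<in> I \<Longrightarrow> \<iota> i \<in> alg_hom (A i) T"
  by (rule coproj_hom[OF alg])

lemmas \<iota>_lin = alg_hom_lin[OF \<iota>_hom]

lemma \<iota>_closed [simp]: "i \<in> I \<Longrightarrow> a \<in> carrier (A i) \<Longrightarrow> \<iota> i a \<in> carrier T"
  using lin_mapD(1)[OF \<iota>_lin] .

text \<open>Elements of T are classes of linear combinations of words, and a word is a product of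
  letters taken from the A_i.\<close>

lemma coproduct_induct [consumes 1, case_names letter one add scale mult]:
  assumes "t \<in> carrier T" and letter: "\<And>i a. i \<in> I \<Longrightarrow> a \<in> carrier (A i) \<Longrightarrow> P (\<iota> i a)"
    and one: "P \<one>\<^bsub>T\<^esub>"
    and add: "\<And>s t. s \<in> carrier T \<Longrightarrow> t \<in> carrier T \<Longrightarrow> P s \<Longrightarrow> P t \<Longrightarrow> P (s \<oplus>\<^bsub>T\<^esub> t)"
    and scale: "\<And>c t. t \<in> carrier T \<Longrightarrow> P t \<Longrightarrow> P (c \<odot>\<^bsub>T\<^esub> t)"
    and mult: "\<And>s t. s \<in> carrier T \<Longrightarrow> t \<in> carrier T \<Longrightarrow> P s \<Longrightarrow> P t \<Longrightarrow> P (s \<otimes>\<^bsub>T\<^esub> t)"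
  shows "P t"
proof -
  let ?F = "coproduct_free I A"
  let ?p = "\<lambda>p. coproduct_ideal I A +>\<^bsub>?F\<^esub> p"
  have F: "k_algebra ?F" "ideal (coproduct_ideal I A) ?F"
    by (rule coproduct_free_alg[OF alg], assumption, rule coproduct_ideal[OF alg])
  note q = quot_alg_simps[OF F, folded coproduct_def]
  have qc: "carrier T = ?p ` carrier ?F" unfolding coproduct_def by (rule quot_alg_carrier[OF F])
  let ?W = "{w. set w \<subseteq> (SIGMA i:I. carrier (A i))}"
  have Fs: "add ?F = (+)" "mult ?F = (*)" "one ?F = 1" "zero ?F = 0" "smult ?F = scale_poly"
    "\<And>p. p \<in> carrier ?F \<longleftrightarrow> Poly_Mapping.keys p \<subseteq> ?W"
    by (auto simp: coproduct_free_def free_assoc_carrier)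
  have word: "P (?p (Poly_Mapping.single w 1))" if "w \<in> ?W" for w
    using that
  proof (induction w)
    case Nil
    have "Poly_Mapping.single [] 1 = \<one>\<^bsub>?F\<^esub>" by (simp add: Fs flip: single_one zero_list_def)
    then show ?case using one by (simp add: q)
  next
    case (Cons x w)
    obtain i a where x: "x = (i, a)" by fastforce
    have ia: "i \<in> I" "a \<in> carrier (A i)" using Cons(2) x by auto
    have cl: "avar x \<in> carrier ?F" "Poly_Mapping.single w (1::'k) \<in> carrier ?F"
      using Cons(2) by (auto simp: Fs avar_def)
    have "?p (Poly_Mapping.single (x # w) 1) = ?p (avar x) \<otimes>\<^bsub>T\<^esub> ?p (Poly_Mapping.single w 1)"
      using cl by (simp add: q single_Cons) (simp add: Fs)
    moreover have "?p (avar x) = \<iota> i a" by (simp add: x coproj_def)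
    moreover have "P (?p (Poly_Mapping.single w 1))" using Cons by simp
    moreover have "?p (Poly_Mapping.single w 1) \<in> carrier T" using cl by (simp add: qc)
    ultimately show ?case using mult[OF \<iota>_closed[OF ia] _ letter[OF ia]] by simp
  qed
  have single: "P (?p (Poly_Mapping.single w c))" if "w \<in> ?W" for w c
  proof -
    have cl: "Poly_Mapping.single w (1::'k) \<in> carrier ?F" using that by (simp add: Fs)
    have "?p (Poly_Mapping.single w c) = c \<odot>\<^bsub>T\<^esub> ?p (Poly_Mapping.single w 1)"
      using cl by (simp add: q) (simp add: Fs)
    then show ?thesis using scale[of "?p (Poly_Mapping.single w 1)" c] word[OF that] cl by (simp add: qc)
  qed
  obtain p where p: "p \<in> carrier ?F" "t = ?p p" using assms(1) by (auto simp: qc)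
  have "P (?p p)"
    using p(1)[unfolded Fs]
  proof (induction p rule: poly_mapping_induct_on)
    case zero
    then show ?case using single[of "[]" 0] by simp
  next
    case (add p q)
    have cl: "p \<in> carrier ?F" "q \<in> carrier ?F" using add by (simp_all add: Fs)
    have "?p (p + q) = ?p p \<oplus>\<^bsub>T\<^esub> ?p q" using cl by (simp add: q) (simp add: Fs)
    then show ?case using assms(4)[of "?p p" "?p q"] add cl by (simp add: qc)
  qed (rule single)
  then show ?thesis using p by simp
qed

text \<open>The abelianization of T. The universal property of the coproduct supplies it and
  determines it on \<open>carrier T\<close>.\<close>

definition "abel = (SOME g. g \<in> alg_hom T S \<and> (\<forall>i\<in>I. \<forall>a\<in>carrier (A i). g (\<iota> i a) = emb i a))"

lemma abel: "abel \<in> alg_hom T S" "\<And>i a. i \<in> I \<Longrightarrow> a \<in> carrier (A i) \<Longrightarrow> abel (\<iota> i a) = emb i a"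
proof -
  have "\<exists>g. g \<in> alg_hom T S \<and> (\<forall>i\<in>I. \<forall>a\<in>carrier (A i). g (\<iota> i a) = emb i a)"
    using coproduct_universal[where I = I and A = A and h = emb, OF alg k_algebra_S emb_hom] by blast
  from someI_ex[OF this] show "abel \<in> alg_hom T S"
    "\<And>i a. i \<in> I \<Longrightarrow> a \<in> carrier (A i) \<Longrightarrow> abel (\<iota> i a) = emb i a"
    unfolding abel_def by auto
qed

lemmas abel_lin = alg_hom_lin[OF abel(1)]
lemmas abel_simps = lin_mapD[OF abel_lin] lin_map_zero_minus[OF abel_lin k_algebra_T k_algebra_S] alg_homD[OF abel(1)]

lemma emb_closed [simp]: "i \<in> I \<Longrightarrow> a \<in> carrier (A i) \<Longrightarrow> emb i a \<in> carrier S"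
  using lin_mapD(1)[OF alg_hom_lin[OF emb_hom]] .

end

text \<open>R is S \<otimes> S, built as the tensor product of the constant family indexed by
  \<open>bool\<close>, with e0 and e1 the embeddings of the two factors. The slices \<Phi> = id
  \<otimes> \<psi> turn identities in R into identities in S. An anonymous R keeps the nested
  construction out of the later proofs.\<close>

lemma tensor_square:
  fixes S :: "('k::field, 's) module"
  assumes S: "k_algebra S" and comm: "\<And>s t. s \<in> carrier S \<Longrightarrow> t \<in> carrier S \<Longrightarrow> s \<otimes>\<^bsub>S\<^esub> t = t \<otimes>\<^bsub>S\<^esub> s"
  obtains R :: "('k, ((bool \<Rightarrow> 's) \<Rightarrow>\<^sub>0 'k) set) module" and e0 e1
  where "k_algebra R" "cring R" "e0 \<in> alg_hom S R" "e1 \<in> alg_hom S R"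
    "\<And>\<psi>. \<psi> \<in> lin_map S base_alg \<Longrightarrow> \<exists>\<Phi>\<in>lin_map R S. \<forall>s\<in>carrier S. \<forall>t\<in>carrier S. \<Phi> (e0 s \<otimes>\<^bsub>R\<^esub> e1 t) = \<psi> t \<odot>\<^bsub>S\<^esub> s"
proof -
  interpret S: k_algebra S by fact
  interpret sq: comm_algebra_family "UNIV :: bool set" "\<lambda>_. S" by unfold_locales (use comm S in auto)
  show thesis
  proof (rule that[OF sq.k_algebra_S sq.S.is_cring sq.emb_hom sq.emb_hom])
    show "\<exists>\<Phi>\<in>lin_map sq.S S. \<forall>s\<in>carrier S. \<forall>t\<in>carrier S.
        \<Phi> (sq.emb False s \<otimes>\<^bsub>sq.S\<^esub> sq.emb True t) = \<psi> t \<odot>\<^bsub>S\<^esub> s"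
      if \<psi>: "\<psi> \<in> lin_map S base_alg" for \<psi>
    proof -
      note psi = lin_mapD[OF \<psi>, simplified]
      obtain \<Phi> where \<Phi>: "\<Phi> \<in> lin_map sq.S S" "\<And>a. a \<in> sq.fam \<Longrightarrow> \<Phi> (sq.pure a) = \<psi> (a True) \<odot>\<^bsub>S\<^esub> a False"
      proof (rule sq.tensor_lift[OF S, of "\<lambda>a. \<psi> (a True) \<odot>\<^bsub>S\<^esub> a False"], goal_cases)
        case (2 a i u v)
        then show ?case using sq.fam_carrier[of a] by (cases i) (auto simp: psi S.scale_add_left S.scale_add_right)
      next
        case (3 a i c u)
        then show ?case using sq.fam_carrier[of a] by (cases i) (auto simp: psi mult.commute)
      qed (auto intro: sq.fam_carrier)
      have "\<Phi> (sq.emb False s \<otimes>\<^bsub>sq.S\<^esub> sq.emb True t) = \<psi> t \<odot>\<^bsub>S\<^esub> s"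
        if "s \<in> carrier S" "t \<in> carrier S" for s t
        using that by (simp add: sq.emb_mult_emb \<Phi>(2) sq.fam_upd sq.fam_one)
      then show ?thesis using \<Phi>(1) by blast
    qed
  qed simp_all
qed

text \<open>Every A_i acts by the matrices diag(e0 a, e1 a). Conjugating those with i \<noteq> j by
  a unipotent matrix puts e0 a - e1 a in the corner, while A_j stays diagonal. The coproduct glues
  these independent choices to a representation of T, and its corner entry \<delta> is a derivation
  between the two abelianizations that does not vanish on commutators.\<close>

lemma (in comm_algebra_family) skew_derivation:
  assumes j: "j \<in> I"
  obtains R :: "('k, ((bool \<Rightarrow> (('i \<Rightarrow> 'a) \<Rightarrow>\<^sub>0 'k) set) \<Rightarrow>\<^sub>0 'k) set) module" and e0 e1 \<delta>
  where "k_algebra R" "cring R" "e0 \<in> alg_hom S R" "e1 \<in> alg_hom S R"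
    "\<And>\<psi>. \<psi> \<in> lin_map S base_alg \<Longrightarrow> \<exists>\<Phi>\<in>lin_map R S. \<forall>s\<in>carrier S. \<forall>t\<in>carrier S. \<Phi> (e0 s \<otimes>\<^bsub>R\<^esub> e1 t) = \<psi> t \<odot>\<^bsub>S\<^esub> s"
    "\<delta> \<in> lin_map T R"
    "\<And>s t. s \<in> carrier T \<Longrightarrow> t \<in> carrier T \<Longrightarrow>
      \<delta> (s \<otimes>\<^bsub>T\<^esub> t) = e0 (abel s) \<otimes>\<^bsub>R\<^esub> \<delta> t \<oplus>\<^bsub>R\<^esub> \<delta> s \<otimes>\<^bsub>R\<^esub> e1 (abel t)"
    "\<And>i a. i \<in> I \<Longrightarrow> i \<noteq> j \<Longrightarrow> a \<in> carrier (A i) \<Longrightarrow> \<delta> (\<iota> i a) = e0 (emb i a) \<ominus>\<^bsub>R\<^esub> e1 (emb i a)"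
    "\<And>a. a \<in> carrier (A j) \<Longrightarrow> \<delta> (\<iota> j a) = \<zero>\<^bsub>R\<^esub>"
proof -
  obtain R :: "('k, ((bool \<Rightarrow> (('i \<Rightarrow> 'a) \<Rightarrow>\<^sub>0 'k) set) \<Rightarrow>\<^sub>0 'k) set) module" and e0 e1
    where R: "k_algebra R" "cring R" "e0 \<in> alg_hom S R" "e1 \<in> alg_hom S R"
      "\<And>\<psi>. \<psi> \<in> lin_map S base_alg \<Longrightarrow> \<exists>\<Phi>\<in>lin_map R S. \<forall>s\<in>carrier S. \<forall>t\<in>carrier S. \<Phi> (e0 s \<otimes>\<^bsub>R\<^esub> e1 t) = \<psi> t \<odot>\<^bsub>S\<^esub> s"
    using tensor_square[OF k_algebra_S S_comm] by blast
  interpret R: k_algebra R by fact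
  interpret R: cring R by fact
  interpret M: k_algebra "mat2 R" by (rule k_algebra_mat2) fact
  note e0 = lin_mapD[OF alg_hom_lin[OF R(3)]] alg_homD[OF R(3)]
  note e1 = lin_mapD[OF alg_hom_lin[OF R(4)]] alg_homD[OF R(4)]
  define h where "h i a = (e0 (emb i a), if i = j then \<zero>\<^bsub>R\<^esub> else e0 (emb i a) \<ominus>\<^bsub>R\<^esub> e1 (emb i a), \<zero>\<^bsub>R\<^esub>, e1 (emb i a))" for i a
  have "h i \<in> alg_hom (A i) (mat2 R)" if i: "i \<in> I" for i
  proof (rule alg_homI)
    interpret Ai: k_algebra "A i" by (rule alg[OF i])
    note m = lin_mapD[OF alg_hom_lin[OF emb_hom[OF i]]] alg_homD[OF emb_hom[OF i]]
    note mc = e0(1)[OF m(1)] e1(1)[OF m(1)]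
    show "h i \<in> lin_map (A i) (mat2 R)"
    proof (rule lin_mapI)
      show "h i a \<in> carrier (mat2 R)" if "a \<in> carrier (A i)" for a
        using that mc by (simp add: h_def)
      show "h i (a \<oplus>\<^bsub>A i\<^esub> b) = h i a \<oplus>\<^bsub>mat2 R\<^esub> h i b" if "a \<in> carrier (A i)" "b \<in> carrier (A i)" for a b
      proof -
        note [simp] = mc[OF that(1)] mc[OF that(2)]
        have "(e0 (emb i a) \<oplus>\<^bsub>R\<^esub> e0 (emb i b)) \<ominus>\<^bsub>R\<^esub> (e1 (emb i a) \<oplus>\<^bsub>R\<^esub> e1 (emb i b))
          = (e0 (emb i a) \<ominus>\<^bsub>R\<^esub> e1 (emb i a)) \<oplus>\<^bsub>R\<^esub> (e0 (emb i b) \<ominus>\<^bsub>R\<^esub> e1 (emb i b))"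
          by (simp add: a_minus_def R.minus_add R.a_ac)
        then show ?thesis using that by (simp add: h_def m e0 e1)
      qed
      show "h i (c \<odot>\<^bsub>A i\<^esub> a) = c \<odot>\<^bsub>mat2 R\<^esub> h i a" if "a \<in> carrier (A i)" for a c
        using that mc by (simp add: h_def m e0 e1 a_minus_def R.scale_add_right R.minus_scale mult.commute)
    qed
    show "h i (a \<otimes>\<^bsub>A i\<^esub> b) = h i a \<otimes>\<^bsub>mat2 R\<^esub> h i b" if "a \<in> carrier (A i)" "b \<in> carrier (A i)" for a b
    proof -
      note [simp] = mc[OF that(1)] mc[OF that(2)]
      have "(e0 (emb i a) \<otimes>\<^bsub>R\<^esub> e0 (emb i b)) \<ominus>\<^bsub>R\<^esub> (e1 (emb i a) \<otimes>\<^bsub>R\<^esub> e1 (emb i b))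
        = e0 (emb i a) \<otimes>\<^bsub>R\<^esub> (e0 (emb i b) \<ominus>\<^bsub>R\<^esub> e1 (emb i b)) \<oplus>\<^bsub>R\<^esub> (e0 (emb i a) \<ominus>\<^bsub>R\<^esub> e1 (emb i a)) \<otimes>\<^bsub>R\<^esub> e1 (emb i b)"
        by (simp add: a_minus_def R.r_distr R.l_distr R.l_minus R.r_minus R.a_ac R.r_neg2)
      moreover have "e0 (emb i (a \<otimes>\<^bsub>A i\<^esub> b)) = e0 (emb i a) \<otimes>\<^bsub>R\<^esub> e0 (emb i b)"
        "e1 (emb i (a \<otimes>\<^bsub>A i\<^esub> b)) = e1 (emb i a) \<otimes>\<^bsub>R\<^esub> e1 (emb i b)"
        using that by (simp_all add: m e0 e1)
      ultimately show ?thesis using mc[OF that(1)] mc[OF that(2)] by (cases "i = j") (simp_all add: h_def)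
    qed
    show "h i \<one>\<^bsub>A i\<^esub> = \<one>\<^bsub>mat2 R\<^esub>"
      by (simp add: h_def m e0 e1 a_minus_def R.r_neg)
  qed
  then obtain \<rho> where \<rho>: "\<rho> \<in> alg_hom T (mat2 R)" "\<And>i a. i \<in> I \<Longrightarrow> a \<in> carrier (A i) \<Longrightarrow> \<rho> (\<iota> i a) = h i a"
    using coproduct_universal[where I = I and A = A and h = h, OF alg M.k_algebra_axioms] by blast
  note rho = lin_mapD[OF alg_hom_lin[OF \<rho>(1)]] alg_homD[OF \<rho>(1)]
  \<comment> \<open>The triangular form and the diagonal are inherited from the letters by sums and
    products, so the corner entry is the only new datum.\<close>
  have ex: "\<exists>d\<in>carrier R. \<rho> t = (e0 (abel t), d, \<zero>\<^bsub>R\<^esub>, e1 (abel t))" if "t \<in> carrier T" for t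
    using that
  proof (induction t rule: coproduct_induct)
    case (letter i a)
    then show ?case using e0(1) e1(1) by (auto simp: \<rho>(2) h_def abel(2))
  next
    case one
    show ?case by (simp add: rho abel_simps e0 e1)
  next
    case (add s t)
    then show ?case by (auto simp: rho abel_simps e0 e1)
  next
    case (scale c t)
    then show ?case by (auto simp: rho abel_simps e0 e1)
  next
    case (mult s t)
    then show ?case by (auto simp: rho abel_simps e0 e1)
  qed
  define \<delta> where "\<delta> t = fst (snd (\<rho> t))" for t
  have d: "\<delta> t \<in> carrier R" "\<rho> t = (e0 (abel t), \<delta> t, \<zero>\<^bsub>R\<^esub>, e1 (abel t))" if "t \<in> carrier T" for t
    using ex[OF that] by (auto simp: \<delta>_def)
  show thesis
  proof (rule that[OF R, of \<delta>])
    show "\<delta> \<in> lin_map T R"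
    proof (rule lin_mapI)
      show "\<delta> (a \<oplus>\<^bsub>T\<^esub> b) = \<delta> a \<oplus>\<^bsub>R\<^esub> \<delta> b" if "a \<in> carrier T" "b \<in> carrier T" for a b
        unfolding \<delta>_def rho(2)[OF that] using d(2)[OF that(1)] d(2)[OF that(2)] by simp
      show "\<delta> (c \<odot>\<^bsub>T\<^esub> a) = c \<odot>\<^bsub>R\<^esub> \<delta> a" if "a \<in> carrier T" for a c
        unfolding \<delta>_def rho(3)[OF that] using d(2)[OF that] by simp
    qed (rule d)
    show "\<delta> (s \<otimes>\<^bsub>T\<^esub> t) = e0 (abel s) \<otimes>\<^bsub>R\<^esub> \<delta> t \<oplus>\<^bsub>R\<^esub> \<delta> s \<otimes>\<^bsub>R\<^esub> e1 (abel t)"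
      if "s \<in> carrier T" "t \<in> carrier T" for s t
      unfolding \<delta>_def rho(4)[OF that] using d(2)[OF that(1)] d(2)[OF that(2)] by simp
  qed (simp_all add: \<delta>_def \<rho>(2) h_def j)
qed

lemma (in abelian_group) minus_eq_zeroD:
  assumes "a \<in> carrier G" "b \<in> carrier G" "a \<ominus> b = \<zero>"
  shows "a = b"
proof -
  have "(a \<ominus> b) \<oplus> b = a" using assms(1,2) by (simp add: a_minus_def a_assoc l_neg)
  then show ?thesis using assms by simp
qed

section \<open>Rigidity of Poisson brackets on noncommutative algebras\<close>

context poisson_structure
begin

text \<open>Expand \<pi>(ac, bd) with the Leibniz rule in the left variable outermost, then with
  that in the right variable outermost. The mixed terms \<open>?K\<close> agree and cancel, and the
  rest differs by the order of a, b on one side and of c, d on the other.\<close>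

lemma commutator_bracket:
  assumes a: "a \<in> carrier A" and b: "b \<in> carrier A" and c: "c \<in> carrier A" and d: "d \<in> carrier A"
  shows "(a \<otimes> b \<ominus> b \<otimes> a) \<otimes> \<pi> c d = \<pi> a b \<otimes> (c \<otimes> d \<ominus> d \<otimes> c)"
proof -
  note [simp] = a b c d closed
  let ?K = "a \<otimes> (\<pi> c b \<otimes> d) \<oplus> b \<otimes> (\<pi> a d \<otimes> c)"
  have 1: "\<pi> (a \<otimes> c) (b \<otimes> d) = (a \<otimes> (b \<otimes> \<pi> c d) \<oplus> \<pi> a b \<otimes> (d \<otimes> c)) \<oplus> ?K"
    by (subst deriv_left) (simp_all add: deriv_right r_distr l_distr m_assoc a_ac)
  have 2: "\<pi> (a \<otimes> c) (b \<otimes> d) = (b \<otimes> (a \<otimes> \<pi> c d) \<oplus> \<pi> a b \<otimes> (c \<otimes> d)) \<oplus> ?K"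
    by (subst deriv_right) (simp_all add: deriv_left r_distr l_distr m_assoc a_ac)
  have "a \<otimes> (b \<otimes> \<pi> c d) \<oplus> \<pi> a b \<otimes> (d \<otimes> c) = b \<otimes> (a \<otimes> \<pi> c d) \<oplus> \<pi> a b \<otimes> (c \<otimes> d)"
    using 1 2 by (simp add: add.right_cancel)
  then have "a \<otimes> (b \<otimes> \<pi> c d) \<ominus> b \<otimes> (a \<otimes> \<pi> c d) = \<pi> a b \<otimes> (c \<otimes> d) \<ominus> \<pi> a b \<otimes> (d \<otimes> c)"
    by (intro add_eq_imp_minus_eq) auto
  then show ?thesis by (simp add: a_minus_def l_distr r_distr l_minus r_minus m_assoc)
qed

text \<open>For u c in place of c both the bracket and the commutator split by Leibniz; the parts
  ending in c agree by the identity without u. The inserted u later carries a free test element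
  w.\<close>

lemma commutator_bracket_insert:
  assumes a: "a \<in> carrier A" and b: "b \<in> carrier A" and c: "c \<in> carrier A" and d: "d \<in> carrier A"
    and u: "u \<in> carrier A"
  shows "(a \<otimes> b \<ominus> b \<otimes> a) \<otimes> (u \<otimes> \<pi> c d) = (\<pi> a b \<otimes> u) \<otimes> (c \<otimes> d \<ominus> d \<otimes> c)"
proof -
  note [simp] = a b c d u closed
  define L where "L = a \<otimes> b \<ominus> b \<otimes> a"
  have L[simp]: "L \<in> carrier A" by (simp add: L_def)
  have "L \<otimes> \<pi> (u \<otimes> c) d = \<pi> a b \<otimes> ((u \<otimes> c) \<otimes> d \<ominus> d \<otimes> (u \<otimes> c))"
    unfolding L_def by (rule commutator_bracket) auto
  also have "(u \<otimes> c) \<otimes> d \<ominus> d \<otimes> (u \<otimes> c) = u \<otimes> (c \<otimes> d \<ominus> d \<otimes> c) \<oplus> (u \<otimes> d \<ominus> d \<otimes> u) \<otimes> c"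
    by (simp add: a_minus_def l_distr r_distr l_minus r_minus m_assoc a_assoc r_neg1)
  also have "\<pi> a b \<otimes> \<dots> = \<pi> a b \<otimes> (u \<otimes> (c \<otimes> d \<ominus> d \<otimes> c)) \<oplus> (\<pi> a b \<otimes> (u \<otimes> d \<ominus> d \<otimes> u)) \<otimes> c"
    by (simp add: r_distr m_assoc)
  also have "\<pi> a b \<otimes> (u \<otimes> d \<ominus> d \<otimes> u) = L \<otimes> \<pi> u d"
    unfolding L_def by (rule commutator_bracket[symmetric]) auto
  finally have "L \<otimes> (u \<otimes> \<pi> c d) \<oplus> L \<otimes> (\<pi> u d \<otimes> c) = \<pi> a b \<otimes> (u \<otimes> (c \<otimes> d \<ominus> d \<otimes> c)) \<oplus> L \<otimes> (\<pi> u d \<otimes> c)"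
    by (simp add: deriv_left r_distr m_assoc)
  then have "L \<otimes> (u \<otimes> \<pi> c d) = \<pi> a b \<otimes> (u \<otimes> (c \<otimes> d \<ominus> d \<otimes> c))" by (simp add: add.right_cancel)
  then show ?thesis by (simp add: L_def m_assoc)
qed

end

section \<open>Rigidity for brackets of letters, read in S\<close>

locale splay = comm_algebra_family I A
  for I :: "'i set" and A :: "'i \<Rightarrow> ('k::field, 'a, 'm) module_scheme" +
  fixes \<pi>
  assumes splay_poisson: "splay_poisson I A \<pi>"
begin

lemma poisson_T: "poisson_structure T \<pi>"
  using splay_poisson by (simp add: splay_poisson_def)

sublocale P: poisson_structure T \<pi> by (rule poisson_T)

lemma bracket_same: "i \<in> I \<Longrightarrow> a \<in> carrier (A i) \<Longrightarrow> b \<in> carrier (A i) \<Longrightarrow> \<pi> (\<iota> i a) (\<iota> i b) = \<zero>\<^bsub>T\<^esub>"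
  using splay_poisson by (simp add: splay_poisson_def)

definition br :: "'i \<Rightarrow> 'a \<Rightarrow> 'i \<Rightarrow> 'a \<Rightarrow> (('i \<Rightarrow> 'a) \<Rightarrow>\<^sub>0 'k) set"
  where "br i a j b = abel (\<pi> (\<iota> i a) (\<iota> j b))"

lemma br_closed [simp]: "i \<in> I \<Longrightarrow> a \<in> carrier (A i) \<Longrightarrow> j \<in> I \<Longrightarrow> b \<in> carrier (A j) \<Longrightarrow> br i a j b \<in> carrier S"
  by (simp add: br_def abel_simps P.closed)

lemma br_swap: "i \<in> I \<Longrightarrow> a \<in> carrier (A i) \<Longrightarrow> j \<in> I \<Longrightarrow> b \<in> carrier (A j) \<Longrightarrow> br j b i a = \<ominus>\<^bsub>S\<^esub> br i a j b"
  unfolding br_def by (subst P.skew) (simp_all add: abel_simps P.closed)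

lemma abel_commutator: "s \<in> carrier T \<Longrightarrow> t \<in> carrier T \<Longrightarrow> abel (s \<otimes>\<^bsub>T\<^esub> t \<ominus>\<^bsub>T\<^esub> t \<otimes>\<^bsub>T\<^esub> s) = \<zero>\<^bsub>S\<^esub>"
  using S_comm[of "abel s" "abel t"] by (simp add: abel_simps a_minus_def S.r_neg)

text \<open>The rigidity identity, transported to \<open>S\<close> by \<open>id \<otimes> \<psi>\<close> and with the terms moved so that no
  subtraction occurs.\<close>

lemma bracket_star:
  assumes j: "j \<in> I" and b: "b \<in> carrier (A j)" and d: "d \<in> carrier (A j)"
    and i: "i \<in> I" "i \<noteq> j" and a: "a \<in> carrier (A i)"
    and i': "i' \<in> I" "i' \<noteq> j" and c: "c \<in> carrier (A i')" and u: "u \<in> carrier T"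
    and \<psi>: "\<psi> \<in> lin_map S base_alg"
    and defs: "x = emb i a" "y = emb j b" "z = emb i' c" "w = emb j d"
      "V = abel u \<otimes>\<^bsub>S\<^esub> br i' c j d" "Q = br i a j b \<otimes>\<^bsub>S\<^esub> abel u"
  shows "\<psi> (y \<otimes>\<^bsub>S\<^esub> V) \<odot>\<^bsub>S\<^esub> x \<oplus>\<^bsub>S\<^esub> \<psi> (x \<otimes>\<^bsub>S\<^esub> V) \<odot>\<^bsub>S\<^esub> y \<oplus>\<^bsub>S\<^esub> \<psi> (z \<otimes>\<^bsub>S\<^esub> w) \<odot>\<^bsub>S\<^esub> Q \<oplus>\<^bsub>S\<^esub> \<psi> \<one>\<^bsub>S\<^esub> \<odot>\<^bsub>S\<^esub> (Q \<otimes>\<^bsub>S\<^esub> (z \<otimes>\<^bsub>S\<^esub> w))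
    = \<psi> (x \<otimes>\<^bsub>S\<^esub> y \<otimes>\<^bsub>S\<^esub> V) \<odot>\<^bsub>S\<^esub> \<one>\<^bsub>S\<^esub> \<oplus>\<^bsub>S\<^esub> \<psi> V \<odot>\<^bsub>S\<^esub> (x \<otimes>\<^bsub>S\<^esub> y) \<oplus>\<^bsub>S\<^esub> \<psi> w \<odot>\<^bsub>S\<^esub> (Q \<otimes>\<^bsub>S\<^esub> z) \<oplus>\<^bsub>S\<^esub> \<psi> z \<odot>\<^bsub>S\<^esub> (Q \<otimes>\<^bsub>S\<^esub> w)"
proof -
  obtain R :: "('k, ((bool \<Rightarrow> (('i \<Rightarrow> 'a) \<Rightarrow>\<^sub>0 'k) set) \<Rightarrow>\<^sub>0 'k) set) module" and e0 e1 \<delta>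
    where R: "k_algebra R" "cring R" "e0 \<in> alg_hom S R" "e1 \<in> alg_hom S R"
    and \<Phi>_ex: "\<And>\<psi>. \<psi> \<in> lin_map S base_alg \<Longrightarrow> \<exists>\<Phi>\<in>lin_map R S. \<forall>s\<in>carrier S. \<forall>t\<in>carrier S. \<Phi> (e0 s \<otimes>\<^bsub>R\<^esub> e1 t) = \<psi> t \<odot>\<^bsub>S\<^esub> s"
    and \<delta>: "\<delta> \<in> lin_map T R"
    "\<And>s t. s \<in> carrier T \<Longrightarrow> t \<in> carrier T \<Longrightarrow>
      \<delta> (s \<otimes>\<^bsub>T\<^esub> t) = e0 (abel s) \<otimes>\<^bsub>R\<^esub> \<delta> t \<oplus>\<^bsub>R\<^esub> \<delta> s \<otimes>\<^bsub>R\<^esub> e1 (abel t)"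
    "\<And>i a. i \<in> I \<Longrightarrow> i \<noteq> j \<Longrightarrow> a \<in> carrier (A i) \<Longrightarrow> \<delta> (\<iota> i a) = e0 (emb i a) \<ominus>\<^bsub>R\<^esub> e1 (emb i a)"
    "\<And>a. a \<in> carrier (A j) \<Longrightarrow> \<delta> (\<iota> j a) = \<zero>\<^bsub>R\<^esub>"
    by (rule skew_derivation[OF j]) (rule that)
  interpret R: k_algebra R by fact
  interpret R: cring R by fact
  obtain \<Phi> where \<Phi>: "\<Phi> \<in> lin_map R S" "\<And>s t. s \<in> carrier S \<Longrightarrow> t \<in> carrier S \<Longrightarrow> \<Phi> (e0 s \<otimes>\<^bsub>R\<^esub> e1 t) = \<psi> t \<odot>\<^bsub>S\<^esub> s"
    using \<Phi>_ex[OF \<psi>] by blast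
  note e0 = lin_mapD[OF alg_hom_lin[OF R(3)]] alg_homD[OF R(3)] lin_map_zero_minus[OF alg_hom_lin[OF R(3)] k_algebra_S R(1)]
  note e1 = lin_mapD[OF alg_hom_lin[OF R(4)]] alg_homD[OF R(4)] lin_map_zero_minus[OF alg_hom_lin[OF R(4)] k_algebra_S R(1)]
  note dl = lin_mapD[OF \<delta>(1)] lin_map_zero_minus[OF \<delta>(1) k_algebra_T R(1)]
  \<comment> \<open>\<delta> kills A_j, so only the terms with \<delta> of the other letter survive,
    and the corner of the commutator becomes a product of two differences.\<close>
  have comm: "\<delta> (\<iota> l p \<otimes>\<^bsub>T\<^esub> \<iota> j r \<ominus>\<^bsub>T\<^esub> \<iota> j r \<otimes>\<^bsub>T\<^esub> \<iota> l p) =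
      (e0 (emb l p) \<ominus>\<^bsub>R\<^esub> e1 (emb l p)) \<otimes>\<^bsub>R\<^esub> (e1 (emb j r) \<ominus>\<^bsub>R\<^esub> e0 (emb j r))"
    if l: "l \<in> I" "l \<noteq> j" "p \<in> carrier (A l)" "r \<in> carrier (A j)" for l p r
  proof -
    define X0 X1 Y0 Y1 where XY: "X0 = e0 (emb l p)" "X1 = e1 (emb l p)" "Y0 = e0 (emb j r)" "Y1 = e1 (emb j r)"
    have [simp]: "X0 \<in> carrier R" "X1 \<in> carrier R" "Y0 \<in> carrier R" "Y1 \<in> carrier R"
      using l j by (simp_all add: XY e0 e1)
    have "\<delta> (\<iota> l p \<otimes>\<^bsub>T\<^esub> \<iota> j r \<ominus>\<^bsub>T\<^esub> \<iota> j r \<otimes>\<^bsub>T\<^esub> \<iota> l p) = (X0 \<ominus>\<^bsub>R\<^esub> X1) \<otimes>\<^bsub>R\<^esub> Y1 \<ominus>\<^bsub>R\<^esub> Y0 \<otimes>\<^bsub>R\<^esub> (X0 \<ominus>\<^bsub>R\<^esub> X1)"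
      using l j by (simp add: dl \<delta>(2-4) abel(2) XY e0(1) e1(1))
    also have "\<dots> = (X0 \<ominus>\<^bsub>R\<^esub> X1) \<otimes>\<^bsub>R\<^esub> (Y1 \<ominus>\<^bsub>R\<^esub> Y0)"
      by (simp add: a_minus_def R.r_distr R.l_distr R.l_minus R.r_minus R.m_ac R.minus_add)
    finally show ?thesis by (simp only: XY)
  qed
  define X0 X1 Y0 Y1 Z0 Z1 W0 W1 V1 Q0 where XY:
    "X0 = e0 x" "X1 = e1 x" "Y0 = e0 y" "Y1 = e1 y" "Z0 = e0 z" "Z1 = e1 z" "W0 = e0 w" "W1 = e1 w"
    "V1 = e1 V" "Q0 = e0 Q"
  have cS[simp]: "x \<in> carrier S" "y \<in> carrier S" "z \<in> carrier S" "w \<in> carrier S" "V \<in> carrier S" "Q \<in> carrier S"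
    using assms by (simp_all add: abel_simps)
  have [simp]: "X0 \<in> carrier R" "X1 \<in> carrier R" "Y0 \<in> carrier R" "Y1 \<in> carrier R" "Z0 \<in> carrier R" "Z1 \<in> carrier R"
    "W0 \<in> carrier R" "W1 \<in> carrier R" "V1 \<in> carrier R" "Q0 \<in> carrier R"
    by (simp_all add: XY e0 e1)
  let ?L = "\<iota> i a \<otimes>\<^bsub>T\<^esub> \<iota> j b \<ominus>\<^bsub>T\<^esub> \<iota> j b \<otimes>\<^bsub>T\<^esub> \<iota> i a"
  let ?L' = "\<iota> i' c \<otimes>\<^bsub>T\<^esub> \<iota> j d \<ominus>\<^bsub>T\<^esub> \<iota> j d \<otimes>\<^bsub>T\<^esub> \<iota> i' c"
  let ?V = "u \<otimes>\<^bsub>T\<^esub> \<pi> (\<iota> i' c) (\<iota> j d)"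
  let ?Q = "\<pi> (\<iota> i a) (\<iota> j b) \<otimes>\<^bsub>T\<^esub> u"
  have cT[simp]: "\<iota> i a \<in> carrier T" "\<iota> j b \<in> carrier T" "\<iota> i' c \<in> carrier T" "\<iota> j d \<in> carrier T"
    "u \<in> carrier T" using assms by auto
  have cl: "?L \<in> carrier T" "?L' \<in> carrier T" "?V \<in> carrier T" "?Q \<in> carrier T" by (simp_all add: P.closed)
  have "?L \<otimes>\<^bsub>T\<^esub> ?V = ?Q \<otimes>\<^bsub>T\<^esub> ?L'"
    by (rule P.commutator_bracket_insert) simp_all
  then have "\<delta> (?L \<otimes>\<^bsub>T\<^esub> ?V) = \<delta> (?Q \<otimes>\<^bsub>T\<^esub> ?L')" by (simp only:)
  \<comment> \<open>Of the two Leibniz terms one contains \<delta> of a bracket, which is unknown.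
    It is multiplied by the abelianization of a commutator, which is zero. The same happens on the
    other side.\<close>
  moreover have "\<delta> (?L \<otimes>\<^bsub>T\<^esub> ?V) = (X0 \<ominus>\<^bsub>R\<^esub> X1) \<otimes>\<^bsub>R\<^esub> (Y1 \<ominus>\<^bsub>R\<^esub> Y0) \<otimes>\<^bsub>R\<^esub> V1"
    using comm[OF i a b] dl(1)[OF cl(3)] i i' j a b c d unfolding \<delta>(2)[OF cl(1,3)] abel_commutator[OF cT(1,2)]
    by (simp add: e0 e1 XY defs br_def abel_simps P.closed)
  moreover have "\<delta> (?Q \<otimes>\<^bsub>T\<^esub> ?L') = Q0 \<otimes>\<^bsub>R\<^esub> ((Z0 \<ominus>\<^bsub>R\<^esub> Z1) \<otimes>\<^bsub>R\<^esub> (W1 \<ominus>\<^bsub>R\<^esub> W0))"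
    using comm[OF i' c d] dl(1)[OF cl(4)] i i' j a b c d unfolding \<delta>(2)[OF cl(4,2)] abel_commutator[OF cT(3,4)]
    by (simp add: e0 e1 XY defs br_def abel_simps P.closed)
  ultimately have eq: "(X0 \<ominus>\<^bsub>R\<^esub> X1) \<otimes>\<^bsub>R\<^esub> (Y1 \<ominus>\<^bsub>R\<^esub> Y0) \<otimes>\<^bsub>R\<^esub> V1 = Q0 \<otimes>\<^bsub>R\<^esub> ((Z0 \<ominus>\<^bsub>R\<^esub> Z1) \<otimes>\<^bsub>R\<^esub> (W1 \<ominus>\<^bsub>R\<^esub> W0))"
    by simp
  \<comment> \<open>The positive and negative parts of the two sides. Each term is arranged as an e0
    factor times an e1 factor, the form on which \<Phi> is known.\<close>
  define D1 D2 E1 E2 where D: "D1 = X0 \<otimes>\<^bsub>R\<^esub> (Y1 \<otimes>\<^bsub>R\<^esub> V1) \<oplus>\<^bsub>R\<^esub> Y0 \<otimes>\<^bsub>R\<^esub> (X1 \<otimes>\<^bsub>R\<^esub> V1)"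
    "D2 = \<one>\<^bsub>R\<^esub> \<otimes>\<^bsub>R\<^esub> (X1 \<otimes>\<^bsub>R\<^esub> Y1 \<otimes>\<^bsub>R\<^esub> V1) \<oplus>\<^bsub>R\<^esub> X0 \<otimes>\<^bsub>R\<^esub> Y0 \<otimes>\<^bsub>R\<^esub> V1"
    "E1 = Q0 \<otimes>\<^bsub>R\<^esub> Z0 \<otimes>\<^bsub>R\<^esub> W1 \<oplus>\<^bsub>R\<^esub> Q0 \<otimes>\<^bsub>R\<^esub> W0 \<otimes>\<^bsub>R\<^esub> Z1"
    "E2 = Q0 \<otimes>\<^bsub>R\<^esub> (Z1 \<otimes>\<^bsub>R\<^esub> W1) \<oplus>\<^bsub>R\<^esub> Q0 \<otimes>\<^bsub>R\<^esub> (Z0 \<otimes>\<^bsub>R\<^esub> W0) \<otimes>\<^bsub>R\<^esub> \<one>\<^bsub>R\<^esub>"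
  have Dc[simp]: "D1 \<in> carrier R" "D2 \<in> carrier R" "E1 \<in> carrier R" "E2 \<in> carrier R" by (simp_all add: D)
  have "(X0 \<ominus>\<^bsub>R\<^esub> X1) \<otimes>\<^bsub>R\<^esub> (Y1 \<ominus>\<^bsub>R\<^esub> Y0) \<otimes>\<^bsub>R\<^esub> V1 = D1 \<ominus>\<^bsub>R\<^esub> D2"
    by (simp add: D a_minus_def R.r_distr R.l_distr R.l_minus R.r_minus R.m_ac R.a_ac R.minus_add)
  moreover have "Q0 \<otimes>\<^bsub>R\<^esub> ((Z0 \<ominus>\<^bsub>R\<^esub> Z1) \<otimes>\<^bsub>R\<^esub> (W1 \<ominus>\<^bsub>R\<^esub> W0)) = E1 \<ominus>\<^bsub>R\<^esub> E2"
    by (simp add: D a_minus_def R.r_distr R.l_distr R.l_minus R.r_minus R.m_ac R.a_ac R.minus_add)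
  ultimately have "\<Phi> (D1 \<ominus>\<^bsub>R\<^esub> D2) = \<Phi> (E1 \<ominus>\<^bsub>R\<^esub> E2)" using eq by simp
  then have 1: "\<Phi> D1 \<ominus>\<^bsub>S\<^esub> \<Phi> D2 = \<Phi> E1 \<ominus>\<^bsub>S\<^esub> \<Phi> E2"
    by (simp add: lin_map_zero_minus[OF \<Phi>(1) R(1) k_algebra_S])
  note ph = lin_mapD[OF \<Phi>(1)]
  have e1': "Y1 \<otimes>\<^bsub>R\<^esub> V1 = e1 (y \<otimes>\<^bsub>S\<^esub> V)" "X1 \<otimes>\<^bsub>R\<^esub> V1 = e1 (x \<otimes>\<^bsub>S\<^esub> V)" "X1 \<otimes>\<^bsub>R\<^esub> Y1 \<otimes>\<^bsub>R\<^esub> V1 = e1 (x \<otimes>\<^bsub>S\<^esub> y \<otimes>\<^bsub>S\<^esub> V)"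
    "Z1 \<otimes>\<^bsub>R\<^esub> W1 = e1 (z \<otimes>\<^bsub>S\<^esub> w)" "\<one>\<^bsub>R\<^esub> = e1 \<one>\<^bsub>S\<^esub>" by (simp_all add: XY e1)
  have e0': "X0 \<otimes>\<^bsub>R\<^esub> Y0 = e0 (x \<otimes>\<^bsub>S\<^esub> y)" "Q0 \<otimes>\<^bsub>R\<^esub> Z0 = e0 (Q \<otimes>\<^bsub>S\<^esub> z)" "Q0 \<otimes>\<^bsub>R\<^esub> W0 = e0 (Q \<otimes>\<^bsub>S\<^esub> w)"
    "Q0 \<otimes>\<^bsub>R\<^esub> (Z0 \<otimes>\<^bsub>R\<^esub> W0) = e0 (Q \<otimes>\<^bsub>S\<^esub> (z \<otimes>\<^bsub>S\<^esub> w))" "\<one>\<^bsub>R\<^esub> = e0 \<one>\<^bsub>S\<^esub>" by (simp_all add: XY e0)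
  have p1: "\<Phi> D1 = \<psi> (y \<otimes>\<^bsub>S\<^esub> V) \<odot>\<^bsub>S\<^esub> x \<oplus>\<^bsub>S\<^esub> \<psi> (x \<otimes>\<^bsub>S\<^esub> V) \<odot>\<^bsub>S\<^esub> y"
    unfolding D(1) by (subst ph(2), simp, simp, unfold e1', unfold XY) (simp add: \<Phi>(2))
  have p2: "\<Phi> D2 = \<psi> (x \<otimes>\<^bsub>S\<^esub> y \<otimes>\<^bsub>S\<^esub> V) \<odot>\<^bsub>S\<^esub> \<one>\<^bsub>S\<^esub> \<oplus>\<^bsub>S\<^esub> \<psi> V \<odot>\<^bsub>S\<^esub> (x \<otimes>\<^bsub>S\<^esub> y)"
    unfolding D(2) by (subst ph(2), simp, simp, unfold e1'(1-4) e0', unfold XY) (simp add: \<Phi>(2))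
  have p3: "\<Phi> E1 = \<psi> w \<odot>\<^bsub>S\<^esub> (Q \<otimes>\<^bsub>S\<^esub> z) \<oplus>\<^bsub>S\<^esub> \<psi> z \<odot>\<^bsub>S\<^esub> (Q \<otimes>\<^bsub>S\<^esub> w)"
    unfolding D(3) by (subst ph(2), simp, simp, unfold e1'(1-4) e0', unfold XY) (simp add: \<Phi>(2))
  have p4: "\<Phi> E2 = \<psi> (z \<otimes>\<^bsub>S\<^esub> w) \<odot>\<^bsub>S\<^esub> Q \<oplus>\<^bsub>S\<^esub> \<psi> \<one>\<^bsub>S\<^esub> \<odot>\<^bsub>S\<^esub> (Q \<otimes>\<^bsub>S\<^esub> (z \<otimes>\<^bsub>S\<^esub> w))"
    unfolding D(4) by (subst ph(2), simp, simp, unfold e1' e0'(1-4), unfold XY) (simp add: \<Phi>(2))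
  have "\<Phi> D1 \<oplus>\<^bsub>S\<^esub> \<Phi> E2 = \<Phi> D2 \<oplus>\<^bsub>S\<^esub> \<Phi> E1"
  proof -
    have [simp]: "\<Phi> D1 \<in> carrier S" "\<Phi> D2 \<in> carrier S" "\<Phi> E1 \<in> carrier S" "\<Phi> E2 \<in> carrier S"
      by (simp_all add: ph)
    have "\<Phi> D1 = \<Phi> D2 \<oplus>\<^bsub>S\<^esub> (\<Phi> D1 \<ominus>\<^bsub>S\<^esub> \<Phi> D2)" by (simp add: a_minus_def S.a_ac S.r_neg2 S.r_neg)
    also have "\<dots> \<oplus>\<^bsub>S\<^esub> \<Phi> E2 = \<Phi> D2 \<oplus>\<^bsub>S\<^esub> \<Phi> E1"
      unfolding 1 by (simp add: a_minus_def S.a_assoc S.l_neg)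
    finally show ?thesis .
  qed
  then show ?thesis unfolding p1 p2 p3 p4 by (simp add: S.a_assoc)
qed

text \<open>Multiplied by \<open>Y = y \<otimes> 1 + 1 \<otimes> y\<close>, the skew derivation \<open>\<delta>\<close> becomes the inner derivation
  \<open>t \<mapsto> t \<otimes> 1 - 1 \<otimes> t\<close>, because \<open>Y\<close> kills \<open>y \<otimes> 1 - 1 \<otimes> y\<close>; and \<open>Y\<close> kills \<open>\<delta>(\<pi>(a, b))\<close>,
  because \<open>\<pi>(a, b\<^sup>2) = 0\<close>.\<close>

lemma bracket_quadratic:
  assumes ij: "i \<in> I" "j \<in> I" "i \<noteq> j" and a: "a \<in> carrier (A i)" and b: "b \<in> carrier (A j)"
    and sq: "b \<otimes>\<^bsub>A j\<^esub> b = r \<odot>\<^bsub>A j\<^esub> \<one>\<^bsub>A j\<^esub>"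
    and span: "\<And>w. w \<in> carrier (A j) \<Longrightarrow> \<exists>r s. w = r \<odot>\<^bsub>A j\<^esub> \<one>\<^bsub>A j\<^esub> \<oplus>\<^bsub>A j\<^esub> s \<odot>\<^bsub>A j\<^esub> b"
    and \<psi>: "\<psi> \<in> lin_map S base_alg"
    and defs: "y = emb j b" "Q = br i a j b"
  shows "\<psi> \<one>\<^bsub>S\<^esub> \<odot>\<^bsub>S\<^esub> (y \<otimes>\<^bsub>S\<^esub> Q) \<oplus>\<^bsub>S\<^esub> \<psi> y \<odot>\<^bsub>S\<^esub> Q = \<psi> Q \<odot>\<^bsub>S\<^esub> y \<oplus>\<^bsub>S\<^esub> \<psi> (y \<otimes>\<^bsub>S\<^esub> Q) \<odot>\<^bsub>S\<^esub> \<one>\<^bsub>S\<^esub>"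
proof -
  obtain R :: "('k, ((bool \<Rightarrow> (('i \<Rightarrow> 'a) \<Rightarrow>\<^sub>0 'k) set) \<Rightarrow>\<^sub>0 'k) set) module" and e0 e1 \<delta>
    where R: "k_algebra R" "cring R" "e0 \<in> alg_hom S R" "e1 \<in> alg_hom S R"
    and \<Phi>_ex: "\<And>\<psi>. \<psi> \<in> lin_map S base_alg \<Longrightarrow> \<exists>\<Phi>\<in>lin_map R S. \<forall>s\<in>carrier S. \<forall>t\<in>carrier S. \<Phi> (e0 s \<otimes>\<^bsub>R\<^esub> e1 t) = \<psi> t \<odot>\<^bsub>S\<^esub> s"
    and \<delta>: "\<delta> \<in> lin_map T R"
    "\<And>s t. s \<in> carrier T \<Longrightarrow> t \<in> carrier T \<Longrightarrow>
      \<delta> (s \<otimes>\<^bsub>T\<^esub> t) = e0 (abel s) \<otimes>\<^bsub>R\<^esub> \<delta> t \<oplus>\<^bsub>R\<^esub> \<delta> s \<otimes>\<^bsub>R\<^esub> e1 (abel t)"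
    "\<And>i a. i \<in> I \<Longrightarrow> i \<noteq> j \<Longrightarrow> a \<in> carrier (A i) \<Longrightarrow> \<delta> (\<iota> i a) = e0 (emb i a) \<ominus>\<^bsub>R\<^esub> e1 (emb i a)"
    "\<And>a. a \<in> carrier (A j) \<Longrightarrow> \<delta> (\<iota> j a) = \<zero>\<^bsub>R\<^esub>"
    by (rule skew_derivation[OF ij(2)]) (rule that)
  interpret R: k_algebra R by fact
  interpret R: cring R by fact
  interpret Aj: k_algebra "A j" by (rule alg[OF ij(2)])
  obtain \<Phi> where \<Phi>: "\<Phi> \<in> lin_map R S" "\<And>s t. s \<in> carrier S \<Longrightarrow> t \<in> carrier S \<Longrightarrow> \<Phi> (e0 s \<otimes>\<^bsub>R\<^esub> e1 t) = \<psi> t \<odot>\<^bsub>S\<^esub> s"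
    using \<Phi>_ex[OF \<psi>] by blast
  note e0 = lin_mapD[OF alg_hom_lin[OF R(3)]] alg_homD[OF R(3)] lin_map_zero_minus[OF alg_hom_lin[OF R(3)] k_algebra_S R(1)]
  note e1 = lin_mapD[OF alg_hom_lin[OF R(4)]] alg_homD[OF R(4)] lin_map_zero_minus[OF alg_hom_lin[OF R(4)] k_algebra_S R(1)]
  note dl = lin_mapD[OF \<delta>(1)] lin_map_zero_minus[OF \<delta>(1) k_algebra_T R(1)]
  note ej = lin_mapD[OF alg_hom_lin[OF emb_hom[OF ij(2)]]] alg_homD[OF emb_hom[OF ij(2)]]
  have y[simp]: "y \<in> carrier S" using ij b defs by simp
  define Y where "Y = e0 y \<oplus>\<^bsub>R\<^esub> e1 y"
  have Y[simp]: "Y \<in> carrier R" by (simp add: Y_def e0 e1)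
  have yy: "y \<otimes>\<^bsub>S\<^esub> y = r \<odot>\<^bsub>S\<^esub> \<one>\<^bsub>S\<^esub>" using b sq ej(4)[of b b] ej(3)[of "\<one>\<^bsub>A j\<^esub>" r] by (simp add: defs ej(5))
  \<comment> \<open>The product is e0(y^2) - e1(y^2), and y^2 is a scalar, on which e0 and e1
    agree.\<close>
  have Yy: "Y \<otimes>\<^bsub>R\<^esub> (e0 y \<ominus>\<^bsub>R\<^esub> e1 y) = \<zero>\<^bsub>R\<^esub>"
  proof -
    have "Y \<otimes>\<^bsub>R\<^esub> (e0 y \<ominus>\<^bsub>R\<^esub> e1 y) = e0 (y \<otimes>\<^bsub>S\<^esub> y) \<ominus>\<^bsub>R\<^esub> e1 (y \<otimes>\<^bsub>S\<^esub> y)"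
      by (simp add: Y_def e0 e1 a_minus_def R.r_distr R.l_distr R.r_minus R.m_ac R.a_ac R.r_neg2 R.r_neg R.r_neg1)
    then show ?thesis by (simp add: yy e0 e1 a_minus_def R.r_neg)
  qed
  \<comment> \<open>Both sides obey the same twisted Leibniz rule, so letters suffice. On A_j the
    left side is zero by the choice of \<delta>, and the right side is zero because A_j is spanned
    by 1 and b.\<close>
  have key: "Y \<otimes>\<^bsub>R\<^esub> \<delta> t = Y \<otimes>\<^bsub>R\<^esub> (e0 (abel t) \<ominus>\<^bsub>R\<^esub> e1 (abel t))" if "t \<in> carrier T" for t
    using that
  proof (induction t rule: coproduct_induct)
    case (letter l p)
    show ?case
    proof (cases "l = j")
      case True
      obtain s0 s where p: "p = s0 \<odot>\<^bsub>A j\<^esub> \<one>\<^bsub>A j\<^esub> \<oplus>\<^bsub>A j\<^esub> s \<odot>\<^bsub>A j\<^esub> b" using span letter True by blast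
      have "emb j p = s0 \<odot>\<^bsub>S\<^esub> \<one>\<^bsub>S\<^esub> \<oplus>\<^bsub>S\<^esub> s \<odot>\<^bsub>S\<^esub> y" using b by (simp add: p ej defs)
      then have "e0 (emb j p) \<ominus>\<^bsub>R\<^esub> e1 (emb j p) = s \<odot>\<^bsub>R\<^esub> (e0 y \<ominus>\<^bsub>R\<^esub> e1 y)"
        using R.add_eq_imp_minus_eq[of "s0 \<odot>\<^bsub>R\<^esub> \<one>\<^bsub>R\<^esub> \<oplus>\<^bsub>R\<^esub> s \<odot>\<^bsub>R\<^esub> e0 y" "s \<odot>\<^bsub>R\<^esub> e1 y"
            "s0 \<odot>\<^bsub>R\<^esub> \<one>\<^bsub>R\<^esub> \<oplus>\<^bsub>R\<^esub> s \<odot>\<^bsub>R\<^esub> e1 y" "s \<odot>\<^bsub>R\<^esub> e0 y"]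
        by (simp add: e0 e1 R.a_ac) (simp add: e0 e1 a_minus_def R.scale_add_right R.minus_scale mult.commute)
      then have "Y \<otimes>\<^bsub>R\<^esub> (e0 (emb j p) \<ominus>\<^bsub>R\<^esub> e1 (emb j p)) = \<zero>\<^bsub>R\<^esub>"
        using Yy by (simp add: R.smult_mult_right e0 e1)
      then show ?thesis using letter True by (simp add: \<delta> abel)
    next
      case False
      then show ?thesis using letter by (simp add: \<delta> abel)
    qed
  next
    case one
    have "\<delta> \<one>\<^bsub>T\<^esub> = \<zero>\<^bsub>R\<^esub>" using \<delta>(4)[of "\<one>\<^bsub>A j\<^esub>"] alg_homD(2)[OF \<iota>_hom[OF ij(2)]] by simp
    then show ?case by (simp add: abel_simps e0 e1 a_minus_def R.r_neg)
  next
    case (add s t)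
    have "e0 (abel (s \<oplus>\<^bsub>T\<^esub> t)) \<ominus>\<^bsub>R\<^esub> e1 (abel (s \<oplus>\<^bsub>T\<^esub> t)) =
      (e0 (abel s) \<ominus>\<^bsub>R\<^esub> e1 (abel s)) \<oplus>\<^bsub>R\<^esub> (e0 (abel t) \<ominus>\<^bsub>R\<^esub> e1 (abel t))"
      using add(1,2) by (simp add: abel_simps e0 e1 a_minus_def R.minus_add R.a_ac)
    then show ?case using add by (simp add: dl(1,2) abel_simps(1) e0(1) e1(1) R.r_distr)
  next
    case (scale c t)
    have "e0 (abel (c \<odot>\<^bsub>T\<^esub> t)) \<ominus>\<^bsub>R\<^esub> e1 (abel (c \<odot>\<^bsub>T\<^esub> t)) = c \<odot>\<^bsub>R\<^esub> (e0 (abel t) \<ominus>\<^bsub>R\<^esub> e1 (abel t))"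
      using scale(1) by (simp add: abel_simps e0 e1 a_minus_def R.scale_add_right R.minus_scale mult.commute)
    then show ?case using scale by (simp add: dl(1,3) abel_simps(1) e0(1) e1(1) R.smult_mult_right)
  next
    case (mult s t)
    have [simp]: "e0 (abel s) \<in> carrier R" "e0 (abel t) \<in> carrier R" "e1 (abel s) \<in> carrier R" "e1 (abel t) \<in> carrier R"
      "\<delta> s \<in> carrier R" "\<delta> t \<in> carrier R"
      using mult(1,2) by (simp_all add: abel_simps e0 e1 dl)
    have "Y \<otimes>\<^bsub>R\<^esub> \<delta> (s \<otimes>\<^bsub>T\<^esub> t) = e0 (abel s) \<otimes>\<^bsub>R\<^esub> (Y \<otimes>\<^bsub>R\<^esub> \<delta> t) \<oplus>\<^bsub>R\<^esub> (Y \<otimes>\<^bsub>R\<^esub> \<delta> s) \<otimes>\<^bsub>R\<^esub> e1 (abel t)"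
      using mult(1,2) by (simp add: \<delta>(2) R.r_distr R.m_ac)
    also have "\<dots> = Y \<otimes>\<^bsub>R\<^esub> (e0 (abel s) \<otimes>\<^bsub>R\<^esub> e0 (abel t) \<ominus>\<^bsub>R\<^esub> e1 (abel s) \<otimes>\<^bsub>R\<^esub> e1 (abel t))"
      unfolding mult(3,4)
      by (simp add: a_minus_def R.r_distr R.l_distr R.l_minus R.r_minus R.m_ac R.a_ac R.r_neg2 R.r_neg1)
    finally show ?case using mult(1,2) by (simp add: abel_simps e0 e1)
  qed
  define t where "t = \<pi> (\<iota> i a) (\<iota> j b)"
  have ct[simp]: "\<iota> i a \<in> carrier T" "\<iota> j b \<in> carrier T" "t \<in> carrier T"
    using ij a b by (simp_all add: t_def P.closed)
  have "\<iota> j b \<otimes>\<^bsub>T\<^esub> t \<oplus>\<^bsub>T\<^esub> t \<otimes>\<^bsub>T\<^esub> \<iota> j b = \<pi> (\<iota> i a) (\<iota> j b \<otimes>\<^bsub>T\<^esub> \<iota> j b)"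
    by (simp add: P.deriv_right t_def)
  also have "\<iota> j b \<otimes>\<^bsub>T\<^esub> \<iota> j b = r \<odot>\<^bsub>T\<^esub> \<one>\<^bsub>T\<^esub>"
    using alg_homD(1)[OF \<iota>_hom[OF ij(2)] b b] alg_homD(2)[OF \<iota>_hom[OF ij(2)]]
      lin_mapD(3)[OF \<iota>_lin[OF ij(2)], of "\<one>\<^bsub>A j\<^esub>" r] by (simp add: sq)
  also have "\<pi> (\<iota> i a) (r \<odot>\<^bsub>T\<^esub> \<one>\<^bsub>T\<^esub>) = \<zero>\<^bsub>T\<^esub>" by (simp add: P.smult_right P.one_right)
  finally have "\<delta> (\<iota> j b \<otimes>\<^bsub>T\<^esub> t \<oplus>\<^bsub>T\<^esub> t \<otimes>\<^bsub>T\<^esub> \<iota> j b) = \<zero>\<^bsub>R\<^esub>" by (simp add: dl)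
  \<comment> \<open>As \<delta> kills \<open>\<iota> j b\<close>, the Leibniz rule leaves e0(y)
    \<delta>(t) + \<delta>(t) e1(y), which is Y \<delta>(t) because R is commutative.\<close>
  then have "Y \<otimes>\<^bsub>R\<^esub> \<delta> t = \<zero>\<^bsub>R\<^esub>"
    using b ij by (simp add: dl(1,2) \<delta>(2,4) abel_simps(1) abel(2) e0(1) e1(1) Y_def defs(1) R.r_distr R.l_distr R.m_comm)
  moreover have "abel t = Q" by (simp add: t_def defs br_def)
  ultimately have "Y \<otimes>\<^bsub>R\<^esub> (e0 Q \<ominus>\<^bsub>R\<^esub> e1 Q) = \<zero>\<^bsub>R\<^esub>" using key[of t] by simp
  have Q[simp]: "Q \<in> carrier S" using ij a b by (simp add: defs)
  note ph = lin_mapD[OF \<Phi>(1)]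
  let ?l = "e0 (y \<otimes>\<^bsub>S\<^esub> Q) \<otimes>\<^bsub>R\<^esub> e1 \<one>\<^bsub>S\<^esub> \<oplus>\<^bsub>R\<^esub> e0 Q \<otimes>\<^bsub>R\<^esub> e1 y"
  let ?r = "e0 y \<otimes>\<^bsub>R\<^esub> e1 Q \<oplus>\<^bsub>R\<^esub> e0 \<one>\<^bsub>S\<^esub> \<otimes>\<^bsub>R\<^esub> e1 (y \<otimes>\<^bsub>S\<^esub> Q)"
  have "?l \<ominus>\<^bsub>R\<^esub> ?r = Y \<otimes>\<^bsub>R\<^esub> (e0 Q \<ominus>\<^bsub>R\<^esub> e1 Q)"
    by (simp add: Y_def e0 e1 a_minus_def R.r_distr R.l_distr R.r_minus R.m_ac R.a_ac R.minus_add)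
  then have z: "?l \<ominus>\<^bsub>R\<^esub> ?r = \<zero>\<^bsub>R\<^esub>" using \<open>Y \<otimes>\<^bsub>R\<^esub> (e0 Q \<ominus>\<^bsub>R\<^esub> e1 Q) = \<zero>\<^bsub>R\<^esub>\<close> by simp
  have "?l = ?r" by (rule R.minus_eq_zeroD[OF _ _ z]) (simp_all add: e0(1) e1(1))
  then have "\<Phi> ?l = \<Phi> ?r" by simp
  moreover have "\<Phi> ?l = \<psi> \<one>\<^bsub>S\<^esub> \<odot>\<^bsub>S\<^esub> (y \<otimes>\<^bsub>S\<^esub> Q) \<oplus>\<^bsub>S\<^esub> \<psi> y \<odot>\<^bsub>S\<^esub> Q"
    by (subst ph(2)) (simp_all add: \<Phi>(2) e0(1) e1(1))
  moreover have "\<Phi> ?r = \<psi> Q \<odot>\<^bsub>S\<^esub> y \<oplus>\<^bsub>S\<^esub> \<psi> (y \<otimes>\<^bsub>S\<^esub> Q) \<odot>\<^bsub>S\<^esub> \<one>\<^bsub>S\<^esub>"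
    by (subst ph(2)) (simp_all add: \<Phi>(2) e0(1) e1(1))
  ultimately show ?thesis by simp
qed

end

lemma (in abelian_group) minus_add_minus:
  assumes "x \<in> carrier G" "y \<in> carrier G" "z \<in> carrier G"
  shows "(x \<ominus> y) \<oplus> (z \<ominus> x) = z \<ominus> y"
proof -
  have "(x \<ominus> y) \<oplus> (z \<ominus> x) = (x \<ominus> x) \<oplus> (z \<ominus> y)" using assms by (simp add: a_minus_def a_ac)
  also have "x \<ominus> x = \<zero>" using assms(1) by (simp add: a_minus_def r_neg)
  finally show ?thesis using assms by simp
qed

text \<open>The Leibniz rules for commutators, written in the shape of \<open>deriv_right\<close>
  and \<open>deriv_left\<close>, so that brackets and commutators can be compared on
  products.\<close>

lemma (in ring) commutator_mult:
  assumes "u \<in> carrier R" "v \<in> carrier R" "w \<in> carrier R"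
  shows "v \<otimes> (u \<otimes> w \<ominus> w \<otimes> u) \<oplus> (u \<otimes> v \<ominus> v \<otimes> u) \<otimes> w = u \<otimes> (v \<otimes> w) \<ominus> (v \<otimes> w) \<otimes> u"
    "v \<otimes> (w \<otimes> u \<ominus> u \<otimes> w) \<oplus> (v \<otimes> u \<ominus> u \<otimes> v) \<otimes> w = (v \<otimes> w) \<otimes> u \<ominus> u \<otimes> (v \<otimes> w)"
proof -
  have "v \<otimes> (u \<otimes> w \<ominus> w \<otimes> u) = v \<otimes> u \<otimes> w \<ominus> v \<otimes> w \<otimes> u" "(u \<otimes> v \<ominus> v \<otimes> u) \<otimes> w = u \<otimes> (v \<otimes> w) \<ominus> v \<otimes> u \<otimes> w"
    "v \<otimes> (w \<otimes> u \<ominus> u \<otimes> w) = v \<otimes> w \<otimes> u \<ominus> v \<otimes> u \<otimes> w" "(v \<otimes> u \<ominus> u \<otimes> v) \<otimes> w = v \<otimes> u \<otimes> w \<ominus> u \<otimes> (v \<otimes> w)"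
    using assms by (simp_all add: a_minus_def r_distr l_distr l_minus r_minus m_assoc)
  note eqs = this
  show "v \<otimes> (u \<otimes> w \<ominus> w \<otimes> u) \<oplus> (u \<otimes> v \<ominus> v \<otimes> u) \<otimes> w = u \<otimes> (v \<otimes> w) \<ominus> (v \<otimes> w) \<otimes> u"
    unfolding eqs using assms by (intro minus_add_minus) auto
  show "v \<otimes> (w \<otimes> u \<ominus> u \<otimes> w) \<oplus> (v \<otimes> u \<ominus> u \<otimes> v) \<otimes> w = (v \<otimes> w) \<otimes> u \<ominus> u \<otimes> (v \<otimes> w)"
    unfolding eqs using assms minus_add_minus[of "v \<otimes> u \<otimes> w" "u \<otimes> (v \<otimes> w)" "v \<otimes> w \<otimes> u"] by (simp add: a_comm)
qed

section \<open>Filtrations by degree of words\<close>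

text \<open>One notion for T and for each A_i. Integer degrees allow pieces below degree 0, which
  are zero and serve as starting point of inductions.\<close>

definition word_filtration ::
    "('k::field, 'b, 'm) module_scheme \<Rightarrow> 'y set \<Rightarrow> ('y \<Rightarrow> 'b) \<Rightarrow> ('y \<Rightarrow> nat) \<Rightarrow> int \<Rightarrow> 'b set"
  where "word_filtration B Y \<phi> dg n = free_assoc_lift B \<phi> `
    {p \<in> carrier (free_assoc Y). \<forall>w\<in>Poly_Mapping.keys p. int (\<Sum>y\<leftarrow>w. dg y) \<le> n}"

context
  fixes B :: "('k::field, 'b, 'm) module_scheme" (structure) and Y :: "'y set" and \<phi> :: "'y \<Rightarrow> 'b" and dg :: "'y \<Rightarrow> nat"
  assumes B: "k_algebra B" and \<phi>_Pi: "\<phi> \<in> Y \<rightarrow> carrier B"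
begin

lemmas gens_closed = funcset_mem[OF \<phi>_Pi]

interpretation k_algebra B by (rule B)
interpretation F: k_algebra "free_assoc Y :: ('k, 'y list \<Rightarrow>\<^sub>0 'k) module" by (rule k_algebra_free_assoc)

abbreviation (input) "L \<equiv> free_assoc_lift B \<phi>"
abbreviation (input) "fil \<equiv> word_filtration B Y \<phi> dg"

lemma lift_hom: "L \<in> alg_hom (free_assoc Y) B"
  by (rule free_assoc_lift_hom(1)[OF B \<phi>_Pi])

lemmas lift_simps = lin_mapD[OF alg_hom_lin[OF lift_hom], simplified] alg_homD[OF lift_hom, simplified]

lemma word_closed: "set w \<subseteq> Y \<Longrightarrow> word_eval B \<phi> w \<in> carrier B"
  by (induction w) (auto simp: word_eval_def gens_closed)

lemma lift_word: "set w \<subseteq> Y \<Longrightarrow> L (Poly_Mapping.single w c) = c \<odot> word_eval B \<phi> w"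
  using word_closed[of w] by (cases "c = 0") (auto simp: free_assoc_lift_def)

lemma word_in_filtration: "set w \<subseteq> Y \<Longrightarrow> int (\<Sum>y\<leftarrow>w. dg y) \<le> n \<Longrightarrow> word_eval B \<phi> w \<in> fil n"
  unfolding word_filtration_def
  by (rule image_eqI[of _ _ "Poly_Mapping.single w 1"])
     (use word_closed in \<open>auto simp: lift_word free_assoc_carrier\<close>)

lemma filtration_submod: "submodule (fil n) field_ring B"
proof (rule submodI)
  show "fil n \<subseteq> carrier B" unfolding word_filtration_def using lift_simps(1) by auto
  have "L 0 = \<zero>" by (simp add: free_assoc_lift_def)
  then show "\<zero> \<in> fil n" unfolding word_filtration_def
    by (intro image_eqI[of _ _ 0]) (auto simp: free_assoc_carrier)
  show "a \<oplus> b \<in> fil n" if ab: "a \<in> fil n" "b \<in> fil n" for a b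
  proof -
    obtain p q where pq: "a = L p" "p \<in> carrier (free_assoc Y)" "\<forall>w\<in>Poly_Mapping.keys p. int (\<Sum>y\<leftarrow>w. dg y) \<le> n"
      "b = L q" "q \<in> carrier (free_assoc Y)" "\<forall>w\<in>Poly_Mapping.keys q. int (\<Sum>y\<leftarrow>w. dg y) \<le> n"
      using ab unfolding word_filtration_def by blast
    then show ?thesis
      unfolding word_filtration_def
      by (intro image_eqI[of _ _ "p + q"])
         (use F.add.m_closed[of p q] in \<open>auto simp: lift_simps dest!: subsetD[OF Poly_Mapping.keys_add]\<close>)
  qed
  show "c \<odot> a \<in> fil n" if a: "a \<in> fil n" for c a
  proof -
    obtain p where p: "a = L p" "p \<in> carrier (free_assoc Y)" "\<forall>w\<in>Poly_Mapping.keys p. int (\<Sum>y\<leftarrow>w. dg y) \<le> n"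
      using a unfolding word_filtration_def by blast
    then show ?thesis
      unfolding word_filtration_def
      by (intro image_eqI[of _ _ "scale_poly c p"])
         (use F.scale_closed[of p c] in \<open>auto simp: lift_simps dest!: subsetD[OF keys_scale_poly]\<close>)
  qed
qed

text \<open>Pieces are spanned by evaluated words, so the inclusion of a piece in a submodule is
  checked on words.\<close>

lemma filtration_least:
  assumes W: "submodule W field_ring B"
    and words: "\<And>w. set w \<subseteq> Y \<Longrightarrow> int (\<Sum>y\<leftarrow>w. dg y) \<le> n \<Longrightarrow> word_eval B \<phi> w \<in> W"
  shows "fil n \<subseteq> W"
proof
  note W' = submodD[OF W]
  let ?Z = "{w. set w \<subseteq> Y \<and> int (\<Sum>y\<leftarrow>w. dg y) \<le> n}"
  fix a assume "a \<in> fil n"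
  then obtain p where p: "a = L p" "Poly_Mapping.keys p \<subseteq> ?Z"
    unfolding word_filtration_def by (auto simp: free_assoc_carrier)
  have "L p \<in> W"
    using p(2)
  proof (induction p rule: poly_mapping_induct_on)
    case zero
    then show ?case using W' by (simp add: free_assoc_lift_def)
  next
    case (single w c)
    then show ?case using words[of w] W' by (simp add: lift_word)
  next
    case (add p q)
    have "p \<in> carrier (free_assoc Y)" "q \<in> carrier (free_assoc Y)" using add by (auto simp: free_assoc_carrier)
    then show ?case using add W' by (simp add: lift_simps)
  qed
  then show "a \<in> W" using p by simp
qed

lemma filtration_mono: "m \<le> n \<Longrightarrow> fil m \<subseteq> fil n"
  by (rule filtration_least[OF filtration_submod]) (auto intro: word_in_filtration)

lemma filtration_neg: "n < 0 \<Longrightarrow> fil n \<subseteq> {\<zero>}"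
  by (rule filtration_least) (auto intro: submodI)

lemma filtration_mult:
  assumes "a \<in> fil m" "b \<in> fil n"
  shows "a \<otimes> b \<in> fil (m + n)"
proof -
  obtain p q where pq: "a = L p" "p \<in> carrier (free_assoc Y)" "\<forall>w\<in>Poly_Mapping.keys p. int (\<Sum>y\<leftarrow>w. dg y) \<le> m"
    "b = L q" "q \<in> carrier (free_assoc Y)" "\<forall>w\<in>Poly_Mapping.keys q. int (\<Sum>y\<leftarrow>w. dg y) \<le> n"
    using assms unfolding word_filtration_def by blast
  have "\<forall>w\<in>Poly_Mapping.keys (p * q). int (\<Sum>y\<leftarrow>w. dg y) \<le> m + n"
  proof
    fix w assume "w \<in> Poly_Mapping.keys (p * q)"
    then obtain u v where "w = u + v" "u \<in> Poly_Mapping.keys p" "v \<in> Poly_Mapping.keys q"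
      using keys_mult[of p q] by auto
    then show "int (\<Sum>y\<leftarrow>w. dg y) \<le> m + n" using pq(3,6) by (force simp: plus_list_def)
  qed
  then show ?thesis
    unfolding word_filtration_def
    by (intro image_eqI[of _ _ "p * q"]) (use pq F.m_closed[of p q] in \<open>auto simp: lift_simps\<close>)
qed

lemma filtration_exhaust:
  assumes "a \<in> L ` carrier (free_assoc Y)"
  shows "\<exists>n. a \<in> fil (int n)"
proof -
  obtain p where p: "a = L p" "p \<in> carrier (free_assoc Y)" using assms by blast
  \<comment> \<open>A crude bound: the degrees of all words of p added up.\<close>
  define n where "n = (\<Sum>w\<in>Poly_Mapping.keys p. \<Sum>y\<leftarrow>w. dg y)"
  have "(\<Sum>y\<leftarrow>w. dg y) \<le> n" if "w \<in> Poly_Mapping.keys p" for w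
    unfolding n_def by (rule member_le_sum[of w "Poly_Mapping.keys p" "\<lambda>w. \<Sum>y\<leftarrow>w. dg y"]) (use that in auto)
  then have "a \<in> fil (int n)" unfolding word_filtration_def using p by auto
  then show ?thesis by blast
qed

end

section \<open>Ordered products\<close>

text \<open>The head of each list precedes all other elements, and by asymmetry only one element can
  do so.\<close>

lemma sorted_wrt_unique:
  assumes "asymp P" "sorted_wrt P xs" "sorted_wrt P ys" "set xs = set ys"
  shows "xs = ys"
  using assms(2-4)
proof (induction xs arbitrary: ys)
  case (Cons x xs)
  obtain y ys' where ys: "ys = y # ys'" using Cons.prems by (cases ys) auto
  have irr: "\<not> P z z" for z using assms(1) by (auto dest: asympD)
  have "x = y"
  proof (rule ccontr)
    assume "x \<noteq> y"
    then have "P x y" "P y x" using Cons.prems ys by auto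
    then show False using assms(1) by (auto dest: asympD)
  qed
  moreover have "x \<notin> set xs" "y \<notin> set ys'" using Cons.prems ys irr by auto
  ultimately have "set xs = set ys'" using Cons.prems ys by auto
  then show ?case using Cons ys \<open>x = y\<close> by simp
qed simp

lemma sorted_wrt_exists:
  assumes r: "strict_linear_order_on I r" and F: "finite F" "F \<subseteq> I"
  shows "\<exists>xs. sorted_wrt (\<lambda>i j. (i, j) \<in> r) xs \<and> set xs = F"
  using F
proof (induction F)
  case (insert x F)
  then obtain xs where xs: "sorted_wrt (\<lambda>i j. (i, j) \<in> r) xs" "set xs = F" by auto
  \<comment> \<open>Insertion of x: totality puts every old element on one side of it, and filtering
    keeps both sides increasing.\<close>
  let ?ys = "filter (\<lambda>z. (z, x) \<in> r) xs @ x # filter (\<lambda>z. (x, z) \<in> r) xs"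
  have tr: "trans r" and tot: "total_on I r" using r by (auto simp: strict_linear_order_on_def)
  have "sorted_wrt (\<lambda>i j. (i, j) \<in> r) ?ys"
    using xs(1) tr by (auto simp: sorted_wrt_append sorted_wrt_filter dest: transD)
  moreover have "set ?ys = insert x F"
    using insert xs(2) tot by (auto simp: total_on_def)
  ultimately show ?case by blast
qed simp

locale ordered_splay = splay I A \<pi>
  for I :: "'i set" and A :: "'i \<Rightarrow> ('k::field, 'a, 'm) module_scheme" and \<pi> +
  fixes ltI :: "'i rel"
  assumes index_order: "strict_linear_order_on I ltI"
begin

definition sorted :: "'i list \<Rightarrow> bool"
  where "sorted xs \<longleftrightarrow> sorted_wrt (\<lambda>i j. (i, j) \<in> ltI) xs \<and> set xs \<subseteq> I"

definition supp :: "('i \<Rightarrow> 'a) \<Rightarrow> 'i set" where "supp a = {l\<in>I. a l \<noteq> \<one>\<^bsub>A l\<^esub>}"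

definition ordered_prod :: "'i list \<Rightarrow> ('i \<Rightarrow> 'a) \<Rightarrow> (('i \<times> 'a) list \<Rightarrow>\<^sub>0 'k) set"
  where "ordered_prod xs a = foldr (\<lambda>l t. \<iota> l (a l) \<otimes>\<^bsub>T\<^esub> t) xs \<one>\<^bsub>T\<^esub>"

lemma lt_asym: "asymp (\<lambda>i j. (i, j) \<in> ltI)"
  using index_order by (auto simp: strict_linear_order_on_def irrefl_def intro!: asympI dest: transD)

lemma sorted_exists: "finite F \<Longrightarrow> F \<subseteq> I \<Longrightarrow> \<exists>xs. sorted xs \<and> set xs = F"
  using sorted_wrt_exists[OF index_order, of F] by (auto simp: sorted_def)

lemma sorted_distinct: "sorted xs \<Longrightarrow> distinct xs"
proof (induction xs)
  case (Cons x xs)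
  then show ?case using lt_asym by (auto simp: sorted_def dest: asympD)
qed simp

lemma ordered_prod_closed [simp]: "a \<in> fam \<Longrightarrow> set xs \<subseteq> I \<Longrightarrow> ordered_prod xs a \<in> carrier T"
  by (induction xs) (auto simp: ordered_prod_def fam_carrier)

lemma ordered_prod_Nil [simp]: "ordered_prod [] a = \<one>\<^bsub>T\<^esub>"
  by (simp add: ordered_prod_def)

lemma ordered_prod_Cons [simp]: "ordered_prod (l # xs) a = \<iota> l (a l) \<otimes>\<^bsub>T\<^esub> ordered_prod xs a"
  by (simp add: ordered_prod_def)

lemma ordered_prod_append:
  "a \<in> fam \<Longrightarrow> set xs \<subseteq> I \<Longrightarrow> set ys \<subseteq> I \<Longrightarrow>
    ordered_prod (xs @ ys) a = ordered_prod xs a \<otimes>\<^bsub>T\<^esub> ordered_prod ys a"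
  by (induction xs) (auto simp: T.m_assoc fam_carrier)

lemma ordered_prod_cong: "(\<And>l. l \<in> set xs \<Longrightarrow> a l = b l) \<Longrightarrow> ordered_prod xs a = ordered_prod xs b"
  by (induction xs) auto

lemma ordered_prod_filter:
  "a \<in> fam \<Longrightarrow> set xs \<subseteq> I \<Longrightarrow> ordered_prod (filter (\<lambda>l. l \<in> supp a) xs) a = ordered_prod xs a"
  by (induction xs) (auto simp: supp_def alg_homD(2)[OF \<iota>_hom])

text \<open>The increasing enumeration of the finite support is unique, so the choice is
  harmless.\<close>

definition pure_prod :: "('i \<Rightarrow> 'a) \<Rightarrow> (('i \<times> 'a) list \<Rightarrow>\<^sub>0 'k) set"
  where "pure_prod a = ordered_prod (SOME xs. sorted xs \<and> set xs = supp a) a"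

text \<open>A unit at an extra index contributes the factor 1. Thus families with different supports
  can be multiplied out along one common list.\<close>

lemma pure_prod_eq:
  assumes a: "a \<in> fam" and xs: "sorted xs" "supp a \<subseteq> set xs"
  shows "pure_prod a = ordered_prod xs a"
proof -
  have "finite (supp a)" "supp a \<subseteq> I" using a by (auto simp: tensor_families_def supp_def)
  then have "\<exists>ys. sorted ys \<and> set ys = supp a" by (rule sorted_exists)
  then have s: "sorted (SOME ys. sorted ys \<and> set ys = supp a) \<and> set (SOME ys. sorted ys \<and> set ys = supp a) = supp a"
    by (rule someI_ex)
  have "(SOME ys. sorted ys \<and> set ys = supp a) = filter (\<lambda>l. l \<in> supp a) xs"
    by (rule sorted_wrt_unique[OF lt_asym]) (use s xs in \<open>auto simp: sorted_def sorted_wrt_filter\<close>)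
  then show ?thesis using ordered_prod_filter[OF a] xs by (simp add: pure_prod_def sorted_def)
qed

text \<open>Gives k a place in the list even if the entry at k is 1. Changing that entry then
  changes a single factor, and multilinearity of \<open>pure_prod\<close> becomes distributivity in
  T.\<close>

lemma sorted_split:
  assumes a: "a \<in> fam" and k: "k \<in> I"
  obtains xs ys where "sorted (xs @ k # ys)" "k \<notin> set xs" "k \<notin> set ys" "supp a \<subseteq> set (xs @ k # ys)"
proof -
  have "finite (insert k (supp a))" "insert k (supp a) \<subseteq> I" using a k by (auto simp: tensor_families_def supp_def)
  then obtain zs where zs: "sorted zs" "set zs = insert k (supp a)" using sorted_exists by blast
  then obtain xs ys where "zs = xs @ k # ys" using split_list[of k zs] by blast
  then show ?thesis using that[of xs ys] zs sorted_distinct[OF zs(1)] by auto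
qed

lemma pure_prod_upd:
  assumes a: "a \<in> fam" and k: "k \<in> I" and s: "sorted (xs @ k # ys)" "k \<notin> set xs" "k \<notin> set ys"
    "supp a \<subseteq> set (xs @ k # ys)" and u: "u \<in> carrier (A k)"
  shows "pure_prod (a(k := u)) = ordered_prod xs a \<otimes>\<^bsub>T\<^esub> (\<iota> k u \<otimes>\<^bsub>T\<^esub> ordered_prod ys a)"
proof -
  have "supp (a(k := u)) \<subseteq> set (xs @ k # ys)" using s(4) by (auto simp: supp_def)
  then have "pure_prod (a(k := u)) = ordered_prod (xs @ k # ys) (a(k := u))"
    by (intro pure_prod_eq fam_upd a k u s)
  also have "\<dots> = ordered_prod xs (a(k := u)) \<otimes>\<^bsub>T\<^esub> ordered_prod (k # ys) (a(k := u))"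
    using s(1) by (intro ordered_prod_append fam_upd a k u) (auto simp: sorted_def)
  also have "ordered_prod xs (a(k := u)) = ordered_prod xs a"
    using s by (intro ordered_prod_cong) auto
  also have "ordered_prod (k # ys) (a(k := u)) = \<iota> k u \<otimes>\<^bsub>T\<^esub> ordered_prod ys (a(k := u))" by simp
  also have "ordered_prod ys (a(k := u)) = ordered_prod ys a"
    using s by (intro ordered_prod_cong) auto
  finally show ?thesis .
qed

definition "ord = (SOME h. h \<in> lin_map S T \<and> (\<forall>a\<in>fam. h (pure a) = pure_prod a))"

lemma ord: "ord \<in> lin_map S T" "\<And>a. a \<in> fam \<Longrightarrow> ord (pure a) = pure_prod a"
proof -
  have cl: "pure_prod a \<in> carrier T" if a: "a \<in> fam" for a
  proof -
    have "finite (supp a)" "supp a \<subseteq> I" using a by (auto simp: tensor_families_def supp_def)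
    then obtain xs where "sorted xs" "set xs = supp a" using sorted_exists by blast
    then show ?thesis using pure_prod_eq[OF a, of xs] a by (simp add: sorted_def)
  qed
  obtain h where "h \<in> lin_map S T" "\<And>a. a \<in> fam \<Longrightarrow> h (pure a) = pure_prod a"
  proof (rule tensor_lift[OF k_algebra_T cl], assumption, goal_cases)
    case (1 a k u v)
    obtain xs ys where s: "sorted (xs @ k # ys)" "k \<notin> set xs" "k \<notin> set ys" "supp a \<subseteq> set (xs @ k # ys)"
      by (rule sorted_split[OF 1(2,3)])
    have "set xs \<subseteq> I" "set ys \<subseteq> I" using s(1) by (auto simp: sorted_def)
    then show ?case
      using 1(2-5) lin_mapD(2)[OF \<iota>_lin[OF 1(3)] 1(4,5)]
      by (simp add: pure_prod_upd[OF 1(2,3) s] alg_closed T.l_distr T.r_distr)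
  next
    case (2 a k c u)
    obtain xs ys where s: "sorted (xs @ k # ys)" "k \<notin> set xs" "k \<notin> set ys" "supp a \<subseteq> set (xs @ k # ys)"
      by (rule sorted_split[OF 2(2,3)])
    have "set xs \<subseteq> I" "set ys \<subseteq> I" using s(1) by (auto simp: sorted_def)
    then show ?case
      using 2(2-4) lin_mapD(3)[OF \<iota>_lin[OF 2(3)] 2(4)]
      by (simp add: pure_prod_upd[OF 2(2,3) s] alg_closed T.smult_mult_left T.smult_mult_right)
  qed blast
  then have "\<exists>h. h \<in> lin_map S T \<and> (\<forall>a\<in>fam. h (pure a) = pure_prod a)" by blast
  from someI_ex[OF this] show "ord \<in> lin_map S T" "\<And>a. a \<in> fam \<Longrightarrow> ord (pure a) = pure_prod a"
    unfolding ord_def by auto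
qed

lemma abel_ordered_prod:
  assumes a: "a \<in> fam" and xs: "distinct xs" "set xs \<subseteq> I"
  shows "abel (ordered_prod xs a) = pure (\<lambda>l\<in>I. if l \<in> set xs then a l else \<one>\<^bsub>A l\<^esub>)"
  using xs
proof (induction xs)
  case Nil
  then show ?case using pure_one by (simp add: abel_simps fam_one_def restrict_def)
next
  case (Cons k xs)
  define b where "b = (\<lambda>l\<in>I. if l \<in> set xs then a l else \<one>\<^bsub>A l\<^esub>)"
  have k: "k \<in> I" "k \<notin> set xs" "set xs \<subseteq> I" using Cons by auto
  have "{l \<in> I. b l \<noteq> \<one>\<^bsub>A l\<^esub>} \<subseteq> set xs" by (auto simp: b_def)
  then have "finite {l \<in> I. b l \<noteq> \<one>\<^bsub>A l\<^esub>}" by (rule finite_subset) simp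
  then have b: "b \<in> fam" using fam_carrier[OF a] by (auto simp: tensor_families_def alg_closed b_def)
  have "abel (ordered_prod (k # xs) a) = emb k (a k) \<otimes>\<^bsub>S\<^esub> pure b"
    using Cons.IH[folded b_def] k a Cons.prems by (simp add: abel_simps abel fam_carrier)
  also have "\<dots> = pure (fam_mult (fam_one(k := a k)) b)"
    unfolding emb_def using a b k by (intro pure_mult fam_upd fam_one fam_carrier)
  also have "fam_mult (fam_one(k := a k)) b = (\<lambda>l\<in>I. if l \<in> set (k # xs) then a l else \<one>\<^bsub>A l\<^esub>)"
  proof
    fix l
    have "\<one>\<^bsub>A l\<^esub> \<otimes>\<^bsub>A l\<^esub> u = u" "u \<otimes>\<^bsub>A l\<^esub> \<one>\<^bsub>A l\<^esub> = u" if "l \<in> I" "u \<in> carrier (A l)" for u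
      using that ring.ring_simprules(12)[OF ring_A] Group.monoid.r_one[OF ring.is_monoid[OF ring_A]] by auto
    then show "fam_mult (fam_one(k := a k)) b l = (\<lambda>l\<in>I. if l \<in> set (k # xs) then a l else \<one>\<^bsub>A l\<^esub>) l"
      using k fam_carrier[OF a] by (auto simp: fam_mult_def fam_one_def alg_closed b_def)
  qed
  finally show ?case .
qed

lemma abel_pure_prod:
  assumes a: "a \<in> fam"
  shows "abel (pure_prod a) = pure a"
proof -
  have "finite (supp a)" "supp a \<subseteq> I" using a by (auto simp: tensor_families_def supp_def)
  then obtain xs where xs: "sorted xs" "set xs = supp a" using sorted_exists by blast
  have "(\<lambda>l\<in>I. if l \<in> set xs then a l else \<one>\<^bsub>A l\<^esub>) = a"
    using a xs(2) by (auto simp: supp_def tensor_families_def PiE_iff extensional_def)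
  moreover have "pure_prod a = ordered_prod xs a" by (rule pure_prod_eq[OF a xs(1)]) (simp add: xs)
  ultimately show ?thesis
    using abel_ordered_prod[OF a sorted_distinct[OF xs(1)]] xs(1) by (simp add: sorted_def)
qed

section \<open>The quotient T / J: retractions onto S and homomorphisms that kill J\<close>

abbreviation "J \<equiv> bracket_ideal T \<pi>"

lemma J_ideal: "ideal J T"
  unfolding bracket_ideal_def by (rule T.genideal_ideal) (auto simp: P.closed)

lemma J_submod: "submodule J field_ring T"
  by (rule T.ideal_submod[OF J_ideal])

lemma J_gen: "a \<in> carrier T \<Longrightarrow> b \<in> carrier T \<Longrightarrow> a \<otimes>\<^bsub>T\<^esub> b \<ominus>\<^bsub>T\<^esub> b \<otimes>\<^bsub>T\<^esub> a \<ominus>\<^bsub>T\<^esub> \<pi> a b \<in> J"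
  unfolding bracket_ideal_def by (rule subsetD[OF T.genideal_self]) (auto simp: P.closed)

text \<open>\<tau> after \<open>ord\<close> is the identity on pure tensors, hence on S. By the
  first hypothesis u and \<open>ord (\<tau> u)\<close> have the same class modulo J, so the map
  induced by \<tau> is inverted by the class of \<open>ord\<close>.\<close>

theorem iso_of_retraction:
  assumes gen: "\<And>t. t \<in> carrier T \<Longrightarrow> \<exists>s\<in>carrier S. \<exists>z\<in>J. t = ord s \<oplus>\<^bsub>T\<^esub> z"
    and \<tau>: "\<tau> \<in> lin_map T S" "\<And>z. z \<in> J \<Longrightarrow> \<tau> z = \<zero>\<^bsub>S\<^esub>" "\<And>a. a \<in> fam \<Longrightarrow> \<tau> (pure_prod a) = pure a"
  shows "k_module_iso (quot_alg T J) S"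
proof -
  note Jc = T.submodD(1)[OF J_submod]
  note t = lin_mapD[OF \<tau>(1)] and o = lin_mapD[OF ord(1)]
  note qc = quot_alg_carrier[OF k_algebra_T J_ideal]
  interpret J: ideal J T by (rule J_ideal)
  have tp: "\<tau> (ord (pure a)) = pure a" if "a \<in> fam" for a using that by (simp add: ord(2) \<tau>(3))
  have id: "\<tau> (ord s) = s" if "s \<in> carrier S" for s
    using that by (induction s rule: S_induct) (simp_all add: o t tp)
  obtain h where h: "h \<in> lin_map (quot_alg T J) S" "\<And>t. t \<in> carrier T \<Longrightarrow> h (J +>\<^bsub>T\<^esub> t) = \<tau> t"
    using lin_map_quot[OF k_algebra_T J_ideal k_algebra_S \<tau>(1,2)] by blast
  have "inj_on h (carrier (quot_alg T J))"
  proof (rule inj_onI)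
    fix x y assume xy: "x \<in> carrier (quot_alg T J)" "y \<in> carrier (quot_alg T J)" "h x = h y"
    obtain u v where uv: "x = J +>\<^bsub>T\<^esub> u" "u \<in> carrier T" "y = J +>\<^bsub>T\<^esub> v" "v \<in> carrier T" using xy by (auto simp: qc)
    have "J +>\<^bsub>T\<^esub> u = J +>\<^bsub>T\<^esub> ord (\<tau> u)" if u: "u \<in> carrier T" for u
    proof -
      obtain s z where s: "s \<in> carrier S" "z \<in> J" "u = ord s \<oplus>\<^bsub>T\<^esub> z" using gen[OF u] by blast
      then have "\<tau> u = s" using Jc[OF s(2)] by (simp add: t o id \<tau>(2))
      moreover have "u = z \<oplus>\<^bsub>T\<^esub> ord s" using s Jc[OF s(2)] o(1) by (simp add: T.a_comm)
      then have "u \<in> J +>\<^bsub>T\<^esub> ord s" using s(2) unfolding a_r_coset_def' by blast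
      ultimately show ?thesis using J.a_repr_independence'[of u "ord s"] o(1) s(1) by simp
    qed
    then show "x = y" using uv xy(3) h(2) by simp
  qed
  moreover have "h ` carrier (quot_alg T J) = carrier S"
  proof
    show "h ` carrier (quot_alg T J) \<subseteq> carrier S" using lin_mapD(1)[OF h(1)] by blast
    show "carrier S \<subseteq> h ` carrier (quot_alg T J)"
    proof
      fix s assume "s \<in> carrier S"
      then have "s = h (J +>\<^bsub>T\<^esub> ord s)" "J +>\<^bsub>T\<^esub> ord s \<in> carrier (quot_alg T J)" by (simp_all add: h(2) o(1) id qc)
      then show "s \<in> h ` carrier (quot_alg T J)" by blast
    qed
  qed
  ultimately have "bij_betw h (carrier (quot_alg T J)) (carrier S)" by (rule bij_betw_imageI)
  then show ?thesis
    unfolding k_module_iso_def by (intro exI[of _ h] conjI ballI allI lin_mapD(2,3)[OF h(1)])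
qed

text \<open>Along h, bracket and commutator obey the same Leibniz rules, so agreement on pairs of
  letters spreads to T one variable at a time. Then h kills the generators of J, and its kernel is
  an ideal.\<close>

lemma bracket_hom:
  fixes B :: "('k, 'b, 'n) module_scheme"
  assumes B: "k_algebra B" and h: "h \<in> alg_hom T B"
    and letters: "\<And>i a j b. i \<in> I \<Longrightarrow> a \<in> carrier (A i) \<Longrightarrow> j \<in> I \<Longrightarrow> b \<in> carrier (A j) \<Longrightarrow>
      h (\<pi> (\<iota> i a) (\<iota> j b)) = h (\<iota> i a) \<otimes>\<^bsub>B\<^esub> h (\<iota> j b) \<ominus>\<^bsub>B\<^esub> h (\<iota> j b) \<otimes>\<^bsub>B\<^esub> h (\<iota> i a)"
    and z: "z \<in> J"
  shows "h z = \<zero>\<^bsub>B\<^esub>"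
proof -
  interpret B: k_algebra B by fact
  note hs = lin_mapD[OF alg_hom_lin[OF h]] alg_homD[OF h] lin_map_zero_minus[OF alg_hom_lin[OF h] k_algebra_T B]
  let ?c = "\<lambda>s t. h s \<otimes>\<^bsub>B\<^esub> h t \<ominus>\<^bsub>B\<^esub> h t \<otimes>\<^bsub>B\<^esub> h s"
  have 1: "h (\<pi> (\<iota> i a) t) = ?c (\<iota> i a) t" if ia: "i \<in> I" "a \<in> carrier (A i)" and t: "t \<in> carrier T" for i a t
    using t
  proof (induction t rule: coproduct_induct)
    case (letter j b)
    then show ?case using letters ia by blast
  next
    case one
    then show ?case using ia by (simp add: P.one_right hs a_minus_def B.r_neg)
  next
    case (add s t)
    then show ?case using ia by (simp add: P.add_right hs P.closed a_minus_def B.l_distr B.r_distr B.minus_add B.a_ac)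
  next
    case (scale c t)
    then show ?case using ia by (simp add: P.smult_right hs P.closed a_minus_def B.smult_mult_left B.smult_mult_right B.scale_add_right B.minus_scale mult.commute)
  next
    case (mult s t)
    then show ?case using ia hs(1)[of "\<iota> i a"] hs(1)[of s] hs(1)[of t]
      by (simp add: P.deriv_right hs(2-5) P.closed B.commutator_mult)
  qed
  have 2: "h (\<pi> s t) = ?c s t" if s: "s \<in> carrier T" and t: "t \<in> carrier T" for s t
    using s
  proof (induction s rule: coproduct_induct)
    case (letter j b)
    then show ?case using 1 t by blast
  next
    case one
    then show ?case using t by (simp add: P.one_left hs a_minus_def B.r_neg)
  next
    case (add r s)
    then show ?case using t by (simp add: P.add_left hs P.closed a_minus_def B.l_distr B.r_distr B.minus_add B.a_ac)
  next
    case (scale c s)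
    then show ?case using t by (simp add: P.smult_left hs P.closed a_minus_def B.smult_mult_left B.smult_mult_right B.scale_add_right B.minus_scale mult.commute)
  next
    case (mult r s)
    then show ?case using t hs(1)[of t] hs(1)[of r] hs(1)[of s]
      by (simp add: P.deriv_left hs(2-5) P.closed B.commutator_mult)
  qed
  have hr: "h \<in> ring_hom T B" using h by (simp add: alg_hom_def)
  interpret h: ring_hom_ring T B h by (rule ring_hom_ringI2[OF T.ring_axioms B.ring_axioms hr])
  have "J \<subseteq> a_kernel T B h"
    unfolding bracket_ideal_def
  proof (rule T.genideal_minimal[OF h.kernel_is_ideal], clarify)
    fix s t assume st: "s \<in> carrier T" "t \<in> carrier T"
    have "h (s \<otimes>\<^bsub>T\<^esub> t \<ominus>\<^bsub>T\<^esub> t \<otimes>\<^bsub>T\<^esub> s \<ominus>\<^bsub>T\<^esub> \<pi> s t) = ?c s t \<ominus>\<^bsub>B\<^esub> ?c s t"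
      using st by (simp add: hs(1-5,7) P.closed 2)
    also have "\<dots> = \<zero>\<^bsub>B\<^esub>" using st by (simp add: a_minus_def B.r_neg hs(1))
    finally have "h (s \<otimes>\<^bsub>T\<^esub> t \<ominus>\<^bsub>T\<^esub> t \<otimes>\<^bsub>T\<^esub> s \<ominus>\<^bsub>T\<^esub> \<pi> s t) = \<zero>\<^bsub>B\<^esub>" .
    moreover have "s \<otimes>\<^bsub>T\<^esub> t \<ominus>\<^bsub>T\<^esub> t \<otimes>\<^bsub>T\<^esub> s \<ominus>\<^bsub>T\<^esub> \<pi> s t \<in> carrier T"
      by (intro T.minus_closed T.m_closed P.closed st)
    ultimately show "s \<otimes>\<^bsub>T\<^esub> t \<ominus>\<^bsub>T\<^esub> t \<otimes>\<^bsub>T\<^esub> s \<ominus>\<^bsub>T\<^esub> \<pi> s t \<in> a_kernel T B h"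
      unfolding a_kernel_def' by blast
  qed
  then show ?thesis using z unfolding a_kernel_def' by blast
qed

end

section \<open>Splays with generators and degrees\<close>

locale filtered_splay = ordered_splay I A \<pi> ltI
  for I :: "'i set" and A :: "'i \<Rightarrow> ('k::field, 'a, 'm) module_scheme" and \<pi> and ltI +
  fixes X :: "'i \<Rightarrow> 'x set" and d :: "'i \<Rightarrow> 'x \<Rightarrow> nat" and g :: "'i \<Rightarrow> 'x \<Rightarrow> 'a"
  assumes gen_closed: "\<And>i x. i \<in> I \<Longrightarrow> x \<in> X i \<Longrightarrow> g i x \<in> carrier (A i)"
    and generated: "\<And>i. i \<in> I \<Longrightarrow> carrier (A i) \<subseteq> free_assoc_lift (A i) (g i) ` carrier (free_assoc (X i))"
    and filtered: "strongly_filtered (word_filtration T (SIGMA i:I. X i) (\<lambda>(i, x). \<iota> i (g i x)) (\<lambda>(i, x). d i x)) \<pi>"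
begin

abbreviation "Y \<equiv> (SIGMA i:I. X i)"
abbreviation "G \<equiv> (\<lambda>(i, x). \<iota> i (g i x))"
abbreviation "dg \<equiv> (\<lambda>(i, x). d i x)"
abbreviation "FT \<equiv> word_filtration T Y G dg"
abbreviation "FA i \<equiv> word_filtration (A i) (X i) (g i) (d i)"
abbreviation "deg w \<equiv> (\<Sum>y\<leftarrow>w. dg y)"

lemma G_closed: "G \<in> Y \<rightarrow> carrier T"
  by (auto simp: gen_closed)

lemma gen_Pi: "i \<in> I \<Longrightarrow> g i \<in> X i \<rightarrow> carrier (A i)"
  by (auto simp: gen_closed)

lemmas FT_submod = filtration_submod[where Y = Y and \<phi> = G and dg = dg, OF k_algebra_T G_closed]
lemmas FT_simps = T.submodD[OF FT_submod]
lemmas FT_mono = filtration_mono[where Y = Y and \<phi> = G and dg = dg, OF k_algebra_T G_closed]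
lemmas FT_mult = filtration_mult[where Y = Y and \<phi> = G and dg = dg, OF k_algebra_T G_closed]
lemmas FT_word = word_in_filtration[where Y = Y and \<phi> = G and dg = dg, OF k_algebra_T G_closed]
lemmas FT_least = filtration_least[where Y = Y and \<phi> = G and dg = dg, OF k_algebra_T G_closed]
lemmas word_T_closed = word_closed[where Y = Y and \<phi> = G, OF k_algebra_T G_closed]

definition part :: "'i \<Rightarrow> ('i \<times> 'x) list \<Rightarrow> 'x list"
  where "part l w = map snd (filter (\<lambda>y. fst y = l) w)"

text \<open>Collects the letters of w by index. The pure tensor of this family is the image of w in
  S, and its ordered product in T is the normal form of w.\<close>

definition wfam :: "('i \<times> 'x) list \<Rightarrow> 'i \<Rightarrow> 'a"
  where "wfam w = (\<lambda>l\<in>I. word_eval (A l) (g l) (part l w))"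

definition deg_at :: "'i \<Rightarrow> ('i \<times> 'x) list \<Rightarrow> nat"
  where "deg_at l w = (\<Sum>x\<leftarrow>part l w. d l x)"

lemma part_set: "set w \<subseteq> Y \<Longrightarrow> set (part l w) \<subseteq> X l"
  by (auto simp: part_def)

lemma wfam_closed: "set w \<subseteq> Y \<Longrightarrow> l \<in> I \<Longrightarrow> wfam w l \<in> carrier (A l)"
  unfolding wfam_def using word_closed[OF alg gen_Pi part_set] by simp

lemma wfam_filtration: "set w \<subseteq> Y \<Longrightarrow> l \<in> I \<Longrightarrow> wfam w l \<in> FA l (int (deg_at l w))"
  unfolding wfam_def deg_at_def using word_in_filtration[OF alg gen_Pi part_set] by simp

lemma wfam_Nil: "wfam [] = fam_one"
  by (auto simp: wfam_def part_def fam_one_def word_eval_def)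

lemma wfam_Cons: "i \<in> I \<Longrightarrow> wfam ((i, x) # w) = (wfam w)(i := g i x \<otimes>\<^bsub>A i\<^esub> wfam w i)"
  by (auto simp: wfam_def part_def word_eval_def fun_eq_iff)

lemma wfam_fam: "set w \<subseteq> Y \<Longrightarrow> wfam w \<in> fam"
proof (induction w)
  case (Cons y w)
  obtain i x where y: "y = (i, x)" by fastforce
  have ix: "i \<in> I" "x \<in> X i" "set w \<subseteq> Y" using Cons y by auto
  have "(wfam w)(i := g i x \<otimes>\<^bsub>A i\<^esub> wfam w i) \<in> fam"
    using Cons.IH ix by (intro fam_upd alg_closed gen_closed wfam_closed)
  then show ?case by (simp only: y wfam_Cons[OF ix(1)])
qed (simp add: wfam_Nil fam_one)

text \<open>An inequality only: letters whose index lies outside F are not counted on the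
  left.\<close>

lemma deg_at_sum: "finite F \<Longrightarrow> (\<Sum>l\<in>F. deg_at l w) \<le> deg w"
proof (induction w)
  case (Cons y w)
  obtain i x where y: "y = (i, x)" by fastforce
  have "(\<Sum>l\<in>F. deg_at l (y # w)) = (\<Sum>l\<in>F. (if l = i then d i x else 0) + deg_at l w)"
    by (intro sum.cong) (auto simp: deg_at_def part_def y)
  also have "\<dots> \<le> d i x + (\<Sum>l\<in>F. deg_at l w)" using Cons(2) by (simp add: sum.distrib)
  finally show ?case using Cons by (simp add: y)
qed (simp add: deg_at_def part_def)

lemma abel_word: "set w \<subseteq> Y \<Longrightarrow> abel (word_eval T G w) = pure (wfam w)"
proof (induction w)
  case Nil
  then show ?case by (simp add: word_eval_def abel_simps wfam_Nil pure_one)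
next
  case (Cons y w)
  obtain i x where y: "y = (i, x)" by fastforce
  have ix: "i \<in> I" "x \<in> X i" "set w \<subseteq> Y" using Cons y by auto
  have "abel (word_eval T G (y # w)) = emb i (g i x) \<otimes>\<^bsub>S\<^esub> pure (wfam w)"
    using Cons ix word_T_closed[OF ix(3)] by (simp add: y word_eval_def abel_simps abel gen_closed)
  also have "\<dots> = pure (fam_mult (wfam w) (fam_one(i := g i x)))"
    unfolding emb_def using ix by (simp add: pure_mult fam_upd fam_one gen_closed wfam_fam fam_mult_comm)
  also have "fam_mult (wfam w) (fam_one(i := g i x)) = (fam_mult (wfam w) fam_one)(i := wfam w i \<otimes>\<^bsub>A i\<^esub> g i x)"
    by (rule fam_mult_upd[OF ix(1)])
  also have "fam_mult (wfam w) fam_one = wfam w"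
    using fam_mult_one[OF wfam_fam[OF ix(3)]] fam_mult_comm[OF wfam_fam[OF ix(3)] fam_one] by simp
  also have "wfam w i \<otimes>\<^bsub>A i\<^esub> g i x = g i x \<otimes>\<^bsub>A i\<^esub> wfam w i"
    using ix by (intro comm wfam_closed gen_closed)
  finally show ?case using ix by (simp add: y wfam_Cons)
qed

text \<open>A word in the generators of A_i maps to the word in the indexed letters, which has the
  same degree.\<close>

lemma \<iota>_filtration:
  assumes i: "i \<in> I" and a: "a \<in> FA i n"
  shows "\<iota> i a \<in> FT n"
proof -
  interpret Ai: k_algebra "A i" by (rule alg[OF i])
  note l = lin_mapD[OF \<iota>_lin[OF i]] alg_homD[OF \<iota>_hom[OF i]]
    lin_map_zero_minus[OF \<iota>_lin[OF i] alg[OF i] k_algebra_T]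
  let ?W = "{a \<in> carrier (A i). \<iota> i a \<in> FT n}"
  have "FA i n \<subseteq> ?W"
  proof (rule filtration_least[OF alg[OF i] gen_Pi[OF i]])
    show "submodule ?W field_ring (A i)" by (rule Ai.submodI) (auto simp: l FT_simps)
    fix w assume w: "set w \<subseteq> X i" "int (\<Sum>y\<leftarrow>w. d i y) \<le> n"
    have "\<iota> i (word_eval (A i) (g i) w) = word_eval T G (map (Pair i) w)"
      using w(1) by (induction w) (auto simp: word_eval_def l gen_closed[OF i] word_closed[OF alg[OF i] gen_Pi[OF i], unfolded word_eval_def])
    moreover have "word_eval T G (map (Pair i) w) \<in> FT n"
      by (rule FT_word) (use w i in \<open>auto simp: o_def\<close>)
    ultimately show "word_eval (A i) (g i) w \<in> ?W"
      using word_closed[OF alg[OF i] gen_Pi[OF i] w(1)] by simp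
  qed
  then show ?thesis using a by blast
qed

section \<open>Commutation modulo J and lower degrees\<close>

lemma bracket_filtered:
  assumes "s \<in> FT (int m)" "t \<in> FT (int n)"
  shows "\<pi> s t \<in> FT (int m + int n - 1)"
  using filtered assms unfolding strongly_filtered_def by blast

lemma one_FT: "n \<ge> 0 \<Longrightarrow> \<one>\<^bsub>T\<^esub> \<in> FT n"
  using FT_word[of "[]" n] by (simp add: word_eval_def)

lemma ordered_prod_filtration:
  "set w \<subseteq> Y \<Longrightarrow> set xs \<subseteq> I \<Longrightarrow> ordered_prod xs (wfam w) \<in> FT (int (\<Sum>l\<leftarrow>xs. deg_at l w))"
proof (induction xs)
  case (Cons l xs)
  then have "\<iota> l (wfam w l) \<otimes>\<^bsub>T\<^esub> ordered_prod xs (wfam w) \<in> FT (int (deg_at l w) + int (\<Sum>l\<leftarrow>xs. deg_at l w))"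
    by (intro FT_mult \<iota>_filtration wfam_filtration) auto
  then show ?case by simp
qed (simp add: one_FT)

text \<open>Elements of A_i have finite degree because the generators generate. Sums are placed in
  the larger of two degrees, and products add degrees.\<close>

lemma filtration_exists:
  assumes "t \<in> carrier T"
  shows "\<exists>n. t \<in> FT (int n)"
  using assms
proof (induction t rule: coproduct_induct)
  case (letter i a)
  have "\<exists>n. a \<in> FA i (int n)"
    by (rule filtration_exhaust[OF alg gen_Pi]) (use letter generated in auto)
  then show ?case using \<iota>_filtration letter by blast
next
  case one
  have "\<one>\<^bsub>T\<^esub> \<in> FT (int 0)" by (rule one_FT) simp
  then show ?case by blast
next
  case (add s t)
  then obtain m n where mn: "s \<in> FT (int m)" "t \<in> FT (int n)" by blast
  have "FT (int m) \<subseteq> FT (int (max m n))" "FT (int n) \<subseteq> FT (int (max m n))" by (rule FT_mono; simp)+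
  then have "s \<oplus>\<^bsub>T\<^esub> t \<in> FT (int (max m n))" using mn FT_simps(3) by blast
  then show ?case by blast
next
  case (scale c t)
  then show ?case using FT_simps(4) by blast
next
  case (mult s t)
  then obtain m n where "s \<in> FT (int m)" "t \<in> FT (int n)" by blast
  then have "s \<otimes>\<^bsub>T\<^esub> t \<in> FT (int (m + n))" using FT_mult[of s "int m" t "int n"] by simp
  then show ?case by blast
qed

definition H :: "int \<Rightarrow> _ set"
  where "H n = {z \<oplus>\<^bsub>T\<^esub> t | z t. z \<in> J \<and> t \<in> FT n}"

lemmas J_simps = T.submodD[OF J_submod]

lemma H_submod: "submodule (H n) field_ring T"
proof (rule T.submodI)
  show "H n \<subseteq> carrier T" using J_simps(1) FT_simps(1) unfolding H_def by blast
  show "\<zero>\<^bsub>T\<^esub> \<in> H n" unfolding H_def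
    using J_simps(2) FT_simps(2)[of n] T.l_zero[OF T.zero_closed] by blast
  show "a \<oplus>\<^bsub>T\<^esub> b \<in> H n" if ab: "a \<in> H n" "b \<in> H n" for a b
  proof -
    obtain z t z' t' where *: "a = z \<oplus>\<^bsub>T\<^esub> t" "z \<in> J" "t \<in> FT n" "b = z' \<oplus>\<^bsub>T\<^esub> t'" "z' \<in> J" "t' \<in> FT n"
      using ab unfolding H_def by blast
    then have "z \<in> carrier T" "t \<in> carrier T" "z' \<in> carrier T" "t' \<in> carrier T"
      using J_simps(1) FT_simps(1) by blast+
    then have "a \<oplus>\<^bsub>T\<^esub> b = (z \<oplus>\<^bsub>T\<^esub> z') \<oplus>\<^bsub>T\<^esub> (t \<oplus>\<^bsub>T\<^esub> t')" using * by (simp add: T.a_ac)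
    then show ?thesis using * J_simps(3) FT_simps(3) unfolding H_def by blast
  qed
  show "c \<odot>\<^bsub>T\<^esub> a \<in> H n" if a: "a \<in> H n" for c a
  proof -
    obtain z t where *: "a = z \<oplus>\<^bsub>T\<^esub> t" "z \<in> J" "t \<in> FT n" using a unfolding H_def by blast
    then have "z \<in> carrier T" "t \<in> carrier T" using J_simps(1) FT_simps(1) by blast+
    then have "c \<odot>\<^bsub>T\<^esub> a = c \<odot>\<^bsub>T\<^esub> z \<oplus>\<^bsub>T\<^esub> c \<odot>\<^bsub>T\<^esub> t" using * by (simp add: T.scale_add_right)
    then show ?thesis using * J_simps(4) FT_simps(4) unfolding H_def by blast
  qed
qed

lemmas H_simps = T.submodD[OF H_submod]

lemma H_mono: "m \<le> n \<Longrightarrow> H m \<subseteq> H n"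
  unfolding H_def using FT_mono[of m n] by blast

lemma H_mult:
  assumes s: "s \<in> FT m"
  shows "t \<in> H n \<Longrightarrow> s \<otimes>\<^bsub>T\<^esub> t \<in> H (m + n)" "t \<in> H n \<Longrightarrow> t \<otimes>\<^bsub>T\<^esub> s \<in> H (n + m)"
proof -
  interpret J: ideal J T by (rule J_ideal)
  have sc: "s \<in> carrier T" using FT_simps(1)[OF s] .
  assume "t \<in> H n"
  then obtain z u where *: "t = z \<oplus>\<^bsub>T\<^esub> u" "z \<in> J" "u \<in> FT n" unfolding H_def by blast
  then have c: "z \<in> carrier T" "u \<in> carrier T" using J_simps(1) FT_simps(1) by blast+
  have "s \<otimes>\<^bsub>T\<^esub> z \<in> J" "z \<otimes>\<^bsub>T\<^esub> s \<in> J" using J.I_l_closed J.I_r_closed * sc by blast+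
  moreover have "s \<otimes>\<^bsub>T\<^esub> u \<in> FT (m + n)" "u \<otimes>\<^bsub>T\<^esub> s \<in> FT (n + m)" using FT_mult s * by blast+
  moreover have "s \<otimes>\<^bsub>T\<^esub> t = s \<otimes>\<^bsub>T\<^esub> z \<oplus>\<^bsub>T\<^esub> s \<otimes>\<^bsub>T\<^esub> u" "t \<otimes>\<^bsub>T\<^esub> s = z \<otimes>\<^bsub>T\<^esub> s \<oplus>\<^bsub>T\<^esub> u \<otimes>\<^bsub>T\<^esub> s"
    using * c sc by (simp_all add: T.r_distr T.l_distr)
  ultimately show "s \<otimes>\<^bsub>T\<^esub> t \<in> H (m + n)" "t \<otimes>\<^bsub>T\<^esub> s \<in> H (n + m)" unfolding H_def by blast+
qed

text \<open>The commutator is a generator of J plus the bracket, and strong filtration places the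
  bracket one degree below the product.\<close>

lemma commute_mod_H:
  assumes s: "s \<in> FT (int m)" and t: "t \<in> FT (int n)"
  shows "s \<otimes>\<^bsub>T\<^esub> t \<ominus>\<^bsub>T\<^esub> t \<otimes>\<^bsub>T\<^esub> s \<in> H (int m + int n - 1)"
proof -
  have c: "s \<in> carrier T" "t \<in> carrier T" using s t FT_simps(1) by blast+
  have "s \<otimes>\<^bsub>T\<^esub> t \<ominus>\<^bsub>T\<^esub> t \<otimes>\<^bsub>T\<^esub> s = (s \<otimes>\<^bsub>T\<^esub> t \<ominus>\<^bsub>T\<^esub> t \<otimes>\<^bsub>T\<^esub> s \<ominus>\<^bsub>T\<^esub> \<pi> s t) \<oplus>\<^bsub>T\<^esub> \<pi> s t"
    using c P.closed[OF c] by (simp add: a_minus_def T.a_assoc T.l_neg)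
  also have "\<dots> \<in> H (int m + int n - 1)"
    unfolding H_def using J_gen[OF c] bracket_filtered[OF s t] by blast
  finally show ?thesis .
qed

text \<open>Modulo \<open>J\<close> and lower degrees the first letter of a word commutes with everything in front of
  its place in the ordered product.\<close>

lemma word_normal_form:
  "set w \<subseteq> Y \<Longrightarrow> word_eval T G w \<ominus>\<^bsub>T\<^esub> pure_prod (wfam w) \<in> H (int (deg w) - 1)"
proof (induction w)
  case Nil
  have "pure_prod fam_one = \<one>\<^bsub>T\<^esub>"
    using pure_prod_eq[OF fam_one, of "[]"] by (auto simp: sorted_def supp_def fam_one_def)
  then show ?case using H_simps(2) by (simp add: word_eval_def wfam_Nil a_minus_def T.r_neg)
next
  case (Cons y w)
  obtain i x where y: "y = (i, x)" by fastforce
  have ix: "i \<in> I" "x \<in> X i" "set w \<subseteq> Y" using Cons y by auto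
  note wf = wfam_fam[OF ix(3)]
  obtain xs ys where s: "sorted (xs @ i # ys)" "i \<notin> set xs" "i \<notin> set ys" "supp (wfam w) \<subseteq> set (xs @ i # ys)"
    by (rule sorted_split[OF wf ix(1)])
  have sI: "set xs \<subseteq> I" "set ys \<subseteq> I" using s(1) by (auto simp: sorted_def)
  define c where "c = wfam w i"
  have cc: "c \<in> carrier (A i)" "g i x \<in> carrier (A i)" using wfam_closed ix gen_closed by (auto simp: c_def)
  \<comment> \<open>The normal form of w is t1 t2 with index i opening t2; the new letter u belongs
    between the two.\<close>
  define t1 t2 u where t: "t1 = ordered_prod xs (wfam w)" "t2 = \<iota> i c \<otimes>\<^bsub>T\<^esub> ordered_prod ys (wfam w)" "u = \<iota> i (g i x)"
  have "(wfam w)(i := c) = wfam w" by (simp add: c_def)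
  then have pw: "pure_prod (wfam w) = t1 \<otimes>\<^bsub>T\<^esub> t2"
    using pure_prod_upd[OF wf ix(1) s cc(1)] by (simp add: t)
  have pyw: "pure_prod (wfam (y # w)) = t1 \<otimes>\<^bsub>T\<^esub> (u \<otimes>\<^bsub>T\<^esub> t2)"
    using pure_prod_upd[OF wf ix(1) s alg_closed(3)[OF ix(1) cc(2,1)]] cc ix(1) wf sI alg_homD(1)[OF \<iota>_hom[OF ix(1)] cc(2,1)]
    by (simp add: y wfam_Cons c_def[symmetric] t T.m_assoc)
  define e1 e2 where e: "e1 = (\<Sum>l\<leftarrow>xs. deg_at l w)" "e2 = deg_at i w + (\<Sum>l\<leftarrow>ys. deg_at l w)"
  have t1: "t1 \<in> FT (int e1)" unfolding t e using ordered_prod_filtration[OF ix(3) sI(1)] .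
  have t2: "t2 \<in> FT (int e2)" unfolding t e of_nat_add c_def
    by (intro FT_mult \<iota>_filtration wfam_filtration ordered_prod_filtration ix sI)
  have "word_eval (A i) (g i) [x] \<in> FA i (int (d i x))"
    using ix by (intro word_in_filtration[OF alg gen_Pi]) auto
  moreover have "word_eval (A i) (g i) [x] = g i x"
    using Group.monoid.r_one[OF ring.is_monoid[OF ring_A[OF ix(1)]] cc(2)] by (simp add: word_eval_def)
  ultimately have u: "u \<in> FT (int (d i x))" unfolding t using \<iota>_filtration[OF ix(1)] by simp
  have cT: "t1 \<in> carrier T" "t2 \<in> carrier T" "u \<in> carrier T" using t1 t2 u FT_simps(1) by blast+
  have wT: "word_eval T G w \<in> carrier T" by (rule word_T_closed[OF ix(3)])
  have "distinct (xs @ i # ys)" by (rule sorted_distinct[OF s(1)])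
  then have "(\<Sum>l\<leftarrow>xs @ i # ys. deg_at l w) = (\<Sum>l\<in>set (xs @ i # ys). deg_at l w)"
    by (rule sum_list_distinct_conv_sum_set)
  then have "e1 + e2 = (\<Sum>l\<in>set (xs @ i # ys). deg_at l w)" by (simp add: e)
  then have le: "e1 + e2 \<le> deg w" using deg_at_sum[of "set (xs @ i # ys)" w] by simp
  have "u \<otimes>\<^bsub>T\<^esub> (word_eval T G w \<ominus>\<^bsub>T\<^esub> t1 \<otimes>\<^bsub>T\<^esub> t2) \<in> H (int (d i x) + (int (deg w) - 1))"
    using H_mult(1)[OF u] Cons.IH[OF ix(3)] pw by simp
  moreover have "(u \<otimes>\<^bsub>T\<^esub> t1 \<ominus>\<^bsub>T\<^esub> t1 \<otimes>\<^bsub>T\<^esub> u) \<otimes>\<^bsub>T\<^esub> t2 \<in> H (int (d i x) + int e1 - 1 + int e2)"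
    by (rule H_mult(2)[OF t2 commute_mod_H[OF u t1]])
  moreover have "H (int (d i x) + int e1 - 1 + int e2) \<subseteq> H (int (d i x) + (int (deg w) - 1))"
    using le by (intro H_mono) linarith
  \<comment> \<open>The difference of u w and t1 u t2 is [u, t1] t2 + u (w - t1 t2). The first
    summand loses a degree by commutation, the second by induction.\<close>
  ultimately have "(u \<otimes>\<^bsub>T\<^esub> t1 \<ominus>\<^bsub>T\<^esub> t1 \<otimes>\<^bsub>T\<^esub> u) \<otimes>\<^bsub>T\<^esub> t2 \<oplus>\<^bsub>T\<^esub> u \<otimes>\<^bsub>T\<^esub> (word_eval T G w \<ominus>\<^bsub>T\<^esub> t1 \<otimes>\<^bsub>T\<^esub> t2)
      \<in> H (int (d i x) + (int (deg w) - 1))"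
    by (intro H_simps(3)) auto
  also have "(u \<otimes>\<^bsub>T\<^esub> t1 \<ominus>\<^bsub>T\<^esub> t1 \<otimes>\<^bsub>T\<^esub> u) \<otimes>\<^bsub>T\<^esub> t2 \<oplus>\<^bsub>T\<^esub> u \<otimes>\<^bsub>T\<^esub> (word_eval T G w \<ominus>\<^bsub>T\<^esub> t1 \<otimes>\<^bsub>T\<^esub> t2)
      = u \<otimes>\<^bsub>T\<^esub> word_eval T G w \<ominus>\<^bsub>T\<^esub> t1 \<otimes>\<^bsub>T\<^esub> (u \<otimes>\<^bsub>T\<^esub> t2)"
    using T.minus_add_minus[of "u \<otimes>\<^bsub>T\<^esub> t1 \<otimes>\<^bsub>T\<^esub> t2" "t1 \<otimes>\<^bsub>T\<^esub> (u \<otimes>\<^bsub>T\<^esub> t2)" "u \<otimes>\<^bsub>T\<^esub> word_eval T G w"] cT wT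
    by (simp add: a_minus_def T.l_distr T.r_distr T.l_minus T.r_minus T.m_assoc)
  also have "u \<otimes>\<^bsub>T\<^esub> word_eval T G w = word_eval T G (y # w)" by (simp add: word_eval_def y t)
  finally show ?case unfolding pyw by (simp add: y algebra_simps)
qed

lemma generated_mod_J:
  assumes "t \<in> carrier T"
  shows "\<exists>s\<in>carrier S. \<exists>z\<in>J. t = ord s \<oplus>\<^bsub>T\<^esub> z"
proof -
  define W where "W = {ord s \<oplus>\<^bsub>T\<^esub> z | s z. s \<in> carrier S \<and> z \<in> J}"
  note o = lin_mapD[OF ord(1)]
  have W: "submodule W field_ring T"
  proof (rule T.submodI)
    show "W \<subseteq> carrier T" using o(1) J_simps(1) unfolding W_def by blast
    have "\<zero>\<^bsub>T\<^esub> = ord \<zero>\<^bsub>S\<^esub> \<oplus>\<^bsub>T\<^esub> \<zero>\<^bsub>T\<^esub>" by (simp add: lin_map_zero_minus[OF ord(1) k_algebra_S k_algebra_T])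
    then show "\<zero>\<^bsub>T\<^esub> \<in> W" unfolding W_def using J_simps(2) by blast
    show "a \<oplus>\<^bsub>T\<^esub> b \<in> W" if ab: "a \<in> W" "b \<in> W" for a b
    proof -
      obtain s z s' z' where *: "a = ord s \<oplus>\<^bsub>T\<^esub> z" "b = ord s' \<oplus>\<^bsub>T\<^esub> z'" "s \<in> carrier S" "s' \<in> carrier S" "z \<in> J" "z' \<in> J"
        using ab unfolding W_def by blast
      then have "a \<oplus>\<^bsub>T\<^esub> b = ord (s \<oplus>\<^bsub>S\<^esub> s') \<oplus>\<^bsub>T\<^esub> (z \<oplus>\<^bsub>T\<^esub> z')"
        using J_simps(1)[of z] J_simps(1)[of z'] by (simp add: o T.a_ac)
      then show ?thesis unfolding W_def using * J_simps(3) by blast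
    qed
    show "c \<odot>\<^bsub>T\<^esub> a \<in> W" if a: "a \<in> W" for c a
    proof -
      obtain s z where *: "a = ord s \<oplus>\<^bsub>T\<^esub> z" "s \<in> carrier S" "z \<in> J" using a unfolding W_def by blast
      then have "c \<odot>\<^bsub>T\<^esub> a = ord (c \<odot>\<^bsub>S\<^esub> s) \<oplus>\<^bsub>T\<^esub> c \<odot>\<^bsub>T\<^esub> z"
        using J_simps(1)[of z] by (simp add: o T.scale_add_right)
      then show ?thesis unfolding W_def using * J_simps(4) S.scale_closed by blast
    qed
  qed
  note W' = T.submodD[OF W]
  have JW: "J \<subseteq> W"
  proof
    fix z assume z: "z \<in> J"
    have "z = ord \<zero>\<^bsub>S\<^esub> \<oplus>\<^bsub>T\<^esub> z" using J_simps(1)[OF z] by (simp add: lin_map_zero_minus[OF ord(1) k_algebra_S k_algebra_T])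
    then show "z \<in> W" unfolding W_def using z by blast
  qed
  \<comment> \<open>The shift by one starts the induction at the piece of degree -1, which is
    zero.\<close>
  have FW: "FT (int n - 1) \<subseteq> W" for n
  proof (induction n)
    case 0
    have "FT (int 0 - 1) \<subseteq> {\<zero>\<^bsub>T\<^esub>}" by (rule filtration_neg[where Y = Y and \<phi> = G and dg = dg, OF k_algebra_T G_closed]) simp_all
    then show ?case using W'(2) by blast
  next
    case (Suc n)
    have "FT (int n) \<subseteq> W"
    proof (rule FT_least[OF W])
      fix w assume w: "set w \<subseteq> Y" "int (deg w) \<le> int n"
      have "H (int (deg w) - 1) \<subseteq> H (int n - 1)" using w by (intro H_mono) simp
      then have h: "word_eval T G w \<ominus>\<^bsub>T\<^esub> pure_prod (wfam w) \<in> H (int n - 1)" using word_normal_form[OF w(1)] by blast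
      have "H (int n - 1) \<subseteq> W" using JW Suc W'(3) unfolding H_def by blast
      then have h: "word_eval T G w \<ominus>\<^bsub>T\<^esub> pure_prod (wfam w) \<in> W" using h by blast
      have p: "pure_prod (wfam w) \<in> carrier T" using ord(2)[OF wfam_fam[OF w(1)]] o(1)[OF pure_closed[OF wfam_fam[OF w(1)]]] by simp
      have "pure_prod (wfam w) = ord (pure (wfam w)) \<oplus>\<^bsub>T\<^esub> \<zero>\<^bsub>T\<^esub>" using p by (simp add: ord(2) wfam_fam w)
      then have "pure_prod (wfam w) \<in> W" unfolding W_def using J_simps(2) pure_closed[OF wfam_fam[OF w(1)]] by blast
      then have "(word_eval T G w \<ominus>\<^bsub>T\<^esub> pure_prod (wfam w)) \<oplus>\<^bsub>T\<^esub> pure_prod (wfam w) \<in> W" using h W'(3) by blast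
      then show "word_eval T G w \<in> W" using p word_T_closed[OF w(1)] by (simp add: a_minus_def T.a_assoc T.l_neg)
    qed
    then show ?case by simp
  qed
  obtain n where "t \<in> FT (int n)" using filtration_exists[OF assms] by blast
  then have "t \<in> W" using FW[of "Suc n"] by auto
  then show ?thesis unfolding W_def by blast
qed

end

section \<open>Nonzero brackets in the abelianization\<close>

text \<open>Subtracts two equations that share a term on either side; two instances of
  \<open>bracket_star\<close> are compared in this way.\<close>

lemma diff_eq_diffI:
  fixes a :: "'b::ab_group_add"
  assumes "a + b = c + d" "a + b' = c + d'"
  shows "b - d = b' - d'"
proof -
  have "b - d = c - a" "b' - d' = c - a" using assms by (simp_all add: algebra_simps)
  then show ?thesis by simp
qed

lemma scaled_bilinear_eq:
  fixes a :: "'b::comm_ring"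
  assumes "a * (c * b) - d * (c * e) = a' * (c * b') - d' * (c * e')"
  shows "c * (e' * d' + b * a) = c * (b' * a' + e * d)"
  using assms by (simp add: algebra_simps)

context k_algebra
begin

lemma scalars_submod: "submodule {r \<odot> \<one> | r. True} field_ring A"
proof (rule submodI)
  have "\<zero> = 0 \<odot> \<one>" by simp
  then show "\<zero> \<in> {r \<odot> \<one> | r. True}" by blast
qed (auto simp flip: scale_add_left)

lemma span_submod:
  assumes x: "x \<in> carrier A" and W: "submodule W field_ring A"
  shows "submodule {w \<oplus> s \<odot> x | w s. w \<in> W} field_ring A"
proof (rule submodI)
  note W' = submodD[OF W]
  show "{w \<oplus> s \<odot> x | w s. w \<in> W} \<subseteq> carrier A" using W'(1) x by auto
  have "\<zero> = \<zero> \<oplus> 0 \<odot> x" using x by simp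
  then show "\<zero> \<in> {w \<oplus> s \<odot> x | w s. w \<in> W}" using W'(2) by blast
  show "a \<oplus> b \<in> {w \<oplus> s \<odot> x | w s. w \<in> W}"
    if ab: "a \<in> {w \<oplus> s \<odot> x | w s. w \<in> W}" "b \<in> {w \<oplus> s \<odot> x | w s. w \<in> W}" for a b
  proof -
    obtain v r w s where *: "a = v \<oplus> r \<odot> x" "v \<in> W" "b = w \<oplus> s \<odot> x" "w \<in> W" using ab by blast
    have "a \<oplus> b = (v \<oplus> w) \<oplus> (r + s) \<odot> x" using * x W'(1)[of v] W'(1)[of w] by (simp add: scale_add_left a_ac)
    then show ?thesis using W'(3) * by blast
  qed
  show "c \<odot> a \<in> {w \<oplus> s \<odot> x | w s. w \<in> W}" if a: "a \<in> {w \<oplus> s \<odot> x | w s. w \<in> W}" for c a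
  proof -
    obtain v r where *: "a = v \<oplus> r \<odot> x" "v \<in> W" using a by blast
    have "c \<odot> a = c \<odot> v \<oplus> (c * r) \<odot> x" using * x W'(1)[of v] by (simp add: scale_add_right)
    then show ?thesis using W'(4) * by blast
  qed
qed

lemma separating_functional:
  assumes "x \<in> carrier A" "\<And>r. x \<noteq> r \<odot> \<one>"
  obtains f where "f \<in> lin_map A base_alg" "f \<one> = 0" "f x = 1"
proof -
  obtain f where f: "f \<in> lin_map A base_alg" "\<And>w. w \<in> {r \<odot> \<one> | r. True} \<Longrightarrow> f w = 0" "f x = 1"
    by (rule functional_exists[OF scalars_submod, of x]) (use assms in auto)
  have "\<one> = 1 \<odot> \<one>" by simp
  then have "f \<one> = 0" by (intro f(2)) blast
  then show thesis using f that by blast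
qed

lemma unit_functional:
  assumes "\<one> \<noteq> \<zero>"
  obtains f where "f \<in> lin_map A base_alg" "f \<one> = 1"
proof -
  have "submodule {\<zero>} field_ring A" by (rule submodI) auto
  then show thesis by (rule functional_exists[of _ \<one>]) (use assms that in auto)
qed

text \<open>The hypothesis is x \<otimes> w + w \<otimes> x = 1 \<otimes> xw + xw \<otimes> 1,
  tested against h \<otimes> f. Let \<alpha>(1) = 0 and \<alpha>(x) = 1. With f = h = \<alpha> and w
  = x it reads 2 = 0. If x^2 were not a scalar, f with f(1) = 0, f(x^2) = 1 and h with h(1) = 1
  would give 1 = 2 h(x) f(x) = 0. If w were outside the span of 1 and x, f vanishing on that span
  with f(w) = 1 and h = \<alpha> would give 1 = 0.\<close>

lemma two_dimensional:
  assumes x: "x \<in> carrier A" "\<And>r. x \<noteq> r \<odot> \<one>"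
    and bilinear: "\<forall>w\<in>carrier A. \<forall>f\<in>lin_map A base_alg. \<forall>h\<in>lin_map A base_alg.
      h x * f w + h w * f x = h \<one> * f (x \<otimes> w) + h (x \<otimes> w) * f \<one>"
  shows "(2 :: 'k) = 0" "\<exists>r. x \<otimes> x = r \<odot> \<one>" "\<And>w. w \<in> carrier A \<Longrightarrow> \<exists>r s. w = r \<odot> \<one> \<oplus> s \<odot> x"
proof -
  have Q: "h x * f w + h w * f x = h \<one> * f (x \<otimes> w) + h (x \<otimes> w) * f \<one>"
    if "w \<in> carrier A" "f \<in> lin_map A base_alg" "h \<in> lin_map A base_alg" for w f h
    using bilinear that by blast
  obtain \<alpha> where \<alpha>: "\<alpha> \<in> lin_map A base_alg" "\<alpha> \<one> = 0" "\<alpha> x = 1" by (rule separating_functional[OF x])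
  show 2: "(2 :: 'k) = 0" using Q[OF x(1) \<alpha>(1) \<alpha>(1)] \<alpha> by simp
  have "\<one> \<noteq> \<zero>"
  proof
    assume "\<one> = \<zero>"
    then have "x = 0 \<odot> \<one>" using l_one[OF x(1)] x(1) by simp
    then show False using x(2) by blast
  qed
  then obtain \<epsilon> where \<epsilon>: "\<epsilon> \<in> lin_map A base_alg" "\<epsilon> \<one> = 1" by (rule unit_functional)
  show "\<exists>r. x \<otimes> x = r \<odot> \<one>"
  proof (rule ccontr)
    assume "\<not> ?thesis"
    then obtain f where f: "f \<in> lin_map A base_alg" "f \<one> = 0" "f (x \<otimes> x) = 1"
      using separating_functional[of "x \<otimes> x"] x(1) by auto
    have "\<epsilon> x * f x + \<epsilon> x * f x = 1" using Q[OF x(1) f(1) \<epsilon>(1)] f \<epsilon> by simp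
    moreover have "\<epsilon> x * f x + \<epsilon> x * f x = 2 * (\<epsilon> x * f x)" by simp
    ultimately show False using 2 by simp
  qed
  show "\<exists>r s. w = r \<odot> \<one> \<oplus> s \<odot> x" if w: "w \<in> carrier A" for w
  proof (rule ccontr)
    assume n: "\<not> ?thesis"
    let ?W = "{v \<oplus> s \<odot> x | v s. v \<in> {r \<odot> \<one> | r. True}}"
    have "w \<notin> ?W" using n by auto
    then obtain f where f: "f \<in> lin_map A base_alg" "\<And>v. v \<in> ?W \<Longrightarrow> f v = 0" "f w = 1"
      by (rule functional_exists[OF span_submod[OF x(1) scalars_submod] w]) blast
    have "\<one> = 1 \<odot> \<one> \<oplus> 0 \<odot> x" "x = 0 \<odot> \<one> \<oplus> 1 \<odot> x" using x(1) by simp_all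
    then have "\<one> \<in> ?W" "x \<in> ?W" by blast+
    then have "f \<one> = 0" "f x = 0" by (simp_all add: f(2) del: mem_Collect_eq)
    then show False using Q[OF w f(1) \<alpha>(1)] f(3) \<alpha> by simp
  qed
qed

end

section \<open>Brackets of the form c0 + c1 x + c2 y\<close>

context splay
begin

definition E :: "'i \<Rightarrow> 'i \<Rightarrow> 'a \<Rightarrow> 'a \<Rightarrow> (('i \<Rightarrow> 'a) \<Rightarrow>\<^sub>0 'k) set"
  where "E i j a b = emb i a \<otimes>\<^bsub>S\<^esub> emb j b"

context
  fixes i j assumes ij: "i \<in> I" "j \<in> I" "i \<noteq> j"
begin

lemma E_closed [simp]: "a \<in> carrier (A i) \<Longrightarrow> b \<in> carrier (A j) \<Longrightarrow> E i j a b \<in> carrier S"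
  using ij by (simp add: E_def)

lemma E_mult: "a \<in> carrier (A i) \<Longrightarrow> b \<in> carrier (A j) \<Longrightarrow> a' \<in> carrier (A i) \<Longrightarrow> b' \<in> carrier (A j) \<Longrightarrow>
  E i j a b \<otimes>\<^bsub>S\<^esub> E i j a' b' = E i j (a \<otimes>\<^bsub>A i\<^esub> a') (b \<otimes>\<^bsub>A j\<^esub> b')"
  using ij by (simp add: E_def alg_homD[OF emb_hom] S.m_ac)

lemma E_one: "a \<in> carrier (A i) \<Longrightarrow> emb i a = E i j a \<one>\<^bsub>A j\<^esub>" "b \<in> carrier (A j) \<Longrightarrow> emb j b = E i j \<one>\<^bsub>A i\<^esub> b"
  "\<one>\<^bsub>S\<^esub> = E i j \<one>\<^bsub>A i\<^esub> \<one>\<^bsub>A j\<^esub>"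
  using ij by (simp_all add: E_def alg_homD[OF emb_hom])

lemma E_functional:
  assumes "\<And>l. l \<in> I \<Longrightarrow> \<one>\<^bsub>A l\<^esub> \<noteq> \<zero>\<^bsub>A l\<^esub>"
    and "f \<in> lin_map (A i) base_alg" and "g \<in> lin_map (A j) base_alg"
  obtains \<psi> where "\<psi> \<in> lin_map S base_alg"
    "\<And>a b. a \<in> carrier (A i) \<Longrightarrow> b \<in> carrier (A j) \<Longrightarrow> \<psi> (E i j a b) = f a * g b"
    "\<And>a. a \<in> fam \<Longrightarrow> \<exists>r. \<psi> (pure a) = f (a i) * g (a j) * r"
  by (rule product_functional[OF ij assms], assumption) (rule that, auto simp: E_def)

lemma br_scalar: "a \<in> carrier (A i) \<Longrightarrow> br i a j (r \<odot>\<^bsub>A j\<^esub> \<one>\<^bsub>A j\<^esub>) = \<zero>\<^bsub>S\<^esub>" "b \<in> carrier (A j) \<Longrightarrow> br i (r \<odot>\<^bsub>A i\<^esub> \<one>\<^bsub>A i\<^esub>) j b = \<zero>\<^bsub>S\<^esub>"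
  using ij by (simp_all add: br_def lin_mapD[OF \<iota>_lin] alg_homD[OF \<iota>_hom] alg_closed P.smult_right P.smult_left P.one_right P.one_left abel_simps)

text \<open>Brackets vanish on constants, and a zero factor would make S zero. So a nonzero bracket
  guarantees that the functionals used below exist.\<close>

lemma br_nonzero_nontrivial:
  assumes "a \<in> carrier (A i)" "b \<in> carrier (A j)" "br i a j b \<noteq> \<zero>\<^bsub>S\<^esub>"
  shows "\<And>l. l \<in> I \<Longrightarrow> \<one>\<^bsub>A l\<^esub> \<noteq> \<zero>\<^bsub>A l\<^esub>" "\<one>\<^bsub>S\<^esub> \<noteq> \<zero>\<^bsub>S\<^esub>"
    "\<And>r. a \<noteq> r \<odot>\<^bsub>A i\<^esub> \<one>\<^bsub>A i\<^esub>" "\<And>r. b \<noteq> r \<odot>\<^bsub>A j\<^esub> \<one>\<^bsub>A j\<^esub>"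
proof -
  show S1: "\<one>\<^bsub>S\<^esub> \<noteq> \<zero>\<^bsub>S\<^esub>"
  proof
    assume "\<one>\<^bsub>S\<^esub> = \<zero>\<^bsub>S\<^esub>"
    then have "br i a j b = \<zero>\<^bsub>S\<^esub>" using S.l_one[of "br i a j b"] assms ij by simp
    then show False using assms by simp
  qed
  show "\<one>\<^bsub>A l\<^esub> \<noteq> \<zero>\<^bsub>A l\<^esub>" if l: "l \<in> I" for l
    using S1 alg_homD(2)[OF emb_hom[OF l]] lin_map_zero_minus(1)[OF alg_hom_lin[OF emb_hom[OF l]] alg[OF l] k_algebra_S] by auto
  show "\<And>r. a \<noteq> r \<odot>\<^bsub>A i\<^esub> \<one>\<^bsub>A i\<^esub>" "\<And>r. b \<noteq> r \<odot>\<^bsub>A j\<^esub> \<one>\<^bsub>A j\<^esub>" using assms br_scalar by auto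
qed

text \<open>Write P for the bracket. In the first part two instances of rigidity are subtracted,
  which leaves f(x) P w - f(1) P x w = f(xw) P - f(w) P x. It then remains to find a functional that
  sends P a to a nonzero multiple of h(a); the hypothesis on c1 and c2 excludes the case P = c0 + c1
  x with c1 \<noteq> 0, where P a cannot be separated from multiplication by x. In the second part
  \<open>bracket_quadratic\<close> is tested with a functional that vanishes at 1, x and y but not
  at xy, which isolates c1.\<close>

lemma affine_bracket:
  assumes x: "x \<in> carrier (A i)" and y: "y \<in> carrier (A j)" and nz: "br i x j y \<noteq> \<zero>\<^bsub>S\<^esub>"
    and P: "br i x j y = c0 \<odot>\<^bsub>S\<^esub> \<one>\<^bsub>S\<^esub> \<oplus>\<^bsub>S\<^esub> c1 \<odot>\<^bsub>S\<^esub> emb i x \<oplus>\<^bsub>S\<^esub> c2 \<odot>\<^bsub>S\<^esub> emb j y"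
  shows affine_bracket_bilinear: "c2 \<noteq> 0 \<or> c1 = 0 \<Longrightarrow> w \<in> carrier (A i) \<Longrightarrow> f \<in> lin_map (A i) base_alg \<Longrightarrow> h \<in> lin_map (A i) base_alg \<Longrightarrow>
      h x * f w + h w * f x = h \<one>\<^bsub>A i\<^esub> * f (x \<otimes>\<^bsub>A i\<^esub> w) + h (x \<otimes>\<^bsub>A i\<^esub> w) * f \<one>\<^bsub>A i\<^esub>"
    and affine_bracket_coefficient: "y \<otimes>\<^bsub>A j\<^esub> y = r \<odot>\<^bsub>A j\<^esub> \<one>\<^bsub>A j\<^esub> \<Longrightarrow>
      (\<And>w. w \<in> carrier (A j) \<Longrightarrow> \<exists>r s. w = r \<odot>\<^bsub>A j\<^esub> \<one>\<^bsub>A j\<^esub> \<oplus>\<^bsub>A j\<^esub> s \<odot>\<^bsub>A j\<^esub> y) \<Longrightarrow> c1 = 0"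
proof -
  interpret Ai: k_algebra "A i" by (rule alg[OF ij(1)])
  interpret Aj: k_algebra "A j" by (rule alg[OF ij(2)])
  note nt = br_nonzero_nontrivial[OF x y nz]
  obtain g where g: "g \<in> lin_map (A j) base_alg" "g \<one>\<^bsub>A j\<^esub> = 0" "g y = 1"
    by (rule Aj.separating_functional[OF y nt(4)])
  let ?E = "E i j"
  define P where "P = br i x j y"
  have PE: "P = c0 \<odot>\<^bsub>S\<^esub> ?E \<one>\<^bsub>A i\<^esub> \<one>\<^bsub>A j\<^esub> \<oplus>\<^bsub>S\<^esub> c1 \<odot>\<^bsub>S\<^esub> ?E x \<one>\<^bsub>A j\<^esub> \<oplus>\<^bsub>S\<^esub> c2 \<odot>\<^bsub>S\<^esub> ?E \<one>\<^bsub>A i\<^esub> y"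
    using P x y by (simp add: P_def E_one)
  have Pc[simp]: "P \<in> carrier S" using x y by (simp add: PE)
  have PEm: "P \<otimes>\<^bsub>S\<^esub> ?E a b = c0 \<odot>\<^bsub>S\<^esub> ?E a b \<oplus>\<^bsub>S\<^esub> c1 \<odot>\<^bsub>S\<^esub> ?E (x \<otimes>\<^bsub>A i\<^esub> a) b \<oplus>\<^bsub>S\<^esub> c2 \<odot>\<^bsub>S\<^esub> ?E a (y \<otimes>\<^bsub>A j\<^esub> b)"
    if "a \<in> carrier (A i)" "b \<in> carrier (A j)" for a b
    using that x y by (simp add: PE S.l_distr S.smult_mult_left E_mult)
  {
    assume c: "c2 \<noteq> 0 \<or> c1 = 0" and w: "w \<in> carrier (A i)" and f: "f \<in> lin_map (A i) base_alg" and h: "h \<in> lin_map (A i) base_alg"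
    obtain \<psi> where \<psi>: "\<psi> \<in> lin_map S base_alg" "\<And>a b. a \<in> carrier (A i) \<Longrightarrow> b \<in> carrier (A j) \<Longrightarrow> \<psi> (?E a b) = f a * g b"
      by (rule E_functional[OF nt(1) f g(1)], assumption) (rule that)
    let ?X = "?E x \<one>\<^bsub>A j\<^esub>" and ?Y = "?E \<one>\<^bsub>A i\<^esub> y" and ?W = "?E w \<one>\<^bsub>A j\<^esub>"
    have cl[simp]: "?X \<in> carrier S" "?Y \<in> carrier S" "?W \<in> carrier S" using x y w by simp_all
    \<comment> \<open>Rigidity with u = 1 and this functional has the same terms containing V as
      rigidity with u = w and \<psi>. They cancel on subtraction, and only the terms linear in the
      other P remain.\<close>
    define \<psi>' where "\<psi>' s = \<psi> (?W \<otimes>\<^bsub>S\<^esub> s)" for s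
    have \<psi>': "\<psi>' \<in> lin_map S base_alg"
      unfolding \<psi>'_def by (rule lin_mapI) (simp_all add: S.r_distr S.smult_mult_right lin_mapD[OF \<psi>(1)])
    have 1: "\<psi> (?Y \<otimes>\<^bsub>S\<^esub> (?W \<otimes>\<^bsub>S\<^esub> P)) \<odot>\<^bsub>S\<^esub> ?X \<oplus>\<^bsub>S\<^esub> \<psi> (?X \<otimes>\<^bsub>S\<^esub> (?W \<otimes>\<^bsub>S\<^esub> P)) \<odot>\<^bsub>S\<^esub> ?Y \<oplus>\<^bsub>S\<^esub> \<psi> (?X \<otimes>\<^bsub>S\<^esub> ?Y) \<odot>\<^bsub>S\<^esub> (P \<otimes>\<^bsub>S\<^esub> ?W)
        \<oplus>\<^bsub>S\<^esub> \<psi> \<one>\<^bsub>S\<^esub> \<odot>\<^bsub>S\<^esub> (P \<otimes>\<^bsub>S\<^esub> ?W \<otimes>\<^bsub>S\<^esub> (?X \<otimes>\<^bsub>S\<^esub> ?Y))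
      = \<psi> (?X \<otimes>\<^bsub>S\<^esub> ?Y \<otimes>\<^bsub>S\<^esub> (?W \<otimes>\<^bsub>S\<^esub> P)) \<odot>\<^bsub>S\<^esub> \<one>\<^bsub>S\<^esub> \<oplus>\<^bsub>S\<^esub> \<psi> (?W \<otimes>\<^bsub>S\<^esub> P) \<odot>\<^bsub>S\<^esub> (?X \<otimes>\<^bsub>S\<^esub> ?Y)
        \<oplus>\<^bsub>S\<^esub> \<psi> ?Y \<odot>\<^bsub>S\<^esub> (P \<otimes>\<^bsub>S\<^esub> ?W \<otimes>\<^bsub>S\<^esub> ?X) \<oplus>\<^bsub>S\<^esub> \<psi> ?X \<odot>\<^bsub>S\<^esub> (P \<otimes>\<^bsub>S\<^esub> ?W \<otimes>\<^bsub>S\<^esub> ?Y)"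
      by (rule bracket_star[OF ij(2) y y ij(1,3) x ij(1,3) x \<iota>_closed[OF ij(1) w] \<psi>(1)])
         (use x y w ij in \<open>simp_all add: E_one[symmetric] P_def abel\<close>)
    have 2: "\<psi>' (?Y \<otimes>\<^bsub>S\<^esub> (\<one>\<^bsub>S\<^esub> \<otimes>\<^bsub>S\<^esub> P)) \<odot>\<^bsub>S\<^esub> ?X \<oplus>\<^bsub>S\<^esub> \<psi>' (?X \<otimes>\<^bsub>S\<^esub> (\<one>\<^bsub>S\<^esub> \<otimes>\<^bsub>S\<^esub> P)) \<odot>\<^bsub>S\<^esub> ?Y \<oplus>\<^bsub>S\<^esub> \<psi>' (?X \<otimes>\<^bsub>S\<^esub> ?Y) \<odot>\<^bsub>S\<^esub> (P \<otimes>\<^bsub>S\<^esub> \<one>\<^bsub>S\<^esub>)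
        \<oplus>\<^bsub>S\<^esub> \<psi>' \<one>\<^bsub>S\<^esub> \<odot>\<^bsub>S\<^esub> (P \<otimes>\<^bsub>S\<^esub> \<one>\<^bsub>S\<^esub> \<otimes>\<^bsub>S\<^esub> (?X \<otimes>\<^bsub>S\<^esub> ?Y))
      = \<psi>' (?X \<otimes>\<^bsub>S\<^esub> ?Y \<otimes>\<^bsub>S\<^esub> (\<one>\<^bsub>S\<^esub> \<otimes>\<^bsub>S\<^esub> P)) \<odot>\<^bsub>S\<^esub> \<one>\<^bsub>S\<^esub> \<oplus>\<^bsub>S\<^esub> \<psi>' (\<one>\<^bsub>S\<^esub> \<otimes>\<^bsub>S\<^esub> P) \<odot>\<^bsub>S\<^esub> (?X \<otimes>\<^bsub>S\<^esub> ?Y)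
        \<oplus>\<^bsub>S\<^esub> \<psi>' ?Y \<odot>\<^bsub>S\<^esub> (P \<otimes>\<^bsub>S\<^esub> \<one>\<^bsub>S\<^esub> \<otimes>\<^bsub>S\<^esub> ?X) \<oplus>\<^bsub>S\<^esub> \<psi>' ?X \<odot>\<^bsub>S\<^esub> (P \<otimes>\<^bsub>S\<^esub> \<one>\<^bsub>S\<^esub> \<otimes>\<^bsub>S\<^esub> ?Y)"
      by (rule bracket_star[OF ij(2) y y ij(1,3) x ij(1,3) x T.one_closed \<psi>'])
         (use x y w ij in \<open>simp_all add: E_one(1,2)[symmetric] P_def abel_simps\<close>)
    have x1: "x \<otimes>\<^bsub>A i\<^esub> \<one>\<^bsub>A i\<^esub> = x" "w \<otimes>\<^bsub>A i\<^esub> x = x \<otimes>\<^bsub>A i\<^esub> w" using x w comm[OF ij(1)] by simp_all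
    have red: "f x * \<chi> (P \<otimes>\<^bsub>S\<^esub> ?W) - f \<one>\<^bsub>A i\<^esub> * \<chi> (P \<otimes>\<^bsub>S\<^esub> ?E (x \<otimes>\<^bsub>A i\<^esub> w) \<one>\<^bsub>A j\<^esub>) = f (x \<otimes>\<^bsub>A i\<^esub> w) * \<chi> P - f w * \<chi> (P \<otimes>\<^bsub>S\<^esub> ?X)"
      if \<chi>: "\<chi> \<in> lin_map S base_alg" for \<chi>
    proof -
      note ch = lin_mapD[OF \<chi>, simplified]
      have YW: "?Y \<otimes>\<^bsub>S\<^esub> (?W \<otimes>\<^bsub>S\<^esub> P) = ?W \<otimes>\<^bsub>S\<^esub> (?Y \<otimes>\<^bsub>S\<^esub> P)" "?X \<otimes>\<^bsub>S\<^esub> (?W \<otimes>\<^bsub>S\<^esub> P) = ?W \<otimes>\<^bsub>S\<^esub> (?X \<otimes>\<^bsub>S\<^esub> P)"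
        "?X \<otimes>\<^bsub>S\<^esub> ?Y \<otimes>\<^bsub>S\<^esub> (?W \<otimes>\<^bsub>S\<^esub> P) = ?W \<otimes>\<^bsub>S\<^esub> (?X \<otimes>\<^bsub>S\<^esub> ?Y \<otimes>\<^bsub>S\<^esub> P)"
        "P \<otimes>\<^bsub>S\<^esub> ?W \<otimes>\<^bsub>S\<^esub> ?X = P \<otimes>\<^bsub>S\<^esub> (?W \<otimes>\<^bsub>S\<^esub> ?X)"
        by (simp_all add: S.m_ac)
      have ev: "\<psi> (?X \<otimes>\<^bsub>S\<^esub> ?Y) = f x" "\<psi> \<one>\<^bsub>S\<^esub> = 0" "\<psi> ?X = 0" "\<psi> ?Y = f \<one>\<^bsub>A i\<^esub>" "\<psi> ?W = 0"
        "\<psi> (?W \<otimes>\<^bsub>S\<^esub> (?X \<otimes>\<^bsub>S\<^esub> ?Y)) = f (x \<otimes>\<^bsub>A i\<^esub> w)" "\<psi> (?W \<otimes>\<^bsub>S\<^esub> \<one>\<^bsub>S\<^esub>) = 0" "\<psi> (?W \<otimes>\<^bsub>S\<^esub> ?X) = 0" "\<psi> (?W \<otimes>\<^bsub>S\<^esub> ?Y) = f w"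
        using x y w g by (simp_all add: E_one(3) E_mult \<psi>(2) x1)
      have WX: "?W \<otimes>\<^bsub>S\<^esub> ?X = ?E (x \<otimes>\<^bsub>A i\<^esub> w) \<one>\<^bsub>A j\<^esub>" using x w by (simp add: E_mult x1)
      from arg_cong[OF 1, of \<chi>] arg_cong[OF 2, of \<chi>] show ?thesis
        by (simp add: ch YW \<psi>'_def ev) (simp add: WX, erule (1) diff_eq_diffI)
    qed
    \<comment> \<open>P (a \<otimes> 1) contains c2 a \<otimes> y and c0 a \<otimes> 1. If c2
      \<noteq> 0, h is tensored with g, which sees y but not 1. Otherwise P is the constant c0
      \<noteq> 0, and a functional normalized at 1 will do.\<close>
    have Ex: "\<exists>c \<chi>. c \<noteq> 0 \<and> \<chi> \<in> lin_map S base_alg \<and> (\<forall>a\<in>carrier (A i). \<chi> (P \<otimes>\<^bsub>S\<^esub> ?E a \<one>\<^bsub>A j\<^esub>) = c * h a)"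
    proof (cases "c2 = 0")
      case False
      obtain \<chi> where \<chi>: "\<chi> \<in> lin_map S base_alg" "\<And>a b. a \<in> carrier (A i) \<Longrightarrow> b \<in> carrier (A j) \<Longrightarrow> \<chi> (?E a b) = h a * g b"
        by (rule E_functional[OF nt(1) h g(1)], assumption) (rule that)
      have "\<chi> (P \<otimes>\<^bsub>S\<^esub> ?E a \<one>\<^bsub>A j\<^esub>) = c2 * h a" if "a \<in> carrier (A i)" for a
        using that x y g by (simp add: PEm lin_mapD[OF \<chi>(1), simplified] \<chi>(2))
      then show ?thesis using False \<chi>(1) by blast
    next
      case True
      then have c1: "c1 = 0" using c by simp
      have c0: "c0 \<noteq> 0" using nz True c1 x y unfolding P_def[symmetric] PE by auto
      obtain e where e: "e \<in> lin_map (A j) base_alg" "e \<one>\<^bsub>A j\<^esub> = 1" using Aj.unit_functional nt(1)[OF ij(2)] by blast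
      obtain \<chi> where \<chi>: "\<chi> \<in> lin_map S base_alg" "\<And>a b. a \<in> carrier (A i) \<Longrightarrow> b \<in> carrier (A j) \<Longrightarrow> \<chi> (?E a b) = h a * e b"
        by (rule E_functional[OF nt(1) h e(1)], assumption) (rule that)
      have "\<chi> (P \<otimes>\<^bsub>S\<^esub> ?E a \<one>\<^bsub>A j\<^esub>) = c0 * h a" if "a \<in> carrier (A i)" for a
        using that x y e True c1 by (simp add: PEm lin_mapD[OF \<chi>(1), simplified] \<chi>(2))
      then show ?thesis using c0 \<chi>(1) by blast
    qed
    then obtain c' \<chi> where \<chi>: "c' \<noteq> 0" "\<chi> \<in> lin_map S base_alg" "\<And>a. a \<in> carrier (A i) \<Longrightarrow> \<chi> (P \<otimes>\<^bsub>S\<^esub> ?E a \<one>\<^bsub>A j\<^esub>) = c' * h a" by blast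
    have "\<chi> P = c' * h \<one>\<^bsub>A i\<^esub>" using \<chi>(3)[OF Ai.one_closed] by (simp flip: E_one(3))
    then have "c' * (h x * f w + h w * f x) = c' * (h \<one>\<^bsub>A i\<^esub> * f (x \<otimes>\<^bsub>A i\<^esub> w) + h (x \<otimes>\<^bsub>A i\<^esub> w) * f \<one>\<^bsub>A i\<^esub>)"
    proof -
      have "f x * (c' * h w) - f \<one>\<^bsub>A i\<^esub> * (c' * h (x \<otimes>\<^bsub>A i\<^esub> w)) = f (x \<otimes>\<^bsub>A i\<^esub> w) * (c' * h \<one>\<^bsub>A i\<^esub>) - f w * (c' * h x)"
        using red[OF \<chi>(2)] \<open>\<chi> P = _\<close> \<chi>(3)[OF w] \<chi>(3)[OF x] \<chi>(3)[OF Ai.m_closed[OF x w]] by (simp only:)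
      then show ?thesis by (rule scaled_bilinear_eq)
    qed
    then show "h x * f w + h w * f x = h \<one>\<^bsub>A i\<^esub> * f (x \<otimes>\<^bsub>A i\<^esub> w) + h (x \<otimes>\<^bsub>A i\<^esub> w) * f \<one>\<^bsub>A i\<^esub>"
      using \<chi>(1) by simp
  }
  {
    assume sq: "y \<otimes>\<^bsub>A j\<^esub> y = r \<odot>\<^bsub>A j\<^esub> \<one>\<^bsub>A j\<^esub>"
      and span: "\<And>w. w \<in> carrier (A j) \<Longrightarrow> \<exists>r s. w = r \<odot>\<^bsub>A j\<^esub> \<one>\<^bsub>A j\<^esub> \<oplus>\<^bsub>A j\<^esub> s \<odot>\<^bsub>A j\<^esub> y"
    obtain f where f: "f \<in> lin_map (A i) base_alg" "f \<one>\<^bsub>A i\<^esub> = 0" "f x = 1"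
      by (rule Ai.separating_functional[OF x nt(3)])
    obtain \<psi> where \<psi>: "\<psi> \<in> lin_map S base_alg" "\<And>a b. a \<in> carrier (A i) \<Longrightarrow> b \<in> carrier (A j) \<Longrightarrow> \<psi> (?E a b) = f a * g b"
      by (rule E_functional[OF nt(1) f(1) g(1)], assumption) (rule that)
    note ps = lin_mapD[OF \<psi>(1), simplified]
    have "\<psi> \<one>\<^bsub>S\<^esub> = 0" "\<psi> (emb j y) = 0" using f g y by (simp_all add: E_one \<psi>(2))
    moreover have "\<psi> P = 0" using f g x y by (simp add: PE ps \<psi>(2))
    moreover have "\<psi> (emb j y \<otimes>\<^bsub>S\<^esub> P) = c1"
    proof -
      have "emb j y \<otimes>\<^bsub>S\<^esub> P = P \<otimes>\<^bsub>S\<^esub> ?E \<one>\<^bsub>A i\<^esub> y" using y ij by (simp add: E_one(2) S.m_comm)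
      then show ?thesis using f g x y by (simp add: PEm ps \<psi>(2))
    qed
    ultimately have "c1 \<odot>\<^bsub>S\<^esub> \<one>\<^bsub>S\<^esub> = \<zero>\<^bsub>S\<^esub>"
      using bracket_quadratic[OF ij x y sq span \<psi>(1) refl refl] x y ij by (simp flip: P_def)
    then show "c1 = 0" using S.scale_cancel[OF S.one_closed] nt(2) by blast
  }
qed

end

text \<open>If c1 \<noteq> 0, the bilinear identity holds on the side of y, so A_j = k + ky with y^2
  a scalar, and then the coefficient lemma says c1 = 0. The same argument with i and j exchanged
  removes c2. Once both vanish, the bilinear identity holds on both sides.\<close>

lemma affine_bracket_constant:
  assumes ij: "i \<in> I" "j \<in> I" "i \<noteq> j" and x: "x \<in> carrier (A i)" and y: "y \<in> carrier (A j)" and nz: "br i x j y \<noteq> \<zero>\<^bsub>S\<^esub>"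
    and P: "br i x j y = c0 \<odot>\<^bsub>S\<^esub> \<one>\<^bsub>S\<^esub> \<oplus>\<^bsub>S\<^esub> c1 \<odot>\<^bsub>S\<^esub> emb i x \<oplus>\<^bsub>S\<^esub> c2 \<odot>\<^bsub>S\<^esub> emb j y"
  shows "br i x j y = c0 \<odot>\<^bsub>S\<^esub> \<one>\<^bsub>S\<^esub>" "(2 :: 'k) = 0"
    "\<exists>r. x \<otimes>\<^bsub>A i\<^esub> x = r \<odot>\<^bsub>A i\<^esub> \<one>\<^bsub>A i\<^esub>" "\<exists>r. y \<otimes>\<^bsub>A j\<^esub> y = r \<odot>\<^bsub>A j\<^esub> \<one>\<^bsub>A j\<^esub>"
    "\<And>w. w \<in> carrier (A i) \<Longrightarrow> \<exists>r s. w = r \<odot>\<^bsub>A i\<^esub> \<one>\<^bsub>A i\<^esub> \<oplus>\<^bsub>A i\<^esub> s \<odot>\<^bsub>A i\<^esub> x"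
    "\<And>w. w \<in> carrier (A j) \<Longrightarrow> \<exists>r s. w = r \<odot>\<^bsub>A j\<^esub> \<one>\<^bsub>A j\<^esub> \<oplus>\<^bsub>A j\<^esub> s \<odot>\<^bsub>A j\<^esub> y"
proof -
  interpret Ai: k_algebra "A i" by (rule alg[OF ij(1)])
  interpret Aj: k_algebra "A j" by (rule alg[OF ij(2)])
  have ji: "j \<in> I" "i \<in> I" "j \<noteq> i" using ij by auto
  have nz': "br j y i x \<noteq> \<zero>\<^bsub>S\<^esub>"
    using nz ij x y S.minus_minus[of "br i x j y"] unfolding br_swap[OF ij(1) x ij(2) y] by auto
  have P': "br j y i x = (- c0) \<odot>\<^bsub>S\<^esub> \<one>\<^bsub>S\<^esub> \<oplus>\<^bsub>S\<^esub> (- c2) \<odot>\<^bsub>S\<^esub> emb j y \<oplus>\<^bsub>S\<^esub> (- c1) \<odot>\<^bsub>S\<^esub> emb i x"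
    unfolding br_swap[OF ij(1) x ij(2) y] P using ij x y by (simp add: S.minus_add S.scale_uminus_left S.a_ac)
  note nt = br_nonzero_nontrivial[OF ij x y nz]
  have bi: "\<forall>w\<in>carrier (A i). \<forall>f\<in>lin_map (A i) base_alg. \<forall>h\<in>lin_map (A i) base_alg.
      h x * f w + h w * f x = h \<one>\<^bsub>A i\<^esub> * f (x \<otimes>\<^bsub>A i\<^esub> w) + h (x \<otimes>\<^bsub>A i\<^esub> w) * f \<one>\<^bsub>A i\<^esub>" if "c2 \<noteq> 0 \<or> c1 = 0"
    by (intro ballI) (rule affine_bracket_bilinear[OF ij x y nz P that])
  have bj: "\<forall>w\<in>carrier (A j). \<forall>f\<in>lin_map (A j) base_alg. \<forall>h\<in>lin_map (A j) base_alg.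
      h y * f w + h w * f y = h \<one>\<^bsub>A j\<^esub> * f (y \<otimes>\<^bsub>A j\<^esub> w) + h (y \<otimes>\<^bsub>A j\<^esub> w) * f \<one>\<^bsub>A j\<^esub>" if "- c1 \<noteq> 0 \<or> - c2 = 0"
    by (intro ballI) (rule affine_bracket_bilinear[OF ji y x nz' P' that])
  note Qi = Ai.two_dimensional[OF x nt(3) bi]
  note Qj = Aj.two_dimensional[OF y nt(4) bj]
  have c1: "c1 = 0"
  proof (rule ccontr)
    assume n: "c1 \<noteq> 0"
    then obtain r where "y \<otimes>\<^bsub>A j\<^esub> y = r \<odot>\<^bsub>A j\<^esub> \<one>\<^bsub>A j\<^esub>" using Qj(2) by auto
    then show False using affine_bracket_coefficient[OF ij x y nz P _ Qj(3)] n by auto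
  qed
  have c2: "c2 = 0"
  proof (rule ccontr)
    assume n: "c2 \<noteq> 0"
    then obtain r where "x \<otimes>\<^bsub>A i\<^esub> x = r \<odot>\<^bsub>A i\<^esub> \<one>\<^bsub>A i\<^esub>" using Qi(2) by auto
    then have "- c2 = 0" using affine_bracket_coefficient[OF ji y x nz' P' _ Qi(3)] n by auto
    then show False using n by simp
  qed
  show "br i x j y = c0 \<odot>\<^bsub>S\<^esub> \<one>\<^bsub>S\<^esub>" using P c1 c2 ij x y by simp
  show "(2 :: 'k) = 0" "\<exists>r. x \<otimes>\<^bsub>A i\<^esub> x = r \<odot>\<^bsub>A i\<^esub> \<one>\<^bsub>A i\<^esub>" "\<And>w. w \<in> carrier (A i) \<Longrightarrow> \<exists>r s. w = r \<odot>\<^bsub>A i\<^esub> \<one>\<^bsub>A i\<^esub> \<oplus>\<^bsub>A i\<^esub> s \<odot>\<^bsub>A i\<^esub> x"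
    using Qi c1 by auto
  show "\<exists>r. y \<otimes>\<^bsub>A j\<^esub> y = r \<odot>\<^bsub>A j\<^esub> \<one>\<^bsub>A j\<^esub>" "\<And>w. w \<in> carrier (A j) \<Longrightarrow> \<exists>r s. w = r \<odot>\<^bsub>A j\<^esub> \<one>\<^bsub>A j\<^esub> \<oplus>\<^bsub>A j\<^esub> s \<odot>\<^bsub>A j\<^esub> y"
    using Qj c2 by auto
qed

text \<open>Rigidity compares the brackets of x and of z with the same y. If z is not a scalar, let
  \<psi> pick out y and \<chi> pick out z: every term dies except \<psi>(y) \<chi>(c z) = c.\<close>

lemma constant_bracket_third_trivial:
  assumes ij: "i \<in> I" "j \<in> I" "i \<noteq> j" and x: "x \<in> carrier (A i)" and y: "y \<in> carrier (A j)" and nz: "br i x j y \<noteq> \<zero>\<^bsub>S\<^esub>"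
    and P: "br i x j y = c \<odot>\<^bsub>S\<^esub> \<one>\<^bsub>S\<^esub>" and l: "l \<in> I" "l \<noteq> i" "l \<noteq> j" and z: "z \<in> carrier (A l)"
  shows "\<exists>r. z = r \<odot>\<^bsub>A l\<^esub> \<one>\<^bsub>A l\<^esub>"
proof (rule ccontr)
  assume n: "\<not> ?thesis"
  interpret Al: k_algebra "A l" by (rule alg[OF l(1)])
  interpret Aj: k_algebra "A j" by (rule alg[OF ij(2)])
  note nt = br_nonzero_nontrivial[OF ij x y nz]
  obtain f where f: "f \<in> lin_map (A l) base_alg" "f \<one>\<^bsub>A l\<^esub> = 0" "f z = 1"
    using Al.separating_functional[OF z] n by blast
  obtain e where e: "e \<in> lin_map (A l) base_alg" "e \<one>\<^bsub>A l\<^esub> = 1" using Al.unit_functional nt(1)[OF l(1)] by blast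
  obtain e' where e': "e' \<in> lin_map (A j) base_alg" "e' \<one>\<^bsub>A j\<^esub> = 1" using Aj.unit_functional nt(1)[OF ij(2)] by blast
  obtain g where g: "g \<in> lin_map (A j) base_alg" "g \<one>\<^bsub>A j\<^esub> = 0" "g y = 1"
    by (rule Aj.separating_functional[OF y nt(4)])
  have lj: "l \<in> I" "j \<in> I" "l \<noteq> j" using l ij by auto
  obtain \<psi> where \<psi>: "\<psi> \<in> lin_map S base_alg" "\<And>a b. a \<in> carrier (A l) \<Longrightarrow> b \<in> carrier (A j) \<Longrightarrow> \<psi> (E l j a b) = e a * g b"
    by (rule E_functional[OF lj nt(1) e(1) g(1)], assumption) (rule that)
  obtain \<chi> where \<chi>: "\<chi> \<in> lin_map S base_alg" "\<And>a b. a \<in> carrier (A l) \<Longrightarrow> b \<in> carrier (A j) \<Longrightarrow> \<chi> (E l j a b) = f a * e' b"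
    "\<And>a. a \<in> fam \<Longrightarrow> \<exists>r. \<chi> (pure a) = f (a l) * e' (a j) * r"
    by (rule E_functional[OF lj nt(1) f(1) e'(1)], assumption) (rule that)
  note ch = lin_mapD[OF \<chi>(1), simplified]
  have cl[simp]: "emb i x \<in> carrier S" "emb j y \<in> carrier S" "emb l z \<in> carrier S" "br l z j y \<in> carrier S"
    using ij l x y z by simp_all
  \<comment> \<open>These tensors have entry 1 at l, where f vanishes. The divisibility clause of
    the product functional is what applies, since i is a third index.\<close>
  have vanish: "\<chi> (emb i x) = 0" "\<chi> (emb i x \<otimes>\<^bsub>S\<^esub> emb j y) = 0"
  proof -
    have "fam_one(i := x) \<in> fam" "fam_one(i := x, j := y) \<in> fam" using ij x y by (simp_all add: fam_upd fam_one)
    moreover have "(fam_one(i := x)) l = \<one>\<^bsub>A l\<^esub>" "(fam_one(i := x, j := y)) l = \<one>\<^bsub>A l\<^esub>"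
      using l by (simp_all add: fam_one_def)
    ultimately have "\<chi> (pure (fam_one(i := x))) = 0" "\<chi> (pure (fam_one(i := x, j := y))) = 0"
      using \<chi>(3) f(2) by (metis mult_zero_left)+
    then show "\<chi> (emb i x) = 0" "\<chi> (emb i x \<otimes>\<^bsub>S\<^esub> emb j y) = 0"
      by (simp_all add: emb_def[of i x, symmetric] emb_mult_emb[OF ij x y])
  qed
  have star: "\<psi> (emb j y \<otimes>\<^bsub>S\<^esub> (\<one>\<^bsub>S\<^esub> \<otimes>\<^bsub>S\<^esub> br l z j y)) \<odot>\<^bsub>S\<^esub> emb i x \<oplus>\<^bsub>S\<^esub> \<psi> (emb i x \<otimes>\<^bsub>S\<^esub> (\<one>\<^bsub>S\<^esub> \<otimes>\<^bsub>S\<^esub> br l z j y)) \<odot>\<^bsub>S\<^esub> emb j y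
      \<oplus>\<^bsub>S\<^esub> \<psi> (emb l z \<otimes>\<^bsub>S\<^esub> emb j y) \<odot>\<^bsub>S\<^esub> (br i x j y \<otimes>\<^bsub>S\<^esub> \<one>\<^bsub>S\<^esub>) \<oplus>\<^bsub>S\<^esub> \<psi> \<one>\<^bsub>S\<^esub> \<odot>\<^bsub>S\<^esub> (br i x j y \<otimes>\<^bsub>S\<^esub> \<one>\<^bsub>S\<^esub> \<otimes>\<^bsub>S\<^esub> (emb l z \<otimes>\<^bsub>S\<^esub> emb j y))
    = \<psi> (emb i x \<otimes>\<^bsub>S\<^esub> emb j y \<otimes>\<^bsub>S\<^esub> (\<one>\<^bsub>S\<^esub> \<otimes>\<^bsub>S\<^esub> br l z j y)) \<odot>\<^bsub>S\<^esub> \<one>\<^bsub>S\<^esub> \<oplus>\<^bsub>S\<^esub> \<psi> (\<one>\<^bsub>S\<^esub> \<otimes>\<^bsub>S\<^esub> br l z j y) \<odot>\<^bsub>S\<^esub> (emb i x \<otimes>\<^bsub>S\<^esub> emb j y)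
      \<oplus>\<^bsub>S\<^esub> \<psi> (emb j y) \<odot>\<^bsub>S\<^esub> (br i x j y \<otimes>\<^bsub>S\<^esub> \<one>\<^bsub>S\<^esub> \<otimes>\<^bsub>S\<^esub> emb l z) \<oplus>\<^bsub>S\<^esub> \<psi> (emb l z) \<odot>\<^bsub>S\<^esub> (br i x j y \<otimes>\<^bsub>S\<^esub> \<one>\<^bsub>S\<^esub> \<otimes>\<^bsub>S\<^esub> emb j y)"
    by (rule bracket_star[OF ij(2) y y ij(1,3) x l(1,3) z T.one_closed \<psi>(1)]) (simp_all add: abel_simps)
  have ev: "\<psi> \<one>\<^bsub>S\<^esub> = 0" "\<psi> (emb j y) = 1" "\<psi> (emb l z) = 0" "\<chi> \<one>\<^bsub>S\<^esub> = 0" "\<chi> (emb j y) = 0" "\<chi> (emb l z) = 1"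
    using e e' f g y z by (simp_all add: E_one[OF lj] \<psi>(2) \<chi>(2))
  from arg_cong[OF star, of \<chi>] have "c = 0"
    by (simp add: ch P S.smult_mult_left vanish ev)
  then show False using nz P by simp
qed

end

context filtered_splay
begin

text \<open>A word of degree at most m + n - 1 has degree at most m - 1 in the letters of i or at
  most n - 1 in those of j, so f or h kills the corresponding component.\<close>

lemma abel_filtration_functional:
  assumes ij: "i \<in> I" "j \<in> I" "i \<noteq> j" and nz: "\<And>l. l \<in> I \<Longrightarrow> \<one>\<^bsub>A l\<^esub> \<noteq> \<zero>\<^bsub>A l\<^esub>"
    and f: "f \<in> lin_map (A i) base_alg" "\<And>a. a \<in> FA i (m - 1) \<Longrightarrow> f a = 0"
    and h: "h \<in> lin_map (A j) base_alg" "\<And>a. a \<in> FA j (n - 1) \<Longrightarrow> h a = 0"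
  obtains \<psi> where "\<psi> \<in> lin_map S base_alg"
    "\<And>a b. a \<in> carrier (A i) \<Longrightarrow> b \<in> carrier (A j) \<Longrightarrow> \<psi> (E i j a b) = f a * h b"
    "\<And>t. t \<in> FT (m + n - 1) \<Longrightarrow> \<psi> (abel t) = 0"
proof -
  obtain \<psi> where \<psi>: "\<psi> \<in> lin_map S base_alg"
    "\<And>a b. a \<in> carrier (A i) \<Longrightarrow> b \<in> carrier (A j) \<Longrightarrow> \<psi> (E i j a b) = f a * h b"
    "\<And>a. a \<in> fam \<Longrightarrow> \<exists>r. \<psi> (pure a) = f (a i) * h (a j) * r"
    by (rule E_functional[OF ij nz f(1) h(1)], assumption) (rule that)
  note ps = lin_mapD[OF \<psi>(1), simplified]
  have "\<psi> \<zero>\<^bsub>S\<^esub> = 0" using lin_map_zero_minus(1)[OF \<psi>(1) k_algebra_S k_algebra_base] by simp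
  then have W: "submodule {t \<in> carrier T. \<psi> (abel t) = 0} field_ring T"
    by (intro T.submodI) (auto simp: abel_simps ps)
  have "FT (m + n - 1) \<subseteq> {t \<in> carrier T. \<psi> (abel t) = 0}"
  proof (rule FT_least[OF W])
    fix w assume w: "set w \<subseteq> Y" "int (deg w) \<le> m + n - 1"
    have "(\<Sum>l\<in>{i, j}. deg_at l w) \<le> deg w" by (rule deg_at_sum) simp
    then have "int (deg_at i w) \<le> m - 1 \<or> int (deg_at j w) \<le> n - 1" using ij w(2) by simp linarith
    then have "f (wfam w i) = 0 \<or> h (wfam w j) = 0"
    proof
      assume "int (deg_at i w) \<le> m - 1"
      then have "wfam w i \<in> FA i (m - 1)"
        using wfam_filtration[OF w(1) ij(1)] filtration_mono[OF alg[OF ij(1)] gen_Pi[OF ij(1)]] by blast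
      then show ?thesis using f(2) by blast
    next
      assume "int (deg_at j w) \<le> n - 1"
      then have "wfam w j \<in> FA j (n - 1)"
        using wfam_filtration[OF w(1) ij(2)] filtration_mono[OF alg[OF ij(2)] gen_Pi[OF ij(2)]] by blast
      then show ?thesis using h(2) by blast
    qed
    then have "\<psi> (pure (wfam w)) = 0" using \<psi>(3)[OF wfam_fam[OF w(1)]] by auto
    then show "word_eval T G w \<in> {t \<in> carrier T. \<psi> (abel t) = 0}" using abel_word[OF w(1)] word_T_closed[OF w(1)] by simp
  qed
  then show thesis using that[OF \<psi>(1,2)] by blast
qed

end

section \<open>Comparison with the tensor product\<close>

context filtered_splay
begin

lemma br_add_scale:
  assumes "i \<in> I" "j \<in> I" "a \<in> carrier (A i)" "a' \<in> carrier (A i)" "b \<in> carrier (A j)" "b' \<in> carrier (A j)"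
  shows "br i (a \<oplus>\<^bsub>A i\<^esub> a') j b = br i a j b \<oplus>\<^bsub>S\<^esub> br i a' j b" "br i a j (b \<oplus>\<^bsub>A j\<^esub> b') = br i a j b \<oplus>\<^bsub>S\<^esub> br i a j b'"
  using assms by (simp_all add: br_def lin_mapD[OF \<iota>_lin] P.add_left P.add_right abel_simps P.closed)

text \<open>Minimize m + n over all nonzero brackets of letters; lowering the degree of one argument
  then gives zero. If m or n is 0, the lower piece is zero and there is nothing to show. The indices
  differ by internal symmetry.\<close>

lemma minimal_bracket:
  assumes "i0 \<in> I" "j0 \<in> I" "a0 \<in> carrier (A i0)" "b0 \<in> carrier (A j0)" "br i0 a0 j0 b0 \<noteq> \<zero>\<^bsub>S\<^esub>"
  obtains i j m n x y where "i \<in> I" "j \<in> I" "i \<noteq> j" "x \<in> FA i (int m)" "y \<in> FA j (int n)" "br i x j y \<noteq> \<zero>\<^bsub>S\<^esub>"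
    "\<And>a. a \<in> FA i (int m - 1) \<Longrightarrow> br i a j y = \<zero>\<^bsub>S\<^esub>" "\<And>b. b \<in> FA j (int n - 1) \<Longrightarrow> br i x j b = \<zero>\<^bsub>S\<^esub>"
proof -
  define good where "good N \<longleftrightarrow> (\<exists>i j m n x y. i \<in> I \<and> j \<in> I \<and> x \<in> FA i (int m) \<and> y \<in> FA j (int n) \<and> br i x j y \<noteq> \<zero>\<^bsub>S\<^esub> \<and> m + n = N)" for N
  have goodI: "good (m + n)" if "i \<in> I" "j \<in> I" "x \<in> FA i (int m)" "y \<in> FA j (int n)" "br i x j y \<noteq> \<zero>\<^bsub>S\<^esub>" for i j x y m n
    unfolding good_def using that by (intro exI conjI) auto
  have ex: "\<exists>m. a \<in> FA l (int m)" if "l \<in> I" "a \<in> carrier (A l)" for l a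
    by (rule filtration_exhaust[OF alg gen_Pi]) (use generated that in auto)
  obtain m0 n0 where "a0 \<in> FA i0 (int m0)" "b0 \<in> FA j0 (int n0)" using ex[OF assms(1,3)] ex[OF assms(2,4)] by blast
  then have "good (m0 + n0)" by (intro goodI[OF assms(1,2) _ _ assms(5)])
  then have "\<exists>N. good N" by (rule exI)
  then obtain N where N: "good N" "\<And>N'. N' < N \<Longrightarrow> \<not> good N'" using exists_least_iff[of good] by auto
  obtain i j m n x y where *: "i \<in> I" "j \<in> I" "x \<in> FA i (int m)" "y \<in> FA j (int n)" "br i x j y \<noteq> \<zero>\<^bsub>S\<^esub>" "m + n = N"
    using N(1) unfolding good_def by blast
  have neg: "FA l (int k - 1) \<subseteq> {\<zero>\<^bsub>A l\<^esub>}" if "l \<in> I" "k = 0" for l k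
    using filtration_neg[OF alg gen_Pi] that by simp
  have FAc: "FA l k \<subseteq> carrier (A l)" if "l \<in> I" for l k
    using k_algebra.submodD(1)[OF alg filtration_submod[OF alg gen_Pi]] that by blast
  have zero: "br l \<zero>\<^bsub>A l\<^esub> l' b = \<zero>\<^bsub>S\<^esub>" "br l' b l \<zero>\<^bsub>A l\<^esub> = \<zero>\<^bsub>S\<^esub>" if "l \<in> I" "l' \<in> I" "b \<in> carrier (A l')" for l l' b
  proof -
    have "\<pi> \<zero>\<^bsub>T\<^esub> t = \<zero>\<^bsub>T\<^esub>" "\<pi> t \<zero>\<^bsub>T\<^esub> = \<zero>\<^bsub>T\<^esub>" if t: "t \<in> carrier T" for t
      using P.smult_left[of "\<zero>\<^bsub>T\<^esub>" t 0] P.smult_right[of t "\<zero>\<^bsub>T\<^esub>" 0] t by (simp_all add: P.closed)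
    then show "br l \<zero>\<^bsub>A l\<^esub> l' b = \<zero>\<^bsub>S\<^esub>" "br l' b l \<zero>\<^bsub>A l\<^esub> = \<zero>\<^bsub>S\<^esub>"
      using that by (simp_all add: br_def lin_map_zero_minus(1)[OF \<iota>_lin alg k_algebra_T] abel_simps)
  qed
  show thesis
  proof (rule that[OF *(1,2) _ *(3-5)])
    show "i \<noteq> j"
    proof
      assume "i = j"
      moreover have "x \<in> carrier (A i)" "y \<in> carrier (A j)" using * FAc by blast+
      ultimately have "br i x j y = \<zero>\<^bsub>S\<^esub>" using *(2) bracket_same[of i x y] by (simp add: br_def abel_simps)
      then show False using * by simp
    qed
    show "br i a j y = \<zero>\<^bsub>S\<^esub>" if a: "a \<in> FA i (int m - 1)" for a
    proof (cases m)
      case 0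
      then have "a = \<zero>\<^bsub>A i\<^esub>" using a neg[OF *(1)] by blast
      then show ?thesis using zero(1)[OF *(1,2)] * FAc by blast
    next
      case (Suc k)
      have "\<not> good (k + n)" using Suc *(6) by (intro N(2)) simp
      then show ?thesis using goodI[OF *(1,2) _ *(4), of a k] a Suc by auto
    qed
    show "br i x j b = \<zero>\<^bsub>S\<^esub>" if b: "b \<in> FA j (int n - 1)" for b
    proof (cases n)
      case 0
      then have "b = \<zero>\<^bsub>A j\<^esub>" using b neg[OF *(2)] by blast
      then show ?thesis using zero(2)[OF *(2,1)] * FAc by blast
    next
      case (Suc k)
      have "\<not> good (m + k)" using Suc *(6) by (intro N(2)) simp
      then show ?thesis using goodI[OF *(1,2,3), of b k] b Suc by auto
    qed
  qed
qed

text \<open>W enlarges the lower piece by the scalars, so that the functional vanishes at 1 as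
  well.\<close>

lemma top_functional:
  assumes i: "i \<in> I" and W: "W = {v \<oplus>\<^bsub>A i\<^esub> s \<odot>\<^bsub>A i\<^esub> \<one>\<^bsub>A i\<^esub> | v s. v \<in> FA i k}" and x: "x \<in> carrier (A i)" "x \<notin> W"
  obtains f where "f \<in> lin_map (A i) base_alg" "\<And>a. a \<in> FA i k \<Longrightarrow> f a = 0" "f \<one>\<^bsub>A i\<^esub> = 0" "f x = 1"
proof -
  interpret Ai: k_algebra "A i" by (rule alg[OF i])
  have fil: "submodule (FA i k) field_ring (A i)" by (rule filtration_submod[OF alg[OF i] gen_Pi[OF i]])
  obtain f where f: "f \<in> lin_map (A i) base_alg" "\<And>w. w \<in> W \<Longrightarrow> f w = 0" "f x = 1"
    by (rule Ai.functional_exists[OF Ai.span_submod[OF Ai.one_closed fil] x(1)]) (use x(2) W in auto)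
  have "a \<in> W" if a: "a \<in> FA i k" for a
  proof -
    have "a = a \<oplus>\<^bsub>A i\<^esub> 0 \<odot>\<^bsub>A i\<^esub> \<one>\<^bsub>A i\<^esub>" using Ai.submodD(1)[OF fil a] by simp
    then show ?thesis unfolding W using a by blast
  qed
  moreover have "\<one>\<^bsub>A i\<^esub> \<in> W"
  proof -
    have "\<one>\<^bsub>A i\<^esub> = \<zero>\<^bsub>A i\<^esub> \<oplus>\<^bsub>A i\<^esub> 1 \<odot>\<^bsub>A i\<^esub> \<one>\<^bsub>A i\<^esub>" by simp
    then show ?thesis unfolding W using Ai.submodD(2)[OF fil] by blast
  qed
  ultimately show thesis using f by (intro that[OF f(1)]) auto
qed

lemma word_in_coordinate:
  assumes i: "i \<in> I" and w: "set w \<subseteq> Y" and letters: "\<And>y. y \<in> set w \<Longrightarrow> G y \<in> \<iota> i ` carrier (A i)"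
  shows "word_eval T G w \<in> \<iota> i ` carrier (A i)"
  using w letters
proof (induction w)
  case Nil
  have "\<one>\<^bsub>T\<^esub> = \<iota> i \<one>\<^bsub>A i\<^esub>" using alg_homD(2)[OF \<iota>_hom[OF i]] by simp
  then show ?case using alg_closed(1)[OF i] by (auto simp: word_eval_def)
next
  case (Cons y w)
  obtain a b where ab: "G y = \<iota> i a" "a \<in> carrier (A i)" "word_eval T G w = \<iota> i b" "b \<in> carrier (A i)"
  proof -
    have "G y \<in> \<iota> i ` carrier (A i)" "word_eval T G w \<in> \<iota> i ` carrier (A i)" using Cons by simp_all
    then show thesis using that by blast
  qed
  have "word_eval T G (y # w) = \<iota> i (a \<otimes>\<^bsub>A i\<^esub> b)"
    using ab(3) alg_homD(1)[OF \<iota>_hom[OF i] ab(2,4)] unfolding word_eval_def foldr.simps o_apply ab(1) by simp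
  then show ?case using alg_closed(3)[OF i ab(2,4)] by blast
qed

lemma bracket_classification:
  assumes "i0 \<in> I" "j0 \<in> I" "a0 \<in> carrier (A i0)" "b0 \<in> carrier (A j0)" "br i0 a0 j0 b0 \<noteq> \<zero>\<^bsub>S\<^esub>"
  obtains i j x y c where "i \<in> I" "j \<in> I" "i \<noteq> j" "x \<in> carrier (A i)" "y \<in> carrier (A j)"
    "\<pi> (\<iota> i x) (\<iota> j y) = c \<odot>\<^bsub>T\<^esub> \<one>\<^bsub>T\<^esub>" "(2 :: 'k) = 0"
    "\<exists>r. x \<otimes>\<^bsub>A i\<^esub> x = r \<odot>\<^bsub>A i\<^esub> \<one>\<^bsub>A i\<^esub>" "\<exists>r. y \<otimes>\<^bsub>A j\<^esub> y = r \<odot>\<^bsub>A j\<^esub> \<one>\<^bsub>A j\<^esub>"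
    "\<And>w. w \<in> carrier (A i) \<Longrightarrow> \<exists>r s. w = r \<odot>\<^bsub>A i\<^esub> \<one>\<^bsub>A i\<^esub> \<oplus>\<^bsub>A i\<^esub> s \<odot>\<^bsub>A i\<^esub> x"
    "\<And>w. w \<in> carrier (A j) \<Longrightarrow> \<exists>r s. w = r \<odot>\<^bsub>A j\<^esub> \<one>\<^bsub>A j\<^esub> \<oplus>\<^bsub>A j\<^esub> s \<odot>\<^bsub>A j\<^esub> y"
    "\<And>l z. l \<in> I \<Longrightarrow> l \<noteq> i \<Longrightarrow> l \<noteq> j \<Longrightarrow> z \<in> carrier (A l) \<Longrightarrow> \<exists>r. z = r \<odot>\<^bsub>A l\<^esub> \<one>\<^bsub>A l\<^esub>"
    "\<And>r. x \<noteq> r \<odot>\<^bsub>A i\<^esub> \<one>\<^bsub>A i\<^esub>" "\<And>r. y \<noteq> r \<odot>\<^bsub>A j\<^esub> \<one>\<^bsub>A j\<^esub>"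
proof -
  obtain i j m n x y where ij: "i \<in> I" "j \<in> I" "i \<noteq> j" and xm: "x \<in> FA i (int m)" and yn: "y \<in> FA j (int n)"
    and nz: "br i x j y \<noteq> \<zero>\<^bsub>S\<^esub>"
    and min: "\<And>a. a \<in> FA i (int m - 1) \<Longrightarrow> br i a j y = \<zero>\<^bsub>S\<^esub>" "\<And>b. b \<in> FA j (int n - 1) \<Longrightarrow> br i x j b = \<zero>\<^bsub>S\<^esub>"
    by (rule minimal_bracket[OF assms]) (rule that)
  interpret Ai: k_algebra "A i" by (rule alg[OF ij(1)])
  interpret Aj: k_algebra "A j" by (rule alg[OF ij(2)])
  have sub: "submodule (FA i k) field_ring (A i)" "submodule (FA j k) field_ring (A j)" for k
    by (rule filtration_submod[OF alg[OF ij(1)] gen_Pi[OF ij(1)]], rule filtration_submod[OF alg[OF ij(2)] gen_Pi[OF ij(2)]])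
  have x: "x \<in> carrier (A i)" and y: "y \<in> carrier (A j)"
    using Ai.submodD(1)[OF sub(1) xm] Aj.submodD(1)[OF sub(2) yn] by auto
  note nt = br_nonzero_nontrivial[OF ij x y nz]
  define P where "P = br i x j y"
  define Wi where "Wi = {v \<oplus>\<^bsub>A i\<^esub> s \<odot>\<^bsub>A i\<^esub> \<one>\<^bsub>A i\<^esub> | v s. v \<in> FA i (int m - 1)}"
  define Wj where "Wj = {v \<oplus>\<^bsub>A j\<^esub> s \<odot>\<^bsub>A j\<^esub> \<one>\<^bsub>A j\<^esub> | v s. v \<in> FA j (int n - 1)}"
  \<comment> \<open>Scalars have zero bracket with everything, and lower elements have zero bracket
    with y by minimality, so x is not a sum of the two.\<close>
  have xW: "x \<notin> Wi"
  proof
    assume "x \<in> Wi"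
    then obtain v s where v: "x = v \<oplus>\<^bsub>A i\<^esub> s \<odot>\<^bsub>A i\<^esub> \<one>\<^bsub>A i\<^esub>" "v \<in> FA i (int m - 1)" unfolding Wi_def by blast
    then have "br i x j y = \<zero>\<^bsub>S\<^esub>"
      using br_add_scale(1)[OF ij(1,2) Ai.submodD(1)[OF sub(1) v(2)] Ai.scale_closed[OF Ai.one_closed] y y, of s] min(1)[OF v(2)] br_scalar(2)[OF ij y]
      by simp
    then show False using nz by simp
  qed
  have yW: "y \<notin> Wj"
  proof
    assume "y \<in> Wj"
    then obtain v s where v: "y = v \<oplus>\<^bsub>A j\<^esub> s \<odot>\<^bsub>A j\<^esub> \<one>\<^bsub>A j\<^esub>" "v \<in> FA j (int n - 1)" unfolding Wj_def by blast
    then have "br i x j y = \<zero>\<^bsub>S\<^esub>"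
      using br_add_scale(2)[OF ij(1,2) x x Aj.submodD(1)[OF sub(2) v(2)] Aj.scale_closed[OF Aj.one_closed], of s] min(2)[OF v(2)] br_scalar(1)[OF ij x]
      by simp
    then show False using nz by simp
  qed
  obtain \<alpha> where \<alpha>: "\<alpha> \<in> lin_map (A i) base_alg" "\<And>a. a \<in> FA i (int m - 1) \<Longrightarrow> \<alpha> a = 0" "\<alpha> \<one>\<^bsub>A i\<^esub> = 0" "\<alpha> x = 1"
    by (rule top_functional[OF ij(1) Wi_def x xW]) (rule that)
  obtain \<beta> where \<beta>: "\<beta> \<in> lin_map (A j) base_alg" "\<And>a. a \<in> FA j (int n - 1) \<Longrightarrow> \<beta> a = 0" "\<beta> \<one>\<^bsub>A j\<^esub> = 0" "\<beta> y = 1"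
    by (rule top_functional[OF ij(2) Wj_def y yW]) (rule that)
  have low: "\<pi> (\<iota> i x) (\<iota> j y) \<in> FT (int m + int n - 1)"
    by (intro bracket_filtered \<iota>_filtration ij xm yn)
  have "\<exists>c0 c1 c2. P = c0 \<odot>\<^bsub>S\<^esub> \<one>\<^bsub>S\<^esub> \<oplus>\<^bsub>S\<^esub> c1 \<odot>\<^bsub>S\<^esub> emb i x \<oplus>\<^bsub>S\<^esub> c2 \<odot>\<^bsub>S\<^esub> emb j y"
  proof -
    obtain \<psi> where \<psi>: "\<psi> \<in> lin_map S base_alg"
      "\<And>a b. a \<in> carrier (A i) \<Longrightarrow> b \<in> carrier (A j) \<Longrightarrow> \<psi> (E i j a b) = \<alpha> a * \<beta> b"
      "\<And>t. t \<in> FT (int m + int n - 1) \<Longrightarrow> \<psi> (abel t) = 0"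
      by (rule abel_filtration_functional[OF ij nt(1) \<alpha>(1,2) \<beta>(1,2)], assumption+) (rule that)
    have ev: "\<psi> \<one>\<^bsub>S\<^esub> = 0" "\<psi> (emb i x) = 0" "\<psi> (emb j y) = 0" "\<psi> (emb i x \<otimes>\<^bsub>S\<^esub> emb j y) = 1"
      using x y \<alpha> \<beta> by (simp_all add: E_one[OF ij] \<psi>(2) E_mult[OF ij])
    have "\<psi> P = 0" unfolding P_def br_def by (rule \<psi>(3)[OF low])
    have Pc[simp]: "P \<in> carrier S" "emb i x \<in> carrier S" "emb j y \<in> carrier S" using ij x y by (simp_all add: P_def)
    have "\<psi> (emb j y \<otimes>\<^bsub>S\<^esub> (\<one>\<^bsub>S\<^esub> \<otimes>\<^bsub>S\<^esub> P)) \<odot>\<^bsub>S\<^esub> emb i x \<oplus>\<^bsub>S\<^esub> \<psi> (emb i x \<otimes>\<^bsub>S\<^esub> (\<one>\<^bsub>S\<^esub> \<otimes>\<^bsub>S\<^esub> P)) \<odot>\<^bsub>S\<^esub> emb j y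
        \<oplus>\<^bsub>S\<^esub> \<psi> (emb i x \<otimes>\<^bsub>S\<^esub> emb j y) \<odot>\<^bsub>S\<^esub> (P \<otimes>\<^bsub>S\<^esub> \<one>\<^bsub>S\<^esub>) \<oplus>\<^bsub>S\<^esub> \<psi> \<one>\<^bsub>S\<^esub> \<odot>\<^bsub>S\<^esub> (P \<otimes>\<^bsub>S\<^esub> \<one>\<^bsub>S\<^esub> \<otimes>\<^bsub>S\<^esub> (emb i x \<otimes>\<^bsub>S\<^esub> emb j y))
      = \<psi> (emb i x \<otimes>\<^bsub>S\<^esub> emb j y \<otimes>\<^bsub>S\<^esub> (\<one>\<^bsub>S\<^esub> \<otimes>\<^bsub>S\<^esub> P)) \<odot>\<^bsub>S\<^esub> \<one>\<^bsub>S\<^esub> \<oplus>\<^bsub>S\<^esub> \<psi> (\<one>\<^bsub>S\<^esub> \<otimes>\<^bsub>S\<^esub> P) \<odot>\<^bsub>S\<^esub> (emb i x \<otimes>\<^bsub>S\<^esub> emb j y)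
        \<oplus>\<^bsub>S\<^esub> \<psi> (emb j y) \<odot>\<^bsub>S\<^esub> (P \<otimes>\<^bsub>S\<^esub> \<one>\<^bsub>S\<^esub> \<otimes>\<^bsub>S\<^esub> emb i x) \<oplus>\<^bsub>S\<^esub> \<psi> (emb i x) \<odot>\<^bsub>S\<^esub> (P \<otimes>\<^bsub>S\<^esub> \<one>\<^bsub>S\<^esub> \<otimes>\<^bsub>S\<^esub> emb j y)"
      by (rule bracket_star[OF ij(2) y y ij(1,3) x ij(1,3) x T.one_closed \<psi>(1)]) (simp_all add: abel_simps P_def)
    \<comment> \<open>\<psi> = \<alpha> \<otimes> \<beta> takes the value 1 at xy, and it kills P
      for degree reasons. Hence P appears alone in the rigidity identity, next to multiples of 1, x
      and y.\<close>
    then have eq: "\<psi> (emb j y \<otimes>\<^bsub>S\<^esub> P) \<odot>\<^bsub>S\<^esub> emb i x \<oplus>\<^bsub>S\<^esub> \<psi> (emb i x \<otimes>\<^bsub>S\<^esub> P) \<odot>\<^bsub>S\<^esub> emb j y \<oplus>\<^bsub>S\<^esub> P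
        = \<psi> (emb i x \<otimes>\<^bsub>S\<^esub> emb j y \<otimes>\<^bsub>S\<^esub> P) \<odot>\<^bsub>S\<^esub> \<one>\<^bsub>S\<^esub>"
      using \<open>\<psi> P = 0\<close> by (simp add: ev)
    let ?L = "\<psi> (emb j y \<otimes>\<^bsub>S\<^esub> P) \<odot>\<^bsub>S\<^esub> emb i x \<oplus>\<^bsub>S\<^esub> \<psi> (emb i x \<otimes>\<^bsub>S\<^esub> P) \<odot>\<^bsub>S\<^esub> emb j y"
    have "P = \<ominus>\<^bsub>S\<^esub> ?L \<oplus>\<^bsub>S\<^esub> (?L \<oplus>\<^bsub>S\<^esub> P)" by (subst S.r_neg1) simp_all
    also have "\<dots> = \<psi> (emb i x \<otimes>\<^bsub>S\<^esub> emb j y \<otimes>\<^bsub>S\<^esub> P) \<odot>\<^bsub>S\<^esub> \<one>\<^bsub>S\<^esub> \<oplus>\<^bsub>S\<^esub> (- \<psi> (emb j y \<otimes>\<^bsub>S\<^esub> P)) \<odot>\<^bsub>S\<^esub> emb i x \<oplus>\<^bsub>S\<^esub> (- \<psi> (emb i x \<otimes>\<^bsub>S\<^esub> P)) \<odot>\<^bsub>S\<^esub> emb j y"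
      unfolding eq by (simp add: S.minus_add S.scale_uminus_left S.a_ac)
    finally show ?thesis by blast
  qed
  then obtain c0 c1 c2 where P: "br i x j y = c0 \<odot>\<^bsub>S\<^esub> \<one>\<^bsub>S\<^esub> \<oplus>\<^bsub>S\<^esub> c1 \<odot>\<^bsub>S\<^esub> emb i x \<oplus>\<^bsub>S\<^esub> c2 \<odot>\<^bsub>S\<^esub> emb j y" unfolding P_def by blast
  note K = affine_bracket_constant[OF ij x y nz P]
  have third: "\<exists>r. z = r \<odot>\<^bsub>A l\<^esub> \<one>\<^bsub>A l\<^esub>" if "l \<in> I" "l \<noteq> i" "l \<noteq> j" "z \<in> carrier (A l)" for l z
    by (rule constant_bracket_third_trivial[OF ij x y nz K(1) that])
  have scalar: "\<exists>r. \<iota> l a = r \<odot>\<^bsub>T\<^esub> \<one>\<^bsub>T\<^esub>" if "l \<in> I" "\<exists>r. a = r \<odot>\<^bsub>A l\<^esub> \<one>\<^bsub>A l\<^esub>" for l a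
    using that lin_mapD(3)[OF \<iota>_lin[OF that(1)] alg_closed(1)[OF that(1)]] alg_homD(2)[OF \<iota>_hom[OF that(1)]] by metis
  have scalar_in: "r \<odot>\<^bsub>T\<^esub> \<one>\<^bsub>T\<^esub> \<in> \<iota> l ` carrier (A l)" if "l \<in> I" for l r
    using that lin_mapD(3)[OF \<iota>_lin[OF that(1)] alg_closed(1)[OF that(1)], of r] alg_homD(2)[OF \<iota>_hom[OF that(1)]] alg_closed[OF that] by (metis image_eqI)
  \<comment> \<open>In A_i = k + kx the coefficient of x is read off by \<alpha>, which vanishes
    below degree m.\<close>
  have low_i: "\<exists>r. a = r \<odot>\<^bsub>A i\<^esub> \<one>\<^bsub>A i\<^esub>" if a: "a \<in> FA i (int m - 1)" for a
  proof -
    obtain r s where rs: "a = r \<odot>\<^bsub>A i\<^esub> \<one>\<^bsub>A i\<^esub> \<oplus>\<^bsub>A i\<^esub> s \<odot>\<^bsub>A i\<^esub> x" using K(5) Ai.submodD(1)[OF sub(1) a] by blast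
    have "\<alpha> a = s" using x \<alpha> by (simp add: rs lin_mapD[OF \<alpha>(1), simplified])
    then show ?thesis using rs x \<alpha>(2)[OF a] by auto
  qed
  have low_j: "\<exists>r. a = r \<odot>\<^bsub>A j\<^esub> \<one>\<^bsub>A j\<^esub>" if a: "a \<in> FA j (int n - 1)" for a
  proof -
    obtain r s where rs: "a = r \<odot>\<^bsub>A j\<^esub> \<one>\<^bsub>A j\<^esub> \<oplus>\<^bsub>A j\<^esub> s \<odot>\<^bsub>A j\<^esub> y" using K(6) Aj.submodD(1)[OF sub(2) a] by blast
    have "\<beta> a = s" using y \<beta> by (simp add: rs lin_mapD[OF \<beta>(1), simplified])
    then show ?thesis using rs y \<beta>(2)[OF a] by auto
  qed
  have gen_deg: "g l u \<in> FA l (int k)" if "l \<in> I" "u \<in> X l" "d l u \<le> k" for l u k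
  proof -
    have "word_eval (A l) (g l) [u] \<in> FA l (int k)"
      using that by (intro word_in_filtration[OF alg gen_Pi]) auto
    then show ?thesis
      using that gen_closed[OF that(1,2)] Group.monoid.r_one[OF ring.is_monoid[OF ring_A[OF that(1)]]] by (simp add: word_eval_def)
  qed
  have letter_deg: "d l u \<le> deg_at l w" if "(l, u) \<in> set w" for l u w
  proof -
    have "u \<in> set (part l w)" using that by (force simp: part_def)
    then show ?thesis unfolding deg_at_def by (intro member_le_sum_list) auto
  qed
  \<comment> \<open>So far the bracket is a constant only in S. To find it in T, take a word of its
    degree: at i or at j the degree is so low that all letters there are scalars, and letters of
    third indices are scalars anyway. So the word lies in the image of a single A_j or A_i.\<close>
  define WT where "WT = {\<iota> i a \<oplus>\<^bsub>T\<^esub> \<iota> j b | a b. a \<in> carrier (A i) \<and> b \<in> carrier (A j)}"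
  note li = lin_mapD[OF \<iota>_lin[OF ij(1)]] lin_map_zero_minus(1)[OF \<iota>_lin[OF ij(1)] alg[OF ij(1)] k_algebra_T]
  note lj = lin_mapD[OF \<iota>_lin[OF ij(2)]] lin_map_zero_minus(1)[OF \<iota>_lin[OF ij(2)] alg[OF ij(2)] k_algebra_T]
  have WTI: "\<iota> i a \<in> WT" "\<iota> j b \<in> WT" if "a \<in> carrier (A i)" "b \<in> carrier (A j)" for a b
  proof -
    have "\<iota> i a = \<iota> i a \<oplus>\<^bsub>T\<^esub> \<iota> j \<zero>\<^bsub>A j\<^esub>" "\<iota> j b = \<iota> i \<zero>\<^bsub>A i\<^esub> \<oplus>\<^bsub>T\<^esub> \<iota> j b" using that ij by (simp_all add: li lj)
    then show "\<iota> i a \<in> WT" "\<iota> j b \<in> WT" unfolding WT_def using that by blast+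
  qed
  have WT: "submodule WT field_ring T"
  proof (rule T.submodI)
    show "WT \<subseteq> carrier T" using ij by (auto simp: WT_def)
    show "\<zero>\<^bsub>T\<^esub> \<in> WT" using WTI(1)[OF Ai.zero_closed Aj.zero_closed] by (simp add: li)
    show "u \<oplus>\<^bsub>T\<^esub> v \<in> WT" if uv: "u \<in> WT" "v \<in> WT" for u v
    proof -
      obtain a b a' b' where *: "u = \<iota> i a \<oplus>\<^bsub>T\<^esub> \<iota> j b" "v = \<iota> i a' \<oplus>\<^bsub>T\<^esub> \<iota> j b'" "a \<in> carrier (A i)" "a' \<in> carrier (A i)"
        "b \<in> carrier (A j)" "b' \<in> carrier (A j)" using uv unfolding WT_def by blast
      then have "u \<oplus>\<^bsub>T\<^esub> v = \<iota> i (a \<oplus>\<^bsub>A i\<^esub> a') \<oplus>\<^bsub>T\<^esub> \<iota> j (b \<oplus>\<^bsub>A j\<^esub> b')" using ij by (simp add: li lj T.a_ac)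
      then show ?thesis unfolding WT_def using * Ai.a_closed Aj.a_closed by blast
    qed
    show "r \<odot>\<^bsub>T\<^esub> u \<in> WT" if u: "u \<in> WT" for r u
    proof -
      obtain a b where *: "u = \<iota> i a \<oplus>\<^bsub>T\<^esub> \<iota> j b" "a \<in> carrier (A i)" "b \<in> carrier (A j)" using u unfolding WT_def by blast
      then have "r \<odot>\<^bsub>T\<^esub> u = \<iota> i (r \<odot>\<^bsub>A i\<^esub> a) \<oplus>\<^bsub>T\<^esub> \<iota> j (r \<odot>\<^bsub>A j\<^esub> b)" using ij by (simp add: li lj T.scale_add_right)
      then show ?thesis unfolding WT_def using * Ai.scale_closed Aj.scale_closed by blast
    qed
  qed
  have "FT (int m + int n - 1) \<subseteq> WT"
  proof (rule FT_least[OF WT])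
    fix w assume w: "set w \<subseteq> Y" "int (deg w) \<le> int m + int n - 1"
    have "(\<Sum>l\<in>{i, j}. deg_at l w) \<le> deg w" by (rule deg_at_sum) simp
    then consider "int (deg_at i w) \<le> int m - 1" | "int (deg_at j w) \<le> int n - 1" using ij w(2) by simp linarith
    then show "word_eval T G w \<in> WT"
    proof cases
      case 1
      have "word_eval T G w \<in> \<iota> j ` carrier (A j)"
      proof (rule word_in_coordinate[OF ij(2) w(1)])
        fix v assume v: "v \<in> set w"
        obtain l u where lu: "v = (l, u)" "l \<in> I" "u \<in> X l" using v w(1) by blast
        consider "l = j" | "l = i" | "l \<noteq> i" "l \<noteq> j" by blast
        then show "G v \<in> \<iota> j ` carrier (A j)"
        proof cases
          case 1
          then show ?thesis using lu gen_closed by auto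
        next
          case 2
          have le: "d i u \<le> m - 1" "int (m - 1) = int m - 1"
            using lu 2 letter_deg[of i u w] v \<open>int (deg_at i w) \<le> int m - 1\<close> by auto
          have "g i u \<in> FA i (int (m - 1))" by (rule gen_deg) (use lu 2 le in auto)
          then have "\<exists>r. g i u = r \<odot>\<^bsub>A i\<^esub> \<one>\<^bsub>A i\<^esub>" unfolding le(2) by (rule low_i)
          then show ?thesis using scalar[OF ij(1)] scalar_in[OF ij(2)] lu 2 by force
        next
          case 3
          then show ?thesis using scalar[OF lu(2) third[OF lu(2) 3 gen_closed[OF lu(2,3)]]] scalar_in[OF ij(2)] lu by force
        qed
      qed
      then show ?thesis using WTI(2)[OF Ai.zero_closed] by (elim imageE) simp
    next
      case 2
      have "word_eval T G w \<in> \<iota> i ` carrier (A i)"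
      proof (rule word_in_coordinate[OF ij(1) w(1)])
        fix v assume v: "v \<in> set w"
        obtain l u where lu: "v = (l, u)" "l \<in> I" "u \<in> X l" using v w(1) by blast
        consider "l = i" | "l = j" | "l \<noteq> i" "l \<noteq> j" by blast
        then show "G v \<in> \<iota> i ` carrier (A i)"
        proof cases
          case 1
          then show ?thesis using lu gen_closed by auto
        next
          case l: 2
          have le: "d j u \<le> n - 1" "int (n - 1) = int n - 1"
            using lu l letter_deg[of j u w] v \<open>int (deg_at j w) \<le> int n - 1\<close> by auto
          have "g j u \<in> FA j (int (n - 1))" by (rule gen_deg) (use lu l le in auto)
          then have "\<exists>r. g j u = r \<odot>\<^bsub>A j\<^esub> \<one>\<^bsub>A j\<^esub>" unfolding le(2) by (rule low_j)
          then show ?thesis using scalar[OF ij(2)] scalar_in[OF ij(1)] lu l by force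
        next
          case 3
          then show ?thesis using scalar[OF lu(2) third[OF lu(2) 3 gen_closed[OF lu(2,3)]]] scalar_in[OF ij(1)] lu by force
        qed
      qed
      then show ?thesis using WTI(1)[OF _ Aj.zero_closed] by (elim imageE) simp
    qed
  qed
  then obtain a b where ab: "\<pi> (\<iota> i x) (\<iota> j y) = \<iota> i a \<oplus>\<^bsub>T\<^esub> \<iota> j b" "a \<in> carrier (A i)" "b \<in> carrier (A j)"
    using low unfolding WT_def by blast
  obtain r s r' s' where rs: "a = r \<odot>\<^bsub>A i\<^esub> \<one>\<^bsub>A i\<^esub> \<oplus>\<^bsub>A i\<^esub> s \<odot>\<^bsub>A i\<^esub> x" "b = r' \<odot>\<^bsub>A j\<^esub> \<one>\<^bsub>A j\<^esub> \<oplus>\<^bsub>A j\<^esub> s' \<odot>\<^bsub>A j\<^esub> y"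
    using K(5)[OF ab(2)] K(6)[OF ab(3)] by blast
  obtain e where e: "e \<in> lin_map (A i) base_alg" "e \<one>\<^bsub>A i\<^esub> = 1" by (rule Ai.unit_functional[OF nt(1)[OF ij(1)]])
  obtain e' where e': "e' \<in> lin_map (A j) base_alg" "e' \<one>\<^bsub>A j\<^esub> = 1" by (rule Aj.unit_functional[OF nt(1)[OF ij(2)]])
  have abel_eq: "emb i a \<oplus>\<^bsub>S\<^esub> emb j b = c0 \<odot>\<^bsub>S\<^esub> \<one>\<^bsub>S\<^esub>"
    using K(1) ab ij by (simp add: br_def abel_simps abel)
  \<comment> \<open>Abelianizing gives the constant c0, and \<alpha> \<otimes> e' reads off the
    coefficient of x.\<close>
  have s: "s = 0"
  proof -
    obtain \<chi> where \<chi>: "\<chi> \<in> lin_map S base_alg" "\<And>a b. a \<in> carrier (A i) \<Longrightarrow> b \<in> carrier (A j) \<Longrightarrow> \<chi> (E i j a b) = \<alpha> a * e' b"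
      by (rule E_functional[OF ij nt(1) \<alpha>(1) e'(1)], assumption) (rule that)
    have "\<chi> (emb i a \<oplus>\<^bsub>S\<^esub> emb j b) = s" "\<chi> (c0 \<odot>\<^bsub>S\<^esub> \<one>\<^bsub>S\<^esub>) = 0"
      using ab(2,3) x \<alpha> e' ij by (simp_all add: lin_mapD[OF \<chi>(1), simplified] E_one[OF ij] \<chi>(2) E_closed[OF ij])
        (simp add: rs(1) lin_mapD[OF \<alpha>(1), simplified])
    then show ?thesis using abel_eq by simp
  qed
  have s': "s' = 0"
  proof -
    obtain \<chi> where \<chi>: "\<chi> \<in> lin_map S base_alg" "\<And>a b. a \<in> carrier (A i) \<Longrightarrow> b \<in> carrier (A j) \<Longrightarrow> \<chi> (E i j a b) = e a * \<beta> b"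
      by (rule E_functional[OF ij nt(1) e(1) \<beta>(1)], assumption) (rule that)
    have "\<chi> (emb i a \<oplus>\<^bsub>S\<^esub> emb j b) = s'" "\<chi> (c0 \<odot>\<^bsub>S\<^esub> \<one>\<^bsub>S\<^esub>) = 0"
      using ab(2,3) y \<beta> e ij by (simp_all add: lin_mapD[OF \<chi>(1), simplified] E_one[OF ij] \<chi>(2) E_closed[OF ij])
        (simp add: rs(2) lin_mapD[OF \<beta>(1), simplified])
    then show ?thesis using abel_eq by simp
  qed
  have "\<pi> (\<iota> i x) (\<iota> j y) = (r + r') \<odot>\<^bsub>T\<^esub> \<one>\<^bsub>T\<^esub>"
    using x y by (simp add: ab(1) rs s s' li lj alg_homD(2)[OF \<iota>_hom[OF ij(1)]] alg_homD(2)[OF \<iota>_hom[OF ij(2)]] T.scale_add_left)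
  from that[OF ij x y this K(2-6) third nt(3,4)] show thesis .
qed

end

text \<open>The multiplication rule of k[x]/(x^2 - p).\<close>

lemma (in k_algebra) quadratic_mult:
  assumes x: "x \<in> carrier A" and xx: "x \<otimes> x = p \<odot> \<one>"
  shows "(r \<odot> \<one> \<oplus> s \<odot> x) \<otimes> (r' \<odot> \<one> \<oplus> s' \<odot> x) = (r * r' + s * s' * p) \<odot> \<one> \<oplus> (r * s' + s * r') \<odot> x"
proof -
  have 1: "(r \<odot> \<one>) \<otimes> (r' \<odot> \<one>) = (r * r') \<odot> \<one>" "(r \<odot> \<one>) \<otimes> (s' \<odot> x) = (r * s') \<odot> x"
    "(s \<odot> x) \<otimes> (r' \<odot> \<one>) = (s * r') \<odot> x" "(s \<odot> x) \<otimes> (s' \<odot> x) = (s * s' * p) \<odot> \<one>"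
    using x by (simp_all add: smult_mult_left smult_mult_right xx mult_ac)
  show ?thesis
    using x by (simp add: l_distr r_distr 1 scale_add_left a_ac)
qed

section \<open>The isomorphism: vanishing brackets and the Clifford case\<close>

context filtered_splay
begin

text \<open>Commutators of letters vanish in S, so \<open>abel\<close> respects the relations of J
  as soon as the brackets vanish there too.\<close>

lemma iso_of_vanishing_bracket:
  assumes van: "\<And>i j a b. i \<in> I \<Longrightarrow> j \<in> I \<Longrightarrow> a \<in> carrier (A i) \<Longrightarrow> b \<in> carrier (A j) \<Longrightarrow> br i a j b = \<zero>\<^bsub>S\<^esub>"
  shows "k_module_iso (quot_alg T J) S"
proof (rule iso_of_retraction[OF generated_mod_J abel_lin _ abel_pure_prod])
  show "abel z = \<zero>\<^bsub>S\<^esub>" if z: "z \<in> J" for z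
  proof (rule bracket_hom[OF k_algebra_S abel(1) _ z])
    fix i a j b assume *: "i \<in> I" "a \<in> carrier (A i)" "j \<in> I" "b \<in> carrier (A j)"
    have "abel (\<iota> i a) \<otimes>\<^bsub>S\<^esub> abel (\<iota> j b) \<ominus>\<^bsub>S\<^esub> abel (\<iota> j b) \<otimes>\<^bsub>S\<^esub> abel (\<iota> i a) = \<zero>\<^bsub>S\<^esub>"
      using * abel_commutator[of "\<iota> i a" "\<iota> j b"] by (simp add: abel_simps)
    then show "abel (\<pi> (\<iota> i a) (\<iota> j b)) = abel (\<iota> i a) \<otimes>\<^bsub>S\<^esub> abel (\<iota> j b) \<ominus>\<^bsub>S\<^esub> abel (\<iota> j b) \<otimes>\<^bsub>S\<^esub> abel (\<iota> i a)"
      using van[OF *(1,3,2,4)] by (simp add: br_def)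
  qed
qed

text \<open>The exceptional case in characteristic two: \<open>T / J\<close> is a Clifford algebra on \<open>x\<close> and \<open>y\<close>,
  represented by letting \<open>x\<close> act on \<open>S\<close> by multiplication and \<open>y\<close> by \<open>y + c \<partial>/\<partial>x\<close>; the matrices
  are taken with respect to the basis \<open>1, x\<close>.\<close>

lemma iso_of_constant_bracket:
  assumes ij: "i \<in> I" "j \<in> I" "i \<noteq> j" and lt: "(i, j) \<in> ltI" and x: "x \<in> carrier (A i)" and y: "y \<in> carrier (A j)"
    and bracket: "\<pi> (\<iota> i x) (\<iota> j y) = c \<odot>\<^bsub>T\<^esub> \<one>\<^bsub>T\<^esub>" and two: "(2 :: 'k) = 0"
    and xx: "x \<otimes>\<^bsub>A i\<^esub> x = p \<odot>\<^bsub>A i\<^esub> \<one>\<^bsub>A i\<^esub>" and yy: "y \<otimes>\<^bsub>A j\<^esub> y = q \<odot>\<^bsub>A j\<^esub> \<one>\<^bsub>A j\<^esub>"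
    and spx: "\<And>w. w \<in> carrier (A i) \<Longrightarrow> \<exists>r s. w = r \<odot>\<^bsub>A i\<^esub> \<one>\<^bsub>A i\<^esub> \<oplus>\<^bsub>A i\<^esub> s \<odot>\<^bsub>A i\<^esub> x"
    and spy: "\<And>w. w \<in> carrier (A j) \<Longrightarrow> \<exists>r s. w = r \<odot>\<^bsub>A j\<^esub> \<one>\<^bsub>A j\<^esub> \<oplus>\<^bsub>A j\<^esub> s \<odot>\<^bsub>A j\<^esub> y"
    and triv: "\<And>l z. l \<in> I \<Longrightarrow> l \<noteq> i \<Longrightarrow> l \<noteq> j \<Longrightarrow> z \<in> carrier (A l) \<Longrightarrow> \<exists>r. z = r \<odot>\<^bsub>A l\<^esub> \<one>\<^bsub>A l\<^esub>"
    and nx: "\<And>r. x \<noteq> r \<odot>\<^bsub>A i\<^esub> \<one>\<^bsub>A i\<^esub>" and ny: "\<And>r. y \<noteq> r \<odot>\<^bsub>A j\<^esub> \<one>\<^bsub>A j\<^esub>"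
  shows "k_module_iso (quot_alg T J) S"
proof -
  interpret Ai: k_algebra "A i" by (rule alg[OF ij(1)])
  interpret Aj: k_algebra "A j" by (rule alg[OF ij(2)])
  interpret M: k_algebra "mat2 S" by (rule k_algebra_mat2[OF k_algebra_S])
  have dbl: "u + u = (0 :: 'k)" for u using two by (metis mult_2 mult_zero_left)
  then have neg: "- u = (u :: 'k)" for u by (metis add_eq_0_iff)
  obtain \<alpha> where \<alpha>: "\<alpha> \<in> lin_map (A i) base_alg" "\<alpha> \<one>\<^bsub>A i\<^esub> = 0" "\<alpha> x = 1" by (rule Ai.separating_functional[OF x nx]) (rule that)
  obtain \<beta> where \<beta>: "\<beta> \<in> lin_map (A j) base_alg" "\<beta> \<one>\<^bsub>A j\<^esub> = 0" "\<beta> y = 1" by (rule Aj.separating_functional[OF y ny]) (rule that)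
  note al = lin_mapD[OF \<alpha>(1), simplified] and be = lin_mapD[OF \<beta>(1), simplified]
  define un where "un = \<one>\<^bsub>S\<^esub>"
  define Xv where "Xv = emb i x"
  define Yv where "Yv = emb j y"
  have [simp]: "un \<in> carrier S" "Xv \<in> carrier S" "Yv \<in> carrier S" using ij x y by (simp_all add: un_def Xv_def Yv_def)
  have o1[simp]: "un \<otimes>\<^bsub>S\<^esub> s = s" "s \<otimes>\<^bsub>S\<^esub> un = s" if "s \<in> carrier S" for s using that by (simp_all add: un_def)
  note ei = lin_mapD[OF alg_hom_lin[OF emb_hom[OF ij(1)]]] alg_homD[OF emb_hom[OF ij(1)], folded un_def]
  note ej = lin_mapD[OF alg_hom_lin[OF emb_hom[OF ij(2)]]] alg_homD[OF emb_hom[OF ij(2)], folded un_def]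
  have XX: "Xv \<otimes>\<^bsub>S\<^esub> Xv = p \<odot>\<^bsub>S\<^esub> un" and YY: "Yv \<otimes>\<^bsub>S\<^esub> Yv = q \<odot>\<^bsub>S\<^esub> un"
    using ei(4)[OF x x] ej(4)[OF y y] by (simp_all add: Xv_def Yv_def xx yy ei ej)
  \<comment> \<open>For a = r + s x the value of \<alpha> is s, and the image of a minus s x is r.
    This is the matrix of multiplication by a in the basis 1, x, and it stays meaningful without
    naming r and s.\<close>
  define Rx where "Rx a = (emb i a \<ominus>\<^bsub>S\<^esub> \<alpha> a \<odot>\<^bsub>S\<^esub> Xv, (\<alpha> a * p) \<odot>\<^bsub>S\<^esub> un, \<alpha> a \<odot>\<^bsub>S\<^esub> un, emb i a \<ominus>\<^bsub>S\<^esub> \<alpha> a \<odot>\<^bsub>S\<^esub> Xv)" for a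
  \<comment> \<open>The derivation sends x to 1 and 1 to 0, hence the single corner entry. It
    squares to zero, and 2 = 0 removes the cross term with y, so y + c \<partial>/\<partial>x still
    squares to q.\<close>
  define Ry where "Ry a = (emb j a, (c * \<beta> a) \<odot>\<^bsub>S\<^esub> un, \<zero>\<^bsub>S\<^esub>, emb j a)" for a
  define R where "R l a = (if l = i then Rx a else if l = j then Ry a else (emb l a, \<zero>\<^bsub>S\<^esub>, \<zero>\<^bsub>S\<^esub>, emb l a))" for l a
  have Rx: "Rx (r \<odot>\<^bsub>A i\<^esub> \<one>\<^bsub>A i\<^esub> \<oplus>\<^bsub>A i\<^esub> s \<odot>\<^bsub>A i\<^esub> x) = (r \<odot>\<^bsub>S\<^esub> un, (s * p) \<odot>\<^bsub>S\<^esub> un, s \<odot>\<^bsub>S\<^esub> un, r \<odot>\<^bsub>S\<^esub> un)" for r s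
    using x by (simp add: Rx_def ei al \<alpha>(2,3) Xv_def[symmetric] a_minus_def S.a_assoc S.r_neg)
  have Ry: "Ry (r \<odot>\<^bsub>A j\<^esub> \<one>\<^bsub>A j\<^esub> \<oplus>\<^bsub>A j\<^esub> s \<odot>\<^bsub>A j\<^esub> y) =
      (r \<odot>\<^bsub>S\<^esub> un \<oplus>\<^bsub>S\<^esub> s \<odot>\<^bsub>S\<^esub> Yv, (c * s) \<odot>\<^bsub>S\<^esub> un, \<zero>\<^bsub>S\<^esub>, r \<odot>\<^bsub>S\<^esub> un \<oplus>\<^bsub>S\<^esub> s \<odot>\<^bsub>S\<^esub> Yv)" for r s
    using y by (simp add: Ry_def ej be \<beta>(2,3) Yv_def[symmetric])
  note sc = S.smult_mult_left S.smult_mult_right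
  have hom: "R l \<in> alg_hom (A l) (mat2 S)" if l: "l \<in> I" for l
  proof -
    consider "l = i" | "l = j" | "l \<noteq> i" "l \<noteq> j" by blast
    then show ?thesis
    proof cases
      case 1
      have "Rx \<in> alg_hom (A i) (mat2 S)"
      proof (rule alg_homI)
        show "Rx \<in> lin_map (A i) (mat2 S)"
        proof (rule lin_mapI)
          show "Rx a \<in> carrier (mat2 S)" if "a \<in> carrier (A i)" for a using that ij by (simp add: Rx_def)
          show "Rx (a \<oplus>\<^bsub>A i\<^esub> b) = Rx a \<oplus>\<^bsub>mat2 S\<^esub> Rx b" if "a \<in> carrier (A i)" "b \<in> carrier (A i)" for a b
            using that ij by (simp add: Rx_def ei al S.scale_add_left distrib_right a_minus_def S.minus_add S.a_ac)
          show "Rx (r \<odot>\<^bsub>A i\<^esub> a) = r \<odot>\<^bsub>mat2 S\<^esub> Rx a" if "a \<in> carrier (A i)" for a r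
            using that ij by (simp add: Rx_def ei al a_minus_def S.scale_add_right S.minus_scale mult.assoc)
        qed
        show "Rx (a \<otimes>\<^bsub>A i\<^esub> b) = Rx a \<otimes>\<^bsub>mat2 S\<^esub> Rx b" if ab: "a \<in> carrier (A i)" "b \<in> carrier (A i)" for a b
        proof -
          obtain r s r' s' where rs: "a = r \<odot>\<^bsub>A i\<^esub> \<one>\<^bsub>A i\<^esub> \<oplus>\<^bsub>A i\<^esub> s \<odot>\<^bsub>A i\<^esub> x" "b = r' \<odot>\<^bsub>A i\<^esub> \<one>\<^bsub>A i\<^esub> \<oplus>\<^bsub>A i\<^esub> s' \<odot>\<^bsub>A i\<^esub> x"
            using spx[OF ab(1)] spx[OF ab(2)] by blast
          have "a \<otimes>\<^bsub>A i\<^esub> b = (r * r' + s * s' * p) \<odot>\<^bsub>A i\<^esub> \<one>\<^bsub>A i\<^esub> \<oplus>\<^bsub>A i\<^esub> (r * s' + s * r') \<odot>\<^bsub>A i\<^esub> x"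
            unfolding rs by (rule Ai.quadratic_mult[OF x xx])
          then show ?thesis unfolding rs
            by (simp add: Rx sc S.scale_add_left[symmetric] algebra_simps)
        qed
        show "Rx \<one>\<^bsub>A i\<^esub> = \<one>\<^bsub>mat2 S\<^esub>" by (simp add: Rx_def ei \<alpha> a_minus_def) (simp add: un_def)
      qed
      moreover have "R l = Rx" using 1 by (simp add: R_def fun_eq_iff)
      ultimately show ?thesis using 1 by simp
    next
      case 2
      have "Ry \<in> alg_hom (A j) (mat2 S)"
      proof (rule alg_homI)
        show "Ry \<in> lin_map (A j) (mat2 S)"
        proof (rule lin_mapI)
          show "Ry a \<in> carrier (mat2 S)" if "a \<in> carrier (A j)" for a using that ij by (simp add: Ry_def)
          show "Ry (a \<oplus>\<^bsub>A j\<^esub> b) = Ry a \<oplus>\<^bsub>mat2 S\<^esub> Ry b" if "a \<in> carrier (A j)" "b \<in> carrier (A j)" for a b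
            using that ij by (simp add: Ry_def ej be S.scale_add_left distrib_left)
          show "Ry (r \<odot>\<^bsub>A j\<^esub> a) = r \<odot>\<^bsub>mat2 S\<^esub> Ry a" if "a \<in> carrier (A j)" for a r
            using that ij by (simp add: Ry_def ej be mult.left_commute)
        qed
        show "Ry (a \<otimes>\<^bsub>A j\<^esub> b) = Ry a \<otimes>\<^bsub>mat2 S\<^esub> Ry b" if ab: "a \<in> carrier (A j)" "b \<in> carrier (A j)" for a b
        proof -
          obtain r s r' s' where rs: "a = r \<odot>\<^bsub>A j\<^esub> \<one>\<^bsub>A j\<^esub> \<oplus>\<^bsub>A j\<^esub> s \<odot>\<^bsub>A j\<^esub> y" "b = r' \<odot>\<^bsub>A j\<^esub> \<one>\<^bsub>A j\<^esub> \<oplus>\<^bsub>A j\<^esub> s' \<odot>\<^bsub>A j\<^esub> y"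
            using spy[OF ab(1)] spy[OF ab(2)] by blast
          define u v where uv: "u = r \<odot>\<^bsub>S\<^esub> un \<oplus>\<^bsub>S\<^esub> s \<odot>\<^bsub>S\<^esub> Yv" "v = r' \<odot>\<^bsub>S\<^esub> un \<oplus>\<^bsub>S\<^esub> s' \<odot>\<^bsub>S\<^esub> Yv"
          have u: "u \<in> carrier S" "v \<in> carrier S" by (simp_all add: uv)
          have prod: "a \<otimes>\<^bsub>A j\<^esub> b = (r * r' + s * s' * q) \<odot>\<^bsub>A j\<^esub> \<one>\<^bsub>A j\<^esub> \<oplus>\<^bsub>A j\<^esub> (r * s' + s * r') \<odot>\<^bsub>A j\<^esub> y"
            unfolding rs by (rule Aj.quadratic_mult[OF y yy])
          have 1: "(r * r' + s * s' * q) \<odot>\<^bsub>S\<^esub> un \<oplus>\<^bsub>S\<^esub> (r * s' + s * r') \<odot>\<^bsub>S\<^esub> Yv = u \<otimes>\<^bsub>S\<^esub> v"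
            unfolding uv un_def by (rule S.quadratic_mult[symmetric]) (use YY in \<open>simp_all add: un_def\<close>)
          have "(c * s') \<odot>\<^bsub>S\<^esub> u \<oplus>\<^bsub>S\<^esub> (c * s) \<odot>\<^bsub>S\<^esub> v = (c * (r * s' + s * r')) \<odot>\<^bsub>S\<^esub> un \<oplus>\<^bsub>S\<^esub> ((c * s * s') \<odot>\<^bsub>S\<^esub> Yv \<oplus>\<^bsub>S\<^esub> (c * s * s') \<odot>\<^bsub>S\<^esub> Yv)"
            by (simp add: uv S.scale_add_right S.scale_add_left distrib_left S.a_ac mult_ac)
          \<comment> \<open>Characteristic two is what makes the assignment multiplicative: the two
            corner terms with y cancel.\<close>
          moreover have "(c * s * s') \<odot>\<^bsub>S\<^esub> Yv \<oplus>\<^bsub>S\<^esub> (c * s * s') \<odot>\<^bsub>S\<^esub> Yv = \<zero>\<^bsub>S\<^esub>"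
            using S.scale_add_left[of Yv "c * s * s'" "c * s * s'", symmetric] unfolding dbl by simp
          ultimately have 2: "(c * (r * s' + s * r')) \<odot>\<^bsub>S\<^esub> un = (c * s') \<odot>\<^bsub>S\<^esub> u \<oplus>\<^bsub>S\<^esub> (c * s) \<odot>\<^bsub>S\<^esub> v" by simp
          show ?thesis unfolding prod Ry 1 2 unfolding rs Ry uv[symmetric] using u by (simp add: sc)
        qed
        show "Ry \<one>\<^bsub>A j\<^esub> = \<one>\<^bsub>mat2 S\<^esub>" by (simp add: Ry_def ej \<beta>) (simp add: un_def)
      qed
      moreover have "R l = Ry" using 2 ij by (simp add: R_def fun_eq_iff)
      ultimately show ?thesis using 2 by simp
    next
      case 3
      note el = lin_mapD[OF alg_hom_lin[OF emb_hom[OF l]]] alg_homD[OF emb_hom[OF l]]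
      have "(\<lambda>a. (emb l a, \<zero>\<^bsub>S\<^esub>, \<zero>\<^bsub>S\<^esub>, emb l a)) \<in> alg_hom (A l) (mat2 S)"
        by (intro alg_homI lin_mapI) (use l in \<open>auto simp: el\<close>)
      moreover have "R l = (\<lambda>a. (emb l a, \<zero>\<^bsub>S\<^esub>, \<zero>\<^bsub>S\<^esub>, emb l a))" using 3 by (simp add: R_def fun_eq_iff)
      ultimately show ?thesis by simp
    qed
  qed
  then obtain \<rho> where \<rho>: "\<rho> \<in> alg_hom T (mat2 S)" "\<And>l a. l \<in> I \<Longrightarrow> a \<in> carrier (A l) \<Longrightarrow> \<rho> (\<iota> l a) = R l a"
    using coproduct_universal[where I = I and A = A and h = R, OF alg M.k_algebra_axioms] by blast
  note rho = lin_mapD[OF alg_hom_lin[OF \<rho>(1)]] alg_homD[OF \<rho>(1)] lin_map_zero_minus[OF alg_hom_lin[OF \<rho>(1)] k_algebra_T M.k_algebra_axioms]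
  \<comment> \<open>The commutator of x with y + c \<partial>/\<partial>x is -c, which equals c in
    characteristic two.\<close>
  have main: "\<rho> (\<pi> (\<iota> i a) (\<iota> j b)) = \<rho> (\<iota> i a) \<otimes>\<^bsub>mat2 S\<^esub> \<rho> (\<iota> j b) \<ominus>\<^bsub>mat2 S\<^esub> \<rho> (\<iota> j b) \<otimes>\<^bsub>mat2 S\<^esub> \<rho> (\<iota> i a)"
    if ab: "a \<in> carrier (A i)" "b \<in> carrier (A j)" for a b
  proof -
    obtain r s r' s' where rs: "a = r \<odot>\<^bsub>A i\<^esub> \<one>\<^bsub>A i\<^esub> \<oplus>\<^bsub>A i\<^esub> s \<odot>\<^bsub>A i\<^esub> x" "b = r' \<odot>\<^bsub>A j\<^esub> \<one>\<^bsub>A j\<^esub> \<oplus>\<^bsub>A j\<^esub> s' \<odot>\<^bsub>A j\<^esub> y"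
      using spx[OF ab(1)] spy[OF ab(2)] by blast
    have "\<pi> (\<iota> i a) (\<iota> j b) = (s * s' * c) \<odot>\<^bsub>T\<^esub> \<one>\<^bsub>T\<^esub>"
      using ij x y unfolding rs
      by (simp add: lin_mapD[OF \<iota>_lin[OF ij(1)]] lin_mapD[OF \<iota>_lin[OF ij(2)]] alg_homD(2)[OF \<iota>_hom[OF ij(1)]] alg_homD(2)[OF \<iota>_hom[OF ij(2)]]
          P.add_left P.add_right P.smult_left P.smult_right P.one_left P.one_right P.closed bracket mult_ac)
    then have 1: "\<rho> (\<pi> (\<iota> i a) (\<iota> j b)) = ((s * s' * c) \<odot>\<^bsub>S\<^esub> un, \<zero>\<^bsub>S\<^esub>, \<zero>\<^bsub>S\<^esub>, (s * s' * c) \<odot>\<^bsub>S\<^esub> un)"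
      by (simp add: rho un_def)
    define v where "v = r' \<odot>\<^bsub>S\<^esub> un \<oplus>\<^bsub>S\<^esub> s' \<odot>\<^bsub>S\<^esub> Yv"
    have v: "v \<in> carrier S" by (simp add: v_def)
    have M1: "\<rho> (\<iota> i a) = (r \<odot>\<^bsub>S\<^esub> un, (s * p) \<odot>\<^bsub>S\<^esub> un, s \<odot>\<^bsub>S\<^esub> un, r \<odot>\<^bsub>S\<^esub> un)"
      using ij ab by (simp add: \<rho>(2) R_def) (simp add: rs Rx)
    have M2: "\<rho> (\<iota> j b) = (v, (c * s') \<odot>\<^bsub>S\<^esub> un, \<zero>\<^bsub>S\<^esub>, v)"
      using ij ab by (simp add: \<rho>(2) R_def) (simp add: rs Ry v_def)
    have P1: "\<rho> (\<iota> i a) \<otimes>\<^bsub>mat2 S\<^esub> \<rho> (\<iota> j b) = (r \<odot>\<^bsub>S\<^esub> v, (r * (c * s')) \<odot>\<^bsub>S\<^esub> un \<oplus>\<^bsub>S\<^esub> (s * p) \<odot>\<^bsub>S\<^esub> v, s \<odot>\<^bsub>S\<^esub> v, (s * (c * s')) \<odot>\<^bsub>S\<^esub> un \<oplus>\<^bsub>S\<^esub> r \<odot>\<^bsub>S\<^esub> v)"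
      unfolding M1 M2 using v by (simp add: sc mult_ac)
    have P2: "\<rho> (\<iota> j b) \<otimes>\<^bsub>mat2 S\<^esub> \<rho> (\<iota> i a) = (r \<odot>\<^bsub>S\<^esub> v \<oplus>\<^bsub>S\<^esub> (s * (c * s')) \<odot>\<^bsub>S\<^esub> un, (r * (c * s')) \<odot>\<^bsub>S\<^esub> un \<oplus>\<^bsub>S\<^esub> (s * p) \<odot>\<^bsub>S\<^esub> v, s \<odot>\<^bsub>S\<^esub> v, r \<odot>\<^bsub>S\<^esub> v)"
      unfolding M1 M2 using v by (simp add: sc S.a_comm mult_ac)
    have ng: "\<ominus>\<^bsub>S\<^esub> (t \<odot>\<^bsub>S\<^esub> w) = t \<odot>\<^bsub>S\<^esub> w" if "w \<in> carrier S" for t w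
      using S.scale_uminus_left[OF that, of t] by (simp only: neg)
    have c1: "u \<ominus>\<^bsub>S\<^esub> (u \<oplus>\<^bsub>S\<^esub> w) = \<ominus>\<^bsub>S\<^esub> w" "(w \<oplus>\<^bsub>S\<^esub> u) \<ominus>\<^bsub>S\<^esub> u = w" "u \<ominus>\<^bsub>S\<^esub> u = \<zero>\<^bsub>S\<^esub>"
      if "u \<in> carrier S" "w \<in> carrier S" for u w
      using that by (simp_all add: a_minus_def S.minus_add S.a_assoc S.r_neg S.r_neg2)
    show ?thesis unfolding 1 P1 P2 using v by (simp add: mat2_minus[OF k_algebra_S] c1 ng mult_ac)
  qed
  \<comment> \<open>Covers the remaining coordinate algebras: their letters are scalars in T, so
    their images commute with all matrices and their brackets vanish.\<close>
  have comm_scalar: "m \<otimes>\<^bsub>mat2 S\<^esub> (r \<odot>\<^bsub>mat2 S\<^esub> \<one>\<^bsub>mat2 S\<^esub>) = r \<odot>\<^bsub>mat2 S\<^esub> m" "(r \<odot>\<^bsub>mat2 S\<^esub> \<one>\<^bsub>mat2 S\<^esub>) \<otimes>\<^bsub>mat2 S\<^esub> m = r \<odot>\<^bsub>mat2 S\<^esub> m"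
    if "m \<in> carrier (mat2 S)" for m r
    using that M.smult_mult_left[OF M.one_closed that] M.smult_mult_right[OF that M.one_closed] M.l_one M.r_one by metis+
  have letters: "\<rho> (\<pi> (\<iota> l a) (\<iota> l' b)) = \<rho> (\<iota> l a) \<otimes>\<^bsub>mat2 S\<^esub> \<rho> (\<iota> l' b) \<ominus>\<^bsub>mat2 S\<^esub> \<rho> (\<iota> l' b) \<otimes>\<^bsub>mat2 S\<^esub> \<rho> (\<iota> l a)"
    if la: "l \<in> I" "a \<in> carrier (A l)" "l' \<in> I" "b \<in> carrier (A l')" for l a l' b
  proof -
    have cl: "\<iota> l a \<in> carrier T" "\<iota> l' b \<in> carrier T" using la by auto
    have rc: "\<rho> (\<iota> l a) \<in> carrier (mat2 S)" "\<rho> (\<iota> l' b) \<in> carrier (mat2 S)" using rho(1) cl by auto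
    have scalar: "\<exists>r. \<iota> k u = r \<odot>\<^bsub>T\<^esub> \<one>\<^bsub>T\<^esub>" if "k \<in> I" "k \<noteq> i" "k \<noteq> j" "u \<in> carrier (A k)" for k u
      using triv[OF that] lin_mapD(3)[OF \<iota>_lin[OF that(1)] alg_closed(1)[OF that(1)]] alg_homD(2)[OF \<iota>_hom[OF that(1)]] by metis
    consider "l = l'" | "l \<noteq> i" "l \<noteq> j" | "l' \<noteq> i" "l' \<noteq> j" | "l = i" "l' = j" | "l = j" "l' = i" by blast
    then show ?thesis
    proof cases
      case 1
      have "\<rho> (\<iota> l a) \<otimes>\<^bsub>mat2 S\<^esub> \<rho> (\<iota> l b) = \<rho> (\<iota> l b) \<otimes>\<^bsub>mat2 S\<^esub> \<rho> (\<iota> l a)"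
      proof -
        have b: "b \<in> carrier (A l)" using la 1 by simp
        show ?thesis
          using alg_homD(1)[OF hom[OF la(1)] la(2) b] alg_homD(1)[OF hom[OF la(1)] b la(2)] comm[OF la(1,2) b]
          by (simp add: \<rho>(2)[OF la(1,2)] \<rho>(2)[OF la(1) b])
      qed
      moreover have "\<pi> (\<iota> l a) (\<iota> l b) = \<zero>\<^bsub>T\<^esub>" using la 1 by (simp add: bracket_same)
      ultimately show ?thesis unfolding 1[symmetric] using M.m_closed[OF rc(2,1)] 1 by (simp add: rho(6) a_minus_def M.r_neg)
    next
      case 2
      then obtain r where r: "\<iota> l a = r \<odot>\<^bsub>T\<^esub> \<one>\<^bsub>T\<^esub>" using scalar la by blast
      have "\<pi> (\<iota> l a) (\<iota> l' b) = \<zero>\<^bsub>T\<^esub>" unfolding r using cl by (simp add: P.smult_left P.one_left)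
      moreover have "\<rho> (\<iota> l a) = r \<odot>\<^bsub>mat2 S\<^esub> \<one>\<^bsub>mat2 S\<^esub>" unfolding r by (simp only: rho(3)[OF T.one_closed] rho(5))
      ultimately show ?thesis using comm_scalar[OF rc(2)] rc by (simp only: rho(6) a_minus_def M.r_neg M.scale_closed)
    next
      case 3
      then obtain r where r: "\<iota> l' b = r \<odot>\<^bsub>T\<^esub> \<one>\<^bsub>T\<^esub>" using scalar la by blast
      have "\<pi> (\<iota> l a) (\<iota> l' b) = \<zero>\<^bsub>T\<^esub>" unfolding r using cl by (simp add: P.smult_right P.one_right)
      moreover have "\<rho> (\<iota> l' b) = r \<odot>\<^bsub>mat2 S\<^esub> \<one>\<^bsub>mat2 S\<^esub>" unfolding r by (simp only: rho(3)[OF T.one_closed] rho(5))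
      ultimately show ?thesis using comm_scalar[OF rc(1)] rc by (simp only: rho(6) a_minus_def M.r_neg M.scale_closed)
    next
      case 4
      then show ?thesis using main la by simp
    next
      case 5
      have "\<rho> (\<pi> (\<iota> j a) (\<iota> i b)) = \<ominus>\<^bsub>mat2 S\<^esub> \<rho> (\<pi> (\<iota> i b) (\<iota> j a))"
        using cl 5 by (subst P.skew) (simp_all only: rho(8) P.closed)
      also have "\<dots> = \<ominus>\<^bsub>mat2 S\<^esub> (\<rho> (\<iota> i b) \<otimes>\<^bsub>mat2 S\<^esub> \<rho> (\<iota> j a) \<ominus>\<^bsub>mat2 S\<^esub> \<rho> (\<iota> j a) \<otimes>\<^bsub>mat2 S\<^esub> \<rho> (\<iota> i b))"
        using main[of b a] la 5 by simp
      also have "\<dots> = \<rho> (\<iota> j a) \<otimes>\<^bsub>mat2 S\<^esub> \<rho> (\<iota> i b) \<ominus>\<^bsub>mat2 S\<^esub> \<rho> (\<iota> i b) \<otimes>\<^bsub>mat2 S\<^esub> \<rho> (\<iota> j a)"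
        using rc[unfolded 5] M.m_closed[OF rc, unfolded 5] M.m_closed[OF rc(2,1), unfolded 5]
        by (simp only: a_minus_def M.minus_add M.minus_minus M.a_comm M.a_inv_closed)
      finally show ?thesis using 5 by simp
    qed
  qed
  \<comment> \<open>The first column of \<open>\<rho> t\<close> is t applied to the basis vector 1.
    Sending the basis vectors 1 and x to the elements 1 and x of S turns it into an element of
    S.\<close>
  define \<tau> where "\<tau> t = fst (\<rho> t) \<oplus>\<^bsub>S\<^esub> Xv \<otimes>\<^bsub>S\<^esub> fst (snd (snd (\<rho> t)))" for t
  have ent: "\<exists>a b c' e. \<rho> t = (a, b, c', e) \<and> a \<in> carrier S \<and> b \<in> carrier S \<and> c' \<in> carrier S \<and> e \<in> carrier S" if "t \<in> carrier T" for t
    using rho(1)[OF that] by (cases "\<rho> t") auto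
  have \<tau>: "\<tau> \<in> lin_map T S"
  proof (rule lin_mapI)
    show "\<tau> t \<in> carrier S" if "t \<in> carrier T" for t using ent[OF that] by (auto simp: \<tau>_def)
    show "\<tau> (t \<oplus>\<^bsub>T\<^esub> u) = \<tau> t \<oplus>\<^bsub>S\<^esub> \<tau> u" if "t \<in> carrier T" "u \<in> carrier T" for t u
      using ent[OF that(1)] ent[OF that(2)] unfolding \<tau>_def rho(2)[OF that] by (auto simp: S.r_distr S.a_ac)
    show "\<tau> (r \<odot>\<^bsub>T\<^esub> t) = r \<odot>\<^bsub>S\<^esub> \<tau> t" if "t \<in> carrier T" for r t
      using ent[OF that] unfolding \<tau>_def rho(3)[OF that] by (auto simp: S.scale_add_right sc)
  qed
  \<comment> \<open>A letter acts through \<tau> as multiplication in S, except that y adds c times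
    the x-component of the column; for l = j that component is therefore required to be
    zero.\<close>
  have step: "\<tau> (\<iota> l a \<otimes>\<^bsub>T\<^esub> t) = emb l a \<otimes>\<^bsub>S\<^esub> \<tau> t"
    if l: "l \<in> I" "a \<in> carrier (A l)" and t: "t \<in> carrier T" and lj: "l = j \<Longrightarrow> fst (snd (snd (\<rho> t))) = \<zero>\<^bsub>S\<^esub>" for l a t
  proof -
    obtain m1 m2 m3 m4 where m: "\<rho> t = (m1, m2, m3, m4)" "m1 \<in> carrier S" "m2 \<in> carrier S" "m3 \<in> carrier S" "m4 \<in> carrier S"
      using ent[OF t] by blast
    have e: "emb l a \<in> carrier S" using l by simp
    have r: "\<rho> (\<iota> l a \<otimes>\<^bsub>T\<^esub> t) = R l a \<otimes>\<^bsub>mat2 S\<^esub> (m1, m2, m3, m4)"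
      using l t by (simp only: rho(4)[OF \<iota>_closed[OF l] t] \<rho>(2)[OF l] m(1))
    consider "l = i" | "l = j" | "l \<noteq> i" "l \<noteq> j" by blast
    then show ?thesis
    proof cases
      case 1
      obtain r' s' where rs: "a = r' \<odot>\<^bsub>A i\<^esub> \<one>\<^bsub>A i\<^esub> \<oplus>\<^bsub>A i\<^esub> s' \<odot>\<^bsub>A i\<^esub> x" using spx l(2) 1 by blast
      have Ra: "R l a = (r' \<odot>\<^bsub>S\<^esub> un, (s' * p) \<odot>\<^bsub>S\<^esub> un, s' \<odot>\<^bsub>S\<^esub> un, r' \<odot>\<^bsub>S\<^esub> un)" using 1 by (simp add: R_def) (simp add: rs Rx)
      have ea: "emb l a = r' \<odot>\<^bsub>S\<^esub> un \<oplus>\<^bsub>S\<^esub> s' \<odot>\<^bsub>S\<^esub> Xv" using 1 x by (simp add: rs ei Xv_def[symmetric])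
      have XXm: "Xv \<otimes>\<^bsub>S\<^esub> (Xv \<otimes>\<^bsub>S\<^esub> m3) = p \<odot>\<^bsub>S\<^esub> m3" using m XX S.m_assoc[of Xv Xv m3] by (simp add: sc)
      show ?thesis unfolding \<tau>_def r m(1) Ra ea using m(2-5)
        by (simp add: sc S.l_distr S.r_distr S.scale_add_right XXm S.a_ac)
    next
      case 2
      have "m3 = \<zero>\<^bsub>S\<^esub>" using lj[OF 2] m by simp
      then show ?thesis unfolding \<tau>_def r m(1) using 2 m(2-5) e ij by (simp add: R_def Ry_def)
    next
      case 3
      then show ?thesis unfolding \<tau>_def r m(1) using m(2-5) e by (simp add: R_def S.r_distr S.m_ac)
    qed
  qed
  \<comment> \<open>Letters outside A_i act by upper triangular matrices, so the x-component of the
    first column stays zero.\<close>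
  have upper: "fst (snd (snd (\<rho> (ordered_prod xs a)))) = \<zero>\<^bsub>S\<^esub>" if "a \<in> fam" "set xs \<subseteq> I" "i \<notin> set xs" for xs a
    using that
  proof (induction xs)
    case Nil
    then show ?case by (simp add: rho)
  next
    case (Cons l xs)
    have l: "l \<in> I" "a l \<in> carrier (A l)" "ordered_prod xs a \<in> carrier T" using Cons fam_carrier by auto
    obtain m1 m2 m3 m4 where m: "\<rho> (ordered_prod xs a) = (m1, m2, m3, m4)" "m1 \<in> carrier S" "m2 \<in> carrier S" "m3 \<in> carrier S" "m4 \<in> carrier S"
      using ent[OF l(3)] by blast
    have "m3 = \<zero>\<^bsub>S\<^esub>" using Cons m by simp
    moreover have "\<rho> (ordered_prod (l # xs) a) = R l (a l) \<otimes>\<^bsub>mat2 S\<^esub> (m1, m2, m3, m4)"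
      by (simp only: ordered_prod_Cons rho(4)[OF \<iota>_closed[OF l(1,2)] l(3)] \<rho>(2)[OF l(1,2)] m(1))
    moreover have "emb l (a l) \<in> carrier S" using l by simp
    ultimately show ?case using m(2-5) Cons.prems by (auto simp: R_def Ry_def)
  qed
  have eq: "\<tau> (ordered_prod xs a) = abel (ordered_prod xs a)" if a: "a \<in> fam" and s: "sorted xs" for xs a
    using s
  proof (induction xs)
    case Nil
    show ?case by (simp add: \<tau>_def rho abel_simps)
  next
    case (Cons l xs)
    have s': "sorted xs" "set xs \<subseteq> I" "l \<in> I" using Cons.prems by (auto simp: sorted_def)
    have l: "a l \<in> carrier (A l)" "ordered_prod xs a \<in> carrier T" using fam_carrier[OF a] a s' by auto
    \<comment> \<open>Since i comes before j, no letter of A_i stands to the right of one of A_j, so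
      the derivation only ever meets vectors without x-component.\<close>
    have "i \<notin> set xs" if "l = j"
    proof
      assume "i \<in> set xs"
      then have "(j, i) \<in> ltI" using Cons.prems that by (auto simp: sorted_def)
      then show False using lt_asym lt by (auto dest: asympD)
    qed
    then have "\<tau> (ordered_prod (l # xs) a) = emb l (a l) \<otimes>\<^bsub>S\<^esub> \<tau> (ordered_prod xs a)"
      using step[OF s'(3) l] upper[OF a s'(2)] by simp
    also have "\<dots> = abel (ordered_prod (l # xs) a)"
      using Cons.IH[OF s'(1)] s' l by (simp add: abel_simps abel)
    finally show ?case .
  qed
  show ?thesis
  proof (rule iso_of_retraction[OF generated_mod_J \<tau>])
    show "\<tau> z = \<zero>\<^bsub>S\<^esub>" if z: "z \<in> J" for z
      using bracket_hom[OF M.k_algebra_axioms \<rho>(1) letters z] by (simp add: \<tau>_def)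
    show "\<tau> (pure_prod a) = pure a" if a: "a \<in> fam" for a
    proof -
      have "finite (supp a)" "supp a \<subseteq> I" using a by (auto simp: tensor_families_def supp_def)
      then obtain xs where xs: "sorted xs" "set xs = supp a" using sorted_exists by blast
      have "pure_prod a = ordered_prod xs a" by (rule pure_prod_eq[OF a xs(1)]) (simp add: xs)
      then show ?thesis using eq[OF a xs(1)] abel_pure_prod[OF a] by simp
    qed
  qed
qed

theorem quotient_iso_tensor: "k_module_iso (quot_alg T J) S"
proof (cases "\<exists>i j a b. i \<in> I \<and> j \<in> I \<and> a \<in> carrier (A i) \<and> b \<in> carrier (A j) \<and> br i a j b \<noteq> \<zero>\<^bsub>S\<^esub>")
  case False
  show ?thesis by (rule iso_of_vanishing_bracket) (use False in blast)
next
  case True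
  then obtain i0 j0 a0 b0 where *: "i0 \<in> I" "j0 \<in> I" "a0 \<in> carrier (A i0)" "b0 \<in> carrier (A j0)" "br i0 a0 j0 b0 \<noteq> \<zero>\<^bsub>S\<^esub>"
    by blast
  obtain i j x y c where ij: "i \<in> I" "j \<in> I" "i \<noteq> j" and x: "x \<in> carrier (A i)" and y: "y \<in> carrier (A j)"
    and bracket: "\<pi> (\<iota> i x) (\<iota> j y) = c \<odot>\<^bsub>T\<^esub> \<one>\<^bsub>T\<^esub>" and two: "(2 :: 'k) = 0"
    and xx: "\<exists>r. x \<otimes>\<^bsub>A i\<^esub> x = r \<odot>\<^bsub>A i\<^esub> \<one>\<^bsub>A i\<^esub>" and yy: "\<exists>r. y \<otimes>\<^bsub>A j\<^esub> y = r \<odot>\<^bsub>A j\<^esub> \<one>\<^bsub>A j\<^esub>"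
    and spx: "\<And>w. w \<in> carrier (A i) \<Longrightarrow> \<exists>r s. w = r \<odot>\<^bsub>A i\<^esub> \<one>\<^bsub>A i\<^esub> \<oplus>\<^bsub>A i\<^esub> s \<odot>\<^bsub>A i\<^esub> x"
    and spy: "\<And>w. w \<in> carrier (A j) \<Longrightarrow> \<exists>r s. w = r \<odot>\<^bsub>A j\<^esub> \<one>\<^bsub>A j\<^esub> \<oplus>\<^bsub>A j\<^esub> s \<odot>\<^bsub>A j\<^esub> y"
    and triv: "\<And>l z. l \<in> I \<Longrightarrow> l \<noteq> i \<Longrightarrow> l \<noteq> j \<Longrightarrow> z \<in> carrier (A l) \<Longrightarrow> \<exists>r. z = r \<odot>\<^bsub>A l\<^esub> \<one>\<^bsub>A l\<^esub>"
    and nx: "\<And>r. x \<noteq> r \<odot>\<^bsub>A i\<^esub> \<one>\<^bsub>A i\<^esub>" and ny: "\<And>r. y \<noteq> r \<odot>\<^bsub>A j\<^esub> \<one>\<^bsub>A j\<^esub>"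
    by (rule bracket_classification[OF *]) (rule that)
  obtain p q where pq: "x \<otimes>\<^bsub>A i\<^esub> x = p \<odot>\<^bsub>A i\<^esub> \<one>\<^bsub>A i\<^esub>" "y \<otimes>\<^bsub>A j\<^esub> y = q \<odot>\<^bsub>A j\<^esub> \<one>\<^bsub>A j\<^esub>" using xx yy by blast
  \<comment> \<open>The Clifford representation treats x and y differently and needs x in front. If
    j comes first, the two exchange roles and c becomes -c.\<close>
  have "(i, j) \<in> ltI \<or> (j, i) \<in> ltI"
    using index_order ij by (auto simp: strict_linear_order_on_def total_on_def)
  then show ?thesis
  proof
    assume "(i, j) \<in> ltI"
    then show ?thesis by (rule iso_of_constant_bracket[OF ij _ x y bracket two pq spx spy triv nx ny])
  next
    assume lt: "(j, i) \<in> ltI"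
    have "\<pi> (\<iota> j y) (\<iota> i x) = (- c) \<odot>\<^bsub>T\<^esub> \<one>\<^bsub>T\<^esub>"
      using ij x y by (subst P.skew) (simp_all add: bracket T.scale_uminus_left)
    then show ?thesis
      using iso_of_constant_bracket[OF ij(2,1) ij(3)[symmetric] lt y x _ two pq(2,1) spy spx triv ny nx] by blast
  qed
qed

end

section \<open>Algebras given by presentations\<close>

lemma free_comm_simps [simp]:
  "mult (free_comm X) = (*)" "one (free_comm X) = 1" "zero (free_comm X) = 0"
  "add (free_comm X) = (+)" "smult (free_comm X) = scale_poly"
  "p \<in> carrier (free_comm X) \<longleftrightarrow> (\<forall>m\<in>Poly_Mapping.keys p. Poly_Mapping.keys m \<subseteq> X)"
  by (simp_all add: free_comm_def)

text \<open>Monomials are peeled off one variable at a time, by induction on the total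
  exponent.\<close>

lemma free_comm_induct [consumes 1, case_names one var add scale mult]:
  fixes p :: "('x \<Rightarrow>\<^sub>0 nat) \<Rightarrow>\<^sub>0 'k::field"
  assumes p: "p \<in> carrier (free_comm X)" and one: "P 1" and var: "\<And>x. x \<in> X \<Longrightarrow> P (cvar x)"
    and add: "\<And>p q. p \<in> carrier (free_comm X) \<Longrightarrow> q \<in> carrier (free_comm X) \<Longrightarrow> P p \<Longrightarrow> P q \<Longrightarrow> P (p + q)"
    and scale: "\<And>c p. p \<in> carrier (free_comm X) \<Longrightarrow> P p \<Longrightarrow> P (scale_poly c p)"
    and mult: "\<And>p q. p \<in> carrier (free_comm X) \<Longrightarrow> q \<in> carrier (free_comm X) \<Longrightarrow> P p \<Longrightarrow> P q \<Longrightarrow> P (p * q)"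
  shows "P p"
proof -
  have mon: "P (Poly_Mapping.single m 1)" if "Poly_Mapping.keys m \<subseteq> X" for m
    using that
  proof (induction "\<Sum>x\<in>Poly_Mapping.keys m. Poly_Mapping.lookup m x" arbitrary: m rule: less_induct)
    case (less m)
    show ?case
    proof (cases "m = 0")
      case True
      then show ?thesis using one by simp
    next
      case False
      then obtain x where x: "x \<in> Poly_Mapping.keys m" using keys_eq_empty by blast
      \<comment> \<open>Subtraction of exponents is truncated, but exact here because x occurs in
        m.\<close>
      define m' where "m' = m - Poly_Mapping.single x 1"
      have m: "m = Poly_Mapping.single x 1 + m'"
        using x by (intro poly_mapping_eqI) (auto simp: m'_def lookup_add lookup_minus lookup_single when_def in_keys_iff)
      have sub: "Poly_Mapping.keys m' \<subseteq> Poly_Mapping.keys m"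
        by (auto simp: m'_def in_keys_iff lookup_minus)
      have "(\<Sum>y\<in>Poly_Mapping.keys m'. Poly_Mapping.lookup m' y) = (\<Sum>y\<in>Poly_Mapping.keys m. Poly_Mapping.lookup m' y)"
        using sub by (intro sum.mono_neutral_left) (auto simp: in_keys_iff)
      also have "\<dots> < (\<Sum>y\<in>Poly_Mapping.keys m. Poly_Mapping.lookup m y)"
        by (rule sum_strict_mono_ex1) (use x in \<open>auto simp: m'_def lookup_minus lookup_single in_keys_iff intro!: bexI[of _ x]\<close>)
      finally have "P (Poly_Mapping.single m' 1)" using less sub by blast
      moreover have "P (cvar x)" using x less.prems by (intro var) auto
      moreover have "Poly_Mapping.single m 1 = (cvar x :: _ \<Rightarrow>\<^sub>0 'k) * Poly_Mapping.single m' 1"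
        by (subst m) (simp add: cvar_def mult_single)
      ultimately show ?thesis
        using mult[of "cvar x" "Poly_Mapping.single m' 1"] x sub less.prems by (auto simp: cvar_def)
    qed
  qed
  have "Poly_Mapping.keys p \<subseteq> {m. Poly_Mapping.keys m \<subseteq> X}" using p by auto
  then show ?thesis
  proof (induction p rule: poly_mapping_induct_on)
    case zero
    have "scale_poly 0 (1 :: ('x \<Rightarrow>\<^sub>0 nat) \<Rightarrow>\<^sub>0 'k) = 0" by (rule poly_mapping_eqI) simp
    then show ?case using scale[OF _ one, of 0] by simp
  next
    case (single m c)
    then show ?case using scale[OF _ mon, of m c] by simp
  next
    case (add p q)
    then show ?case using assms(4)[of p q] by auto
  qed
qed

text \<open>The values of words in the classes of the variables contain these classes and are closed
  under the algebra operations, so every class of a commutative polynomial is reached.\<close>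

lemma presented_alg_generated:
  fixes X :: "'i \<Rightarrow> 'x set" and S :: "'i \<Rightarrow> (('x \<Rightarrow>\<^sub>0 nat) \<Rightarrow>\<^sub>0 'k::field) set"
  assumes S: "ideal (S i) (free_comm (X i))"
  defines "g \<equiv> \<lambda>x. S i +>\<^bsub>free_comm (X i)\<^esub> cvar x"
  shows "g \<in> X i \<rightarrow> carrier (presented_alg X S i)"
    "carrier (presented_alg X S i) \<subseteq> free_assoc_lift (presented_alg X S i) g ` carrier (free_assoc (X i))"
proof -
  note Q = quot_alg_simps[OF k_algebra_free_comm S, folded presented_alg_def]
  note Qc = quot_alg_carrier[OF k_algebra_free_comm S, folded presented_alg_def]
  have alg: "k_algebra (presented_alg X S i)"
    unfolding presented_alg_def by (rule k_algebra_quot_alg[OF k_algebra_free_comm S])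
  interpret F: k_algebra "free_assoc (X i) :: ('k, 'x list \<Rightarrow>\<^sub>0 'k) module" by (rule k_algebra_free_assoc)
  show g: "g \<in> X i \<rightarrow> carrier (presented_alg X S i)" by (auto simp: Qc g_def cvar_def)
  let ?L = "free_assoc_lift (presented_alg X S i) g"
  have L: "?L \<in> alg_hom (free_assoc (X i)) (presented_alg X S i)" by (rule free_assoc_lift_hom(1)[OF alg g])
  note l = lin_mapD[OF alg_hom_lin[OF L], simplified] alg_homD[OF L, simplified]
  have "S i +>\<^bsub>free_comm (X i)\<^esub> p \<in> ?L ` carrier (free_assoc (X i))" if "p \<in> carrier (free_comm (X i))" for p
    using that
  proof (induction p rule: free_comm_induct)
    case one
    have "S i +>\<^bsub>free_comm (X i)\<^esub> 1 = ?L 1" using Q(1) by (simp add: l)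
    then show ?case using F.one_closed by simp
  next
    case (var x)
    have "S i +>\<^bsub>free_comm (X i)\<^esub> cvar x = ?L (avar x)" using free_assoc_lift_hom(2)[OF alg g var] by (simp add: g_def)
    then show ?case by (rule image_eqI[OF _ avar_carrier[OF var]])
  next
    case (add p q)
    then obtain p' q' where "S i +>\<^bsub>free_comm (X i)\<^esub> p = ?L p'" "S i +>\<^bsub>free_comm (X i)\<^esub> q = ?L q'"
      "p' \<in> carrier (free_assoc (X i))" "q' \<in> carrier (free_assoc (X i))" by blast
    moreover from this have "S i +>\<^bsub>free_comm (X i)\<^esub> (p + q) = ?L (p' + q')"
      using Q(3)[OF add(1,2)] by (simp add: l)
    ultimately show ?case using F.add.m_closed[of p' q'] by (intro image_eqI[of _ _ "p' + q'"]) simp_all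
  next
    case (scale c p)
    then obtain p' where "S i +>\<^bsub>free_comm (X i)\<^esub> p = ?L p'" "p' \<in> carrier (free_assoc (X i))" by blast
    moreover from this have "S i +>\<^bsub>free_comm (X i)\<^esub> (scale_poly c p) = ?L (scale_poly c p')"
      using Q(5)[OF scale(1), of c] by (simp add: l)
    ultimately show ?case using F.scale_closed[of p' c] by (intro image_eqI[of _ _ "scale_poly c p'"]) simp_all
  next
    case (mult p q)
    then obtain p' q' where "S i +>\<^bsub>free_comm (X i)\<^esub> p = ?L p'" "S i +>\<^bsub>free_comm (X i)\<^esub> q = ?L q'"
      "p' \<in> carrier (free_assoc (X i))" "q' \<in> carrier (free_assoc (X i))" by blast
    moreover from this have "S i +>\<^bsub>free_comm (X i)\<^esub> (p * q) = ?L (p' * q')"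
      using Q(4)[OF mult(1,2)] by (simp add: l)
    ultimately show ?case using F.m_closed[of p' q'] by (intro image_eqI[of _ _ "p' * q'"]) simp_all
  qed
  then show "carrier (presented_alg X S i) \<subseteq> ?L ` carrier (free_assoc (X i))" by (auto simp: Qc)
qed

theorem theorem1p9:
  fixes I :: "'i set"
    and X :: "'i \<Rightarrow> 'x set"
    and d :: "'i \<Rightarrow> 'x \<Rightarrow> nat"
    and lt :: "'i \<Rightarrow> 'x rel"
    and S :: "'i \<Rightarrow> (('x \<Rightarrow>\<^sub>0 nat) \<Rightarrow>\<^sub>0 'k::field) set"
    and J :: "'i \<Rightarrow> 'j set"
    and f :: "'i \<Rightarrow> 'j \<Rightarrow> (('x \<Rightarrow>\<^sub>0 nat) \<Rightarrow>\<^sub>0 'k)"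
    and A :: "'i \<Rightarrow> ('k, (('x \<Rightarrow>\<^sub>0 nat) \<Rightarrow>\<^sub>0 'k) set) module"
    and T :: "('k, (('i \<times> (('x \<Rightarrow>\<^sub>0 nat) \<Rightarrow>\<^sub>0 'k) set) list \<Rightarrow>\<^sub>0 'k) set) module"
    and \<pi> :: "(('i \<times> (('x \<Rightarrow>\<^sub>0 nat) \<Rightarrow>\<^sub>0 'k) set) list \<Rightarrow>\<^sub>0 'k) set \<Rightarrow>
              (('i \<times> (('x \<Rightarrow>\<^sub>0 nat) \<Rightarrow>\<^sub>0 'k) set) list \<Rightarrow>\<^sub>0 'k) set \<Rightarrow>
              (('i \<times> (('x \<Rightarrow>\<^sub>0 nat) \<Rightarrow>\<^sub>0 'k) set) list \<Rightarrow>\<^sub>0 'k) set"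
    and ltI :: "'i rel"
  assumes ideal: "\<And>i. i \<in> I \<Longrightarrow> ideal (S i) (free_comm (X i))"
    and coordinate_algebras: "A = presented_alg X S"
    and splay_algebra: "T = coproduct I A"
    and deg_pos: "\<And>i x. i \<in> I \<Longrightarrow> x \<in> X i \<Longrightarrow> d i x \<ge> 1"
    and var_order: "\<And>i. i \<in> I \<Longrightarrow> strict_linear_order_on (X i) (lt i)"
    and grlex_monomial_ordering: "\<And>i. i \<in> I \<Longrightarrow> monomial_ordering (X i) (grlex (X i) (d i) (lt i))"
    and groebner: "\<And>i. i \<in> I \<Longrightarrow> groebner_basis (X i) (grlex (X i) (d i) (lt i)) (f i ` J i) (S i)"
    and poisson: "splay_poisson I A \<pi>"
    and filtered: "strongly_filtered (splay_filtration I X S d) \<pi>"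
    and index_order: "strict_linear_order_on I ltI"
  shows "k_module_iso (quot_alg T (bracket_ideal T \<pi>)) (tensor_product I A)"
proof -
  \<comment> \<open>The generators of A_i are the classes of the variables, which carry the given
    degrees.\<close>
  interpret filtered_splay I A \<pi> ltI X d "\<lambda>i x. S i +>\<^bsub>free_comm (X i)\<^esub> cvar x"
  proof (intro filtered_splay.intro ordered_splay.intro splay.intro comm_algebra_family.intro
      filtered_splay_axioms.intro ordered_splay_axioms.intro splay_axioms.intro)
    show "k_algebra (A i)" if "i \<in> I" for i
      unfolding coordinate_algebras presented_alg_def by (rule k_algebra_quot_alg[OF k_algebra_free_comm ideal[OF that]])
    show "a \<otimes>\<^bsub>A i\<^esub> b = b \<otimes>\<^bsub>A i\<^esub> a" if i: "i \<in> I" and ab: "a \<in> carrier (A i)" "b \<in> carrier (A i)" for i a b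
      using ab unfolding coordinate_algebras presented_alg_def
      by (auto simp: quot_alg_carrier[OF k_algebra_free_comm ideal[OF i]] quot_alg_simps[OF k_algebra_free_comm ideal[OF i]] mult.commute)
    show "(S i +>\<^bsub>free_comm (X i)\<^esub> cvar x) \<in> carrier (A i)" if "i \<in> I" "x \<in> X i" for i x
      using presented_alg_generated(1)[of S i X, OF ideal] that unfolding coordinate_algebras by blast
    show "carrier (A i) \<subseteq> free_assoc_lift (A i) (\<lambda>x. S i +>\<^bsub>free_comm (X i)\<^esub> cvar x) ` carrier (free_assoc (X i))" if "i \<in> I" for i
      using presented_alg_generated(2)[of S i X, OF ideal] that unfolding coordinate_algebras by blast
    \<comment> \<open>For these generators the filtration of the splay is by definition the word
      filtration of T.\<close>
    have "splay_filtration I X S d = word_filtration (coproduct I A) (SIGMA i:I. X i)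
        (\<lambda>(i, x). coproj I A i (S i +>\<^bsub>free_comm (X i)\<^esub> cvar x)) (\<lambda>(i, x). d i x)"
      by (rule ext) (simp add: splay_filtration_def word_filtration_def splay_gen_def coordinate_algebras)
    then show "strongly_filtered (word_filtration (coproduct I A) (SIGMA i:I. X i)
        (\<lambda>(i, x). coproj I A i (S i +>\<^bsub>free_comm (X i)\<^esub> cvar x)) (\<lambda>(i, x). d i x)) \<pi>"
      using filtered by simp
  qed (fact poisson index_order)+
  show ?thesis unfolding splay_algebra by (rule quotient_iso_tensor)
qed

end
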